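(* Let $\epsilon\ge0$ and let $R_E$ be defined by $$\frac1{R_E^2}=\max_{(w,\psi)\in X_1\setminus\{0\}}\frac{\mathcal I_2}{\mathcal I_1},\qquad \mathcal I_1=\|\nabla w\|^2+\|\Delta\psi\|^2,\quad \mathcal I_2=\langle\psi_\theta,\,w-\epsilon\Delta w\rangle,$$ where $X_1=H_0^1(\Omega)\times H_0^2(\Omega)$. Suppose $R<R_E$, and let $(w,\psi)$ be a solution of $$\partial_t(1-\epsilon\Delta)w=\tfrac1R\Delta w+R\psi_\theta+J(\psi,(1-\epsilon\Delta)w),$$ $$\partial_t\Delta(\epsilon\Delta-1)\psi=-\tfrac1R\Delta^2\psi+\epsilon R\Delta w_\theta+J((1-\epsilon\Delta)\Delta\psi,\psi)+\epsilon J(\Delta w,w)$$ in $\Omega$ with boundary conditions $w=\psi=\partial_r\psi=0$ at $r=1$ and initial data in $X_1$. Then the energy $$\mathcal E(t)=\|w\|^2+\epsilon\|\nabla w\|^2+\|\nabla\psi\|^2+\epsilon\|\Delta\psi\|^2$$ satisfies $$\mathcal E(t)\le e^{-c_Rt}\,\mathcal E(0),\qquad c_R=\frac{2R\eta_1}{1+\epsilon\eta_1}\left(\frac1{R^2}-\frac1{R_E^2}\right)>0,$$ where $\eta_1\approx5.78$ is the first eigenvalue of the negative Laplacian on $\Omega$ (with Dirichlet boundary conditions). In particular, for $R<R_E$ any initial disturbance in $X_1$ decays to zero, implying the unconditional stability of the basic steady state solution.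
   Context: $\Omega$ is the unit disk in $\mathbb{R}^2$ with polar coordinates $(r,\theta)$; $H_0^1(\Omega)$ and $H_0^2(\Omega)$ are the usual Sobolev spaces; $\|\cdot\|$ and $\langle\cdot,\cdot\rangle$ are the $L^2(\Omega)$ norm and inner product; $J(f,g)=\frac1r(f_rg_\theta-f_\theta g_r)$ is the advection operator. $R>0$ is the Reynolds number and $\epsilon\ge0$ is the non-dimensional second order material constant of a second grade fluid. The flow is in an infinite circular pipe and independent of the axial coordinate; $(w,\psi)$ are the deviations of the axial velocity and of the stream function of the cross-sectional velocity from the basic steady state (Poiseuille flow) $w_0=\frac12(1-x^2-y^2)$, $\psi_0=0$, so the basic steady state corresponds to $w=\psi=0$. *)

theory Defs
  imports "HOL-Analysis.Analysis"
begin

type_synonym plane = "real \<times> real"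

abbreviation disk :: "plane set"
  where "disk \<equiv> ball 0 1"

section \<open>Test functions, weak derivatives, Sobolev spaces\<close>

text \<open>Functions on the disk are total functions on the plane; only their values almost everywhere
  in the disk matter.\<close>

primrec Ck :: "nat \<Rightarrow> (plane \<Rightarrow> real) \<Rightarrow> bool" where
  "Ck 0 \<phi> \<longleftrightarrow> continuous_on UNIV \<phi>"
| "Ck (Suc k) \<phi> \<longleftrightarrow> (\<forall>z. \<phi> differentiable (at z)) \<and>
     (\<forall>b\<in>Basis. Ck k (\<lambda>z. frechet_derivative \<phi> (at z) b))"

definition test_fun :: "(plane \<Rightarrow> real) \<Rightarrow> bool" where
  "test_fun \<phi> \<longleftrightarrow> (\<forall>k. Ck k \<phi>) \<and> (\<exists>K. compact K \<and> K \<subseteq> disk \<and> (\<forall>z. z \<notin> K \<longrightarrow> \<phi> z = 0))"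

definition L2 :: "(plane \<Rightarrow> real) \<Rightarrow> bool" where
  "L2 u \<longleftrightarrow> u \<in> borel_measurable (lebesgue_on disk) \<and> integrable (lebesgue_on disk) (\<lambda>z. (u z)\<^sup>2)"

definition ip :: "(plane \<Rightarrow> real) \<Rightarrow> (plane \<Rightarrow> real) \<Rightarrow> real" where
  "ip u v = (LINT z|lebesgue_on disk. u z * v z)"

definition weak_partial :: "plane \<Rightarrow> (plane \<Rightarrow> real) \<Rightarrow> (plane \<Rightarrow> real) \<Rightarrow> bool" where
  "weak_partial b u g \<longleftrightarrow>
     (\<forall>\<phi>. test_fun \<phi> \<longrightarrow> ip u (\<lambda>z. frechet_derivative \<phi> (at z) b) = - ip g \<phi>)"

primrec sobolev :: "nat \<Rightarrow> (plane \<Rightarrow> real) \<Rightarrow> bool" where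
  "sobolev 0 u \<longleftrightarrow> L2 u"
| "sobolev (Suc k) u \<longleftrightarrow> L2 u \<and> (\<forall>b\<in>Basis. \<exists>g. weak_partial b u g \<and> sobolev k g)"

text \<open>A choice of representative; the weak derivative is unique up to a null set.\<close>

definition wd :: "plane \<Rightarrow> (plane \<Rightarrow> real) \<Rightarrow> plane \<Rightarrow> real" where
  "wd b u = (SOME g. L2 g \<and> weak_partial b u g)"

primrec sobolev_sq :: "nat \<Rightarrow> (plane \<Rightarrow> real) \<Rightarrow> real" where
  "sobolev_sq 0 u = ip u u"
| "sobolev_sq (Suc k) u = ip u u + (\<Sum>b\<in>Basis. sobolev_sq k (wd b u))"

definition sobolev0 :: "nat \<Rightarrow> (plane \<Rightarrow> real) \<Rightarrow> bool" where
  "sobolev0 k u \<longleftrightarrow> sobolev k u \<and>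
     (\<exists>\<phi>. (\<forall>n. test_fun (\<phi> n)) \<and> (\<lambda>n::nat. sobolev_sq k (\<lambda>z. u z - \<phi> n z)) \<longlonglongrightarrow> 0)"

section \<open>Differential operators\<close>

definition grad_ip :: "(plane \<Rightarrow> real) \<Rightarrow> (plane \<Rightarrow> real) \<Rightarrow> real" where
  "grad_ip u v = (\<Sum>b\<in>Basis. ip (wd b u) (wd b v))"

definition lap :: "(plane \<Rightarrow> real) \<Rightarrow> plane \<Rightarrow> real" where
  "lap u z = (\<Sum>b\<in>Basis. wd b (wd b u) z)"

definition d_r :: "(plane \<Rightarrow> real) \<Rightarrow> plane \<Rightarrow> real" where
  "d_r f z = (fst z * wd (1, 0) f z + snd z * wd (0, 1) f z) / norm z"

definition d_theta :: "(plane \<Rightarrow> real) \<Rightarrow> plane \<Rightarrow> real" where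
  "d_theta f z = fst z * wd (0, 1) f z - snd z * wd (1, 0) f z"

definition J :: "(plane \<Rightarrow> real) \<Rightarrow> (plane \<Rightarrow> real) \<Rightarrow> plane \<Rightarrow> real" where
  "J f g z = 1 / norm z * (d_r f z * d_theta g z - d_theta f z * d_r g z)"

lemma J_cartesian:
  assumes "z \<noteq> 0"
  shows "J f g z = wd (1, 0) f z * wd (0, 1) g z - wd (0, 1) f z * wd (1, 0) g z"
proof -
  obtain x y where z: "z = (x, y)" by (cases z)
  have n: "norm z * norm z = x\<^sup>2 + y\<^sup>2" "norm z \<noteq> 0"
    using assms by (auto simp: z norm_Pair zero_prod_def power2_eq_square[symmetric])
  have "J f g z = ((x\<^sup>2 + y\<^sup>2) * (wd (1, 0) f z * wd (0, 1) g z - wd (0, 1) f z * wd (1, 0) g z))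
      / (norm z * norm z)"
    unfolding J_def d_r_def d_theta_def using n(2)
    by (simp add: z divide_simps) (simp add: algebra_simps power2_eq_square)
  then show ?thesis using n by (metis mult_eq_0_iff nonzero_mult_div_cancel_left)
qed

section \<open>Energy functionals, critical Reynolds number, first Dirichlet eigenvalue\<close>

definition X1_nonzero :: "((plane \<Rightarrow> real) \<times> (plane \<Rightarrow> real)) set" where
  "X1_nonzero = {(w, \<psi>). sobolev0 1 w \<and> sobolev0 2 \<psi> \<and>
     \<not> (AE z in lebesgue_on disk. w z = 0 \<and> \<psi> z = 0)}"

definition I1 :: "(plane \<Rightarrow> real) \<Rightarrow> (plane \<Rightarrow> real) \<Rightarrow> real" where
  "I1 w \<psi> = grad_ip w w + ip (lap \<psi>) (lap \<psi>)"

text \<open>For \<open>w\<close> merely in \<open>H\<^sub>0\<^sup>1\<close>, \<open>\<Delta>w\<close> lies in \<open>H\<^sup>-\<^sup>1\<close> and the term \<open>\<langle>\<psi>\<^sub>\<theta>, -\<epsilon>\<Delta>w\<rangle>\<close> of \<open>\<langle>\<psi>\<^sub>\<theta>, w - \<epsilon>\<Delta>w\<rangle>\<close>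
  is the duality pairing with \<open>\<psi>\<^sub>\<theta> \<in> H\<^sub>0\<^sup>1\<close>, i.e. \<open>\<epsilon>\<langle>\<nabla>\<psi>\<^sub>\<theta>, \<nabla>w\<rangle>\<close>.\<close>

definition I2 :: "real \<Rightarrow> (plane \<Rightarrow> real) \<Rightarrow> (plane \<Rightarrow> real) \<Rightarrow> real" where
  "I2 \<epsilon> w \<psi> = ip (d_theta \<psi>) w + \<epsilon> * grad_ip (d_theta \<psi>) w"

text \<open>The supremum below is the maximum whenever the maximum is attained.\<close>

definition critical_ratio :: "real \<Rightarrow> real" where
  "critical_ratio \<epsilon> = (SUP (w, \<psi>)\<in>X1_nonzero. I2 \<epsilon> w \<psi> / I1 w \<psi>)"

definition dirichlet_eigenvalue :: "real \<Rightarrow> bool" where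
  "dirichlet_eigenvalue \<eta> \<longleftrightarrow>
     (\<exists>u. sobolev0 1 u \<and> \<not> (AE z in lebesgue_on disk. u z = 0) \<and>
       (\<forall>\<phi>. test_fun \<phi> \<longrightarrow> grad_ip u \<phi> = \<eta> * ip u \<phi>))"

definition eta1 :: real where
  "eta1 = (LEAST \<eta>. dirichlet_eigenvalue \<eta>)"

definition energy :: "real \<Rightarrow> (plane \<Rightarrow> real) \<Rightarrow> (plane \<Rightarrow> real) \<Rightarrow> real" where
  "energy \<epsilon> w \<psi> = ip w w + \<epsilon> * grad_ip w w + grad_ip \<psi> \<psi> + \<epsilon> * ip (lap \<psi>) (lap \<psi>)"

section \<open>Solutions\<close>

text \<open>The two equations in the sense of distributions, with \<open>w'\<close>, \<open>\<psi>'\<close> the time derivatives.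
  On a test function \<open>\<phi>\<close>, integration by parts gives
  \<open>\<langle>J(f, g), \<phi>\<rangle> = \<langle>f, J(g, \<phi>)\<rangle>\<close> and \<open>\<langle>\<Delta>w\<^sub>\<theta>, \<phi>\<rangle> = -\<langle>\<Delta>w, \<phi>\<^sub>\<theta>\<rangle>\<close>; moreover
  \<open>\<langle>(1 - \<epsilon>\<Delta>)\<Delta>\<psi>, J(\<psi>, \<phi>)\<rangle> = \<langle>\<Delta>\<psi>, J(\<psi>, \<phi>)\<rangle> + \<epsilon>\<langle>\<nabla>\<Delta>\<psi>, \<nabla>J(\<psi>, \<phi>)\<rangle>\<close>.\<close>

definition axial_equation ::
  "real \<Rightarrow> real \<Rightarrow> (plane \<Rightarrow> real) \<Rightarrow> (plane \<Rightarrow> real) \<Rightarrow> (plane \<Rightarrow> real) \<Rightarrow> bool" where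
  "axial_equation \<epsilon> R w' w \<psi> \<longleftrightarrow> (\<forall>\<phi>. test_fun \<phi> \<longrightarrow>
     ip w' \<phi> + \<epsilon> * grad_ip w' \<phi> =
       - (1 / R) * grad_ip w \<phi> + R * ip (d_theta \<psi>) \<phi>
       - ip (\<lambda>z. w z - \<epsilon> * lap w z) (J \<psi> \<phi>))"

definition stream_equation ::
  "real \<Rightarrow> real \<Rightarrow> (plane \<Rightarrow> real) \<Rightarrow> (plane \<Rightarrow> real) \<Rightarrow> (plane \<Rightarrow> real) \<Rightarrow> bool" where
  "stream_equation \<epsilon> R \<psi>' w \<psi> \<longleftrightarrow> (\<forall>\<phi>. test_fun \<phi> \<longrightarrow>
     grad_ip \<psi>' \<phi> + \<epsilon> * ip (lap \<psi>') (lap \<phi>) =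
       - (1 / R) * ip (lap \<psi>) (lap \<phi>) - \<epsilon> * R * ip (lap w) (d_theta \<phi>)
       + (ip (lap \<psi>) (J \<psi> \<phi>) + \<epsilon> * grad_ip (lap \<psi>) (J \<psi> \<phi>))
       + \<epsilon> * ip (lap w) (J w \<phi>))"

definition sobolev_deriv ::
  "nat \<Rightarrow> (real \<Rightarrow> plane \<Rightarrow> real) \<Rightarrow> (plane \<Rightarrow> real) \<Rightarrow> real \<Rightarrow> bool" where
  "sobolev_deriv k u u' t \<longleftrightarrow>
     ((\<lambda>h. sobolev_sq k (\<lambda>z. (u (t + h) z - u t z) / h - u' z)) \<longlongrightarrow> 0) (at 0)"

text \<open>The boundary conditions \<open>w = 0\<close> and \<open>\<psi> = \<partial>\<^sub>r\<psi> = 0\<close> are membership in \<open>H\<^sub>0\<^sup>1\<close> and \<open>H\<^sub>0\<^sup>2\<close>.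
  The initial data lie in \<open>X\<^sub>1\<close> and are attained in its norm. For \<open>t > 0\<close>, the regularity
  \<open>w \<in> H\<^sup>2\<close>, \<open>\<psi> \<in> H\<^sup>3\<close> is what the nonlinear terms need to be paired with the solution itself.\<close>

definition is_solution ::
  "real \<Rightarrow> real \<Rightarrow> (real \<Rightarrow> plane \<Rightarrow> real) \<Rightarrow> (real \<Rightarrow> plane \<Rightarrow> real) \<Rightarrow> bool" where
  "is_solution \<epsilon> R w \<psi> \<longleftrightarrow>
     (\<forall>t\<ge>0. sobolev0 1 (w t) \<and> sobolev0 2 (\<psi> t)) \<and>
     ((\<lambda>t. sobolev_sq 1 (\<lambda>z. w t z - w 0 z)) \<longlongrightarrow> 0) (at_right 0) \<and>
     ((\<lambda>t. sobolev_sq 2 (\<lambda>z. \<psi> t z - \<psi> 0 z)) \<longlongrightarrow> 0) (at_right 0) \<and>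
     (\<forall>t>0. sobolev 2 (w t) \<and> sobolev 3 (\<psi> t) \<and>
       (\<exists>w' \<psi>'. sobolev0 1 w' \<and> sobolev0 2 \<psi>' \<and>
         sobolev_deriv 1 w w' t \<and> sobolev_deriv 2 \<psi> \<psi>' t \<and>
         axial_equation \<epsilon> R w' (w t) (\<psi> t) \<and>
         stream_equation \<epsilon> R \<psi>' (w t) (\<psi> t)))"

text \<open>Stability in the energy norm with decay of every disturbance, whatever its initial size.\<close>

definition unconditionally_stable :: "real \<Rightarrow> real \<Rightarrow> bool" where
  "unconditionally_stable \<epsilon> R \<longleftrightarrow>
     (\<forall>e>0. \<exists>d>0. \<forall>w \<psi>. is_solution \<epsilon> R w \<psi> \<and> energy \<epsilon> (w 0) (\<psi> 0) < d \<longrightarrow>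
        (\<forall>t\<ge>0. energy \<epsilon> (w t) (\<psi> t) < e)) \<and>
     (\<forall>w \<psi>. is_solution \<epsilon> R w \<psi> \<longrightarrow> ((\<lambda>t. energy \<epsilon> (w t) (\<psi> t)) \<longlongrightarrow> 0) at_top)"

end

theory Submission
  imports Defs "HOL-Computational_Algebra.Polynomial"
begin

text \<open>
  The theorem is an instance of the energy method. Testing the axial equation with \<open>w\<close> and the stream
  equation with \<open>\<psi>\<close> and adding, the nonlinear terms cancel and \<open>E' / 2 = - I1 / R + R I2\<close> remains
  (\<open>energy_identity\<close>, \<open>energy_deriv\<close>). By definition of the critical Reynolds number \<open>I2 \<le> I1 / R\<^sub>E\<^sup>2\<close>
  (\<open>I2_le_critical\<close>), so that \<open>E' \<le> - 2R (1/R\<^sup>2 - 1/R\<^sub>E\<^sup>2) I1\<close>. Poincare's inequality with the constant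
  \<open>\<eta>\<^sub>1\<close>, for \<open>w\<close> and for the partial derivatives of \<open>\<psi>\<close>, gives \<open>\<eta>\<^sub>1 E \<le> (1 + \<epsilon>\<eta>\<^sub>1) I1\<close>
  (\<open>energy_le_I1\<close>). Together \<open>E' \<le> - c\<^sub>R E\<close>, and Gronwall's inequality on \<open>t > 0\<close> and the continuity of
  the energy at \<open>t = 0\<close> give the decay, hence also the stability.

  The first difficulty is that \<open>w\<close> and \<open>\<psi>\<close> are not test functions, and for \<open>w \<in> H\<^sup>2 \<inter> H\<^sub>0\<^sup>1\<close> and
  \<open>\<psi> \<in> H\<^sup>3 \<inter> H\<^sub>0\<^sup>2\<close> they need not even be limits of test functions in the norms, those of \<open>H\<^sup>2\<close> and
  \<open>H\<^sup>3\<close>, in which the nonlinear terms are continuous. The products \<open>\<chi>\<^sub>n w\<close> and \<open>\<chi>\<^sub>n \<psi>\<close> with cut-off functions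
  are such limits, by mollification (\<open>sobolev0_mult_test\<close>). Inserting them, the derivatives of \<open>\<chi>\<^sub>n\<close>
  are of the size of negative powers of \<open>1 - r\<^sup>2\<close>, and must be compensated by the vanishing of the functions on
  the boundary. This is the role of Hardy's inequality: for \<open>u\<close> in \<open>H\<^sub>0\<^sup>1\<close>, \<open>u / (1 - r\<^sup>2)\<close> is
  square integrable, and so is \<open>u\<^sup>2 / (1 - r\<^sup>2)\<close>, a weighted form of the embedding into \<open>L\<^sup>4\<close>; for \<open>u\<close>
  in \<open>H\<^sub>0\<^sup>2\<close> the same holds with \<open>u / (1 - r\<^sup>2)\<^sup>2\<close> and \<open>u\<^sup>2 / (1 - r\<^sup>2)\<^sup>3\<close> (\<open>sobolev0_hardy\<close>, \<open>sobolev0_L4\<close>,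
  \<open>sobolev0_H2_weights\<close>). Hence all terms with derivatives of \<open>\<chi>\<^sub>n\<close> tend to 0, and the others cancel
  up to \<open>\<langle>w, J(\<psi>, w)\<rangle> = 0\<close> (\<open>nonlinear_cancellation\<close>).

  The second difficulty is \<open>\<eta>\<^sub>1\<close>, the least number that is an eigenvalue: its existence, its value and
  Poincare's inequality come together. If \<open>\<phi> > 0\<close> is a radial solution of \<open>-\<Delta>\<phi> = \<eta>\<phi>\<close> in the open disk, then
  integrating \<open>|\<nabla>u - u \<nabla>\<phi> / \<phi>|\<^sup>2 \<ge> 0\<close> gives \<open>\<eta> \<parallel>u\<parallel>\<^sup>2 \<le> \<parallel>\<nabla>u\<parallel>\<^sup>2\<close> (\<open>c1c_barta\<close>, which also contains Hardy's
  inequality). For \<open>\<phi> = J\<^sub>0(\<surd>\<eta> r)\<close> with \<open>\<surd>\<eta>\<close> the first zero of the Bessel function \<open>J\<^sub>0\<close>,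
  \<open>\<phi>\<close> is itself an eigenfunction, so \<open>\<eta> = \<eta>\<^sub>1\<close>; the zero is located by the Taylor
  polynomial of degree 5 in \<open>\<eta>\<close> (\<open>eta1_facts\<close>).
\<close>

section \<open>Square integrable functions on the disk\<close>

lemma finite_measure_disk: "finite_measure (lebesgue_on disk)"
  by (intro finite_measure_lebesgue_on) (simp add: lmeasurable_ball)

lemma disk_lebesgue [simp]: "disk \<in> sets lebesgue"
  by simp

lemma measurable_disk_continuous:
  fixes f :: "plane \<Rightarrow> real"
  assumes "continuous_on disk f"
  shows "f \<in> borel_measurable (lebesgue_on disk)"
  using assms by (intro continuous_imp_measurable_on_sets_lebesgue) auto

lemma AE_diskI: "(\<And>z. norm z < 1 \<Longrightarrow> P z) \<Longrightarrow> AE z in lebesgue_on disk. P z"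
  by (rule AE_I2) (auto simp: space_restrict_space)

lemma L2_measurable: "L2 u \<Longrightarrow> u \<in> borel_measurable (lebesgue_on disk)"
  by (simp add: L2_def)

lemma L2_integrable_mult:
  assumes "L2 u" "L2 v"
  shows "integrable (lebesgue_on disk) (\<lambda>z. u z * v z)"
proof (rule Bochner_Integration.integrable_bound)
  show "integrable (lebesgue_on disk) (\<lambda>z. (u z)\<^sup>2 + (v z)\<^sup>2)"
    using assms by (auto simp: L2_def)
  show "(\<lambda>z. u z * v z) \<in> borel_measurable (lebesgue_on disk)"
    using assms[THEN L2_measurable] by measurable
  have "\<bar>a * b\<bar> \<le> a\<^sup>2 + b\<^sup>2" for a b :: real
  proof -
    have "2 * (\<bar>a\<bar> * \<bar>b\<bar>) \<le> a\<^sup>2 + b\<^sup>2"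
      using sum_squares_bound[of "\<bar>a\<bar>" "\<bar>b\<bar>"] by simp
    moreover have "0 \<le> \<bar>a\<bar> * \<bar>b\<bar>" by simp
    ultimately show ?thesis unfolding abs_mult by linarith
  qed
  then show "AE z in lebesgue_on disk. norm (u z * v z) \<le> norm ((u z)\<^sup>2 + (v z)\<^sup>2)"
    by simp
qed

lemma L2_bounded:
  assumes "L2 v" "u \<in> borel_measurable (lebesgue_on disk)"
    and "AE z in lebesgue_on disk. \<bar>u z\<bar> \<le> \<bar>v z\<bar>"
  shows "L2 u"
proof -
  have "integrable (lebesgue_on disk) (\<lambda>z. (u z)\<^sup>2)"
  proof (rule Bochner_Integration.integrable_bound)
    show "integrable (lebesgue_on disk) (\<lambda>z. (v z)\<^sup>2)" using assms by (simp add: L2_def)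
    show "(\<lambda>z. (u z)\<^sup>2) \<in> borel_measurable (lebesgue_on disk)" using assms by measurable
    show "AE z in lebesgue_on disk. norm ((u z)\<^sup>2) \<le> norm ((v z)\<^sup>2)"
      using assms(3) by eventually_elim (simp add: abs_le_square_iff)
  qed
  then show ?thesis using assms by (simp add: L2_def)
qed

lemma L2_cmult: "L2 u \<Longrightarrow> L2 (\<lambda>z. c * u z)"
  by (auto simp: L2_def power_mult_distrib)

lemma L2_uminus: "L2 u \<Longrightarrow> L2 (\<lambda>z. - u z)"
  by (auto simp: L2_def)

lemma L2_zero: "L2 (\<lambda>z. 0)"
  by (simp add: L2_def)

lemma L2_add:
  assumes "L2 u" "L2 v" shows "L2 (\<lambda>z. u z + v z)"
proof -
  have "integrable (lebesgue_on disk) (\<lambda>z. (u z)\<^sup>2 + (v z)\<^sup>2 + 2 * (u z * v z))"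
    using assms L2_integrable_mult[OF assms] by (auto simp: L2_def)
  moreover have "(\<lambda>z. (u z + v z)\<^sup>2) = (\<lambda>z. (u z)\<^sup>2 + (v z)\<^sup>2 + 2 * (u z * v z))"
    by (simp add: power2_sum mult.assoc)
  ultimately show ?thesis using assms by (auto simp: L2_def)
qed

lemma L2_diff: "L2 u \<Longrightarrow> L2 v \<Longrightarrow> L2 (\<lambda>z. u z - v z)"
  using L2_add[OF _ L2_uminus, of u v] by simp

lemma L2_bmult:
  assumes "L2 u" "f \<in> borel_measurable (lebesgue_on disk)" "\<And>z. norm z < 1 \<Longrightarrow> \<bar>f z\<bar> \<le> B"
  shows "L2 (\<lambda>z. f z * u z)"
proof (rule L2_bounded[OF L2_cmult[of u B]])
  show "L2 u" by fact
  show "(\<lambda>z. f z * u z) \<in> borel_measurable (lebesgue_on disk)"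
    using assms(2) L2_measurable[OF assms(1)] by measurable
  show "AE z in lebesgue_on disk. \<bar>f z * u z\<bar> \<le> \<bar>B * u z\<bar>"
  proof (rule AE_diskI)
    fix z :: plane assume "norm z < 1"
    from assms(3)[OF this] show "\<bar>f z * u z\<bar> \<le> \<bar>B * u z\<bar>"
      by (auto simp: abs_mult intro!: mult_right_mono)
  qed
qed

lemma L2_cong_AE:
  assumes "AE z in lebesgue_on disk. u z = v z" "L2 v" "u \<in> borel_measurable (lebesgue_on disk)"
  shows "L2 u"
  by (rule L2_bounded[OF assms(2,3)]) (use assms(1) in eventually_elim, simp)

lemma L2_bounded_measurable:
  assumes "u \<in> borel_measurable (lebesgue_on disk)" "\<And>z. norm z < 1 \<Longrightarrow> \<bar>u z\<bar> \<le> B"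
  shows "L2 u"
proof (rule L2_bounded[OF _ assms(1), of "\<lambda>_. B"])
  interpret finite_measure "lebesgue_on disk" by (rule finite_measure_disk)
  show "L2 (\<lambda>_. B)" by (simp add: L2_def)
  show "AE z in lebesgue_on disk. \<bar>u z\<bar> \<le> \<bar>B\<bar>"
    using assms(2) by (intro AE_diskI) force
qed

lemma continuous_bounded_disk:
  fixes f :: "plane \<Rightarrow> 'a::real_normed_vector"
  assumes "continuous_on UNIV f"
  obtains B where "B > 0" "\<And>z. norm z < 1 \<Longrightarrow> norm (f z) \<le> B"
proof -
  have "compact (f ` cball 0 1)"
    using assms by (intro compact_continuous_image continuous_on_subset[OF assms]) auto
  then obtain B where "B > 0" "\<forall>y\<in>f ` cball 0 1. norm y \<le> B"
    using compact_imp_bounded bounded_pos by metis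
  then show ?thesis by (intro that[of B]) auto
qed

lemma L2_continuous: "continuous_on UNIV (u :: plane \<Rightarrow> real) \<Longrightarrow> L2 u"
proof -
  assume u: "continuous_on UNIV u"
  obtain B where "\<And>z. norm z < 1 \<Longrightarrow> norm (u z) \<le> B" using continuous_bounded_disk[OF u] by blast
  then show "L2 u"
    using measurable_disk_continuous[OF continuous_on_subset[OF u]] by (intro L2_bounded_measurable[of u B]) auto
qed

lemma L2_mult_continuous:
  fixes f :: "plane \<Rightarrow> real"
  assumes "L2 u" "continuous_on UNIV f" shows "L2 (\<lambda>z. f z * u z)"
proof -
  obtain B where "\<And>z. norm z < 1 \<Longrightarrow> norm (f z) \<le> B" using continuous_bounded_disk[OF assms(2)] by blast
  then show ?thesis
    using measurable_disk_continuous[OF continuous_on_subset[OF assms(2)]] by (intro L2_bmult[OF assms(1), of f B]) auto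
qed

lemma integrable_disk_continuous:
  "continuous_on UNIV (f :: plane \<Rightarrow> real) \<Longrightarrow> integrable (lebesgue_on disk) f"
  using L2_integrable_mult[OF L2_continuous L2_continuous, of f "\<lambda>_. 1"] by simp

subsection \<open>The inner product\<close>

lemma ip_commute: "ip u v = ip v u"
  by (simp add: ip_def mult.commute)

lemma ip_cong_AE:
  assumes "AE z in lebesgue_on disk. u z = u' z" "AE z in lebesgue_on disk. v z = v' z"
    "u \<in> borel_measurable (lebesgue_on disk)" "u' \<in> borel_measurable (lebesgue_on disk)"
    "v \<in> borel_measurable (lebesgue_on disk)" "v' \<in> borel_measurable (lebesgue_on disk)"
  shows "ip u v = ip u' v'"
  unfolding ip_def using assms by (intro integral_cong_AE) auto

lemma ip_cong: "(\<And>z. norm z < 1 \<Longrightarrow> u z * v z = u' z * v' z) \<Longrightarrow> ip u v = ip u' v'"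
  unfolding ip_def by (intro Bochner_Integration.integral_cong) (auto simp: space_restrict_space)

lemma ip_add_left: "L2 u \<Longrightarrow> L2 v \<Longrightarrow> L2 w \<Longrightarrow> ip (\<lambda>z. u z + v z) w = ip u w + ip v w"
  by (simp add: ip_def distrib_right L2_integrable_mult)

lemma ip_add_right: "L2 u \<Longrightarrow> L2 v \<Longrightarrow> L2 w \<Longrightarrow> ip w (\<lambda>z. u z + v z) = ip w u + ip w v"
  by (simp add: ip_def distrib_left L2_integrable_mult)

lemma ip_diff_left: "L2 u \<Longrightarrow> L2 v \<Longrightarrow> L2 w \<Longrightarrow> ip (\<lambda>z. u z - v z) w = ip u w - ip v w"
  by (simp add: ip_def left_diff_distrib L2_integrable_mult)

lemma ip_diff_right: "L2 u \<Longrightarrow> L2 v \<Longrightarrow> L2 w \<Longrightarrow> ip w (\<lambda>z. u z - v z) = ip w u - ip w v"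
  by (simp add: ip_def right_diff_distrib L2_integrable_mult)

lemma ip_cmult_left: "ip (\<lambda>z. c * u z) w = c * ip u w"
  by (simp add: ip_def mult.assoc)

lemma ip_cmult_right: "ip w (\<lambda>z. c * u z) = c * ip w u"
  using ip_cmult_left[of c u w] by (simp add: ip_commute)

lemma ip_uminus_left: "ip (\<lambda>z. - u z) w = - ip u w"
  by (simp add: ip_def)

lemma ip_uminus_right: "ip w (\<lambda>z. - u z) = - ip w u"
  by (simp add: ip_def)

lemma ip_zero [simp]: "ip (\<lambda>z. 0) w = 0" "ip w (\<lambda>z. 0) = 0"
  by (simp_all add: ip_def)

lemma ip_sum_left:
  "(\<And>i. i \<in> A \<Longrightarrow> L2 (u i)) \<Longrightarrow> L2 w \<Longrightarrow> ip (\<lambda>z. \<Sum>i\<in>A. u i z) w = (\<Sum>i\<in>A. ip (u i) w)"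
  by (simp add: ip_def sum_distrib_right L2_integrable_mult)

lemma ip_self_nonneg: "0 \<le> ip u u"
  unfolding ip_def by (intro Bochner_Integration.integral_nonneg) auto

lemma ip_self_eq_0_iff:
  assumes "L2 u" shows "ip u u = 0 \<longleftrightarrow> (AE z in lebesgue_on disk. u z = 0)"
proof -
  have "ip u u = 0 \<longleftrightarrow> (AE z in lebesgue_on disk. u z * u z = 0)"
    unfolding ip_def using L2_integrable_mult[OF assms assms]
    by (intro integral_nonneg_eq_0_iff_AE) auto
  then show ?thesis by simp
qed

lemma ip_mono:
  assumes "L2 u" "L2 v" "AE z in lebesgue_on disk. \<bar>u z\<bar> \<le> \<bar>v z\<bar>"
  shows "ip u u \<le> ip v v"
  unfolding ip_def
  by (intro integral_mono_AE L2_integrable_mult assms)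
    (use assms(3) in eventually_elim, metis abs_le_square_iff power2_eq_square)

lemma ip_young:
  assumes "L2 u" "L2 v" "s > 0"
  shows "2 * \<bar>ip u v\<bar> \<le> s * ip u u + ip v v / s"
proof -
  have 1: "0 \<le> ip (\<lambda>z. s * u z + v z) (\<lambda>z. s * u z + v z)"
    and 2: "0 \<le> ip (\<lambda>z. s * u z - v z) (\<lambda>z. s * u z - v z)" by (rule ip_self_nonneg)+
  have "ip (\<lambda>z. s * u z + v z) (\<lambda>z. s * u z + v z) = s * s * ip u u + 2 * s * ip u v + ip v v"
    using assms by (simp add: ip_add_left ip_add_right L2_cmult L2_add ip_cmult_left ip_cmult_right
        ip_commute[of v u] algebra_simps)
  moreover have "ip (\<lambda>z. s * u z - v z) (\<lambda>z. s * u z - v z) = s * s * ip u u - 2 * s * ip u v + ip v v"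
    using assms by (simp add: ip_diff_left ip_diff_right L2_cmult L2_diff ip_cmult_left ip_cmult_right
        ip_commute[of v u] algebra_simps)
  ultimately have "2 * s * \<bar>ip u v\<bar> \<le> s * s * ip u u + ip v v" using 1 2 by (auto simp: abs_if)
  then show ?thesis using assms(3) by (simp add: field_simps)
qed

lemma ip_cauchy_schwarz:
  assumes "L2 u" "L2 v"
  shows "\<bar>ip u v\<bar> \<le> sqrt (ip u u) * sqrt (ip v v)"
proof -
  have *: "2 * \<bar>ip u v\<bar> \<le> 2 * (sqrt (ip u u) + e) * (sqrt (ip v v) + e)" if "e > 0" for e
  proof -
    define a b where "a = sqrt (ip u u) + e" and "b = sqrt (ip v v) + e"
    have a: "a > 0" "b > 0" unfolding a_def b_def using that ip_self_nonneg
      by (auto intro: add_nonneg_pos)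
    have "ip u u \<le> a\<^sup>2" "ip v v \<le> b\<^sup>2" unfolding a_def b_def using that ip_self_nonneg[of u] ip_self_nonneg[of v]
      by (auto simp: power2_sum)
    moreover have "2 * \<bar>ip u v\<bar> \<le> b/a * ip u u + ip v v / (b/a)"
      using assms a by (intro ip_young) auto
    ultimately have "2 * \<bar>ip u v\<bar> \<le> b/a * a\<^sup>2 + b\<^sup>2 / (b/a)"
      using a by (smt (verit) divide_right_mono mult_left_mono divide_pos_pos)
    also have "\<dots> = 2 * a * b" using a by (simp add: power2_eq_square)
    finally show ?thesis by (simp add: a_def b_def)
  qed
  have "((\<lambda>e. 2 * (sqrt (ip u u) + e) * (sqrt (ip v v) + e)) \<longlongrightarrow> 2 * (sqrt (ip u u) + 0) * (sqrt (ip v v) + 0)) (at_right 0)"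
    by (intro tendsto_intros)
  then have "2 * \<bar>ip u v\<bar> \<le> 2 * (sqrt (ip u u) + 0) * (sqrt (ip v v) + 0)"
    by (rule tendsto_lowerbound) (use * in \<open>auto intro!: eventually_at_rightI[of 0 1] simp del: distrib_left_numeral\<close>)
  then show ?thesis by simp
qed

lemma ip_add_le:
  assumes "L2 u" "L2 v"
  shows "ip (\<lambda>z. u z + v z) (\<lambda>z. u z + v z) \<le> 2 * ip u u + 2 * ip v v"
  using ip_young[OF assms, of 1] assms
  by (simp add: ip_add_left ip_add_right L2_add ip_commute[of v u])

subsection \<open>Convergence in mean square\<close>

definition L2lim :: "(nat \<Rightarrow> plane \<Rightarrow> real) \<Rightarrow> (plane \<Rightarrow> real) \<Rightarrow> bool" where
  "L2lim f u \<longleftrightarrow> (\<forall>n. L2 (f n)) \<and> L2 u \<and>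
     (\<lambda>n. ip (\<lambda>z. f n z - u z) (\<lambda>z. f n z - u z)) \<longlonglongrightarrow> 0"

lemma L2lim_L2: "L2lim f u \<Longrightarrow> L2 (f n)" "L2lim f u \<Longrightarrow> L2 u"
  by (auto simp: L2lim_def)

lemma L2limI_bound:
  assumes "\<And>n. L2 (f n)" "L2 u"
    "\<And>n. ip (\<lambda>z. f n z - u z) (\<lambda>z. f n z - u z) \<le> c n" "c \<longlonglongrightarrow> 0"
  shows "L2lim f u"
  unfolding L2lim_def
  using assms by (auto intro!: tendsto_sandwich[OF _ _ tendsto_const assms(4)] always_eventually ip_self_nonneg)

lemma L2lim_const: "L2 u \<Longrightarrow> L2lim (\<lambda>n. u) u"
  by (simp add: L2lim_def)

lemma L2lim_cong_AE:
  assumes "L2lim f u" "\<And>n. AE z in lebesgue_on disk. f n z = g n z"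
    "AE z in lebesgue_on disk. u z = v z" "\<And>n. L2 (g n)" "L2 v"
  shows "L2lim g v"
proof (rule L2limI_bound[OF assms(4,5)])
  show "(\<lambda>n. ip (\<lambda>z. f n z - u z) (\<lambda>z. f n z - u z)) \<longlonglongrightarrow> 0" using assms(1) by (simp add: L2lim_def)
  fix n
  have "AE z in lebesgue_on disk. g n z - v z = f n z - u z"
    using assms(2)[of n] assms(3) by eventually_elim simp
  then show "ip (\<lambda>z. g n z - v z) (\<lambda>z. g n z - v z) \<le> ip (\<lambda>z. f n z - u z) (\<lambda>z. f n z - u z)"
    using assms L2lim_L2[OF assms(1)]
    by (intro eq_refl ip_cong_AE) (auto intro!: L2_measurable L2_diff)
qed

lemma L2lim_add:
  assumes "L2lim f u" "L2lim g v" shows "L2lim (\<lambda>n z. f n z + g n z) (\<lambda>z. u z + v z)"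
proof (rule L2limI_bound)
  let ?c = "\<lambda>n. 2 * ip (\<lambda>z. f n z - u z) (\<lambda>z. f n z - u z) + 2 * ip (\<lambda>z. g n z - v z) (\<lambda>z. g n z - v z)"
  have "?c \<longlonglongrightarrow> 2 * 0 + 2 * 0" using assms by (intro tendsto_intros) (auto simp: L2lim_def)
  then show "?c \<longlonglongrightarrow> 0" by simp
  note l = L2lim_L2[OF assms(1)] L2lim_L2[OF assms(2)]
  show "ip (\<lambda>z. f n z + g n z - (u z + v z)) (\<lambda>z. f n z + g n z - (u z + v z)) \<le> ?c n" for n
    using ip_add_le[of "\<lambda>z. f n z - u z" "\<lambda>z. g n z - v z"] l by (simp add: L2_diff algebra_simps)
qed (auto intro!: L2_add L2lim_L2[OF assms(1)] L2lim_L2[OF assms(2)])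

lemma L2lim_bmult:
  assumes "L2lim f u" "m \<in> borel_measurable (lebesgue_on disk)" "\<And>z. norm z < 1 \<Longrightarrow> \<bar>m z\<bar> \<le> B"
  shows "L2lim (\<lambda>n z. m z * f n z) (\<lambda>z. m z * u z)"
proof (rule L2limI_bound)
  note l = L2lim_L2[OF assms(1)]
  show "L2 (\<lambda>z. m z * f n z)" "L2 (\<lambda>z. m z * u z)" for n using assms l by (blast intro: L2_bmult)+
  let ?c = "\<lambda>n. B * B * ip (\<lambda>z. f n z - u z) (\<lambda>z. f n z - u z)"
  have "?c \<longlonglongrightarrow> B * B * 0" using assms by (intro tendsto_intros) (auto simp: L2lim_def)
  then show "?c \<longlonglongrightarrow> 0" by simp
  fix n
  have "ip (\<lambda>z. m z * (f n z - u z)) (\<lambda>z. m z * (f n z - u z))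
      \<le> ip (\<lambda>z. B * (f n z - u z)) (\<lambda>z. B * (f n z - u z))"
  proof (intro ip_mono AE_diskI)
    show "L2 (\<lambda>z. m z * (f n z - u z))" using assms l by (intro L2_bmult L2_diff) auto
    show "L2 (\<lambda>z. B * (f n z - u z))" using l by (intro L2_cmult L2_diff) auto
    fix z :: plane assume "norm z < 1"
    from assms(3)[OF this] show "\<bar>m z * (f n z - u z)\<bar> \<le> \<bar>B * (f n z - u z)\<bar>"
      by (auto simp: abs_mult intro!: mult_right_mono)
  qed
  then show "ip (\<lambda>z. m z * f n z - m z * u z) (\<lambda>z. m z * f n z - m z * u z) \<le> ?c n"
    by (simp only: ip_cmult_left ip_cmult_right right_diff_distrib[symmetric] mult.assoc)
qed

lemma L2lim_mult_continuous:
  fixes m :: "plane \<Rightarrow> real"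
  assumes "L2lim f u" "continuous_on UNIV m"
  shows "L2lim (\<lambda>n z. m z * f n z) (\<lambda>z. m z * u z)"
proof -
  obtain B where "\<And>z. norm z < 1 \<Longrightarrow> norm (m z) \<le> B" using continuous_bounded_disk[OF assms(2)] by blast
  then show ?thesis
    using measurable_disk_continuous[OF continuous_on_subset[OF assms(2)]] by (intro L2lim_bmult[OF assms(1), of m B]) auto
qed

lemma L2lim_cmult: "L2lim f u \<Longrightarrow> L2lim (\<lambda>n z. c * f n z) (\<lambda>z. c * u z)"
  by (rule L2lim_mult_continuous) auto

lemma L2lim_diff:
  assumes "L2lim f u" "L2lim g v" shows "L2lim (\<lambda>n z. f n z - g n z) (\<lambda>z. u z - v z)"
  using L2lim_add[OF assms(1) L2lim_cmult[OF assms(2), of "-1"]] by simp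

lemma L2lim_sum:
  assumes "\<And>i. i \<in> A \<Longrightarrow> L2lim (f i) (u i)"
  shows "L2lim (\<lambda>n z. \<Sum>i\<in>A. f i n z) (\<lambda>z. \<Sum>i\<in>A. u i z)"
  using assms
  by (induction A rule: infinite_finite_induct) (auto intro!: L2lim_const L2_zero L2lim_add)

text \<open>\<open>\<langle>f\<^sub>n, g\<^sub>n\<rangle> - \<langle>u, v\<rangle> = \<langle>f\<^sub>n - u, g\<^sub>n - v\<rangle> + \<langle>f\<^sub>n - u, v\<rangle> + \<langle>u, g\<^sub>n - v\<rangle>\<close> and Cauchy-Schwarz.\<close>

lemma L2lim_ip:
  assumes "L2lim f u" "L2lim g v" shows "(\<lambda>n. ip (f n) (g n)) \<longlonglongrightarrow> ip u v"
proof -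
  note l = L2lim_L2[OF assms(1)] L2lim_L2[OF assms(2)]
  let ?a = "\<lambda>n. ip (\<lambda>z. f n z - u z) (\<lambda>z. f n z - u z)"
  let ?b = "\<lambda>n. ip (\<lambda>z. g n z - v z) (\<lambda>z. g n z - v z)"
  let ?c = "\<lambda>n. sqrt (?a n) * sqrt (?b n) + sqrt (ip u u) * sqrt (?b n) + sqrt (?a n) * sqrt (ip v v)"
  have "(\<lambda>n. ip (f n) (g n) - ip u v) \<longlonglongrightarrow> 0"
  proof (rule Lim_null_comparison[OF always_eventually, of _ ?c], intro allI)
    fix n
    have "ip (f n) (g n) - ip u v = ip (\<lambda>z. f n z - u z) (\<lambda>z. g n z - v z)
        + ip u (\<lambda>z. g n z - v z) + ip (\<lambda>z. f n z - u z) v"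
      using l by (simp add: ip_diff_left ip_diff_right L2_diff)
    moreover have "\<bar>ip (\<lambda>z. f n z - u z) (\<lambda>z. g n z - v z)\<bar> \<le> sqrt (?a n) * sqrt (?b n)"
      "\<bar>ip u (\<lambda>z. g n z - v z)\<bar> \<le> sqrt (ip u u) * sqrt (?b n)"
      "\<bar>ip (\<lambda>z. f n z - u z) v\<bar> \<le> sqrt (?a n) * sqrt (ip v v)"
      using l by (intro ip_cauchy_schwarz L2_diff; simp)+
    ultimately show "norm (ip (f n) (g n) - ip u v) \<le> ?c n" by (simp add: abs_le_iff)
  next
    have "?a \<longlonglongrightarrow> 0" "?b \<longlonglongrightarrow> 0" using assms by (auto simp: L2lim_def)
    then have "?c \<longlonglongrightarrow> sqrt 0 * sqrt 0 + sqrt (ip u u) * sqrt 0 + sqrt 0 * sqrt (ip v v)"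
      by (intro tendsto_intros)
    then show "?c \<longlonglongrightarrow> 0" by simp
  qed
  then show ?thesis by (simp add: LIM_zero_iff)
qed

lemma L2lim_dominated:
  assumes "\<And>n. f n \<in> borel_measurable (lebesgue_on disk)" "u \<in> borel_measurable (lebesgue_on disk)"
    and "L2 g" "\<And>n. AE z in lebesgue_on disk. \<bar>f n z\<bar> \<le> \<bar>g z\<bar>"
    and lim: "AE z in lebesgue_on disk. (\<lambda>n. f n z) \<longlonglongrightarrow> u z"
  shows "L2lim f u"
proof -
  have f: "L2 (f n)" for n by (rule L2_bounded[OF assms(3) assms(1) assms(4)])
  have all: "AE z in lebesgue_on disk. \<forall>n. \<bar>f n z\<bar> \<le> \<bar>g z\<bar>"
    using assms(4) by (simp add: AE_all_countable)
  have u_le: "AE z in lebesgue_on disk. \<bar>u z\<bar> \<le> \<bar>g z\<bar>"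
    using all lim
  proof eventually_elim
    case (elim z)
    then have "(\<lambda>n. \<bar>f n z\<bar>) \<longlonglongrightarrow> \<bar>u z\<bar>" by (intro tendsto_intros)
    then show ?case using elim(1) by (intro tendsto_upperbound[where f = "\<lambda>n. \<bar>f n z\<bar>"]) auto
  qed
  have u: "L2 u" by (rule L2_bounded[OF assms(3) assms(2) u_le])
  have "(\<lambda>n. LINT z|lebesgue_on disk. (f n z - u z) * (f n z - u z))
      \<longlonglongrightarrow> (LINT z|lebesgue_on disk. 0)"
  proof (rule integral_dominated_convergence[where w = "\<lambda>z. 4 * (g z * g z)"])
    show "(\<lambda>z. (f n z - u z) * (f n z - u z)) \<in> borel_measurable (lebesgue_on disk)" for n
      using assms(1)[of n] assms(2) by measurable
    show "integrable (lebesgue_on disk) (\<lambda>z. 4 * (g z * g z))"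
      using L2_integrable_mult[OF assms(3) assms(3)] by simp
    show "AE z in lebesgue_on disk. (\<lambda>n. (f n z - u z) * (f n z - u z)) \<longlonglongrightarrow> 0"
      using lim
    proof eventually_elim
      case (elim z)
      then have "(\<lambda>n. (f n z - u z) * (f n z - u z)) \<longlonglongrightarrow> (u z - u z) * (u z - u z)"
        by (intro tendsto_intros)
      then show ?case by simp
    qed
    show "AE z in lebesgue_on disk. norm ((f n z - u z) * (f n z - u z)) \<le> 4 * (g z * g z)" for n
      using assms(4)[of n] u_le
    proof eventually_elim
      case (elim z)
      then have "\<bar>f n z - u z\<bar> \<le> 2 * \<bar>g z\<bar>" by linarith
      then have "\<bar>f n z - u z\<bar> * \<bar>f n z - u z\<bar> \<le> (2 * \<bar>g z\<bar>) * (2 * \<bar>g z\<bar>)"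
        by (intro mult_mono) auto
      then show ?case by (simp add: abs_mult)
    qed
  qed auto
  then show ?thesis using f u by (simp add: L2lim_def ip_def)
qed

section \<open>Calculus of test functions\<close>

declare split_paired_All [simp del] split_paired_Ex [simp del]

abbreviation pd :: "plane \<Rightarrow> (plane \<Rightarrow> real) \<Rightarrow> plane \<Rightarrow> real" where
  "pd b f \<equiv> (\<lambda>z. frechet_derivative f (at z) b)"

lemma Basis_plane: "(Basis :: plane set) = {(1, 0), (0, 1)}"
  by (auto simp: Basis_prod_def)

lemma sum_Basis_plane: "(\<Sum>b\<in>(Basis :: plane set). f b) = f (1, 0) + f (0, 1)"
  by (simp add: Basis_plane)

lemma Basis_plane_simps [simp]: "((1, 0) :: plane) \<in> Basis" "((0, 1) :: plane) \<in> Basis"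
  by (auto simp: Basis_plane)

lemma pd_unique: "(f has_derivative f') (at z) \<Longrightarrow> frechet_derivative f (at z) b = f' b"
  using frechet_derivative_at by metis

lemma has_derivative_frechet:
  "f differentiable (at z) \<Longrightarrow> (f has_derivative frechet_derivative f (at z)) (at z)"
  by (simp add: frechet_derivative_works)

lemma Ck_differentiable: "Ck (Suc k) f \<Longrightarrow> f differentiable (at z)"
  by simp

lemma Ck_continuous: "Ck k f \<Longrightarrow> continuous_on UNIV f"
  by (cases k) (auto intro!: differentiable_imp_continuous_on simp: differentiable_on_def
      differentiable_at_withinI)

lemma Ck_Suc_D: "Ck (Suc k) f \<Longrightarrow> Ck k f"
proof (induction k arbitrary: f)
  case 0
  then show ?case using Ck_continuous[OF 0] by simp
next
  case (Suc k)
  then show ?case by (auto simp del: Ck.simps(2) simp: Ck.simps(2)[of "Suc k"] Ck.simps(2)[of k])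
qed

lemma Ck_const: "Ck k (\<lambda>z. c)"
  by (induction k arbitrary: c) auto

lemma Ck_bounded_linear:
  assumes "bounded_linear f" shows "Ck k f"
proof -
  have d: "(f has_derivative f) (at z)" for z
    using assms by (rule bounded_linear_imp_has_derivative)
  have "pd b f = (\<lambda>z. f b)" for b using pd_unique[OF d] by auto
  moreover have "f differentiable (at z)" for z using d by (rule differentiableI)
  ultimately show ?thesis using Ck_const
    by (cases k) (auto intro!: linear_continuous_on assms)
qed

lemma Ck_add: "Ck k f \<Longrightarrow> Ck k g \<Longrightarrow> Ck k (\<lambda>z. f z + g z)"
proof (induction k arbitrary: f g)
  case (Suc k)
  have d: "((\<lambda>z. f z + g z) has_derivative
      (\<lambda>h. frechet_derivative f (at z) h + frechet_derivative g (at z) h)) (at z)" for z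
    using Suc.prems by (intro has_derivative_add has_derivative_frechet) auto
  have "pd b (\<lambda>z. f z + g z) = (\<lambda>z. pd b f z + pd b g z)" for b
    using pd_unique[OF d] by auto
  moreover have "(\<lambda>z. f z + g z) differentiable (at z)" for z using d by (rule differentiableI)
  ultimately show ?case using Suc by auto
qed (auto intro: continuous_on_add)

lemma has_derivative_mult_frechet:
  fixes f g :: "plane \<Rightarrow> real"
  assumes "f differentiable (at z)" "g differentiable (at z)"
  shows "((\<lambda>z. f z * g z) has_derivative
      (\<lambda>h. f z * frechet_derivative g (at z) h + frechet_derivative f (at z) h * g z)) (at z)"
  using assms by (intro has_derivative_mult has_derivative_frechet)

lemma pd_mult:
  "f differentiable (at z) \<Longrightarrow> g differentiable (at z) \<Longrightarrow>
    pd b (\<lambda>z. f z * g z) z = f z * pd b g z + pd b f z * g z"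
  using pd_unique[OF has_derivative_mult_frechet] by blast

lemma Ck_mult: "Ck k f \<Longrightarrow> Ck k g \<Longrightarrow> Ck k (\<lambda>z. f z * g z)"
proof (induction k arbitrary: f g)
  case (Suc k)
  have "pd b (\<lambda>z. f z * g z) = (\<lambda>z. f z * pd b g z + pd b f z * g z)" for b
    using Suc.prems by (intro ext pd_mult) auto
  moreover have "(\<lambda>z. f z * g z) differentiable (at z)" for z
    using Suc.prems by (intro differentiable_mult) auto
  moreover have "Ck k (\<lambda>z. f z * pd b g z + pd b f z * g z)" if "b \<in> Basis" for b
    using Suc.prems that Ck_Suc_D[OF Suc.prems(1)] Ck_Suc_D[OF Suc.prems(2)]
    by (intro Ck_add Suc.IH) auto
  ultimately show ?case by auto
qed (auto intro: continuous_on_mult)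

lemma Ck_cmult: "Ck k f \<Longrightarrow> Ck k (\<lambda>z. c * f z)"
  by (intro Ck_mult Ck_const)

lemma Ck_diff: "Ck k f \<Longrightarrow> Ck k g \<Longrightarrow> Ck k (\<lambda>z. f z - g z)"
  using Ck_add[OF _ Ck_cmult[of k g "-1"], of f] by simp

lemma Ck_fst: "Ck k fst" and Ck_snd: "Ck k snd"
  by (intro Ck_bounded_linear bounded_linear_fst bounded_linear_snd)+

lemma Ck_inner: "Ck k (\<lambda>z. z \<bullet> b)"
  by (intro Ck_bounded_linear bounded_linear_inner_left)

lemma Ck_norm_sq: "Ck k (\<lambda>z. (norm z)\<^sup>2)"
proof -
  have "(\<lambda>z::plane. (norm z)\<^sup>2) = (\<lambda>z. fst z * fst z + snd z * snd z)"
    by (auto simp: norm_Pair power2_eq_square fun_eq_iff)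
  then show ?thesis by (simp only:) (intro Ck_add Ck_mult Ck_fst Ck_snd)
qed

text \<open>Smoothness of a composite is inherited along any family of real functions that is closed
  under differentiation; the two families used are the flat functions \<open>p(1/t) exp(-1/t)\<close> and the
  entire power series.\<close>

lemma Ck_comp_family:
  assumes fam: "\<And>f. f \<in> \<F> \<Longrightarrow> \<exists>f'\<in>\<F>. \<forall>t. (f has_real_derivative f' t) (at t)"
    and \<sigma>: "\<And>k. Ck k \<sigma>" and "f \<in> \<F>"
  shows "Ck k (\<lambda>z. f (\<sigma> z))"
  using \<open>f \<in> \<F>\<close>
proof (induction k arbitrary: f)
  case (0 f)
  obtain f' where "\<And>t. (f has_real_derivative f' t) (at t)" using fam[OF 0] by blast
  then have "continuous_on UNIV f" by (meson DERIV_continuous continuous_at_imp_continuous_on)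
  then show ?case using \<sigma>[of 0] by (auto intro: continuous_on_compose2)
next
  case (Suc k f)
  obtain f' where f': "f' \<in> \<F>" "\<And>t. (f has_real_derivative f' t) (at t)" using fam[OF Suc.prems] by blast
  have d: "((\<lambda>z. f (\<sigma> z)) has_derivative (\<lambda>h. frechet_derivative \<sigma> (at z) h * f' (\<sigma> z))) (at z)" for z
    using f'(2)[of "\<sigma> z"] \<sigma>[of 1]
    by (intro has_derivative_compose[OF has_derivative_frechet, where g = f and g' = "\<lambda>h. h * f' (\<sigma> z)", simplified])
      (auto simp: has_field_derivative_def mult_commute_abs)
  have "pd b (\<lambda>z. f (\<sigma> z)) = (\<lambda>z. pd b \<sigma> z * f' (\<sigma> z))" for b
    using pd_unique[OF d] by auto
  moreover have "Ck k (\<lambda>z. pd b \<sigma> z * f' (\<sigma> z))" if "b \<in> Basis" for b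
    using \<sigma>[of "Suc k"] that by (intro Ck_mult Suc.IH f'(1)) auto
  moreover have "(\<lambda>z. f (\<sigma> z)) differentiable (at z)" for z using d by (rule differentiableI)
  ultimately show ?case by auto
qed

subsection \<open>Closure properties of test functions\<close>

lemma test_fun_Ck: "test_fun \<phi> \<Longrightarrow> Ck k \<phi>"
  by (simp add: test_fun_def)

lemma test_fun_differentiable: "test_fun \<phi> \<Longrightarrow> \<phi> differentiable (at z)"
  using test_fun_Ck[of \<phi> 1] by simp

lemma test_fun_continuous: "test_fun \<phi> \<Longrightarrow> continuous_on UNIV \<phi>"
  using test_fun_Ck Ck_continuous by blast

lemma test_fun_L2: "test_fun \<phi> \<Longrightarrow> L2 \<phi>"
  by (intro L2_continuous test_fun_continuous)

lemma test_fun_support: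
  assumes "test_fun \<phi>"
  obtains K where "compact K" "K \<subseteq> disk" "\<And>z. z \<notin> K \<Longrightarrow> \<phi> z = 0"
  using assms unfolding test_fun_def by blast

lemma frechet_derivative_zero_outside:
  fixes f :: "plane \<Rightarrow> real"
  assumes "closed K" "\<And>z. z \<notin> K \<Longrightarrow> f z = 0" "z \<notin> K"
  shows "(f has_derivative (\<lambda>h. 0)) (at z)"
proof -
  have "((\<lambda>_. 0) has_derivative (\<lambda>h. 0)) (at z)" by simp
  then show ?thesis
    by (rule has_derivative_transform_within_open[of _ _ _ _ "- K"]) (use assms in auto)
qed

lemma test_fun_pd:
  assumes "test_fun \<phi>" "b \<in> Basis" shows "test_fun (pd b \<phi>)"
proof -
  obtain K where K: "compact K" "K \<subseteq> disk" "\<And>z. z \<notin> K \<Longrightarrow> \<phi> z = 0"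
    using test_fun_support[OF assms(1)] by blast
  have "pd b \<phi> z = 0" if "z \<notin> K" for z
    using frechet_derivative_zero_outside[of K \<phi> z] K that compact_imp_closed pd_unique by metis
  moreover have "Ck k (pd b \<phi>)" for k using test_fun_Ck[OF assms(1), of "Suc k"] assms(2) by auto
  ultimately show ?thesis using K unfolding test_fun_def by blast
qed

lemma test_fun_mult_smooth:
  assumes "test_fun \<phi>" "\<And>k. Ck k f" shows "test_fun (\<lambda>z. f z * \<phi> z)"
proof -
  obtain K where K: "compact K" "K \<subseteq> disk" "\<And>z. z \<notin> K \<Longrightarrow> \<phi> z = 0"
    using test_fun_support[OF assms(1)] by blast
  then show ?thesis using assms Ck_mult[of _ f \<phi>] unfolding test_fun_def
    by (auto intro!: exI[of _ K])
qed

lemma test_fun_mult: "test_fun \<phi> \<Longrightarrow> test_fun \<zeta> \<Longrightarrow> test_fun (\<lambda>z. \<zeta> z * \<phi> z)"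
  by (intro test_fun_mult_smooth test_fun_Ck)

lemma test_fun_cmult: "test_fun \<phi> \<Longrightarrow> test_fun (\<lambda>z. c * \<phi> z)"
  by (intro test_fun_mult_smooth Ck_const)

lemma test_fun_add:
  assumes "test_fun \<phi>" "test_fun \<zeta>" shows "test_fun (\<lambda>z. \<phi> z + \<zeta> z)"
proof -
  obtain K where K: "compact K" "K \<subseteq> disk" "\<And>z. z \<notin> K \<Longrightarrow> \<phi> z = 0"
    using test_fun_support[OF assms(1)] by blast
  obtain L where L: "compact L" "L \<subseteq> disk" "\<And>z. z \<notin> L \<Longrightarrow> \<zeta> z = 0"
    using test_fun_support[OF assms(2)] by blast
  have "compact (K \<union> L)" "K \<union> L \<subseteq> disk" "\<And>z. z \<notin> K \<union> L \<Longrightarrow> \<phi> z + \<zeta> z = 0"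
    using K L by (auto intro: compact_Un)
  then show ?thesis using assms Ck_add[of _ \<phi> \<zeta>] unfolding test_fun_def by blast
qed

subsection \<open>Continuously differentiable functions of compact support in the disk\<close>

text \<open>Besides test functions, quotients of test functions by powers of \<open>1 - r\<^sup>2\<close> occur; the gradient
  is kept as an explicit vector field.\<close>

definition c1c :: "(plane \<Rightarrow> real) \<Rightarrow> (plane \<Rightarrow> plane) \<Rightarrow> bool" where
  "c1c f G \<longleftrightarrow> (\<forall>z. (f has_derivative (\<lambda>h. h \<bullet> G z)) (at z)) \<and> continuous_on UNIV G \<and>
     (\<exists>K. compact K \<and> K \<subseteq> disk \<and> (\<forall>z. z \<notin> K \<longrightarrow> f z = 0 \<and> G z = 0))"

definition grad :: "(plane \<Rightarrow> real) \<Rightarrow> plane \<Rightarrow> plane" where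
  "grad f z = (pd (1, 0) f z, pd (0, 1) f z)"

lemma frechet_derivative_grad:
  assumes "f differentiable (at z)"
  shows "frechet_derivative f (at z) h = h \<bullet> grad f z"
proof -
  interpret bounded_linear "frechet_derivative f (at z)"
    using has_derivative_frechet[OF assms] by (rule has_derivative_bounded_linear)
  have "h = fst h *\<^sub>R (1, 0) + snd h *\<^sub>R (0, 1)" by (cases h) simp
  then have "frechet_derivative f (at z) h = fst h * pd (1, 0) f z + snd h * pd (0, 1) f z"
    by (metis add scaleR real_scaleR_def)
  then show ?thesis by (simp add: grad_def inner_prod_def)
qed

lemma has_derivative_grad:
  assumes "f differentiable (at z)"
  shows "(f has_derivative (\<lambda>h. h \<bullet> grad f z)) (at z)"
proof -
  have "frechet_derivative f (at z) = (\<lambda>h. h \<bullet> grad f z)"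
    by (rule ext) (rule frechet_derivative_grad[OF assms])
  then show ?thesis using has_derivative_frechet[OF assms] by simp
qed

lemma c1c_test_fun:
  assumes "test_fun \<phi>" shows "c1c \<phi> (grad \<phi>)"
proof -
  obtain K where K: "compact K" "K \<subseteq> disk" "\<And>z. z \<notin> K \<Longrightarrow> \<phi> z = 0"
    using test_fun_support[OF assms] by blast
  have "pd b \<phi> z = 0" if "z \<notin> K" for z b
    using frechet_derivative_zero_outside[of K \<phi> z] K that compact_imp_closed pd_unique by metis
  moreover have "(\<phi> has_derivative (\<lambda>h. h \<bullet> grad \<phi> z)) (at z)" for z
    by (rule has_derivative_grad[OF test_fun_differentiable[OF assms]])
  moreover have "continuous_on UNIV (grad \<phi>)"
    unfolding grad_def by (intro continuous_on_Pair test_fun_continuous test_fun_pd assms) auto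
  ultimately show ?thesis using K unfolding c1c_def grad_def zero_prod_def by blast
qed

lemma c1c_support:
  assumes "c1c f G"
  obtains K where "compact K" "K \<subseteq> disk" "\<And>z. z \<notin> K \<Longrightarrow> f z = 0" "\<And>z. z \<notin> K \<Longrightarrow> G z = 0"
proof -
  have "\<exists>K. compact K \<and> K \<subseteq> disk \<and> (\<forall>z. z \<notin> K \<longrightarrow> f z = 0 \<and> G z = 0)"
    using assms by (simp only: c1c_def)
  then obtain K where "compact K" "K \<subseteq> disk" "\<forall>z. z \<notin> K \<longrightarrow> f z = 0 \<and> G z = 0"
    by (elim exE conjE)
  then show ?thesis by (intro that[of K]) simp_all
qed

lemma c1c_zero_outside:
  assumes "c1c f G" "norm z \<ge> 1"
  shows "f z = 0" "G z = 0"
proof -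
  obtain K where K: "compact K" "K \<subseteq> disk" "\<And>z. z \<notin> K \<Longrightarrow> f z = 0" "\<And>z. z \<notin> K \<Longrightarrow> G z = 0"
    using c1c_support[OF assms(1)] by blast
  have "z \<notin> K"
  proof
    assume "z \<in> K"
    then have "z \<in> disk" using K(2) by (rule subsetD[rotated])
    then show False using assms(2) by simp
  qed
  then show "f z = 0" "G z = 0" by (rule K(3), rule K(4))
qed

lemma c1c_continuous: "c1c f G \<Longrightarrow> continuous_on UNIV f" "c1c f G \<Longrightarrow> continuous_on UNIV G"
  unfolding c1c_def
  by (auto intro!: continuous_at_imp_continuous_on has_derivative_continuous)

lemma continuous_on_UNIV_supported:
  fixes F :: "plane \<Rightarrow> 'a::real_normed_vector"
  assumes "continuous_on disk F" "compact K" "K \<subseteq> disk" "\<And>z. z \<notin> K \<Longrightarrow> F z = 0"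
  shows "continuous_on UNIV F"
proof -
  have "continuous_on (- K) F"
    by (rule continuous_on_eq[OF continuous_on_const[of _ 0]]) (use assms in auto)
  then have "continuous_on (disk \<union> - K) F"
    using assms by (intro continuous_on_open_Un) (auto intro: compact_imp_closed)
  moreover have "disk \<union> - K = UNIV" using assms by auto
  ultimately show ?thesis by simp
qed

lemma c1c_mult_disk:
  assumes f: "c1c f G"
    and h: "\<And>z. norm z < 1 \<Longrightarrow> (h has_derivative (\<lambda>k. k \<bullet> H z)) (at z)" "continuous_on disk H"
  shows "c1c (\<lambda>z. f z * h z) (\<lambda>z. f z *\<^sub>R H z + h z *\<^sub>R G z)"
proof -
  obtain K where K: "compact K" "K \<subseteq> disk" "\<And>z. z \<notin> K \<Longrightarrow> f z = 0" "\<And>z. z \<notin> K \<Longrightarrow> G z = 0"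
    using c1c_support[OF f] by blast
  have hc: "continuous_on disk h"
    using h(1) by (intro continuous_at_imp_continuous_on ballI) (auto intro: has_derivative_continuous)
  have "((\<lambda>z. f z * h z) has_derivative (\<lambda>k. k \<bullet> (f z *\<^sub>R H z + h z *\<^sub>R G z))) (at z)" for z
  proof (cases "norm z < 1")
    case True
    have "((\<lambda>z. f z * h z) has_derivative (\<lambda>k. f z * (k \<bullet> H z) + (k \<bullet> G z) * h z)) (at z)"
      using f h(1)[OF True] by (intro has_derivative_mult) (auto simp: c1c_def)
    then show ?thesis by (simp add: inner_add_right algebra_simps)
  next
    case False
    then have "z \<notin> K" using K by auto
    then have "((\<lambda>z. f z * h z) has_derivative (\<lambda>k. 0)) (at z)"
      using K by (intro frechet_derivative_zero_outside[of K]) (auto intro: compact_imp_closed)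
    then show ?thesis using K \<open>z \<notin> K\<close> by simp
  qed
  moreover have "continuous_on UNIV (\<lambda>z. f z *\<^sub>R H z + h z *\<^sub>R G z)"
  proof (rule continuous_on_UNIV_supported[OF _ K(1,2)])
    show "continuous_on disk (\<lambda>z. f z *\<^sub>R H z + h z *\<^sub>R G z)"
      using c1c_continuous[OF f] h(2) hc
      by (intro continuous_intros) (auto intro: continuous_on_subset)
  qed (use K in auto)
  moreover have "\<forall>z. z \<notin> K \<longrightarrow> f z * h z = 0 \<and> f z *\<^sub>R H z + h z *\<^sub>R G z = 0"
    using K by auto
  ultimately show ?thesis unfolding c1c_def using K by blast
qed

lemma c1c_mult:
  assumes "c1c f G" "c1c h H"
  shows "c1c (\<lambda>z. f z * h z) (\<lambda>z. f z *\<^sub>R H z + h z *\<^sub>R G z)"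
  using assms(2) c1c_continuous(2)[OF assms(2)]
  by (intro c1c_mult_disk[OF assms(1)]) (auto simp: c1c_def intro: continuous_on_subset)

lemma has_derivative_norm_sq:
  "((\<lambda>z::plane. (norm z)\<^sup>2) has_derivative (\<lambda>h. h \<bullet> (2 *\<^sub>R z))) (at z)"
  unfolding power2_norm_eq_inner
  by (auto intro!: derivative_eq_intros simp: inner_commute)

lemma has_derivative_radial:
  assumes "(m has_real_derivative m') (at ((norm z)\<^sup>2))"
  shows "((\<lambda>z::plane. m ((norm z)\<^sup>2)) has_derivative (\<lambda>h. h \<bullet> ((2 * m') *\<^sub>R z))) (at z)"
proof -
  have "((\<lambda>z::plane. m ((norm z)\<^sup>2)) has_derivative (\<lambda>h. m' * (h \<bullet> (2 *\<^sub>R z)))) (at z)"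
    using has_derivative_compose[OF has_derivative_norm_sq, of m "\<lambda>h. m' * h"] assms
    by (simp add: has_field_derivative_def)
  then show ?thesis by (simp add: mult_ac)
qed

lemma norm_sq_less_1: "norm (z::plane) < 1 \<longleftrightarrow> (norm z)\<^sup>2 < 1"
  by (simp add: power_less_one_iff abs_square_less_1)

lemma c1c_mult_radial:
  assumes f: "c1c f G"
    and m: "\<And>t. t < 1 \<Longrightarrow> (m has_real_derivative m' t) (at t)" "continuous_on {..<1} m'"
  shows "c1c (\<lambda>z. f z * m ((norm z)\<^sup>2)) (\<lambda>z. f z *\<^sub>R ((2 * m' ((norm z)\<^sup>2)) *\<^sub>R z) + m ((norm z)\<^sup>2) *\<^sub>R G z)"
proof (rule c1c_mult_disk[OF f])
  show "((\<lambda>z. m ((norm z)\<^sup>2)) has_derivative (\<lambda>k. k \<bullet> ((2 * m' ((norm z)\<^sup>2)) *\<^sub>R z))) (at z)"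
    if "norm z < 1" for z :: plane
    using that by (intro has_derivative_radial m) (simp add: norm_sq_less_1[symmetric])
  show "continuous_on disk (\<lambda>z. (2 * m' ((norm z)\<^sup>2)) *\<^sub>R z)"
    by (intro continuous_intros continuous_on_compose2[OF m(2)]) (auto simp: norm_sq_less_1[symmetric])
qed

subsection \<open>Integration by parts\<close>

lemma LINT_disk_lborel:
  fixes f :: "plane \<Rightarrow> real"
  assumes "f \<in> borel_measurable borel" "\<And>z. norm z \<ge> 1 \<Longrightarrow> f z = 0"
  shows "(LINT z|lebesgue_on disk. f z) = (LINT z|lborel. f z)"
proof -
  have "(LINT z|lebesgue_on disk. f z) = (LINT z|lebesgue. indicator disk z *\<^sub>R f z)"
    by (subst integral_restrict_space) auto
  also have "(\<lambda>z. indicator disk z *\<^sub>R f z) = f" using assms(2) by (auto simp: indicator_def fun_eq_iff)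
  also have "(LINT z|lebesgue. f z) = (LINT z|lborel. f z)"
    using assms(1) by (intro integral_completion) simp
  finally show ?thesis .
qed

lemma integrable_lborel_supported:
  fixes f :: "'a::euclidean_space \<Rightarrow> real"
  assumes "continuous_on UNIV f" "compact K" "\<And>z. z \<notin> K \<Longrightarrow> f z = 0"
  shows "integrable lborel f"
proof -
  have "integrable lborel (\<lambda>z. indicator K z *\<^sub>R f z)"
    using assms by (intro borel_integrable_compact) (auto intro: continuous_on_subset)
  moreover have "(\<lambda>z. indicator K z *\<^sub>R f z) = f" using assms(3) by (auto simp: indicator_def fun_eq_iff)
  ultimately show ?thesis by simp
qed

lemma lborel_integral_derivative:
  fixes g g' :: "real \<Rightarrow> real"
  assumes d: "\<And>x. (g has_real_derivative g' x) (at x)" and c: "continuous_on UNIV g'"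
    and z: "\<And>x. \<bar>x\<bar> \<ge> 1 \<Longrightarrow> g x = 0" "\<And>x. \<bar>x\<bar> \<ge> 1 \<Longrightarrow> g' x = 0"
  shows "(LINT x|lborel. g' x) = 0" "\<bar>g x\<bar> \<le> (LINT x|lborel. \<bar>g' x\<bar>)"
proof -
  have c': "isCont g' x" for x using c by (simp add: continuous_on_eq_continuous_at)
  have z': "g' x = 0" if "x \<notin> {-1..1}" for x using that by (intro z(2)) auto
  then have cut: "g' x * indicator {-1..1} x = g' x" for x by (auto simp: indicator_def)
  have "has_bochner_integral lborel (\<lambda>x. g' x * indicator {-1..1} x) (g 1 - g (-1))"
    by (intro has_bochner_integral_FTC_Icc_real d c') auto
  then show "(LINT x|lborel. g' x) = 0" using z(1) by (simp add: cut has_bochner_integral_integral_eq)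
  have int: "integrable lborel (\<lambda>x. \<bar>g' x\<bar>)"
    using c z' by (intro integrable_lborel_supported[where K = "{-1..1}"] continuous_intros) auto
  show "\<bar>g x\<bar> \<le> (LINT x|lborel. \<bar>g' x\<bar>)"
  proof (cases "\<bar>x\<bar> \<ge> 1")
    case True
    then show ?thesis using z(1) by (auto intro!: Bochner_Integration.integral_nonneg)
  next
    case False
    have "has_bochner_integral lborel (\<lambda>y. g' y * indicator {-1..x} y) (g x - g (-1))"
      by (intro has_bochner_integral_FTC_Icc_real d c') (use False in auto)
    then have i: "integrable lborel (\<lambda>y. g' y * indicator {-1..x} y)" and
      e: "g x = (LINT y|lborel. g' y * indicator {-1..x} y)"
      using z(1)[of "-1"] by (simp_all add: has_bochner_integral_iff)
    have "\<bar>g x\<bar> \<le> (LINT y|lborel. \<bar>g' y * indicator {-1..x} y\<bar>)"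
      unfolding e by (rule integral_abs_bound)
    also have "\<dots> \<le> (LINT x|lborel. \<bar>g' x\<bar>)"
      using i by (intro integral_mono int integrable_abs) (auto simp: indicator_def)
    finally show ?thesis .
  qed
qed

lemma c1c_slices:
  assumes "c1c f G"
  shows "((\<lambda>x. f (x, y)) has_real_derivative fst (G (x, y))) (at x)"
    and "((\<lambda>y. f (x, y)) has_real_derivative snd (G (x, y))) (at y)"
proof -
  have f: "(f has_derivative (\<lambda>h. h \<bullet> G z)) (at z)" for z using assms by (simp add: c1c_def)
  have "((\<lambda>x. f (x, y)) has_derivative (\<lambda>h. (h, 0) \<bullet> G (x, y))) (at x)"
    by (rule has_derivative_compose[OF _ f]) (auto intro!: derivative_eq_intros)
  then show "((\<lambda>x. f (x, y)) has_real_derivative fst (G (x, y))) (at x)"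
    by (simp add: has_field_derivative_def inner_prod_def mult_commute_abs)
  have "((\<lambda>y. f (x, y)) has_derivative (\<lambda>h. (0, h) \<bullet> G (x, y))) (at y)"
    by (rule has_derivative_compose[OF _ f]) (auto intro!: derivative_eq_intros)
  then show "((\<lambda>y. f (x, y)) has_real_derivative snd (G (x, y))) (at y)"
    by (simp add: has_field_derivative_def inner_prod_def mult_commute_abs)
qed

lemma norm_pair_ge: "\<bar>x\<bar> \<le> norm (x, y :: real)" "\<bar>y\<bar> \<le> norm (x :: real, y)"
  by (auto simp: norm_Pair intro!: real_le_rsqrt)

lemma c1c_slice_facts:
  assumes "c1c f G"
  shows "(LINT x|lborel. fst (G (x, y))) = 0" "\<bar>f (x, y)\<bar> \<le> (LINT x|lborel. \<bar>fst (G (x, y))\<bar>)"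
    and "(LINT y|lborel. snd (G (x, y))) = 0" "\<bar>f (x, y)\<bar> \<le> (LINT y|lborel. \<bar>snd (G (x, y))\<bar>)"
proof -
  note G = c1c_continuous(2)[OF assms]
  have z: "f (x, y) = 0" "G (x, y) = 0" if "\<bar>x\<bar> \<ge> 1 \<or> \<bar>y\<bar> \<ge> 1" for x y
    using c1c_zero_outside[OF assms, of "(x, y)"] norm_pair_ge(1)[of x y] norm_pair_ge(2)[of y x] that by auto
  have c1: "continuous_on UNIV (\<lambda>x. fst (G (x, y)))" and c2: "continuous_on UNIV (\<lambda>y. snd (G (x, y)))" for x y
    by (intro continuous_intros continuous_on_compose2[OF G]; simp)+
  show "(LINT x|lborel. fst (G (x, y))) = 0" "\<bar>f (x, y)\<bar> \<le> (LINT x|lborel. \<bar>fst (G (x, y))\<bar>)"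
    using lborel_integral_derivative[OF c1c_slices(1)[OF assms] c1] z by auto
  show "(LINT y|lborel. snd (G (x, y))) = 0" "\<bar>f (x, y)\<bar> \<le> (LINT y|lborel. \<bar>snd (G (x, y))\<bar>)"
    using lborel_integral_derivative[OF c1c_slices(2)[OF assms] c2] z by auto
qed

lemma c1c_integrable_grad:
  assumes "c1c f G"
  shows "integrable lborel (\<lambda>z. fst (G z))" "integrable lborel (\<lambda>z. snd (G z))"
    "integrable lborel f"
proof -
  obtain K where K: "compact K" "K \<subseteq> disk" "\<And>z. z \<notin> K \<Longrightarrow> f z = 0" "\<And>z. z \<notin> K \<Longrightarrow> G z = 0"
    using c1c_support[OF assms] by blast
  show "integrable lborel (\<lambda>z. fst (G z))" "integrable lborel (\<lambda>z. snd (G z))" "integrable lborel f"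
    using c1c_continuous[OF assms] K
    by (intro integrable_lborel_supported[OF _ K(1)] continuous_intros; simp)+
qed

lemma lborel_plane_iterated:
  fixes f :: "plane \<Rightarrow> real"
  assumes "integrable lborel f"
  shows "(LINT x|lborel. LINT y|lborel. f (x, y)) = (LINT z|lborel. f z)"
    and "(LINT y|lborel. LINT x|lborel. f (x, y)) = (LINT z|lborel. f z)"
    and "integrable lborel (\<lambda>x. LINT y|lborel. f (x, y))"
    and "integrable lborel (\<lambda>y. LINT x|lborel. f (x, y))"
proof -
  have e: "(\<lambda>(x, y). f (x, y)) = f" by auto
  have i: "integrable (lborel \<Otimes>\<^sub>M lborel) (\<lambda>(x, y). f (x, y))"
    unfolding e lborel_prod by (rule assms)
  note f = lborel_pair.integral_fst[OF i] lborel_pair.integral_snd[OF i]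
    lborel_pair.integrable_fst[OF i] lborel_pair.integrable_snd[OF i]
  from f(1,2) show "(LINT x|lborel. LINT y|lborel. f (x, y)) = (LINT z|lborel. f z)"
    "(LINT y|lborel. LINT x|lborel. f (x, y)) = (LINT z|lborel. f z)"
    unfolding e lborel_prod by auto
  from f(3,4) show "integrable lborel (\<lambda>x. LINT y|lborel. f (x, y))"
    "integrable lborel (\<lambda>y. LINT x|lborel. f (x, y))" by auto
qed

text \<open>Fubini: on each line the integral of a derivative of a compactly supported function is 0.\<close>

lemma c1c_integral_grad:
  assumes "c1c f G" "b \<in> Basis"
  shows "(LINT z|lebesgue_on disk. G z \<bullet> b) = 0"
proof -
  note i = c1c_integrable_grad[OF assms(1)]
  note G = c1c_continuous(2)[OF assms(1)]
  have m: "(\<lambda>z. fst (G z)) \<in> borel_measurable borel" "(\<lambda>z. snd (G z)) \<in> borel_measurable borel"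
    by (intro borel_measurable_continuous_onI continuous_intros G)+
  have 1: "(LINT z|lborel. fst (G z)) = 0"
    using lborel_plane_iterated(2)[OF i(1)] unfolding c1c_slice_facts(1)[OF assms(1)] by simp
  have 2: "(LINT z|lborel. snd (G z)) = 0"
    using lborel_plane_iterated(1)[OF i(2)] unfolding c1c_slice_facts(3)[OF assms(1)] by simp
  have z: "fst (G z) = 0" "snd (G z) = 0" if "norm z \<ge> 1" for z
    using c1c_zero_outside(2)[OF assms(1) that] by simp_all
  have "(LINT z|lebesgue_on disk. fst (G z)) = 0"
    using LINT_disk_lborel[OF m(1) z(1)] 1 by simp
  moreover have "(LINT z|lebesgue_on disk. snd (G z)) = 0"
    using LINT_disk_lborel[OF m(2) z(2)] 2 by simp
  ultimately show ?thesis using assms(2) by (auto simp: Basis_plane inner_prod_def)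
qed

text \<open>Integrability over slices in both directions at once: \<open>g(x,y)\<^sup>2\<close> is at most a function of \<open>y\<close>
  times a function of \<open>x\<close>, namely the integrals of the partial derivatives along the two axes.\<close>

lemma c1c_ladyzhenskaya:
  assumes g: "c1c g G"
  shows "ip g g \<le> (LINT z|lebesgue_on disk. \<bar>fst (G z)\<bar>) * (LINT z|lebesgue_on disk. \<bar>snd (G z)\<bar>)"
proof -
  obtain K where K: "compact K" "K \<subseteq> disk" "\<And>z. z \<notin> K \<Longrightarrow> g z = 0" "\<And>z. z \<notin> K \<Longrightarrow> G z = 0"
    using c1c_support[OF g] by blast
  note G = c1c_continuous(2)[OF g] and gc = c1c_continuous(1)[OF g]
  define A where "A y = (LINT x|lborel. \<bar>fst (G (x, y))\<bar>)" for y
  define B where "B x = (LINT y|lborel. \<bar>snd (G (x, y))\<bar>)" for x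
  have i: "integrable lborel (\<lambda>z. \<bar>fst (G z)\<bar>)" "integrable lborel (\<lambda>z. \<bar>snd (G z)\<bar>)"
    using c1c_integrable_grad[OF g] by auto
  have A: "integrable lborel A" "(LINT y|lborel. A y) = (LINT z|lborel. \<bar>fst (G z)\<bar>)"
    unfolding A_def by (rule lborel_plane_iterated[OF i(1)])+
  have B: "integrable lborel B" "(LINT x|lborel. B x) = (LINT z|lborel. \<bar>snd (G z)\<bar>)"
    unfolding B_def by (rule lborel_plane_iterated[OF i(2)])+
  have le: "g (x, y) * g (x, y) \<le> B x * A y" for x y
    using c1c_slice_facts(2,4)[OF g, of x y] mult_mono[of "\<bar>g (x, y)\<bar>" "B x" "\<bar>g (x, y)\<bar>" "A y"]
    unfolding A_def B_def by simp
  have sq: "integrable lborel (\<lambda>z. g z * g z)"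
    using K by (intro integrable_lborel_supported[OF _ K(1)] continuous_intros gc) simp
  have zero: "g (x, y) = 0" if "\<bar>y\<bar> \<ge> 1" for x y
    using c1c_zero_outside(1)[OF g, of "(x, y)"] norm_pair_ge(2)[of y x] that by auto
  have sl: "integrable lborel (\<lambda>y. g (x, y) * g (x, y))" for x
    using zero by (intro integrable_lborel_supported[where K = "{-1..1}"] continuous_intros
        continuous_on_compose2[OF gc]) force+
  have "ip g g = (LINT z|lborel. g z * g z)"
    unfolding ip_def using c1c_zero_outside[OF g]
    by (intro LINT_disk_lborel borel_measurable_continuous_onI continuous_intros gc) auto
  also have "\<dots> = (LINT x|lborel. LINT y|lborel. g (x, y) * g (x, y))"
    using lborel_plane_iterated(1)[OF sq] by simp
  also have "\<dots> \<le> (LINT x|lborel. B x * (LINT y|lborel. A y))"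
  proof (rule integral_mono)
    show "integrable lborel (\<lambda>x. LINT y|lborel. g (x, y) * g (x, y))"
      by (rule lborel_plane_iterated(3)[OF sq])
    show "integrable lborel (\<lambda>x. B x * (LINT y|lborel. A y))" using B by simp
    fix x
    have "(LINT y|lborel. g (x, y) * g (x, y)) \<le> (LINT y|lborel. B x * A y)"
      using A by (intro integral_mono sl le) auto
    then show "(LINT y|lborel. g (x, y) * g (x, y)) \<le> B x * (LINT y|lborel. A y)" by simp
  qed
  also have "\<dots> = (LINT z|lborel. \<bar>fst (G z)\<bar>) * (LINT z|lborel. \<bar>snd (G z)\<bar>)"
    using A B by simp
  also have "(LINT z|lborel. \<bar>fst (G z)\<bar>) = (LINT z|lebesgue_on disk. \<bar>fst (G z)\<bar>)"
    using c1c_zero_outside(2)[OF g]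
    by (intro LINT_disk_lborel[symmetric] borel_measurable_continuous_onI continuous_intros G) auto
  also have "(LINT z|lborel. \<bar>snd (G z)\<bar>) = (LINT z|lebesgue_on disk. \<bar>snd (G z)\<bar>)"
    using c1c_zero_outside(2)[OF g]
    by (intro LINT_disk_lborel[symmetric] borel_measurable_continuous_onI continuous_intros G) auto
  finally show ?thesis .
qed

text \<open>The product of a test function and a smooth function is again a test function, so its gradient integrates to 0.\<close>

lemma test_fun_by_parts:
  assumes "test_fun \<phi>" "\<And>k. Ck k f" "b \<in> Basis"
  shows "ip (pd b f) \<phi> = - ip f (pd b \<phi>)"
proof -
  have t: "test_fun (\<lambda>z. f z * \<phi> z)" by (intro test_fun_mult_smooth assms)
  have d: "f differentiable (at z)" for z using assms(2)[of 1] by simp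
  have "grad (\<lambda>z. f z * \<phi> z) z \<bullet> b = pd b (\<lambda>z. f z * \<phi> z) z" for z
    using assms(3) by (auto simp: Basis_plane grad_def)
  then have "grad (\<lambda>z. f z * \<phi> z) z \<bullet> b = f z * pd b \<phi> z + pd b f z * \<phi> z" for z
    using pd_mult[OF d test_fun_differentiable[OF assms(1)]] by simp
  then have "(LINT z|lebesgue_on disk. f z * pd b \<phi> z + pd b f z * \<phi> z) = 0"
    using c1c_integral_grad[OF c1c_test_fun[OF t] assms(3)] by simp
  moreover have "L2 \<phi>" "L2 (pd b \<phi>)"
    by (intro test_fun_L2 test_fun_pd assms)+
  moreover have "L2 f" by (rule L2_continuous[OF Ck_continuous[OF assms(2)]])
  moreover have "L2 (pd b f)"
    using assms(2)[of "Suc 0"] assms(3) by (intro L2_continuous) simp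
  ultimately show ?thesis by (simp add: ip_def L2_integrable_mult)
qed

text \<open>Symmetry of the mixed partial derivatives, by differentiating
  \<open>f(x,y) - f(a,y) = \<integral>\<^sub>a\<^sup>x f\<^sub>x(s,y) ds\<close> under the integral sign.\<close>

lemma Ck_slices:
  assumes "Ck (Suc k) f"
  shows "((\<lambda>x. f (x, y)) has_real_derivative pd (1, 0) f (x, y)) (at x)"
    and "((\<lambda>y. f (x, y)) has_real_derivative pd (0, 1) f (x, y)) (at y)"
proof -
  have f: "(f has_derivative (\<lambda>h. h \<bullet> grad f z)) (at z)" for z
    by (rule has_derivative_grad[OF Ck_differentiable[OF assms]])
  have "((\<lambda>x. f (x, y)) has_derivative (\<lambda>h. (h, 0) \<bullet> grad f (x, y))) (at x)"
    by (rule has_derivative_compose[OF _ f]) (auto intro!: derivative_eq_intros)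
  then show "((\<lambda>x. f (x, y)) has_real_derivative pd (1, 0) f (x, y)) (at x)"
    by (simp add: has_field_derivative_def grad_def inner_prod_def mult_commute_abs)
  have "((\<lambda>y. f (x, y)) has_derivative (\<lambda>h. (0, h) \<bullet> grad f (x, y))) (at y)"
    by (rule has_derivative_compose[OF _ f]) (auto intro!: derivative_eq_intros)
  then show "((\<lambda>y. f (x, y)) has_real_derivative pd (0, 1) f (x, y)) (at y)"
    by (simp add: has_field_derivative_def grad_def inner_prod_def mult_commute_abs)
qed

lemma pd_commute_xy:
  assumes "Ck (Suc (Suc 0)) f"
  shows "pd (1, 0) (pd (0, 1) f) z = pd (0, 1) (pd (1, 0) f) z"
proof -
  obtain x0 y0 where z: "z = (x0, y0)" by (cases z)
  define a where "a = x0 - 1"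
  let ?fx = "pd (1, 0) f" and ?fy = "pd (0, 1) f" and ?fxy = "pd (0, 1) (pd (1, 0) f)"
  have C: "Ck (Suc 0) ?fx" "Ck (Suc 0) ?fy" "continuous_on UNIV ?fxy"
  proof -
    have D: "Ck k (pd b g)" if "Ck (Suc k) g" "b \<in> Basis" for k b and g :: "plane \<Rightarrow> real"
      using that unfolding Ck.simps(2) by blast
    show "Ck (Suc 0) ?fx" "Ck (Suc 0) ?fy" by (rule D[OF assms], simp)+
    show "continuous_on UNIV ?fxy"
      by (rule Ck_continuous[OF D[OF \<open>Ck (Suc 0) ?fx\<close>]]) simp
  qed
  have cx: "continuous_on UNIV ?fx" by (rule Ck_continuous[OF C(1)])
  have ftc: "((\<lambda>s. ?fx (s, y)) has_integral (f (x, y) - f (a, y))) {a..x}" if "a \<le> x" for x y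
  proof (rule fundamental_theorem_of_calculus[OF that])
    fix s
    have "((\<lambda>x. f (x, y)) has_real_derivative ?fx (s, y)) (at s within {a..x})"
      by (rule has_field_derivative_at_within, rule Ck_slices(1)[OF assms])
    then show "((\<lambda>x. f (x, y)) has_vector_derivative ?fx (s, y)) (at s within {a..x})"
      by (simp only: has_real_derivative_iff_has_vector_derivative)
  qed
  have e: "?fy (x, y0) - ?fy (a, y0) = integral {a..x} (\<lambda>s. ?fxy (s, y0))" if "a \<le> x" for x
  proof -
    have "((\<lambda>y. integral (cbox a x) (\<lambda>s. ?fx (s, y))) has_field_derivative
        integral (cbox a x) (\<lambda>s. ?fxy (s, y0))) (at y0 within UNIV)"
    proof (rule leibniz_rule_field_derivative)
      show "((\<lambda>y. ?fx (s, y)) has_field_derivative ?fxy (s, y)) (at y within UNIV)" for y s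
        using Ck_slices(2)[OF C(1)] by simp
      show "(\<lambda>s. ?fx (s, y)) integrable_on cbox a x" for y
        by (intro integrable_continuous continuous_on_compose2[OF cx] continuous_intros) auto
      show "continuous_on (UNIV \<times> cbox a x) (\<lambda>(y, s). ?fxy (s, y))"
        unfolding case_prod_unfold
        by (intro continuous_on_compose2[OF C(3)] continuous_intros) auto
    qed auto
    moreover have "integral (cbox a x) (\<lambda>s. ?fx (s, y)) = f (x, y) - f (a, y)" for y
      using ftc[OF that] by (simp add: integral_unique)
    ultimately have "((\<lambda>y. f (x, y) - f (a, y)) has_real_derivative integral {a..x} (\<lambda>s. ?fxy (s, y0))) (at y0)"
      by simp
    moreover have "((\<lambda>y. f (x, y) - f (a, y)) has_real_derivative (?fy (x, y0) - ?fy (a, y0))) (at y0)"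
      by (intro DERIV_diff Ck_slices(2)[OF assms])
    ultimately show ?thesis using DERIV_unique by blast
  qed
  have "((\<lambda>x. integral {a..x} (\<lambda>s. ?fxy (s, y0))) has_real_derivative ?fxy (x0, y0)) (at x0 within {a..x0+1})"
    unfolding a_def
    by (intro integral_has_real_derivative continuous_on_compose2[OF C(3)] continuous_intros) auto
  then have "((\<lambda>x. ?fy (x, y0) - ?fy (a, y0)) has_real_derivative ?fxy (x0, y0)) (at x0 within {a..x0+1})"
    using e by (subst has_field_derivative_cong_ev[where y = x0])
      (auto simp: a_def eventually_nhds intro!: exI[of _ UNIV])
  then have 1: "((\<lambda>x. ?fy (x, y0) - ?fy (a, y0)) has_real_derivative ?fxy (x0, y0)) (at x0)"
    using at_within_Icc_at[of a x0 "x0+1"] by (simp add: a_def)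
  have "((\<lambda>x. ?fy (x, y0) - ?fy (a, y0)) has_real_derivative pd (1, 0) ?fy (x0, y0) - 0) (at x0)"
    by (intro DERIV_diff Ck_slices(1)[OF C(2)] DERIV_const)
  then show ?thesis using 1 DERIV_unique z by auto
qed

lemma pd_commute:
  assumes "test_fun \<phi>" "b \<in> Basis" "c \<in> Basis"
  shows "pd b (pd c \<phi>) = pd c (pd b \<phi>)"
  using assms(2,3) pd_commute_xy[OF test_fun_Ck[OF assms(1)]] by (auto simp: Basis_plane)

section \<open>Flat functions and cut-offs\<close>

text \<open>The derivative of \<open>p(1/t) exp(-1/t)\<close> is \<open>q(1/t) exp(-1/t)\<close> with \<open>q = x\<^sup>2 (p - p')\<close>. Keeping the polynomial
  as a parameter makes the family closed under differentiation, which gives smoothness at 0 to all orders at once.\<close>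

definition flat :: "real poly \<Rightarrow> real \<Rightarrow> real" where
  "flat p t = (if t \<le> 0 then 0 else poly p (1 / t) * exp (- (1 / t)))"

lemma poly_div_exp_tendsto_0: "((\<lambda>x. poly p x / exp x) \<longlongrightarrow> (0::real)) at_top"
proof -
  have "((\<lambda>x. \<Sum>i\<le>degree p. coeff p i * (x ^ i / exp x)) \<longlongrightarrow> (\<Sum>i\<le>degree p. coeff p i * 0)) at_top"
    by (intro tendsto_intros tendsto_power_div_exp_0)
  then show ?thesis by (simp add: poly_altdef sum_divide_distrib)
qed

lemma flat_tendsto_0: "(flat p \<longlongrightarrow> 0) (at_right 0)"
proof -
  have "((\<lambda>t. poly p (inverse t) / exp (inverse t)) \<longlongrightarrow> 0) (at_right 0)"
    by (rule filterlim_compose[OF poly_div_exp_tendsto_0 filterlim_inverse_at_top_right])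
  then show ?thesis
    by (rule Lim_transform_eventually)
      (auto simp: eventually_at_right_less flat_def exp_minus divide_simps intro!: eventually_at_rightI[of 0 1])
qed

lemma flat_has_derivative:
  "(flat p has_real_derivative flat ([:0, 0, 1:] * (p - pderiv p)) t) (at t)"
proof -
  consider "t < 0" | "t = 0" | "t > 0" by linarith
  then show ?thesis
  proof cases
    case 1
    have "((\<lambda>_. 0) has_real_derivative 0) (at t)" by simp
    then have "(flat p has_real_derivative 0) (at t)"
      by (rule has_field_derivative_transform_within_open[of _ _ _ "{..<0}"]) (use 1 in \<open>auto simp: flat_def\<close>)
    then show ?thesis using 1 by (simp add: flat_def)
  next
    case 2
    have "((\<lambda>h. flat p h / h) \<longlongrightarrow> 0) (at_right 0)"
      using flat_tendsto_0[of "[:0, 1:] * p"]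
      by (rule Lim_transform_eventually) (auto simp: flat_def intro!: eventually_at_rightI[of 0 1])
    moreover have "((\<lambda>h. flat p h / h) \<longlongrightarrow> 0) (at_left 0)"
      by (rule Lim_transform_eventually[OF tendsto_const])
        (auto simp: flat_def intro!: eventually_at_leftI[of "-1" 0])
    ultimately have "((\<lambda>h. flat p h / h) \<longlongrightarrow> 0) (at 0)" by (simp add: filterlim_split_at)
    then show ?thesis using 2 by (simp add: has_field_derivative_iff flat_def)
  next
    case 3
    have "((\<lambda>t. poly p (1 / t) * exp (- (1 / t))) has_real_derivative
        poly p (1 / t) * (exp (- (1 / t)) * (1 / t\<^sup>2)) + poly (pderiv p) (1 / t) * (- (1 / t\<^sup>2)) * exp (- (1 / t))) (at t)"
      using 3 by (auto intro!: derivative_eq_intros DERIV_chain2[OF poly_DERIV] simp: power2_eq_square)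
    then have "(flat p has_real_derivative
        poly p (1 / t) * (exp (- (1 / t)) * (1 / t\<^sup>2)) + poly (pderiv p) (1 / t) * (- (1 / t\<^sup>2)) * exp (- (1 / t))) (at t)"
      by (rule has_field_derivative_transform_within_open[of _ _ _ "{0<..}"]) (use 3 in \<open>auto simp: flat_def\<close>)
    moreover have "poly p (1 / t) * (exp (- (1 / t)) * (1 / t\<^sup>2)) + poly (pderiv p) (1 / t) * (- (1 / t\<^sup>2)) * exp (- (1 / t))
        = flat ([:0, 0, 1:] * (p - pderiv p)) t"
      using 3 by (simp add: flat_def power2_eq_square algebra_simps)
    ultimately show ?thesis by simp
  qed
qed

lemma Ck_flat:
  assumes "\<And>k. Ck k \<sigma>" shows "Ck k (\<lambda>z. flat p (\<sigma> z))"
proof (rule Ck_comp_family[of "range flat", OF _ assms])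
  fix f assume "f \<in> range flat"
  then obtain q where "f = flat q" by (rule rangeE)
  then show "\<exists>f'\<in>range flat. \<forall>t. (f has_real_derivative f' t) (at t)"
    using flat_has_derivative[of q] by (intro bexI[of _ "flat ([:0, 0, 1:] * (q - pderiv q))"]) auto
qed simp

abbreviation expm :: "real \<Rightarrow> real" where "expm \<equiv> flat 1"

lemma expm_pos: "t > 0 \<Longrightarrow> expm t = exp (- (1 / t))" and expm_neg: "t \<le> 0 \<Longrightarrow> expm t = 0"
  by (simp_all add: flat_def)

lemma expm_bounds: "0 \<le> expm t" "expm t \<le> 1"
  by (auto simp: flat_def)

lemma expm_tendsto_1:
  assumes "filterlim f at_top F" shows "((\<lambda>n. expm (f n)) \<longlongrightarrow> 1) F"
proof -
  have "((\<lambda>n. exp (- inverse (f n))) \<longlongrightarrow> exp (- 0)) F"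
    by (intro tendsto_intros tendsto_inverse_0_at_top assms)
  moreover have "\<forall>\<^sub>F n in F. f n > 0" using assms by (simp add: filterlim_at_top_dense)
  ultimately show ?thesis
    by (auto elim!: Lim_transform_eventually eventually_mono simp: expm_pos inverse_eq_divide)
qed

text \<open>A cut-off that equals 0 where \<open>1 - r\<^sup>2 \<le> a\<close> and tends to 1 pointwise in the disk as \<open>a \<rightarrow> 0\<close>. It is not constant near
  the centre, but its derivatives are explicit, and of the size \<open>a / (1 - r\<^sup>2)\<^sup>2\<close> that is needed (\<open>pd_cut_bounds\<close>).\<close>

definition cut :: "real \<Rightarrow> plane \<Rightarrow> real" where
  "cut a z = expm ((1 - a - (norm z)\<^sup>2) / a)"

lemma Ck_radial_affine: "Ck k (\<lambda>z::plane. (c - (norm z)\<^sup>2) / a)"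
proof -
  have "Ck k (\<lambda>z::plane. (1 / a) * (c - (norm z)\<^sup>2))"
    by (intro Ck_cmult Ck_diff Ck_const Ck_norm_sq)
  then show ?thesis by simp
qed

lemma test_fun_radial_flat:
  assumes "a > 0" "c < 1"
  shows "test_fun (\<lambda>z. flat p ((c - (norm z)\<^sup>2) / a))"
proof -
  have "z \<in> cball 0 (sqrt (max c 0))" if "\<not> c \<le> (norm z)\<^sup>2" for z :: plane
    using that by (auto intro!: real_le_rsqrt)
  then have "flat p ((c - (norm z)\<^sup>2) / a) = 0" if "z \<notin> cball 0 (sqrt (max c 0))" for z :: plane
    using that assms unfolding flat_def by (metis diff_le_0_iff_le divide_nonpos_pos)
  moreover have "cball 0 (sqrt (max c 0)) \<subseteq> disk"
  proof
    fix z :: plane assume "z \<in> cball 0 (sqrt (max c 0))"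
    then have "norm z \<le> sqrt (max c 0)" by simp
    also have "\<dots> < sqrt 1" using assms by (intro real_sqrt_less_mono) auto
    finally show "z \<in> disk" by simp
  qed
  ultimately show ?thesis
    unfolding test_fun_def using Ck_flat[OF Ck_radial_affine] by (auto intro!: exI[of _ "cball 0 (sqrt (max c 0))"])
qed

lemma test_fun_cut: "a > 0 \<Longrightarrow> test_fun (cut a)"
  using test_fun_radial_flat[of a "1 - a" 1] by (simp add: cut_def[abs_def])

lemma cut_bounds: "0 \<le> cut a z" "cut a z \<le> 1"
  by (simp_all add: cut_def expm_bounds)

lemma filterlim_recip_Suc: "filterlim (\<lambda>n. c / (1 / real (Suc n)) - 1) at_top sequentially" if "c > 0"
proof -
  have "filterlim (\<lambda>n. (c - 1) + c * real n) at_top sequentially"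
    using that by (intro filterlim_tendsto_add_at_top[OF tendsto_const]
        filterlim_tendsto_pos_mult_at_top[OF tendsto_const _ filterlim_real_sequentially])
  then show ?thesis by (simp add: algebra_simps)
qed

lemma cut_tendsto_1:
  assumes "norm z < 1" shows "(\<lambda>n. cut (1 / real (Suc n)) z) \<longlonglongrightarrow> 1"
proof -
  have e: "(1 - a - (norm z)\<^sup>2) / a = (1 - (norm z)\<^sup>2) / a - 1" if "a > 0" for a
    using that by (simp add: field_simps)
  have "cut (1 / real (Suc n)) z = expm ((1 - (norm z)\<^sup>2) / (1 / real (Suc n)) - 1)" for n
    unfolding cut_def by (subst e) auto
  then show ?thesis
    using assms by (simp only:) (intro expm_tendsto_1 filterlim_recip_Suc, simp add: norm_sq_less_1)
qed

section \<open>Weak derivatives\<close>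

subsection \<open>Test functions separate square integrable functions\<close>

lemma disk_borel_rep:
  assumes "u \<in> borel_measurable (lebesgue_on disk)"
  obtains v :: "plane \<Rightarrow> real" where "v \<in> borel_measurable borel" "\<And>z. norm z \<ge> 1 \<Longrightarrow> v z = 0"
    "AE z in lebesgue_on disk. u z = v z"
proof -
  have "(\<lambda>z. if z \<in> disk then u z else 0) \<in> borel_measurable lebesgue"
    using assms by (subst borel_measurable_if) auto
  then obtain g where g: "g \<in> borel_measurable lborel" "AE z in lborel. (if z \<in> disk then u z else 0) = g z"
    using completion_ex_borel_measurable_real[of "\<lambda>z. if z \<in> disk then u z else 0" lborel] by auto
  define v where "v z = (if z \<in> disk then g z else 0)" for z
  have "AE z in lebesgue. (if z \<in> disk then u z else 0) = g z" using g(2) by (rule AE_completion)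
  then have "AE z in lebesgue. z \<in> disk \<longrightarrow> u z = v z" by eventually_elim (auto simp: v_def)
  then have "AE z in lebesgue_on disk. u z = v z" by (simp add: AE_restrict_space_iff)
  moreover have "v \<in> borel_measurable borel"
  proof -
    have [measurable]: "g \<in> borel_measurable borel" "disk \<in> sets borel" using g(1) by simp_all
    show ?thesis unfolding v_def[abs_def] by measurable
  qed
  moreover have "v z = 0" if "norm z \<ge> 1" for z using that by (simp add: v_def)
  ultimately show ?thesis using that by blast
qed

lemma borel_disk_measurable:
  fixes f :: "plane \<Rightarrow> real"
  shows "f \<in> borel_measurable borel \<Longrightarrow> f \<in> borel_measurable (lebesgue_on disk)"
  by (intro measurable_restrict_space1 measurable_completion) simp

lemma integrable_disk_lborel:
  fixes f :: "plane \<Rightarrow> real"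
  assumes "f \<in> borel_measurable borel" "\<And>z. norm z \<ge> 1 \<Longrightarrow> f z = 0"
  shows "integrable (lebesgue_on disk) f \<longleftrightarrow> integrable lborel f"
proof -
  have "integrable (lebesgue_on disk) f \<longleftrightarrow> integrable lebesgue (\<lambda>z. indicator disk z *\<^sub>R f z)"
    by (subst integrable_restrict_space) auto
  also have "(\<lambda>z. indicator disk z *\<^sub>R f z) = f" using assms(2) by (auto simp: indicator_def fun_eq_iff)
  also have "integrable lebesgue f \<longleftrightarrow> integrable lborel f"
    using assms(1) by (intro integrable_completion) simp
  finally show ?thesis .
qed

text \<open>The indicator of a box is the pointwise limit of the test functions obtained from the factors
  \<open>exp (-1 / (n \<sigma>))\<close>, one for each side \<open>\<sigma> > 0\<close> of the box, and a cut-off.\<close>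

lemma integral_box_eq_0:
  assumes g: "L2 g" and orth: "\<And>\<phi>. test_fun \<phi> \<Longrightarrow> ip g \<phi> = 0"
  shows "(LINT z|lebesgue_on disk. g z * indicator (box a b) z) = 0"
proof -
  let ?e = "\<lambda>n \<sigma> z. expm (real n * \<sigma> z)"
  define \<phi> where "\<phi> n z = ?e n (\<lambda>z. z \<bullet> (1,0) - a \<bullet> (1,0)) z * (?e n (\<lambda>z. b \<bullet> (1,0) - z \<bullet> (1,0)) z *
      (?e n (\<lambda>z. z \<bullet> (0,1) - a \<bullet> (0,1)) z * (?e n (\<lambda>z. b \<bullet> (0,1) - z \<bullet> (0,1)) z * cut (1 / real (Suc n)) z)))"
    for n and z :: plane
  have t: "test_fun (\<phi> n)" for n
    unfolding \<phi>_def[abs_def]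
    by (intro test_fun_mult_smooth test_fun_cut Ck_flat Ck_cmult Ck_diff Ck_inner Ck_const) auto
  have le: "\<bar>\<phi> n z\<bar> \<le> 1" for n z
  proof -
    have "0 \<le> \<phi> n z" unfolding \<phi>_def by (intro mult_nonneg_nonneg expm_bounds cut_bounds)
    moreover have "\<phi> n z \<le> 1"
      unfolding \<phi>_def by (intro mult_le_one mult_nonneg_nonneg expm_bounds cut_bounds)
    ultimately show ?thesis by simp
  qed
  have lim1: "(\<lambda>n. expm (real n * c)) \<longlonglongrightarrow> indicator {0<..} c" for c :: real
  proof (cases "c > 0")
    case True
    then have "filterlim (\<lambda>n. c * real n) at_top sequentially"
      by (rule filterlim_tendsto_pos_mult_at_top[OF tendsto_const _ filterlim_real_sequentially])
    then have "filterlim (\<lambda>n. real n * c) at_top sequentially" by (simp add: mult.commute)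
    from expm_tendsto_1[OF this] show ?thesis using True by simp
  next
    case False
    then have "expm (real n * c) = 0" for n by (intro expm_neg) (simp add: mult_nonneg_nonpos)
    then show ?thesis using False by simp
  qed
  have lim: "(\<lambda>n. \<phi> n z) \<longlonglongrightarrow> indicator (box a b) z" if "norm z < 1" for z
  proof -
    let ?I = "\<lambda>c :: real. indicator {0<..} c :: real"
    have "(\<lambda>n. \<phi> n z) \<longlonglongrightarrow> ?I (z \<bullet> (1,0) - a \<bullet> (1,0)) * (?I (b \<bullet> (1,0) - z \<bullet> (1,0)) *
      (?I (z \<bullet> (0,1) - a \<bullet> (0,1)) * (?I (b \<bullet> (0,1) - z \<bullet> (0,1)) * 1)))"
      unfolding \<phi>_def by (intro tendsto_mult lim1 cut_tendsto_1 that)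
    moreover have "?I (z \<bullet> (1,0) - a \<bullet> (1,0)) * (?I (b \<bullet> (1,0) - z \<bullet> (1,0)) *
      (?I (z \<bullet> (0,1) - a \<bullet> (0,1)) * (?I (b \<bullet> (0,1) - z \<bullet> (0,1)) * 1))) = indicator (box a b) z"
      by (auto simp: indicator_def mem_box Basis_plane)
    ultimately show ?thesis by simp
  qed
  have gm: "g \<in> borel_measurable (lebesgue_on disk)" by (rule L2_measurable[OF g])
  have "(\<lambda>n. LINT z|lebesgue_on disk. g z * \<phi> n z) \<longlonglongrightarrow> (LINT z|lebesgue_on disk. g z * indicator (box a b) z)"
  proof (rule integral_dominated_convergence[where w = "\<lambda>z. \<bar>g z\<bar>"])
    show "(\<lambda>z. g z * indicator (box a b) z) \<in> borel_measurable (lebesgue_on disk)"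
      by (intro borel_measurable_times gm borel_disk_measurable) simp
    show "(\<lambda>z. g z * \<phi> n z) \<in> borel_measurable (lebesgue_on disk)" for n
      by (intro borel_measurable_times L2_measurable g test_fun_L2 t)
    show "integrable (lebesgue_on disk) (\<lambda>z. \<bar>g z\<bar>)"
      using L2_integrable_mult[OF g L2_continuous[of "\<lambda>_. 1"]] by simp
    show "AE z in lebesgue_on disk. (\<lambda>n. g z * \<phi> n z) \<longlonglongrightarrow> g z * indicator (box a b) z"
      by (intro AE_diskI tendsto_mult tendsto_const lim)
    show "AE z in lebesgue_on disk. norm (g z * \<phi> n z) \<le> \<bar>g z\<bar>" for n
      using le by (intro AE_I2) (auto simp: abs_mult intro!: mult_left_le)
  qed
  moreover have "(LINT z|lebesgue_on disk. g z * \<phi> n z) = 0" for n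
    using orth[OF t, of n] by (simp add: ip_def)
  ultimately show ?thesis by (simp add: LIMSEQ_const_iff)
qed

text \<open>Boxes generate the Borel sets and are closed under intersection, so the integral of \<open>g\<close> over every Borel set is 0.\<close>

lemma L2_eq_0_if_orthogonal:
  assumes g: "L2 g" and orth: "\<And>\<phi>. test_fun \<phi> \<Longrightarrow> ip g \<phi> = 0"
  shows "AE z in lebesgue_on disk. g z = 0"
proof -
  obtain v where v: "v \<in> borel_measurable borel" "\<And>z. norm z \<ge> 1 \<Longrightarrow> v z = 0"
    "AE z in lebesgue_on disk. g z = v z" using disk_borel_rep[OF L2_measurable[OF g]] by blast
  have "integrable (lebesgue_on disk) g"
    using L2_integrable_mult[OF g L2_continuous[of "\<lambda>_. 1"]] by simp
  then have "integrable (lebesgue_on disk) v"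
    using v(3) L2_measurable[OF g] borel_disk_measurable[OF v(1)] by (subst integrable_cong_AE[of _ _ g]) auto
  then have i: "integrable lborel v" using integrable_disk_lborel[OF v(1,2)] by simp
  have eq: "(LINT z|lborel. v z * indicator A z) = (LINT z|lebesgue_on disk. g z * indicator A z)" if "A \<in> sets borel" for A
  proof -
    have "(LINT z|lborel. v z * indicator A z) = (LINT z|lebesgue_on disk. v z * indicator A z)"
      using v that by (intro LINT_disk_lborel[symmetric]) auto
    also have "\<dots> = (LINT z|lebesgue_on disk. g z * indicator A z)"
      using v(3) that by (intro integral_cong_AE borel_measurable_times L2_measurable[OF g] borel_disk_measurable v(1)) auto
    finally show ?thesis .
  qed
  let ?G = "range (\<lambda>(a, b). box a b :: plane set)"
  have Int: "Int_stable ?G"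
  proof -
    have bG: "box p q \<in> ?G" for p q by (rule range_eqI[of _ _ "(p, q)"]) simp
    show ?thesis
      unfolding Int_stable_def
    proof (intro ballI)
      fix P Q assume "P \<in> ?G" "Q \<in> ?G"
      then obtain p q where "P = (\<lambda>(a, b). box a b) p" "Q = (\<lambda>(a, b). box a b) q" by (elim rangeE)
      then have "P = box (fst p) (snd p)" "Q = box (fst q) (snd q)" by (simp_all only: case_prod_unfold)
      then show "P \<inter> Q \<in> ?G" by (simp only: box_Int_box bG)
    qed
  qed
  have cl: "?G \<subseteq> Pow UNIV" by simp
  have im: "integrable lborel (\<lambda>z. v z * indicator A z)" if "A \<in> sets borel" for A
    using integrable_real_mult_indicator[of A lborel v] i that by simp
  have "(LINT z|lborel. v z * indicator A z) = 0" if "A \<in> sigma_sets UNIV ?G" for A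
    using Int cl that
  proof (induction rule: sigma_sets_induct_disjoint)
    case (basic A)
    then show ?case using eq integral_box_eq_0[OF g orth] by auto
  next
    case (compl A)
    have A: "A \<in> sets borel" using compl(1) by (simp add: borel_eq_box)
    have "\<exists>a b :: plane. disk \<subseteq> box a b" using bounded_subset_box_symmetric[of "disk"] by blast
    then obtain a b :: plane where ab: "disk \<subseteq> box a b" by blast
    have "(LINT z|lborel. v z * indicator (UNIV - A) z) = (LINT z|lborel. v z * indicator (box a b) z - v z * indicator A z)"
      using ab v(2) by (intro Bochner_Integration.integral_cong) (auto simp: indicator_def subset_eq not_less)
    also have "\<dots> = (LINT z|lborel. v z * indicator (box a b) z) - (LINT z|lborel. v z * indicator A z)"
      by (intro Bochner_Integration.integral_diff im A) auto
    finally show ?case using compl(2) eq[of "box a b"] integral_box_eq_0[OF g orth] by simp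
  next
    case (union A)
    have A: "A i \<in> sets borel" for i using union(2) by (auto simp: borel_eq_box)
    have "(\<lambda>n. LINT z|lborel. v z * indicator (\<Union>i<n. A i) z) \<longlonglongrightarrow> (LINT z|lborel. v z * indicator (\<Union>i. A i) z)"
    proof (rule integral_dominated_convergence[where w = "\<lambda>z. \<bar>v z\<bar>"])
      show "AE z in lborel. (\<lambda>n. v z * indicator (\<Union>i<n. A i) z) \<longlonglongrightarrow> v z * indicator (\<Union>i. A i) z"
        by (intro AE_I2 tendsto_mult tendsto_const LIMSEQ_indicator_UN)
    qed (use v(1) A i in \<open>auto simp: indicator_def\<close>)
    moreover have "(LINT z|lborel. v z * indicator (\<Union>i<n. A i) z) = 0" for n
    proof -
      have "indicator (\<Union>i<n. A i) z = (\<Sum>i<n. indicator (A i) z :: real)" for z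
        using union(1) by (intro indicator_UN_disjoint) (auto simp: disjoint_family_on_def)
      then have "(LINT z|lborel. v z * indicator (\<Union>i<n. A i) z) = (LINT z|lborel. (\<Sum>i<n. v z * indicator (A i) z))"
        by (simp only: sum_distrib_left)
      also have "\<dots> = (\<Sum>i<n. (LINT z|lborel. v z * indicator (A i) z))"
        by (intro Bochner_Integration.integral_sum im A)
      finally show ?thesis by (simp only: union(3) sum.neutral_const)
    qed
    ultimately show ?case by (simp add: LIMSEQ_const_iff)
  qed auto
  then have "AE z in lborel. v z = 0"
    by (intro sigma_finite_measure.density_zero[OF sigma_finite_lborel i]) (auto simp: set_lebesgue_integral_def borel_eq_box mult.commute)
  then have "AE z in lebesgue. v z = 0" by (rule AE_completion)
  then have "AE z in lebesgue. z \<in> disk \<longrightarrow> v z = 0" by (rule eventually_mono) simp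
  then have "AE z in lebesgue_on disk. v z = 0" by (simp add: AE_restrict_space_iff)
  with v(3) show ?thesis by eventually_elim simp
qed

lemma L2_AE_eq_if_ip_eq:
  assumes "L2 g" "L2 h" "\<And>\<phi>. test_fun \<phi> \<Longrightarrow> ip g \<phi> = ip h \<phi>"
  shows "AE z in lebesgue_on disk. g z = h z"
proof -
  have "AE z in lebesgue_on disk. g z - h z = 0"
    using assms by (intro L2_eq_0_if_orthogonal L2_diff) (simp_all add: ip_diff_left test_fun_L2)
  then show ?thesis by (rule eventually_mono) simp
qed

subsection \<open>Uniqueness and linearity\<close>

lemma weak_partialD:
  "weak_partial b u g \<Longrightarrow> test_fun \<phi> \<Longrightarrow> ip u (pd b \<phi>) = - ip g \<phi>"
  by (simp add: weak_partial_def)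

lemma ip_cong_AE_left:
  assumes "AE z in lebesgue_on disk. u z = v z" "L2 u" "L2 v" "L2 w"
  shows "ip u w = ip v w"
  using assms by (intro ip_cong_AE) (auto intro!: L2_measurable)

lemma weak_partial_cong:
  assumes "AE z in lebesgue_on disk. u z = u' z" "AE z in lebesgue_on disk. g z = g' z"
    "L2 u" "L2 u'" "L2 g" "L2 g'" "b \<in> Basis" "weak_partial b u g"
  shows "weak_partial b u' g'"
  unfolding weak_partial_def
proof (intro allI impI)
  fix \<phi> assume \<phi>: "test_fun \<phi>"
  have "ip u' (pd b \<phi>) = ip u (pd b \<phi>)" "ip g \<phi> = ip g' \<phi>"
    using assms \<phi> ip_cong_AE_left[OF assms(1,3,4) test_fun_L2[OF test_fun_pd[OF \<phi> assms(7)]]]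
      ip_cong_AE_left[OF assms(2,5,6) test_fun_L2[OF \<phi>]] by auto
  then show "ip u' (pd b \<phi>) = - ip g' \<phi>" using weak_partialD[OF assms(8) \<phi>] by simp
qed

lemma weak_partial_unique:
  assumes "weak_partial b u g" "weak_partial b u h" "L2 g" "L2 h"
  shows "AE z in lebesgue_on disk. g z = h z"
proof (rule L2_AE_eq_if_ip_eq[OF assms(3,4)])
  fix \<phi> assume "test_fun \<phi>"
  then show "ip g \<phi> = ip h \<phi>" using weak_partialD[OF assms(1)] weak_partialD[OF assms(2)] by simp
qed

text \<open>A weak derivative that exists in \<open>L\<^sup>2\<close> is unique up to a null set, so the one selected by \<open>wd\<close> agrees with any
  other that is at hand.\<close>

lemma wd_works:
  assumes "weak_partial b u g" "L2 g"
  shows "L2 (wd b u)" "weak_partial b u (wd b u)" "AE z in lebesgue_on disk. wd b u z = g z"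
proof -
  have "L2 (wd b u) \<and> weak_partial b u (wd b u)"
    unfolding wd_def using assms by (intro someI[of "\<lambda>g. L2 g \<and> weak_partial b u g"]) simp
  then show *: "L2 (wd b u)" "weak_partial b u (wd b u)" by auto
  show "AE z in lebesgue_on disk. wd b u z = g z"
    using assms * by (intro weak_partial_unique)
qed

text \<open>Equality, not just almost everywhere: functions that agree almost everywhere have the same weak derivatives, so the
  choice in \<open>wd\<close> is made from the same set.\<close>

lemma wd_cong:
  assumes "AE z in lebesgue_on disk. u z = u' z" "L2 u" "L2 u'" "b \<in> Basis"
  shows "wd b u = wd b u'"
proof -
  have s: "AE z in lebesgue_on disk. u' z = u z" using assms(1) by (rule eventually_mono) simp
  have "L2 g \<and> weak_partial b u g \<longleftrightarrow> L2 g \<and> weak_partial b u' g" for g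
  proof (rule conj_cong[OF refl], rule iffI)
    assume g: "L2 g"
    show "weak_partial b u' g" if "weak_partial b u g"
      by (rule weak_partial_cong[OF assms(1) _ assms(2,3) g g assms(4) that]) simp
    show "weak_partial b u g" if "weak_partial b u' g"
      by (rule weak_partial_cong[OF s _ assms(3,2) g g assms(4) that]) simp
  qed
  then show ?thesis unfolding wd_def by (simp only:)
qed

lemma weak_partial_add:
  assumes "weak_partial b u g" "weak_partial b v h" "L2 u" "L2 v" "L2 g" "L2 h" "b \<in> Basis"
  shows "weak_partial b (\<lambda>z. u z + v z) (\<lambda>z. g z + h z)"
  unfolding weak_partial_def
proof (intro allI impI)
  fix \<phi> assume \<phi>: "test_fun \<phi>"
  note t = test_fun_L2[OF \<phi>] test_fun_L2[OF test_fun_pd[OF \<phi> assms(7)]]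
  show "ip (\<lambda>z. u z + v z) (pd b \<phi>) = - ip (\<lambda>z. g z + h z) \<phi>"
    using weak_partialD[OF assms(1) \<phi>] weak_partialD[OF assms(2) \<phi>]
    by (simp add: ip_add_left assms(3-6) t)
qed

lemma weak_partial_mult_smooth:
  assumes "weak_partial b u g" "L2 u" "L2 g" "b \<in> Basis" "\<And>k. Ck k f"
  shows "weak_partial b (\<lambda>z. f z * u z) (\<lambda>z. pd b f z * u z + f z * g z)"
  unfolding weak_partial_def
proof (intro allI impI)
  fix \<phi> assume \<phi>: "test_fun \<phi>"
  have f: "f differentiable (at z)" for z using assms(5) by (rule Ck_differentiable)
  have c: "continuous_on UNIV f" "continuous_on UNIV (pd b f)"
    using Ck_continuous[OF assms(5)] assms(5)[of "Suc 0"] assms(4) by auto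
  have p: "pd b (\<lambda>z. f z * \<phi> z) = (\<lambda>z. f z * pd b \<phi> z + pd b f z * \<phi> z)"
    by (intro ext pd_mult f test_fun_differentiable \<phi>)
  note t = test_fun_L2[OF \<phi>] test_fun_L2[OF test_fun_pd[OF \<phi> assms(4)]]
  have l: "L2 (\<lambda>z. f z * pd b \<phi> z)" "L2 (\<lambda>z. pd b f z * \<phi> z)" "L2 (\<lambda>z. pd b f z * u z)" "L2 (\<lambda>z. f z * g z)"
    by (intro L2_mult_continuous c t assms)+
  have "ip u (pd b (\<lambda>z. f z * \<phi> z)) = - ip g (\<lambda>z. f z * \<phi> z)"
    using assms(1) test_fun_mult_smooth[OF \<phi> assms(5)] by (rule weak_partialD)
  then have "ip u (\<lambda>z. f z * pd b \<phi> z) + ip u (\<lambda>z. pd b f z * \<phi> z) = - ip g (\<lambda>z. f z * \<phi> z)"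
    unfolding p using l assms(2) by (simp only: ip_add_right)
  moreover have "ip (\<lambda>z. f z * u z) (pd b \<phi>) = ip u (\<lambda>z. f z * pd b \<phi> z)"
    "ip (\<lambda>z. pd b f z * u z) \<phi> = ip u (\<lambda>z. pd b f z * \<phi> z)"
    "ip (\<lambda>z. f z * g z) \<phi> = ip g (\<lambda>z. f z * \<phi> z)"
    by (intro ip_cong; simp)+
  moreover have "ip (\<lambda>z. pd b f z * u z + f z * g z) \<phi> = ip (\<lambda>z. pd b f z * u z) \<phi> + ip (\<lambda>z. f z * g z) \<phi>"
    using l t by (intro ip_add_left)
  ultimately show "ip (\<lambda>z. f z * u z) (pd b \<phi>) = - ip (\<lambda>z. pd b f z * u z + f z * g z) \<phi>"
    by simp
qed

lemma weak_partial_cmult: "weak_partial b u g \<Longrightarrow> weak_partial b (\<lambda>z. c * u z) (\<lambda>z. c * g z)"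
  by (simp add: weak_partial_def ip_cmult_left)

lemma weak_partial_smooth:
  assumes "\<And>k. Ck k f" "b \<in> Basis" shows "weak_partial b f (pd b f)"
  unfolding weak_partial_def using test_fun_by_parts[OF _ assms] by simp

section \<open>Sobolev spaces\<close>

lemma sobolev_L2: "sobolev k u \<Longrightarrow> L2 u"
  by (cases k) auto

lemma sobolev_cong:
  assumes "AE z in lebesgue_on disk. u z = v z" "L2 v" "sobolev k u"
  shows "sobolev k v"
proof (cases k)
  case 0
  then show ?thesis using assms by simp
next
  case (Suc j)
  have "\<exists>g. weak_partial b v g \<and> sobolev j g" if b: "b \<in> Basis" for b
  proof -
    obtain g where g: "weak_partial b u g" "sobolev j g" using assms(3) b unfolding Suc sobolev.simps by blast
    then have "weak_partial b v g"
      using weak_partial_cong[OF assms(1) _ sobolev_L2[OF assms(3)] assms(2) sobolev_L2[OF g(2)] sobolev_L2[OF g(2)] b g(1)]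
      by simp
    then show ?thesis using g by blast
  qed
  then show ?thesis using assms(2) unfolding Suc sobolev.simps by blast
qed

lemma sobolev_Suc_iff:
  "sobolev (Suc k) u \<longleftrightarrow> L2 u \<and> (\<forall>b\<in>Basis. weak_partial b u (wd b u) \<and> sobolev k (wd b u))"
proof -
  have "weak_partial b u (wd b u) \<and> sobolev k (wd b u)" if "weak_partial b u g" "sobolev k g" for b g
  proof -
    note w = wd_works[OF that(1) sobolev_L2[OF that(2)]]
    have "AE z in lebesgue_on disk. g z = wd b u z" using w(3) by (rule eventually_mono) simp
    then show ?thesis using w(1,2) sobolev_cong[OF _ _ that(2)] by blast
  qed
  then show ?thesis unfolding sobolev.simps by blast
qed

lemma sobolev_wd: "sobolev (Suc k) u \<Longrightarrow> b \<in> Basis \<Longrightarrow> sobolev k (wd b u)"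
  unfolding sobolev_Suc_iff by blast

lemma sobolev_wd_L2: "sobolev (Suc k) u \<Longrightarrow> b \<in> Basis \<Longrightarrow> L2 (wd b u)"
  using sobolev_wd sobolev_L2 by blast

lemma sobolev_weak: "sobolev (Suc k) u \<Longrightarrow> b \<in> Basis \<Longrightarrow> weak_partial b u (wd b u)"
  unfolding sobolev_Suc_iff by blast

lemma sobolev_SucI:
  "L2 u \<Longrightarrow> (\<And>b. b \<in> Basis \<Longrightarrow> weak_partial b u (g b)) \<Longrightarrow> (\<And>b. b \<in> Basis \<Longrightarrow> sobolev k (g b)) \<Longrightarrow>
    sobolev (Suc k) u"
  unfolding sobolev.simps by blast

lemma sobolev_Suc_D: "sobolev (Suc k) u \<Longrightarrow> sobolev k u"
proof (induction k arbitrary: u)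
  case 0
  then show ?case by (simp add: sobolev_L2)
next
  case (Suc k)
  show ?case
  proof (rule sobolev_SucI)
    show "L2 u" using Suc.prems by (rule sobolev_L2)
    show "weak_partial b u (wd b u)" if "b \<in> Basis" for b using Suc.prems that by (rule sobolev_weak)
    show "sobolev k (wd b u)" if "b \<in> Basis" for b using sobolev_wd[OF Suc.prems that] by (rule Suc.IH)
  qed
qed

lemma sobolev_add: "sobolev k u \<Longrightarrow> sobolev k v \<Longrightarrow> sobolev k (\<lambda>z. u z + v z)"
proof (induction k arbitrary: u v)
  case 0
  then show ?case by (simp add: L2_add)
next
  case (Suc k)
  show ?case
  proof (rule sobolev_SucI)
    show "L2 (\<lambda>z. u z + v z)" using Suc.prems by (intro L2_add sobolev_L2)
    fix b :: plane assume b: "b \<in> Basis"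
    show "weak_partial b (\<lambda>z. u z + v z) (\<lambda>z. wd b u z + wd b v z)"
      using Suc.prems b by (intro weak_partial_add sobolev_weak sobolev_wd_L2 sobolev_L2)
    show "sobolev k (\<lambda>z. wd b u z + wd b v z)"
      using Suc.prems b by (intro Suc.IH sobolev_wd)
  qed
qed

lemma Ck_all_pd: "(\<And>k. Ck k f) \<Longrightarrow> b \<in> Basis \<Longrightarrow> Ck k (pd b f)"
proof -
  assume "\<And>k. Ck k f" "b \<in> Basis"
  from this(1)[of "Suc k"] this(2) show ?thesis unfolding Ck.simps(2) by blast
qed

lemma sobolev_mult_smooth: "sobolev k u \<Longrightarrow> (\<And>k. Ck k f) \<Longrightarrow> sobolev k (\<lambda>z. f z * u z)"
proof (induction k arbitrary: u f)
  case 0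
  then show ?case by (simp add: L2_mult_continuous[OF _ Ck_continuous])
next
  case (Suc k)
  show ?case
  proof (rule sobolev_SucI)
    show "L2 (\<lambda>z. f z * u z)" using Suc.prems(1) Suc.prems(2)[of 0] by (intro L2_mult_continuous sobolev_L2 Ck_continuous)
    fix b :: plane assume b: "b \<in> Basis"
    show "weak_partial b (\<lambda>z. f z * u z) (\<lambda>z. pd b f z * u z + f z * wd b u z)"
      using Suc.prems b by (intro weak_partial_mult_smooth sobolev_weak sobolev_wd_L2 sobolev_L2)
    show "sobolev k (\<lambda>z. pd b f z * u z + f z * wd b u z)"
      using Suc.prems b
      by (intro sobolev_add Suc.IH sobolev_wd) (auto intro: sobolev_Suc_D Ck_all_pd)
  qed
qed

lemma sobolev_cmult: "sobolev k u \<Longrightarrow> sobolev k (\<lambda>z. c * u z)"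
  by (intro sobolev_mult_smooth Ck_const)

lemma sobolev_diff: "sobolev k u \<Longrightarrow> sobolev k v \<Longrightarrow> sobolev k (\<lambda>z. u z - v z)"
  using sobolev_add[OF _ sobolev_cmult[of k v "-1"], of u] by simp

lemma sobolev_smooth: "(\<And>k. Ck k f) \<Longrightarrow> sobolev k f"
proof (induction k arbitrary: f)
  case 0
  then show ?case by (simp add: L2_continuous Ck_continuous)
next
  case (Suc k)
  show ?case
    using Suc.prems by (intro sobolev_SucI[where g = "\<lambda>b. pd b f"] weak_partial_smooth Suc.IH Ck_all_pd)
      (auto intro: L2_continuous Ck_continuous)
qed

lemma sobolev_test: "test_fun \<phi> \<Longrightarrow> sobolev k \<phi>"
  by (intro sobolev_smooth test_fun_Ck)

lemma sobolev_zero: "sobolev k (\<lambda>z. 0)"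
  by (intro sobolev_smooth Ck_const)

lemma sobolev_sum: "(\<And>i. i \<in> A \<Longrightarrow> sobolev k (u i)) \<Longrightarrow> sobolev k (\<lambda>z. \<Sum>i\<in>A. u i z)"
  by (induction A rule: infinite_finite_induct) (auto intro: sobolev_zero sobolev_add)

lemma wd_smooth: "(\<And>k. Ck k f) \<Longrightarrow> b \<in> Basis \<Longrightarrow> AE z in lebesgue_on disk. wd b f z = pd b f z"
  by (rule wd_works(3)[OF weak_partial_smooth]) (auto intro: L2_continuous Ck_continuous Ck_all_pd)

lemma wd_test: "test_fun \<phi> \<Longrightarrow> b \<in> Basis \<Longrightarrow> AE z in lebesgue_on disk. wd b \<phi> z = pd b \<phi> z"
  by (intro wd_smooth test_fun_Ck)

lemma wd_add:
  assumes "sobolev (Suc k) u" "sobolev (Suc k) v" "b \<in> Basis"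
  shows "AE z in lebesgue_on disk. wd b (\<lambda>z. u z + v z) z = wd b u z + wd b v z"
  using assms by (intro wd_works(3) weak_partial_add sobolev_weak sobolev_wd_L2 sobolev_L2 L2_add)

lemma wd_mult_smooth:
  assumes "sobolev (Suc k) u" "b \<in> Basis" "\<And>k. Ck k f"
  shows "AE z in lebesgue_on disk. wd b (\<lambda>z. f z * u z) z = pd b f z * u z + f z * wd b u z"
  using assms sobolev_wd_L2[OF assms(1,2)] sobolev_L2[OF assms(1)] Ck_continuous[OF assms(3)] Ck_continuous[OF Ck_all_pd[OF assms(3,2)]]
  by (intro wd_works(3) weak_partial_mult_smooth sobolev_weak L2_add L2_mult_continuous)

lemma wd_cmult:
  assumes "sobolev (Suc k) u" "b \<in> Basis"
  shows "AE z in lebesgue_on disk. wd b (\<lambda>z. c * u z) z = c * wd b u z"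
  using assms by (intro wd_works(3) weak_partial_cmult sobolev_weak L2_cmult sobolev_wd_L2)

lemma wd_diff:
  assumes "sobolev (Suc k) u" "sobolev (Suc k) v" "b \<in> Basis"
  shows "AE z in lebesgue_on disk. wd b (\<lambda>z. u z - v z) z = wd b u z - wd b v z"
proof -
  have "AE z in lebesgue_on disk. wd b (\<lambda>z. u z + (-1) * v z) z = wd b u z + wd b (\<lambda>z. (-1) * v z) z"
    using assms by (intro wd_add sobolev_cmult)
  with wd_cmult[OF assms(2,3), of "-1"] show ?thesis by eventually_elim simp
qed

subsection \<open>Sobolev norms and convergence\<close>

lemma sobolev_sq_nonneg: "0 \<le> sobolev_sq k u"
  by (induction k arbitrary: u) (auto intro!: ip_self_nonneg add_nonneg_nonneg sum_nonneg)

lemma sobolev_sq_cong: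
  assumes "AE z in lebesgue_on disk. u z = v z" "L2 u" "L2 v"
  shows "sobolev_sq k u = sobolev_sq k v"
proof -
  have "ip u u = ip v v" using assms by (intro ip_cong_AE) (auto intro: L2_measurable)
  moreover have "wd b u = wd b v" if "b \<in> Basis" for b using assms that by (intro wd_cong)
  ultimately show ?thesis by (cases k) simp_all
qed

lemma sobolev_sq_add_le:
  "sobolev k u \<Longrightarrow> sobolev k v \<Longrightarrow>
    sobolev_sq k (\<lambda>z. u z + v z) \<le> 2 * sobolev_sq k u + 2 * sobolev_sq k v"
proof (induction k arbitrary: u v)
  case 0
  then show ?case by (simp add: ip_add_le)
next
  case (Suc k)
  have "sobolev_sq k (wd b (\<lambda>z. u z + v z)) \<le> 2 * sobolev_sq k (wd b u) + 2 * sobolev_sq k (wd b v)"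
    if b: "b \<in> Basis" for b
  proof -
    have "sobolev_sq k (wd b (\<lambda>z. u z + v z)) = sobolev_sq k (\<lambda>z. wd b u z + wd b v z)"
      using Suc.prems b by (intro sobolev_sq_cong wd_add L2_add sobolev_wd_L2 sobolev_add)
    also have "\<dots> \<le> 2 * sobolev_sq k (wd b u) + 2 * sobolev_sq k (wd b v)"
      using Suc.prems b by (intro Suc.IH sobolev_wd)
    finally show ?thesis .
  qed
  moreover have "ip (\<lambda>z. u z + v z) (\<lambda>z. u z + v z) \<le> 2 * ip u u + 2 * ip v v"
    using Suc.prems by (intro ip_add_le sobolev_L2)
  ultimately show ?case
    by (simp add: sum_Basis_plane) (smt (verit) Basis_plane_simps)
qed

text \<open>Convergence of \<open>f\<^sub>n\<close> to \<open>u\<close> in \<open>H\<^sup>k\<close>, in terms of the weak derivatives of the sequence and of the limit instead of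
  those of the difference.\<close>

primrec sconv :: "nat \<Rightarrow> (nat \<Rightarrow> plane \<Rightarrow> real) \<Rightarrow> (plane \<Rightarrow> real) \<Rightarrow> bool" where
  "sconv 0 f u \<longleftrightarrow> L2lim f u"
| "sconv (Suc k) f u \<longleftrightarrow> L2lim f u \<and> (\<forall>b\<in>Basis. sconv k (\<lambda>n. wd b (f n)) (wd b u))"

lemma ip_diff_commute: "ip (\<lambda>z. u z - v z) (\<lambda>z. u z - v z) = ip (\<lambda>z. v z - u z) (\<lambda>z. v z - u z)"
  by (rule ip_cong) (simp add: algebra_simps)

lemma sconv_iff:
  "(\<And>n. sobolev k (f n)) \<Longrightarrow> sobolev k u \<Longrightarrow>
    sconv k f u \<longleftrightarrow> (\<lambda>n. sobolev_sq k (\<lambda>z. u z - f n z)) \<longlonglongrightarrow> 0"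
proof (induction k arbitrary: f u)
  case 0
  then show ?case by (simp add: L2lim_def ip_diff_commute[of u])
next
  case (Suc k)
  have IH: "sconv k (\<lambda>n. wd b (f n)) (wd b u) \<longleftrightarrow> (\<lambda>n. sobolev_sq k (wd b (\<lambda>z. u z - f n z))) \<longlonglongrightarrow> 0"
    if b: "b \<in> Basis" for b
  proof -
    have "sobolev_sq k (wd b (\<lambda>z. u z - f n z)) = sobolev_sq k (\<lambda>z. wd b u z - wd b (f n) z)" for n
      using Suc.prems b by (intro sobolev_sq_cong wd_diff L2_diff sobolev_wd_L2 sobolev_diff)
    then show ?thesis using Suc.prems b by (subst Suc.IH) (auto intro: sobolev_wd)
  qed
  have L: "L2lim f u \<longleftrightarrow> (\<lambda>n. ip (\<lambda>z. u z - f n z) (\<lambda>z. u z - f n z)) \<longlonglongrightarrow> 0"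
    using Suc.prems by (auto simp: L2lim_def ip_diff_commute[of u] intro: sobolev_L2)
  have "(\<lambda>n. sobolev_sq (Suc k) (\<lambda>z. u z - f n z)) \<longlonglongrightarrow> 0 \<longleftrightarrow>
      (\<lambda>n. ip (\<lambda>z. u z - f n z) (\<lambda>z. u z - f n z)) \<longlonglongrightarrow> 0 \<and>
      (\<forall>b\<in>Basis. (\<lambda>n. sobolev_sq k (wd b (\<lambda>z. u z - f n z))) \<longlonglongrightarrow> 0)" (is "?S \<longleftrightarrow> ?A \<and> ?B")
  proof (intro iffI conjI ballI)
    assume S: ?S
    show ?A
      by (rule tendsto_sandwich[OF _ _ tendsto_const S])
        (auto intro!: always_eventually ip_self_nonneg sum_nonneg sobolev_sq_nonneg)
    fix b :: plane assume b: "b \<in> Basis"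
    have "sobolev_sq k (wd b (\<lambda>z. u z - f n z)) \<le> sobolev_sq (Suc k) (\<lambda>z. u z - f n z)" for n
      using member_le_sum[of b Basis "\<lambda>b. sobolev_sq k (wd b (\<lambda>z. u z - f n z))"] b
        ip_self_nonneg[of "\<lambda>z. u z - f n z"] by (auto simp: sobolev_sq_nonneg)
    then show "(\<lambda>n. sobolev_sq k (wd b (\<lambda>z. u z - f n z))) \<longlonglongrightarrow> 0"
      by (intro tendsto_sandwich[OF _ _ tendsto_const S]) (auto intro!: always_eventually sobolev_sq_nonneg)
  next
    assume "?A \<and> ?B"
    then have "(\<lambda>n. sobolev_sq (Suc k) (\<lambda>z. u z - f n z)) \<longlonglongrightarrow> 0 + (\<Sum>b\<in>(Basis::plane set). 0)"
      unfolding sobolev_sq.simps by (intro tendsto_add tendsto_sum) auto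
    then show ?S by simp
  qed
  then show ?case using IH L by simp
qed

lemma sobolev0_iff:
  "sobolev0 k u \<longleftrightarrow> sobolev k u \<and> (\<exists>\<phi>. (\<forall>n. test_fun (\<phi> n)) \<and> sconv k \<phi> u)"
proof -
  have "sconv k \<phi> u \<longleftrightarrow> (\<lambda>n. sobolev_sq k (\<lambda>z. u z - \<phi> n z)) \<longlonglongrightarrow> 0"
    if "\<forall>n. test_fun (\<phi> n)" "sobolev k u" for \<phi>
    using that by (intro sconv_iff) (auto intro: sobolev_test)
  then show ?thesis unfolding sobolev0_def by blast
qed

lemma sconv_L2lim: "sconv k f u \<Longrightarrow> L2lim f u"
  by (cases k) auto

lemma sconv_Suc_D: "sconv (Suc k) f u \<Longrightarrow> sconv k f u"
proof (induction k arbitrary: f u)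
  case 0
  then show ?case by simp
next
  case (Suc k)
  have "sconv k (\<lambda>n. wd b (f n)) (wd b u)" if "b \<in> Basis" for b
    using Suc.prems that by (intro Suc.IH) simp
  then show ?case using Suc.prems by simp
qed

lemma sobolev0_sobolev: "sobolev0 k u \<Longrightarrow> sobolev k u"
  by (simp add: sobolev0_def)

lemma sobolev0_Suc_D: "sobolev0 (Suc k) u \<Longrightarrow> sobolev0 k u"
  unfolding sobolev0_iff by (blast intro: sobolev_Suc_D sconv_Suc_D)

lemma sobolev0_test: "test_fun \<phi> \<Longrightarrow> sobolev0 k \<phi>"
proof -
  assume \<phi>: "test_fun \<phi>"
  have "sobolev_sq k (\<lambda>z. 0) = 0"
  proof (induction k)
    case (Suc k)
    have "sobolev_sq k (wd b (\<lambda>z. 0)) = sobolev_sq k (\<lambda>z. 0)" if "b \<in> Basis" for b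
      using wd_cmult[OF sobolev_zero that, where c = 0] sobolev_wd_L2[OF sobolev_zero that]
      by (intro sobolev_sq_cong) (auto simp: L2_zero)
    then show ?case using Suc by simp
  qed simp
  then show ?thesis unfolding sobolev0_def using \<phi> sobolev_test[OF \<phi>] by (intro conjI exI[of _ "\<lambda>_. \<phi>"]) auto
qed

text \<open>A diagonal sequence.\<close>

lemma sobolev0_closed:
  assumes "\<And>n. sobolev0 k (f n)" "sobolev k u" "sconv k f u"
  shows "sobolev0 k u"
proof -
  define Q where "Q n \<phi> \<longleftrightarrow> test_fun \<phi> \<and> sobolev_sq k (\<lambda>z. f n z - \<phi> z) < 1 / real (Suc n)" for n \<phi>
  have "\<exists>\<phi>. Q n \<phi>" for n
  proof -
    obtain \<phi> where \<phi>: "\<forall>j. test_fun (\<phi> j)" "(\<lambda>j::nat. sobolev_sq k (\<lambda>z. f n z - \<phi> j z)) \<longlonglongrightarrow> 0"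
      using assms(1)[of n] unfolding sobolev0_def by (elim conjE exE)
    have "\<forall>\<^sub>F j in sequentially. sobolev_sq k (\<lambda>z. f n z - \<phi> j z) < 1 / real (Suc n)"
      by (rule order_tendstoD(2)[OF \<phi>(2)]) simp
    then obtain j where "sobolev_sq k (\<lambda>z. f n z - \<phi> j z) < 1 / real (Suc n)"
      using eventually_happens'[OF sequentially_bot] by blast
    then show ?thesis using \<phi>(1) by (intro exI[of _ "\<phi> j"]) (simp add: Q_def)
  qed
  then have "\<forall>n. \<exists>\<phi>. Q n \<phi>" by simp
  then obtain \<phi> where "\<forall>n. Q n (\<phi> n)" by (elim choice[THEN exE])
  then have \<phi>: "\<And>n. test_fun (\<phi> n)" "\<And>n. sobolev_sq k (\<lambda>z. f n z - \<phi> n z) < 1 / real (Suc n)"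
    by (simp_all add: Q_def)
  note sf = sobolev0_sobolev[OF assms(1)]
  have lim: "(\<lambda>n. sobolev_sq k (\<lambda>z. u z - f n z)) \<longlonglongrightarrow> 0"
    using sconv_iff[OF sf assms(2)] assms(3) by simp
  have "(\<lambda>n. 2 * sobolev_sq k (\<lambda>z. u z - f n z) + 2 * (1 / real (Suc n))) \<longlonglongrightarrow> 2 * 0 + 2 * 0"
    by (intro tendsto_add tendsto_mult tendsto_const lim LIMSEQ_Suc[OF lim_1_over_n])
  then have up: "(\<lambda>n. 2 * sobolev_sq k (\<lambda>z. u z - f n z) + 2 * (1 / real (Suc n))) \<longlonglongrightarrow> 0"
    by (simp only: mult_zero_right add_0_left)
  have le: "sobolev_sq k (\<lambda>z. u z - \<phi> n z) \<le> 2 * sobolev_sq k (\<lambda>z. u z - f n z) + 2 * (1 / real (Suc n))" for n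
  proof -
    have "sobolev_sq k (\<lambda>z. (u z - f n z) + (f n z - \<phi> n z)) \<le>
      2 * sobolev_sq k (\<lambda>z. u z - f n z) + 2 * sobolev_sq k (\<lambda>z. f n z - \<phi> n z)"
      by (intro sobolev_sq_add_le sobolev_diff assms(2) sf sobolev_test \<phi>(1))
    then show ?thesis using \<phi>(2)[of n] by simp
  qed
  have "(\<lambda>n. sobolev_sq k (\<lambda>z. u z - \<phi> n z)) \<longlonglongrightarrow> 0"
    by (rule tendsto_sandwich[OF always_eventually always_eventually tendsto_const up])
      (intro allI sobolev_sq_nonneg le)+
  then show ?thesis unfolding sobolev0_def using assms(2) \<phi>(1) by (intro conjI exI[of _ \<phi>]) simp_all
qed

section \<open>Mollification\<close>

definition conv :: "(plane \<Rightarrow> real) \<Rightarrow> (plane \<Rightarrow> real) \<Rightarrow> plane \<Rightarrow> real" where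
  "conv \<psi> v z = (LINT y|lborel. \<psi> (z - y) * v y)"

lemma supported_bounded:
  fixes f :: "plane \<Rightarrow> 'a::real_normed_vector"
  assumes "continuous_on UNIV f" "\<And>z. norm z \<ge> 1 \<Longrightarrow> f z = 0"
  obtains B where "B > 0" "\<And>z. norm (f z) \<le> B"
proof -
  obtain B where B: "B > 0" "\<And>z. norm z < 1 \<Longrightarrow> norm (f z) \<le> B"
    using continuous_bounded_disk[OF assms(1)] by blast
  have "norm (f z) \<le> B" for z using B assms(2)[of z] by (cases "norm z < 1") auto
  with B(1) show ?thesis by (rule that)
qed

lemma integrable_bounded_mult:
  fixes f v :: "plane \<Rightarrow> real"
  assumes "f \<in> borel_measurable borel" "\<And>z. \<bar>f z\<bar> \<le> B" "integrable lborel v"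
  shows "integrable lborel (\<lambda>z. f z * v z)"
proof (rule Bochner_Integration.integrable_bound)
  show "integrable lborel (\<lambda>z. B * v z)" using assms(3) by simp
  show "(\<lambda>z. f z * v z) \<in> borel_measurable lborel"
    using assms(1) borel_measurable_integrable[OF assms(3)] by simp
  show "AE z in lborel. norm (f z * v z) \<le> norm (B * v z)"
  proof (rule AE_I2)
    fix z
    have "\<bar>f z\<bar> \<le> \<bar>B\<bar>" using assms(2)[of z] by linarith
    then show "norm (f z * v z) \<le> norm (B * v z)" by (auto simp: abs_mult intro: mult_right_mono)
  qed
qed

lemma integrable_conv:
  fixes \<psi> v :: "plane \<Rightarrow> real"
  assumes "continuous_on UNIV \<psi>" "\<And>z. norm z \<ge> 1 \<Longrightarrow> \<psi> z = 0" "integrable lborel v"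
  shows "integrable lborel (\<lambda>y. \<psi> (z - y) * v y)"
proof -
  obtain B where B: "\<And>z. norm (\<psi> z) \<le> B" using supported_bounded[OF assms(1,2)] by blast
  show ?thesis
  proof (rule integrable_bounded_mult[OF _ _ assms(3)])
    show "(\<lambda>y. \<psi> (z - y)) \<in> borel_measurable borel"
      by (intro borel_measurable_continuous_onI continuous_on_compose2[OF assms(1)] continuous_intros) auto
    show "\<bar>\<psi> (z - y)\<bar> \<le> B" for y using B[of "z - y"] by simp
  qed
qed

lemma supported_uniformly_continuous:
  fixes f :: "plane \<Rightarrow> 'a::real_normed_vector"
  assumes f: "continuous_on UNIV f" and z: "\<And>z. norm z \<ge> R \<Longrightarrow> f z = 0" and "e > 0"
  shows "\<exists>d>0. \<forall>x y. dist x y < d \<longrightarrow> dist (f x) (f y) < e"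
proof -
  have "uniformly_continuous_on (cball 0 (R + 1)) f"
    using f by (intro compact_uniformly_continuous) (auto intro: continuous_on_subset)
  then obtain d where d: "d > 0"
    "\<And>x y. x \<in> cball 0 (R + 1) \<Longrightarrow> y \<in> cball 0 (R + 1) \<Longrightarrow> dist y x < d \<Longrightarrow> dist (f y) (f x) < e"
    using \<open>e > 0\<close> unfolding uniformly_continuous_on_def by metis
  have "dist (f x) (f y) < e" if xy: "dist x y < min d 1" for x y
  proof (cases "norm x \<le> R + 1 \<and> norm y \<le> R + 1")
    case True
    then show ?thesis using xy by (intro d(2)) auto
  next
    case False
    have "\<bar>norm x - norm y\<bar> < 1"
      using xy norm_triangle_ineq3[of x y] by (simp add: dist_norm)
    then have "norm x \<ge> R" "norm y \<ge> R" using False by linarith+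
    then show ?thesis using z \<open>e > 0\<close> by simp
  qed
  then show ?thesis using d(1) by (intro exI[of _ "min d 1"]) auto
qed

text \<open>The gradient has compact support, hence is uniformly continuous.\<close>

lemma c1c_uniform_linearization:
  assumes "c1c f G" "e > 0"
  shows "\<exists>d>0. \<forall>p h. norm h < d \<longrightarrow> \<bar>f (p + h) - f p - h \<bullet> G p\<bar> \<le> e * norm h"
proof -
  obtain d where d: "d > 0" "\<forall>x y. dist x y < d \<longrightarrow> dist (G x) (G y) < e"
    using supported_uniformly_continuous[OF c1c_continuous(2)[OF assms(1)] c1c_zero_outside(2)[OF assms(1)] assms(2)]
    by blast
  have "\<bar>f (p + h) - f p - h \<bullet> G p\<bar> \<le> e * norm h" if h: "norm h < d" for p h
  proof -
    have "norm (f (p + h) - f p - (\<lambda>k. k \<bullet> G p) (p + h - p)) \<le> norm (p + h - p) * e"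
    proof (rule differentiable_bound_linearization[where S = "ball p d" and f' = "\<lambda>x k. k \<bullet> G x"])
      show "p + t *\<^sub>R (p + h - p) \<in> ball p d" if "t \<in> {0..1}" for t
      proof -
        have "\<bar>t\<bar> * norm h \<le> norm h" using that by (intro mult_left_le_one_le) auto
        then show ?thesis using h by (simp add: dist_norm)
      qed
      show "(f has_derivative (\<lambda>k. k \<bullet> G x)) (at x within ball p d)" for x
        using assms(1) by (auto simp: c1c_def intro: has_derivative_at_withinI)
      show "onorm ((\<lambda>k. k \<bullet> G x) - (\<lambda>k. k \<bullet> G p)) \<le> e" if "x \<in> ball p d" for x
      proof (rule onorm_le)
        fix k :: plane
        have "dist x p < d" using that by (simp add: dist_commute)
        then have "dist (G x) (G p) < e" using d(2) by blast
        then have "norm (G x - G p) \<le> e" by (simp add: dist_norm)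
        then have "norm k * norm (G x - G p) \<le> norm k * e" by (intro mult_left_mono) auto
        moreover have "\<bar>k \<bullet> (G x - G p)\<bar> \<le> norm k * norm (G x - G p)" by (rule Cauchy_Schwarz_ineq2)
        ultimately show "norm (((\<lambda>k. k \<bullet> G x) - (\<lambda>k. k \<bullet> G p)) k) \<le> e * norm k"
          by (simp add: inner_diff_right mult.commute)
      qed
      show "p \<in> ball p d" using d(1) by simp
    qed
    then show ?thesis by (simp add: mult.commute)
  qed
  then show ?thesis using d(1) by blast
qed

text \<open>Differentiation under the integral, with the error controlled by \<open>c1c_uniform_linearization\<close> uniformly in \<open>y\<close>.\<close>

lemma conv_has_derivative:
  assumes \<psi>: "c1c \<psi> G" and v: "integrable lborel v"
  shows "(conv \<psi> v has_derivative (\<lambda>h. h \<bullet> (conv (\<lambda>z. fst (G z)) v z, conv (\<lambda>z. snd (G z)) v z))) (at z)"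
  unfolding has_derivative_at_alt
proof (intro conjI allI impI)
  note G = c1c_continuous(2)[OF \<psi>]
  have i: "integrable lborel (\<lambda>y. \<psi> (z - y) * v y)" "integrable lborel (\<lambda>y. fst (G (z - y)) * v y)"
    "integrable lborel (\<lambda>y. snd (G (z - y)) * v y)" for z
    using c1c_zero_outside[OF \<psi>]
    by (intro integrable_conv[OF _ _ v] integrable_conv[of "\<lambda>z. fst (G z)", OF _ _ v]
        integrable_conv[of "\<lambda>z. snd (G z)", OF _ _ v] c1c_continuous[OF \<psi>] continuous_intros G; simp)+
  let ?L = "\<lambda>h. h \<bullet> (conv (\<lambda>z. fst (G z)) v z, conv (\<lambda>z. snd (G z)) v z)"
  show "bounded_linear ?L" by (rule bounded_linear_inner_left)
  fix e :: real assume "e > 0"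
  define N where "N = (LINT y|lborel. \<bar>v y\<bar>)"
  have "N \<ge> 0" unfolding N_def by simp
  then obtain d where d: "d > 0" "\<And>p h. norm h < d \<Longrightarrow> \<bar>\<psi> (p + h) - \<psi> p - h \<bullet> G p\<bar> \<le> e / (N + 1) * norm h"
    using c1c_uniform_linearization[OF \<psi>, of "e / (N + 1)"] \<open>e > 0\<close> by auto
  show "\<exists>d>0. \<forall>y. norm (y - z) < d \<longrightarrow> norm (conv \<psi> v y - conv \<psi> v z - ?L (y - z)) \<le> e * norm (y - z)"
  proof (intro exI[of _ d] conjI allI impI d(1))
    fix y assume y: "norm (y - z) < d"
    let ?h = "y - z"
    let ?D = "\<lambda>s. (\<psi> (y - s) - \<psi> (z - s) - ?h \<bullet> G (z - s)) * v s"
    have e1: "?D s = \<psi> (y - s) * v s - \<psi> (z - s) * v s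
        - (fst ?h * (fst (G (z - s)) * v s) + snd ?h * (snd (G (z - s)) * v s))" for s
      by (simp add: inner_prod_def algebra_simps)
    have iD: "integrable lborel ?D" unfolding e1 using i by (intro Bochner_Integration.integrable_diff Bochner_Integration.integrable_add integrable_mult_right) auto
    have "(LINT s|lborel. ?D s) = conv \<psi> v y - conv \<psi> v z - ?L (y - z)"
      unfolding e1 conv_def using i by (simp add: inner_prod_def)
    then have "norm (conv \<psi> v y - conv \<psi> v z - ?L (y - z)) \<le> (LINT s|lborel. \<bar>?D s\<bar>)"
      using integral_abs_bound[of lborel ?D] by simp
    also have "\<dots> \<le> (LINT s|lborel. e / (N + 1) * norm ?h * \<bar>v s\<bar>)"
    proof (rule integral_mono)
      show "integrable lborel (\<lambda>s. \<bar>?D s\<bar>)" using iD by simp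
      show "integrable lborel (\<lambda>s. e / (N + 1) * norm ?h * \<bar>v s\<bar>)" using v by simp
      fix s
      have "\<bar>\<psi> (y - s) - \<psi> (z - s) - ?h \<bullet> G (z - s)\<bar> \<le> e / (N + 1) * norm ?h"
        using d(2)[of ?h "z - s"] y by (simp add: algebra_simps)
      then show "\<bar>?D s\<bar> \<le> e / (N + 1) * norm ?h * \<bar>v s\<bar>"
        unfolding abs_mult by (rule mult_right_mono) simp
    qed
    also have "\<dots> = e * norm ?h * (N / (N + 1))" by (simp add: N_def)
    also have "\<dots> \<le> e * norm ?h * 1"
      using \<open>N \<ge> 0\<close> \<open>e > 0\<close> by (intro mult_left_mono) auto
    finally show "norm (conv \<psi> v y - conv \<psi> v z - ?L (y - z)) \<le> e * norm (y - z)" by simp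
  qed
qed

lemma pd_conv:
  assumes "test_fun \<psi>" "integrable lborel v" "b \<in> Basis"
  shows "pd b (conv \<psi> v) = conv (pd b \<psi>) v" "conv \<psi> v differentiable (at z)"
proof -
  note d = conv_has_derivative[OF c1c_test_fun[OF assms(1)] assms(2)]
  show "conv \<psi> v differentiable (at z)" using d by (rule differentiableI)
  show "pd b (conv \<psi> v) = conv (pd b \<psi>) v"
    using assms(3) pd_unique[OF d] by (auto simp: Basis_plane grad_def)
qed

lemma Ck_conv:
  assumes "integrable lborel v" shows "test_fun \<psi> \<Longrightarrow> Ck k (conv \<psi> v)"
proof (induction k arbitrary: \<psi>)
  case 0
  have "conv \<psi> v differentiable (at z)" for z by (rule pd_conv(2)[OF 0 assms Basis_plane_simps(1)])
  then show ?case
    by (simp add: differentiable_imp_continuous_on differentiable_on_def differentiable_at_withinI)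
next
  case (Suc k)
  have "Ck k (pd b (conv \<psi> v))" if "b \<in> Basis" for b
    unfolding pd_conv(1)[OF Suc.prems assms that] by (intro Suc.IH test_fun_pd Suc.prems that)
  then show ?case using pd_conv(2)[OF Suc.prems assms Basis_plane_simps(1)] by simp
qed

subsection \<open>The mollifiers\<close>

definition bump :: "real \<Rightarrow> plane \<Rightarrow> real" where
  "bump r z = expm (r\<^sup>2 - (norm z)\<^sup>2)"

definition mol :: "real \<Rightarrow> plane \<Rightarrow> real" where
  "mol r z = 1 / (LINT y|lborel. bump r y) * bump r z"

lemma test_fun_bump: "0 < r \<Longrightarrow> r < 1 \<Longrightarrow> test_fun (bump r)"
  using test_fun_radial_flat[of 1 "r\<^sup>2" 1] by (simp add: bump_def[abs_def] power_less_one_iff)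

lemma bump_nonneg: "0 \<le> bump r z"
  by (simp add: bump_def expm_bounds)

lemma bump_zero: "norm z \<ge> r \<Longrightarrow> 0 < r \<Longrightarrow> bump r z = 0"
  by (auto simp: bump_def intro!: expm_neg power_mono)

lemma test_fun_integrable_lborel: "test_fun \<phi> \<Longrightarrow> integrable lborel \<phi>"
  using c1c_integrable_grad(3)[OF c1c_test_fun] .

lemma bump_integral_pos:
  assumes "0 < r" "r < 1" shows "0 < (LINT y|lborel. bump r y)"
proof -
  have i: "integrable lborel (bump r)" using assms by (intro test_fun_integrable_lborel test_fun_bump)
  have "\<not> (AE y in lborel. bump r y = 0)"
  proof
    assume "AE y in lborel. bump r y = 0"
    then have "AE y :: plane in lborel. y \<notin> ball 0 r"
    proof (rule eventually_mono)
      fix y :: plane assume y: "bump r y = 0"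
      show "y \<notin> ball 0 r"
      proof
        assume "y \<in> ball 0 r"
        then have "(norm y)\<^sup>2 < r\<^sup>2" using assms by (intro power_strict_mono) auto
        then show False using y by (simp add: bump_def flat_def)
      qed
    qed
    then have "ball 0 r \<in> null_sets (lborel :: plane measure)"
      by (subst AE_iff_null_sets) auto
    moreover have "emeasure lborel (ball (0::plane) r) > 0"
      using content_ball_pos[OF assms(1), of "0::plane"] by (simp add: measure_def enn2real_positive_iff)
    ultimately show False by auto
  qed
  then have "(LINT y|lborel. bump r y) \<noteq> 0"
    using integral_nonneg_eq_0_iff_AE[OF i] bump_nonneg by auto
  moreover have "(LINT y|lborel. bump r y) \<ge> 0" by (intro Bochner_Integration.integral_nonneg bump_nonneg)
  ultimately show ?thesis by linarith
qed

lemma mol_props: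
  assumes "0 < r" "r < 1"
  shows "test_fun (mol r)" "\<And>z. 0 \<le> mol r z" "\<And>z. norm z \<ge> r \<Longrightarrow> mol r z = 0" "(LINT y|lborel. mol r y) = 1"
    "integrable lborel (mol r)" "continuous_on UNIV (mol r)"
proof -
  note p = bump_integral_pos[OF assms]
  show t: "test_fun (mol r)" unfolding mol_def[abs_def] by (intro test_fun_cmult test_fun_bump assms)
  show "0 \<le> mol r z" for z using p bump_nonneg by (simp add: mol_def)
  show "norm z \<ge> r \<Longrightarrow> mol r z = 0" for z using bump_zero assms by (simp add: mol_def)
  show "(LINT y|lborel. mol r y) = 1" using p by (simp add: mol_def)
  show "integrable lborel (mol r)" by (rule test_fun_integrable_lborel[OF t])
  show "continuous_on UNIV (mol r)" by (rule test_fun_continuous[OF t])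
qed

lemma lborel_distr_reflect: "distr lborel borel (\<lambda>y. z - y) = (lborel :: plane measure)"
  by (subst (2) lborel_affine[of "-1" z]) (auto simp: density_1)

lemma lborel_reflect:
  fixes f :: "plane \<Rightarrow> real"
  assumes "f \<in> borel_measurable borel"
  shows "(LINT y|lborel. f (z - y)) = (LINT y|lborel. f y)"
  using integral_distr[of "\<lambda>y. z - y" lborel borel f] assms by (simp add: lborel_distr_reflect)

lemma nn_integral_shift:
  fixes f :: "plane \<Rightarrow> ennreal"
  assumes "f \<in> borel_measurable borel"
  shows "(\<integral>\<^sup>+z. f (z - y) \<partial>lborel) = (\<integral>\<^sup>+z. f z \<partial>lborel)"
  using nn_integral_distr[of "(+) (- y)" lborel borel f] assms
  by (simp add: lborel_distr_plus)

text \<open>Jensen's inequality for the probability density \<open>y \<mapsto> mol r (z - y)\<close>, from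
  \<open>0 \<le> \<integral> mol r (z - y) (v y - m)\<^sup>2\<close> with \<open>m\<close> the mean.\<close>

lemma conv_mol_sq_le:
  assumes r: "0 < r" "r < 1" and v: "integrable lborel v" "integrable lborel (\<lambda>y. (v y)\<^sup>2)"
  shows "(conv (mol r) v z)\<^sup>2 \<le> conv (mol r) (\<lambda>y. (v y)\<^sup>2) z"
proof -
  note p = mol_props[OF r]
  have z: "mol r y = 0" if "norm y \<ge> 1" for y using that r by (intro p) auto
  have i: "integrable lborel (\<lambda>y. mol r (z - y) * v y)" "integrable lborel (\<lambda>y. mol r (z - y) * (v y)\<^sup>2)"
    by (rule integrable_conv[OF p(6) z v(1)], assumption, rule integrable_conv[OF p(6) z v(2)], assumption)
  have one: "(LINT y|lborel. mol r (z - y)) = 1"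
    using lborel_reflect[of "mol r" z] p(4,5) by simp
  then have i1: "integrable lborel (\<lambda>y. mol r (z - y))" using not_integrable_integral_eq by force
  define m where "m = conv (mol r) v z"
  have "0 \<le> (LINT y|lborel. mol r (z - y) * (v y - m)\<^sup>2)"
    by (intro Bochner_Integration.integral_nonneg mult_nonneg_nonneg p) auto
  also have "(\<lambda>y. mol r (z - y) * (v y - m)\<^sup>2) =
      (\<lambda>y. mol r (z - y) * (v y)\<^sup>2 - 2 * m * (mol r (z - y) * v y) + m\<^sup>2 * mol r (z - y))"
    by (simp add: power2_eq_square algebra_simps)
  also have "(LINT y|lborel. mol r (z - y) * (v y)\<^sup>2 - 2 * m * (mol r (z - y) * v y) + m\<^sup>2 * mol r (z - y))
      = conv (mol r) (\<lambda>y. (v y)\<^sup>2) z - 2 * m * m + m\<^sup>2 * 1"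
    using i i1 by (simp add: one conv_def m_def)
  finally show ?thesis by (simp add: m_def power2_eq_square)
qed

lemma conv_borel:
  assumes "test_fun \<psi>" "integrable lborel v" shows "conv \<psi> v \<in> borel_measurable borel"
  using Ck_conv[OF assms(2,1), of 0] by (intro borel_measurable_continuous_onI) simp

lemma nn_integral_conv_mol:
  assumes r: "0 < r" "r < 1" and w: "integrable lborel w" "\<And>y. 0 \<le> w y"
  shows "(\<integral>\<^sup>+z. ennreal (conv (mol r) w z) \<partial>lborel) = ennreal (LINT y|lborel. w y)"
proof -
  note p = mol_props[OF r]
  have z: "mol r y = 0" if "norm y \<ge> 1" for y using that r by (intro p) auto
  have [measurable]: "mol r \<in> borel_measurable borel" "w \<in> borel_measurable borel"
    using p(5) w(1) by auto
  have m1: "(\<integral>\<^sup>+z. ennreal (mol r (z - y)) \<partial>lborel) = 1" for y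
    using nn_integral_shift[of "\<lambda>z. ennreal (mol r z)" y] nn_integral_eq_integral[OF p(5)] p(2,4) by simp
  have "(\<integral>\<^sup>+z. ennreal (conv (mol r) w z) \<partial>lborel) = (\<integral>\<^sup>+z. (\<integral>\<^sup>+y. ennreal (mol r (z - y) * w y) \<partial>lborel) \<partial>lborel)"
  proof (rule nn_integral_cong)
    fix x
    show "ennreal (conv (mol r) w x) = (\<integral>\<^sup>+y. ennreal (mol r (x - y) * w y) \<partial>lborel)"
      unfolding conv_def
      by (intro nn_integral_eq_integral[symmetric] integrable_conv p(6) z w(1) AE_I2 mult_nonneg_nonneg p(2) w(2))
  qed
  also have "\<dots> = (\<integral>\<^sup>+y. (\<integral>\<^sup>+z. ennreal (mol r (z - y) * w y) \<partial>lborel) \<partial>lborel)"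
    by (intro lborel_pair.Fubini'[symmetric]) measurable
  also have "\<dots> = (\<integral>\<^sup>+y. ennreal (w y) \<partial>lborel)"
    using w(2) p(2) by (intro nn_integral_cong) (simp add: ennreal_mult' nn_integral_multc m1)
  also have "\<dots> = ennreal (LINT y|lborel. w y)"
    using w by (intro nn_integral_eq_integral) auto
  finally show ?thesis .
qed

lemma conv_mol_young:
  assumes r: "0 < r" "r < 1" and v: "integrable lborel v" "integrable lborel (\<lambda>y. (v y)\<^sup>2)"
  shows "integrable lborel (\<lambda>z. (conv (mol r) v z)\<^sup>2)"
    "(LINT z|lborel. (conv (mol r) v z)\<^sup>2) \<le> (LINT y|lborel. (v y)\<^sup>2)"
proof -
  note p = mol_props[OF r]
  have m: "(\<lambda>z. (conv (mol r) v z)\<^sup>2) \<in> borel_measurable lborel"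
    using conv_borel[OF p(1) v(1)] by simp
  have le: "(\<integral>\<^sup>+z. ennreal ((conv (mol r) v z)\<^sup>2) \<partial>lborel) \<le> ennreal (LINT y|lborel. (v y)\<^sup>2)"
    using nn_integral_mono[of lborel "\<lambda>z. ennreal ((conv (mol r) v z)\<^sup>2)" "\<lambda>z. ennreal (conv (mol r) (\<lambda>y. (v y)\<^sup>2) z)"]
      conv_mol_sq_le[OF r v] nn_integral_conv_mol[OF r v(2)] by (simp add: ennreal_leI)
  then show i: "integrable lborel (\<lambda>z. (conv (mol r) v z)\<^sup>2)"
    using m by (intro integrableI_bounded) (auto intro: le_less_trans)
  show "(LINT z|lborel. (conv (mol r) v z)\<^sup>2) \<le> (LINT y|lborel. (v y)\<^sup>2)"
    using le nn_integral_eq_integral[OF i] by (simp add: ennreal_le_iff)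
qed

text \<open>Truncation reduces the claim to bounded functions; such a function is an almost everywhere limit of continuous
  functions, which can be truncated and cut off in the same way, so that dominated convergence applies.\<close>

lemma L2_approx_continuous:
  fixes v :: "plane \<Rightarrow> real"
  assumes v: "v \<in> borel_measurable borel" "\<And>z. norm z \<ge> 1 \<Longrightarrow> v z = 0" "integrable lborel (\<lambda>z. (v z)\<^sup>2)" and e: "e > 0"
  shows "\<exists>g. continuous_on UNIV g \<and> (\<forall>z. norm z \<ge> 2 \<longrightarrow> g z = 0) \<and> (LINT z|lborel. (v z - g z)\<^sup>2) < e"
proof -
  note [measurable] = v(1)
  define c where "c M x = max (- M) (min M x)" for M x :: real
  have c_abs: "\<bar>c M x\<bar> \<le> M" if "M \<ge> 0" for M x using that by (auto simp: c_def)
  have [measurable]: "c M \<in> borel_measurable borel" for M unfolding c_def[abs_def] by measurable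
  have "(\<lambda>n. LINT z|lborel. (v z - c (real n) (v z))\<^sup>2) \<longlonglongrightarrow> (LINT z|(lborel::plane measure). 0)"
  proof (rule integral_dominated_convergence[where w = "\<lambda>z. (v z)\<^sup>2"])
    show "AE z in lborel. (\<lambda>n. (v z - c (real n) (v z))\<^sup>2) \<longlonglongrightarrow> 0"
    proof (rule AE_I2)
      fix z
      have "\<forall>\<^sub>F n in sequentially. \<bar>v z\<bar> \<le> real n"
        using filterlim_real_sequentially unfolding filterlim_at_top by blast
      then have "\<forall>\<^sub>F n in sequentially. 0 = (v z - c (real n) (v z))\<^sup>2"
        by eventually_elim (auto simp: c_def)
      then show "(\<lambda>n. (v z - c (real n) (v z))\<^sup>2) \<longlonglongrightarrow> 0" by (rule Lim_transform_eventually[OF tendsto_const])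
    qed
    show "AE z in lborel. norm ((v z - c (real n) (v z))\<^sup>2) \<le> (v z)\<^sup>2" for n
    proof (rule AE_I2)
      fix z have "\<bar>v z - c (real n) (v z)\<bar> \<le> \<bar>v z\<bar>" by (auto simp: c_def max_def min_def)
      then show "norm ((v z - c (real n) (v z))\<^sup>2) \<le> (v z)\<^sup>2" by (simp add: abs_le_square_iff)
    qed
  qed (use v(3) in auto)
  then have "\<forall>\<^sub>F n in sequentially. (LINT z|lborel. (v z - c (real n) (v z))\<^sup>2) < e / 4"
    using e by (intro order_tendstoD(2)) auto
  then obtain n where n: "(LINT z|lborel. (v z - c (real n) (v z))\<^sup>2) < e / 4"
    using eventually_happens'[OF sequentially_bot] by blast
  define M where "M = real n"
  have M: "M \<ge> 0" "(LINT z|lborel. (v z - c M (v z))\<^sup>2) < e / 4" using n by (auto simp: M_def)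
  have "v \<in> borel_measurable lebesgue" using v(1) by (simp add: measurable_completion)
  then have "v measurable_on UNIV" by (intro lebesgue_measurable_imp_measurable_on) auto
  then obtain N g where N: "negligible N" and g: "\<And>k::nat. continuous_on UNIV (g k)"
    and lim: "\<And>z. z \<notin> N \<Longrightarrow> (\<lambda>k. g k z) \<longlonglongrightarrow> v z"
    unfolding measurable_on_def by auto
  have "N \<in> null_sets lebesgue" using N by (simp add: negligible_iff_null_sets)
  then have "AE z in lebesgue. z \<notin> N" by (rule AE_not_in)
  then have ae: "AE z in lborel. z \<notin> N" by (simp only: AE_completion_iff)
  define \<zeta> where "\<zeta> z = max 0 (min 1 (2 - norm z))" for z :: plane
  define h where "h k z = c M (g k z) * \<zeta> z" for k z
  have h_cont: "continuous_on UNIV (h k)" for k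
    unfolding h_def[abs_def] c_def \<zeta>_def by (intro continuous_intros g)
  have h0: "h k z = 0" if "norm z \<ge> 2" for k z using that by (simp add: h_def \<zeta>_def)
  have h_abs: "\<bar>h k z\<bar> \<le> M" for k z
    using mult_mono[OF c_abs[OF M(1), of "g k z"], of "\<zeta> z" 1] M(1) by (auto simp: h_def abs_mult \<zeta>_def)
  have [measurable]: "h k \<in> borel_measurable borel" for k by (intro borel_measurable_continuous_onI h_cont)
  have icb: "integrable lborel (indicator (cball (0::plane) 2) :: plane \<Rightarrow> real)"
    by (intro integrable_real_indicator) (auto simp: emeasure_bounded_finite[unfolded infinity_ennreal_def])
  have sm: "(c M (v z) - h k z)\<^sup>2 \<le> 4 * M\<^sup>2 * indicator (cball 0 2) z" for k z
  proof (cases "norm z \<le> 2")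
    case True
    have "\<bar>c M (v z) - h k z\<bar> \<le> \<bar>2 * M\<bar>" using c_abs[OF M(1), of "v z"] h_abs[of k z] by linarith
    then have "(c M (v z) - h k z)\<^sup>2 \<le> (2 * M)\<^sup>2" by (simp only: abs_le_square_iff)
    then show ?thesis using True by (simp add: power_mult_distrib)
  next
    case False
    then have "v z = 0" "h k z = 0" using v(2) h0 by auto
    then show ?thesis using M(1) by (simp add: c_def)
  qed
  have i2: "integrable lborel (\<lambda>z. (c M (v z) - h k z)\<^sup>2)" for k
    by (rule Bochner_Integration.integrable_bound[of _ "\<lambda>z. 4 * M\<^sup>2 * indicator (cball 0 2) z"]) (use sm icb in auto)
  have "(\<lambda>k. LINT z|lborel. (c M (v z) - h k z)\<^sup>2) \<longlonglongrightarrow> (LINT z|(lborel::plane measure). 0)"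
  proof (rule integral_dominated_convergence[where w = "\<lambda>z. 4 * M\<^sup>2 * indicator (cball 0 2) z"])
    show "AE z in lborel. (\<lambda>k. (c M (v z) - h k z)\<^sup>2) \<longlonglongrightarrow> 0"
      using ae
    proof eventually_elim
      case (elim z)
      have "(\<lambda>k. (c M (v z) - h k z)\<^sup>2) \<longlonglongrightarrow> (c M (v z) - c M (v z) * \<zeta> z)\<^sup>2"
        unfolding h_def c_def by (intro tendsto_intros lim elim)
      moreover have "c M (v z) - c M (v z) * \<zeta> z = 0"
        using v(2)[of z] M(1) by (cases "norm z < 1") (auto simp: \<zeta>_def c_def)
      ultimately show ?case by simp
    qed
  qed (use sm icb in auto)
  then have "\<forall>\<^sub>F k in sequentially. (LINT z|lborel. (c M (v z) - h k z)\<^sup>2) < e / 4"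
    using e by (intro order_tendstoD(2)) auto
  then obtain k where k: "(LINT z|lborel. (c M (v z) - h k z)\<^sup>2) < e / 4"
    using eventually_happens'[OF sequentially_bot] by blast
  have i1: "integrable lborel (\<lambda>z. (v z - c M (v z))\<^sup>2)"
  proof (rule Bochner_Integration.integrable_bound[OF v(3)])
    show "AE z in lborel. norm ((v z - c M (v z))\<^sup>2) \<le> norm ((v z)\<^sup>2)"
    proof (rule AE_I2)
      fix z have "\<bar>v z - c M (v z)\<bar> \<le> \<bar>v z\<bar>" using M(1) by (auto simp: c_def max_def min_def)
      then show "norm ((v z - c M (v z))\<^sup>2) \<le> norm ((v z)\<^sup>2)" by (simp add: abs_le_square_iff)
    qed
  qed simp
  have "(LINT z|lborel. (v z - h k z)\<^sup>2) \<le> (LINT z|lborel. 2 * (v z - c M (v z))\<^sup>2 + 2 * (c M (v z) - h k z)\<^sup>2)"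
  proof (rule integral_mono')
    show "integrable lborel (\<lambda>z. 2 * (v z - c M (v z))\<^sup>2 + 2 * (c M (v z) - h k z)\<^sup>2)" using i1 i2 by simp
    fix z
    have "2 * (v z - c M (v z))\<^sup>2 + 2 * (c M (v z) - h k z)\<^sup>2 - (v z - h k z)\<^sup>2 = (v z - 2 * c M (v z) + h k z)\<^sup>2"
      by (simp add: power2_eq_square algebra_simps)
    then show "(v z - h k z)\<^sup>2 \<le> 2 * (v z - c M (v z))\<^sup>2 + 2 * (c M (v z) - h k z)\<^sup>2"
      using zero_le_power2[of "v z - 2 * c M (v z) + h k z"] by linarith
  qed simp
  also have "\<dots> = 2 * (LINT z|lborel. (v z - c M (v z))\<^sup>2) + 2 * (LINT z|lborel. (c M (v z) - h k z)\<^sup>2)"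
    using i1 i2 by simp
  also have "\<dots> < e" using k M(2) by linarith
  finally have "(LINT z|lborel. (v z - h k z)\<^sup>2) < e" .
  with h_cont h0 show ?thesis by (intro exI[of _ "h k"]) auto
qed

lemma conv_mol_near:
  assumes r: "0 < r" "r < 1" and g: "continuous_on UNIV g" "integrable lborel g"
    and d: "\<And>x y. dist x y < d \<Longrightarrow> dist (g x) (g y) < \<delta>" "r \<le> d"
  shows "\<bar>conv (mol r) g z - g z\<bar> \<le> \<delta>"
proof -
  note p = mol_props[OF r]
  have z: "mol r y = 0" if "norm y \<ge> 1" for y using that r by (intro p) auto
  have one: "(LINT y|lborel. mol r (z - y)) = 1"
    using lborel_reflect[of "mol r" z] p(4,5) by simp
  then have i1: "integrable lborel (\<lambda>y. mol r (z - y))" using not_integrable_integral_eq by force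
  have i: "integrable lborel (\<lambda>y. mol r (z - y) * g y)"
    by (intro integrable_conv p(6) z g)
  have "conv (mol r) g z - g z = (LINT y|lborel. mol r (z - y) * g y - mol r (z - y) * g z)"
    using i i1 one by (simp add: conv_def)
  also have "\<bar>\<dots>\<bar> \<le> (LINT y|lborel. \<bar>mol r (z - y) * g y - mol r (z - y) * g z\<bar>)"
    by (rule integral_abs_bound)
  also have "\<dots> \<le> (LINT y|lborel. \<delta> * mol r (z - y))"
  proof (rule integral_mono)
    show "integrable lborel (\<lambda>y. \<bar>mol r (z - y) * g y - mol r (z - y) * g z\<bar>)" using i i1 by simp
    show "integrable lborel (\<lambda>y. \<delta> * mol r (z - y))" using i1 by simp
    fix y
    show "\<bar>mol r (z - y) * g y - mol r (z - y) * g z\<bar> \<le> \<delta> * mol r (z - y)"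
    proof (cases "norm (z - y) < r")
      case True
      then have "dist (g y) (g z) < \<delta>" using d by (intro d(1)) (simp add: dist_norm norm_minus_commute)
      then have "mol r (z - y) * \<bar>g y - g z\<bar> \<le> mol r (z - y) * \<delta>"
        by (intro mult_left_mono p(2)) (simp add: dist_real_def)
      moreover have "\<bar>mol r (z - y) * g y - mol r (z - y) * g z\<bar> = mol r (z - y) * \<bar>g y - g z\<bar>"
        using p(2)[of "z - y"] by (simp only: right_diff_distrib[symmetric] abs_mult abs_of_nonneg)
      ultimately show ?thesis by (simp only: mult.commute[of \<delta>])
    next
      case False
      then show ?thesis using p(3)[of "z - y"] by simp
    qed
  qed
  also have "\<dots> = \<delta>" using one by simp
  finally show ?thesis .
qed

lemma conv_zero_outside:
  assumes "\<And>z. norm z \<ge> r \<Longrightarrow> \<psi> z = 0" "\<And>z. norm z > \<rho> \<Longrightarrow> v z = 0" "norm z \<ge> \<rho> + r"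
  shows "conv \<psi> v z = 0"
proof -
  have "\<psi> (z - y) * v y = 0" for y
  proof (cases "norm y > \<rho>")
    case False
    then have "norm (z - y) \<ge> r" using norm_triangle_ineq2[of z y] assms(3) by linarith
    then show ?thesis using assms(1) by simp
  qed (use assms(2) in simp)
  then have "(\<lambda>y. \<psi> (z - y) * v y) = (\<lambda>_. 0)" by (rule ext)
  then show ?thesis by (simp add: conv_def)
qed

lemma supported_sq_integrable:
  fixes v :: "plane \<Rightarrow> real"
  assumes v: "v \<in> borel_measurable borel" "\<And>z. norm z \<ge> R \<Longrightarrow> v z = 0" "integrable lborel (\<lambda>z. (v z)\<^sup>2)"
  shows "integrable lborel v"
proof (rule Bochner_Integration.integrable_bound)
  show "integrable lborel (\<lambda>z. (v z)\<^sup>2 + indicator (cball 0 R) z)"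
    using v(3) by (intro Bochner_Integration.integrable_add integrable_real_indicator) (auto simp: emeasure_bounded_finite[unfolded infinity_ennreal_def])
  show "AE z in lborel. norm (v z) \<le> norm ((v z)\<^sup>2 + indicator (cball 0 R) z :: real)"
  proof (rule AE_I2)
    fix z
    have "\<bar>v z\<bar> \<le> (v z)\<^sup>2 + 1" using zero_le_power2[of "\<bar>v z\<bar> - 1/2"] by (simp add: power2_diff power_divide)
    then show "norm (v z) \<le> norm ((v z)\<^sup>2 + indicator (cball 0 R) z :: real)"
      using v(2)[of z] by (cases "norm z \<le> R") auto
  qed
qed (use v(1) in simp)

text \<open>The usual three-term argument: mollification does not increase the \<open>L\<^sup>2\<close> norm, and it is uniformly close to the
  identity on a continuous function of compact support.\<close>

lemma conv_mol_tendsto: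
  assumes r: "\<And>n. 0 < r n" "\<And>n. r n < 1" "r \<longlonglongrightarrow> 0"
    and v: "v \<in> borel_measurable borel" "\<And>z. norm z \<ge> 1 \<Longrightarrow> v z = 0" "integrable lborel (\<lambda>z. (v z)\<^sup>2)"
  shows "(\<lambda>n. LINT z|lborel. (conv (mol (r n)) v z - v z)\<^sup>2) \<longlonglongrightarrow> 0"
proof (rule LIMSEQ_I)
  fix e :: real assume e: "e > 0"
  obtain g where g: "continuous_on UNIV g" "\<forall>z. norm z \<ge> 2 \<longrightarrow> g z = 0" "(LINT z|lborel. (v z - g z)\<^sup>2) < e / 12"
    using L2_approx_continuous[OF v, of "e / 12"] e by auto
  have vi: "integrable lborel v" by (rule supported_sq_integrable[OF v])
  have gi: "integrable lborel g" "integrable lborel (\<lambda>z. (g z)\<^sup>2)"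
    using g(1,2) by (intro integrable_lborel_supported[of _ "cball 0 2"] continuous_intros; simp)+
  define V where "V = measure lborel (cball (0::plane) 3)"
  define \<delta> where "\<delta> = sqrt (e / (12 * (V + 1)))"
  have V: "V \<ge> 0" by (simp add: V_def)
  have \<delta>: "\<delta> > 0" "\<delta>\<^sup>2 * V \<le> e / 12"
  proof -
    show "\<delta> > 0" using e V by (simp add: \<delta>_def)
    have "\<delta>\<^sup>2 * V = e / 12 * (V / (V + 1))" using e V by (simp add: \<delta>_def field_simps)
    also have "\<dots> \<le> e / 12 * 1" using e V by (intro mult_left_mono) auto
    finally show "\<delta>\<^sup>2 * V \<le> e / 12" by simp
  qed
  obtain d where d: "d > 0" "\<forall>x y. dist x y < d \<longrightarrow> dist (g x) (g y) < \<delta>"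
    using supported_uniformly_continuous[OF g(1) _ \<delta>(1), of 2] g(2) by blast
  have "\<forall>\<^sub>F n in sequentially. r n < d" by (rule order_tendstoD(2)[OF r(3) d(1)])
  then obtain n0 where n0: "\<And>n. n \<ge> n0 \<Longrightarrow> r n < d" unfolding eventually_sequentially by blast
  have "norm ((LINT z|lborel. (conv (mol (r n)) v z - v z)\<^sup>2) - 0) < e" if n: "n \<ge> n0" for n
  proof -
    note p = mol_props[OF r(1,2)[of n]]
    define u where "u z = v z - g z" for z
    have ui: "integrable lborel u" using vi gi by (simp add: u_def[abs_def])
    have u2: "integrable lborel (\<lambda>z. (u z)\<^sup>2)"
    proof (rule Bochner_Integration.integrable_bound)
      show "integrable lborel (\<lambda>z. 2 * (v z)\<^sup>2 + 2 * (g z)\<^sup>2)" using v(3) gi by simp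
      show "(\<lambda>z. (u z)\<^sup>2) \<in> borel_measurable lborel" using ui by measurable
      show "AE z in lborel. norm ((u z)\<^sup>2) \<le> norm (2 * (v z)\<^sup>2 + 2 * (g z)\<^sup>2)"
      proof (rule AE_I2)
        fix z
        have "2 * (v z)\<^sup>2 + 2 * (g z)\<^sup>2 - (u z)\<^sup>2 = (v z + g z)\<^sup>2" by (simp add: u_def power2_eq_square algebra_simps)
        then have "(u z)\<^sup>2 \<le> 2 * (v z)\<^sup>2 + 2 * (g z)\<^sup>2" using zero_le_power2[of "v z + g z"] by linarith
        then show "norm ((u z)\<^sup>2) \<le> norm (2 * (v z)\<^sup>2 + 2 * (g z)\<^sup>2)" by simp
      qed
    qed
    have "conv (mol (r n)) u z = conv (mol (r n)) v z - conv (mol (r n)) g z" for z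
    proof -
      have z0: "mol (r n) y = 0" if "norm y \<ge> 1" for y using that r(2)[of n] by (intro p(3)) simp
      show ?thesis
        using integrable_conv[OF p(6) z0 vi, of z] integrable_conv[OF p(6) z0 gi(1), of z]
        by (simp add: conv_def u_def right_diff_distrib)
    qed
    then have split: "conv (mol (r n)) v z - v z = conv (mol (r n)) u z + (conv (mol (r n)) g z - g z) - u z" for z
      by (simp add: u_def)
    have sq3: "(a + b - c)\<^sup>2 \<le> 3 * a\<^sup>2 + 3 * b\<^sup>2 + 3 * c\<^sup>2" for a b c :: real
    proof -
      have "3 * a\<^sup>2 + 3 * b\<^sup>2 + 3 * c\<^sup>2 - (a + b - c)\<^sup>2 = (a - b)\<^sup>2 + (a + c)\<^sup>2 + (b + c)\<^sup>2"
        by (simp add: power2_eq_square algebra_simps)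
      then show ?thesis using zero_le_power2[of "a - b"] zero_le_power2[of "a + c"] zero_le_power2[of "b + c"] by linarith
    qed
    have near: "(conv (mol (r n)) g z - g z)\<^sup>2 \<le> \<delta>\<^sup>2 * indicator (cball 0 3) z" for z
    proof (cases "norm z \<le> 3")
      case True
      have "\<bar>conv (mol (r n)) g z - g z\<bar> \<le> \<delta>"
        using d(2) n0[OF n] by (intro conv_mol_near[OF r(1,2)[of n] g(1) gi(1), of d]) auto
      then have "\<bar>conv (mol (r n)) g z - g z\<bar> \<le> \<bar>\<delta>\<bar>" by linarith
      then have "(conv (mol (r n)) g z - g z)\<^sup>2 \<le> \<delta>\<^sup>2" by (simp only: abs_le_square_iff)
      then show ?thesis using True by simp
    next
      case False
      have "conv (mol (r n)) g z = 0"
        by (rule conv_zero_outside[of "r n" _ 2]) (use p(3) g(2) r(2)[of n] False in auto)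
      then show ?thesis using False g(2) by simp
    qed
    have icb: "integrable lborel (indicator (cball (0::plane) 3) :: plane \<Rightarrow> real)"
      by (intro integrable_real_indicator) (auto simp: emeasure_bounded_finite[unfolded infinity_ennreal_def])
    have [measurable]: "conv (mol (r n)) g \<in> borel_measurable borel" "g \<in> borel_measurable borel"
      using conv_borel[OF p(1) gi(1)] gi(1) by auto
    have ni: "integrable lborel (\<lambda>z. (conv (mol (r n)) g z - g z)\<^sup>2)"
      by (rule Bochner_Integration.integrable_bound[of _ "\<lambda>z. \<delta>\<^sup>2 * indicator (cball 0 3) z"]) (use near icb in auto)
    note y = conv_mol_young[OF r(1,2)[of n] ui u2]
    have "(LINT z|lborel. (conv (mol (r n)) v z - v z)\<^sup>2)
        \<le> (LINT z|lborel. 3 * (conv (mol (r n)) u z)\<^sup>2 + 3 * (conv (mol (r n)) g z - g z)\<^sup>2 + 3 * (u z)\<^sup>2)"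
      unfolding split using sq3 y(1) ni u2 by (intro integral_mono') auto
    also have "\<dots> = 3 * (LINT z|lborel. (conv (mol (r n)) u z)\<^sup>2) + 3 * (LINT z|lborel. (conv (mol (r n)) g z - g z)\<^sup>2)
        + 3 * (LINT z|lborel. (u z)\<^sup>2)"
      using y(1) ni u2 by simp
    finally have le3: "(LINT z|lborel. (conv (mol (r n)) v z - v z)\<^sup>2)
      \<le> 3 * (LINT z|lborel. (conv (mol (r n)) u z)\<^sup>2) + 3 * (LINT z|lborel. (conv (mol (r n)) g z - g z)\<^sup>2)
        + 3 * (LINT z|lborel. (u z)\<^sup>2)" .
    have "(LINT z|lborel. (conv (mol (r n)) g z - g z)\<^sup>2) \<le> (LINT z|lborel. \<delta>\<^sup>2 * indicator (cball 0 3) (z :: plane))"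
      by (rule integral_mono[OF ni _ near]) (use icb in simp)
    also have "(LINT z|lborel. \<delta>\<^sup>2 * indicator (cball 0 3) (z :: plane)) = \<delta>\<^sup>2 * V" by (simp add: V_def)
    finally have "(LINT z|lborel. (conv (mol (r n)) g z - g z)\<^sup>2) \<le> e / 12" using \<delta>(2) by linarith
    moreover have "(LINT z|lborel. (u z)\<^sup>2) < e / 12" using g(3) by (simp only: u_def)
    ultimately have "(LINT z|lborel. (conv (mol (r n)) v z - v z)\<^sup>2) < e"
      using y(2) le3 e by linarith
    moreover have "(LINT z|lborel. (conv (mol (r n)) v z - v z)\<^sup>2) \<ge> 0" by simp
    ultimately show ?thesis by simp
  qed
  then show "\<exists>no. \<forall>n\<ge>no. norm ((LINT z|lborel. (conv (mol (r n)) v z - v z)\<^sup>2) - 0) < e" by blast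
qed

subsection \<open>Compactly supported Sobolev functions\<close>

text \<open>Sobolev functions on the disk that vanish outside the disk of radius \<open>\<rho>\<close>, together with their derivatives. The values are Borel
  measurable and 0 everywhere outside, so that convolutions over the plane make sense; \<open>wd\<close> guarantees neither, hence the
  existential quantifier.\<close>

fun csob :: "real \<Rightarrow> nat \<Rightarrow> (plane \<Rightarrow> real) \<Rightarrow> bool" where
  "csob \<rho> 0 v \<longleftrightarrow> v \<in> borel_measurable borel \<and> L2 v \<and> (\<forall>z. norm z > \<rho> \<longrightarrow> v z = 0)"
| "csob \<rho> (Suc k) v \<longleftrightarrow> csob \<rho> 0 v \<and> (\<forall>b\<in>Basis. \<exists>g. weak_partial b v g \<and> csob \<rho> k g)"

lemma csob_0: "csob \<rho> k v \<Longrightarrow> csob \<rho> 0 v"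
  by (cases k) auto

lemma csob_add: "csob \<rho> k u \<Longrightarrow> csob \<rho> k v \<Longrightarrow> csob \<rho> k (\<lambda>z. u z + v z)"
proof (induction k arbitrary: u v)
  case 0
  then show ?case by (auto intro: L2_add)
next
  case (Suc k)
  have 0: "csob \<rho> 0 (\<lambda>z. u z + v z)"
    using csob_0[OF Suc.prems(1)] csob_0[OF Suc.prems(2)] by (auto intro: L2_add)
  have "\<exists>g. weak_partial b (\<lambda>z. u z + v z) g \<and> csob \<rho> k g" if b: "b \<in> Basis" for b
  proof -
    obtain g where g: "weak_partial b u g" "csob \<rho> k g" using Suc.prems(1) b by auto
    obtain h where h: "weak_partial b v h" "csob \<rho> k h" using Suc.prems(2) b by auto
    have "L2 u" "L2 v" "L2 g" "L2 h"
      using csob_0[OF Suc.prems(1)] csob_0[OF Suc.prems(2)] csob_0[OF g(2)] csob_0[OF h(2)] by simp_all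
    then have "weak_partial b (\<lambda>z. u z + v z) (\<lambda>z. g z + h z)"
      using g h b by (intro weak_partial_add)
    then show ?thesis using Suc.IH[OF g(2) h(2)] by blast
  qed
  with 0 show ?case by simp
qed

lemma csob_localize_0:
  assumes "L2 u" "test_fun \<zeta>" "\<And>z. norm z > \<rho> \<Longrightarrow> \<zeta> z = 0"
  shows "\<exists>v. csob \<rho> 0 v \<and> (AE z in lebesgue_on disk. \<zeta> z * u z = v z)"
proof -
  obtain w where w: "w \<in> borel_measurable borel" "AE z in lebesgue_on disk. u z = w z"
    using disk_borel_rep[OF L2_measurable[OF assms(1)]] by blast
  have "AE z in lebesgue_on disk. w z = u z" using w(2) by (rule eventually_mono) simp
  then have l: "L2 w" using assms(1) borel_disk_measurable[OF w(1)] by (rule L2_cong_AE)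
  have c: "continuous_on UNIV \<zeta>" by (rule test_fun_continuous[OF assms(2)])
  have "(\<lambda>z. \<zeta> z * w z) \<in> borel_measurable borel"
    by (rule borel_measurable_times[OF borel_measurable_continuous_onI[OF c] w(1)])
  then have "csob \<rho> 0 (\<lambda>z. \<zeta> z * w z)"
    using assms(3) L2_mult_continuous[OF l c] by simp
  moreover have "AE z in lebesgue_on disk. \<zeta> z * u z = \<zeta> z * w z" using w(2) by (rule eventually_mono) simp
  ultimately show ?thesis by (intro exI[of _ "\<lambda>z. \<zeta> z * w z"]) simp
qed

lemma csob_localize:
  "sobolev k u \<Longrightarrow> test_fun \<zeta> \<Longrightarrow> (\<And>z. norm z > \<rho> \<Longrightarrow> \<zeta> z = 0) \<Longrightarrow>
    \<exists>v. csob \<rho> k v \<and> (AE z in lebesgue_on disk. \<zeta> z * u z = v z)"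
proof (induction k arbitrary: u \<zeta>)
  case (0 u \<zeta>)
  show ?case by (rule csob_localize_0[OF sobolev_L2[OF 0(1)] 0(2,3)])
next
  case (Suc k u \<zeta>)
  obtain v where v: "csob \<rho> 0 v" "AE z in lebesgue_on disk. \<zeta> z * u z = v z"
    using csob_localize_0[OF sobolev_L2[OF Suc.prems(1)] Suc.prems(2), of \<rho>] Suc.prems(3) by blast
  have uL: "L2 u" by (rule sobolev_L2[OF Suc.prems(1)])
  have "\<exists>g. weak_partial b v g \<and> csob \<rho> k g" if b: "b \<in> Basis" for b
  proof -
    have z: "pd b \<zeta> z = 0" if "norm z > \<rho>" for z
      using frechet_derivative_zero_outside[of "cball 0 \<rho>" \<zeta> z] that Suc.prems(3)
      by (intro pd_unique[where f' = "\<lambda>h. 0"]) auto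
    obtain g1 where g1: "csob \<rho> k g1" "AE z in lebesgue_on disk. pd b \<zeta> z * u z = g1 z"
      using Suc.IH[OF sobolev_Suc_D[OF Suc.prems(1)] test_fun_pd[OF Suc.prems(2) b] z] by blast
    obtain g2 where g2: "csob \<rho> k g2" "AE z in lebesgue_on disk. \<zeta> z * wd b u z = g2 z"
      using Suc.IH[OF sobolev_wd[OF Suc.prems(1) b] Suc.prems(2,3)] by blast
    have wu: "weak_partial b (\<lambda>z. \<zeta> z * u z) (\<lambda>z. pd b \<zeta> z * u z + \<zeta> z * wd b u z)"
      using Suc.prems(1,2) b uL by (intro weak_partial_mult_smooth sobolev_weak sobolev_wd_L2 test_fun_Ck)
    have s: "csob \<rho> k (\<lambda>z. g1 z + g2 z)" by (rule csob_add[OF g1(1) g2(1)])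
    have ae: "AE z in lebesgue_on disk. pd b \<zeta> z * u z + \<zeta> z * wd b u z = g1 z + g2 z"
      using g1(2) g2(2) by eventually_elim simp
    have l: "L2 (\<lambda>z. \<zeta> z * u z)" "L2 (\<lambda>z. pd b \<zeta> z * u z + \<zeta> z * wd b u z)"
      by (intro L2_add L2_mult_continuous uL test_fun_continuous Suc.prems test_fun_pd b sobolev_wd_L2[OF Suc.prems(1)])+
    have l': "L2 v" "L2 (\<lambda>z. g1 z + g2 z)" using v(1) csob_0[OF s] by simp_all
    have "weak_partial b v (\<lambda>z. g1 z + g2 z)"
      by (rule weak_partial_cong[OF v(2) ae l(1) l'(1) l(2) l'(2) b wu])
    then show ?thesis using s by (intro exI[of _ "\<lambda>z. g1 z + g2 z"]) simp
  qed
  with v show ?case by (intro exI[of _ v]) simp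
qed

lemma sconv_cong:
  assumes "sconv k f u" "\<And>n. AE z in lebesgue_on disk. f n z = g n z" "AE z in lebesgue_on disk. u z = v z"
    "\<And>n. L2 (g n)" "L2 v"
  shows "sconv k g v"
proof -
  note L = L2lim_cong_AE[OF sconv_L2lim[OF assms(1)] assms(2-5)]
  show ?thesis
  proof (cases k)
    case 0
    then show ?thesis using L by simp
  next
    case (Suc j)
    have "wd b (f n) = wd b (g n)" "wd b u = wd b v" if "b \<in> Basis" for b n
      using wd_cong[OF assms(2) L2lim_L2(1)[OF sconv_L2lim[OF assms(1)]] assms(4) that]
        wd_cong[OF assms(3) L2lim_L2(2)[OF sconv_L2lim[OF assms(1)]] assms(5) that] by auto
    then show ?thesis using assms(1) L unfolding Suc by simp
  qed
qed

lemma csob_lborel: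
  assumes "csob \<rho> k v" "\<rho> < 1"
  shows "v \<in> borel_measurable borel" "\<And>z. norm z \<ge> 1 \<Longrightarrow> v z = 0" "integrable lborel (\<lambda>z. (v z)\<^sup>2)"
    "integrable lborel v" "L2 v"
proof -
  note c = csob_0[OF assms(1), unfolded csob.simps]
  show v: "v \<in> borel_measurable borel" "\<And>z. norm z \<ge> 1 \<Longrightarrow> v z = 0" and "L2 v" using c assms(2) by auto
  then show i: "integrable lborel (\<lambda>z. (v z)\<^sup>2)"
    by (subst integrable_disk_lborel[symmetric]) (auto simp: L2_def)
  show "integrable lborel v" by (rule supported_sq_integrable[OF v i])
qed

lemma mol_conv_test:
  assumes v: "csob \<rho> k v" and "\<rho> < 1" "0 < r" "r < 1 - \<rho>" "0 \<le> \<rho>"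
  shows "test_fun (conv (mol r) v)"
proof -
  note p = mol_props[of r] and l = csob_lborel[OF v assms(2)]
  have "r < 1" using assms by simp
  have "compact (cball (0::plane) (\<rho> + r))" "cball (0::plane) (\<rho> + r) \<subseteq> disk" using assms by auto
  moreover have "conv (mol r) v z = 0" if "z \<notin> cball 0 (\<rho> + r)" for z
    by (rule conv_zero_outside[of r _ \<rho>]) (use p(3) csob_0[OF v] that assms in auto)
  ultimately show ?thesis
    unfolding test_fun_def using Ck_conv[OF l(4) p(1)[OF assms(3) \<open>r < 1\<close>]] by (intro conjI allI exI[of _ "cball 0 (\<rho> + r)"]) auto
qed

text \<open>For \<open>z\<close> at distance more than \<open>r\<close> from the unit circle, \<open>y \<mapsto> mol r (z - y)\<close> is a test function;
  nearer to the circle both sides vanish because \<open>v\<close> does.\<close>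

lemma pd_mol_conv:
  assumes v: "csob \<rho> k v" "csob \<rho> j g" "weak_partial b v g" "b \<in> Basis" and r: "\<rho> < 1" "0 < r" "2 * r < 1 - \<rho>" "0 \<le> \<rho>"
  shows "pd b (conv (mol r) v) z = conv (mol r) g z"
proof -
  have r1: "r < 1" using r by simp
  note p = mol_props[OF r(2) r1] and l = csob_lborel[OF v(1) r(1)] and lg = csob_lborel[OF v(2) r(1)]
  have pd0: "pd b (mol r) y = 0" if "norm y \<ge> r" for y
  proof (cases "norm y = r")
    case True
    \<comment> \<open>off the closed disk the derivative is 0, and the circle is reached by continuity\<close>
    have "y \<noteq> 0" using True r by auto
    have "(\<lambda>n. pd b (mol r) ((1 + 1 / real (Suc n)) *\<^sub>R y)) \<longlonglongrightarrow> pd b (mol r) ((1 + 0) *\<^sub>R y)"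
      by (rule continuous_on_tendsto_compose[OF test_fun_continuous[OF test_fun_pd[OF p(1) v(4)]]])
        (intro tendsto_scaleR tendsto_add tendsto_const LIMSEQ_Suc[OF lim_1_over_n] UNIV_I always_eventually allI)+
    moreover have "pd b (mol r) ((1 + 1 / real (Suc n)) *\<^sub>R y) = 0" for n
    proof -
      have "norm ((1 + 1 / real (Suc n)) *\<^sub>R y) = (1 + 1 / real (Suc n)) * r"
        using True by (simp add: add_nonneg_nonneg)
      also have "\<dots> > r" using r by (simp add: distrib_right)
      finally have "(1 + 1 / real (Suc n)) *\<^sub>R y \<notin> cball 0 r" by simp
      from frechet_derivative_zero_outside[OF closed_cball _ this, of "mol r"] p(3)
      show ?thesis by (intro pd_unique[where f' = "\<lambda>h. 0"]) auto
    qed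
    ultimately show ?thesis by (simp add: LIMSEQ_const_iff)
  next
    case False
    then have "y \<notin> cball 0 r" using that by simp
    from frechet_derivative_zero_outside[OF closed_cball _ this, of "mol r"] p(3)
    show ?thesis by (intro pd_unique[where f' = "\<lambda>h. 0"]) auto
  qed
  have "pd b (conv (mol r) v) z = conv (pd b (mol r)) v z"
    by (rule fun_cong[OF pd_conv(1)[OF p(1) l(4) v(4)]])
  also have "\<dots> = conv (mol r) g z"
  proof (cases "norm z < 1 - r")
    case False
    have "conv (pd b (mol r)) v z = 0" "conv (mol r) g z = 0"
      using False r csob_0[OF v(1)] csob_0[OF v(2)] p(3) pd0 by (auto intro!: conv_zero_outside[of r _ \<rho>])
    then show ?thesis by simp
  next
    case True
    define \<phi> where "\<phi> y = mol r (z - y)" for y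
    have eq: "\<phi> = (\<lambda>y. 1 / (LINT y|lborel. bump r y) * flat 1 (r\<^sup>2 - (norm (z - y))\<^sup>2))"
      by (auto simp: \<phi>_def mol_def bump_def fun_eq_iff)
    have "Ck k (\<lambda>y. r\<^sup>2 - (norm (z - y))\<^sup>2)" for k
    proof -
      have "(\<lambda>y. r\<^sup>2 - (norm (z - y))\<^sup>2) = (\<lambda>y. r\<^sup>2 - ((fst z - fst y) * (fst z - fst y) + (snd z - snd y) * (snd z - snd y)))"
        by (auto simp: norm_prod_def power2_eq_square fun_eq_iff)
      then show ?thesis by (simp only:) (intro Ck_diff Ck_add Ck_mult Ck_const Ck_fst Ck_snd)
    qed
    then have "Ck k \<phi>" for k unfolding eq by (intro Ck_cmult Ck_flat)
    moreover have "compact (cball z r)" "cball z r \<subseteq> disk"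
    proof -
      show "cball z r \<subseteq> disk"
      proof
        fix y assume "y \<in> cball z r"
        then have "norm (z - y) \<le> r" by (simp add: dist_norm)
        then show "y \<in> disk" using True norm_triangle_ineq2[of y z] by (simp add: norm_minus_commute)
      qed
    qed simp
    moreover have "\<phi> y = 0" if "y \<notin> cball z r" for y
      using that unfolding \<phi>_def by (intro p(3)) (simp add: dist_norm)
    ultimately have t: "test_fun \<phi>" unfolding test_fun_def by blast
    have pd\<phi>: "pd b \<phi> = (\<lambda>y. - pd b (mol r) (z - y))"
    proof
      fix y
      have "(\<phi> has_derivative (\<lambda>h. frechet_derivative (mol r) (at (z - y)) (- h))) (at y)"
        unfolding \<phi>_def
        by (rule has_derivative_compose[OF _ has_derivative_frechet[OF test_fun_differentiable[OF p(1)]]])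
          (auto intro!: derivative_eq_intros)
      then have "pd b \<phi> y = frechet_derivative (mol r) (at (z - y)) (- b)" by (rule pd_unique)
      then show "pd b \<phi> y = - pd b (mol r) (z - y)"
        using linear_neg[OF linear_frechet_derivative[OF test_fun_differentiable[OF p(1)]]] by simp
    qed
    have "ip v (pd b \<phi>) = - ip g \<phi>" by (rule weak_partialD[OF v(3) t])
    moreover have "ip v (pd b \<phi>) = - conv (pd b (mol r)) v z"
    proof -
      have "ip v (pd b \<phi>) = (LINT y|lborel. v y * pd b \<phi> y)"
        unfolding ip_def
        using borel_measurable_times[OF l(1) borel_measurable_continuous_onI[OF test_fun_continuous[OF test_fun_pd[OF t v(4)]]]]
        by (rule LINT_disk_lborel) (simp add: l(2))
      also have "\<dots> = (LINT y|lborel. - (pd b (mol r) (z - y) * v y))"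
        by (intro Bochner_Integration.integral_cong refl) (simp add: fun_cong[OF pd\<phi>] mult.commute)
      finally show ?thesis by (simp only: conv_def Bochner_Integration.integral_minus)
    qed
    moreover have "ip g \<phi> = conv (mol r) g z"
    proof -
      have "ip g \<phi> = (LINT y|lborel. g y * \<phi> y)"
        unfolding ip_def
        using borel_measurable_times[OF lg(1) borel_measurable_continuous_onI[OF test_fun_continuous[OF t]]]
        by (rule LINT_disk_lborel) (simp add: lg(2))
      then show ?thesis by (simp add: \<phi>_def conv_def mult.commute)
    qed
    ultimately show ?thesis by simp
  qed
  finally show ?thesis .
qed

lemma csob_mol_L2lim:
  assumes r: "\<And>n. 0 < r n" "\<And>n. 2 * r n < 1 - \<rho>" "r \<longlonglongrightarrow> 0" "0 \<le> \<rho>" "\<rho> < 1" and v: "csob \<rho> k v"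
  shows "test_fun (conv (mol (r n)) v)" "L2lim (\<lambda>n. conv (mol (r n)) v) v"
proof -
  note l = csob_lborel[OF v r(5)]
  have r1: "r n < 1" "r n < 1 - \<rho>" for n using r(1,2)[of n] r(4) by linarith+
  show t: "test_fun (conv (mol (r n)) v)" for n
    by (rule mol_conv_test[OF v r(5,1) r1(2) r(4)])
  have "(\<lambda>n. LINT z|lborel. (conv (mol (r n)) v z - v z)\<^sup>2) \<longlonglongrightarrow> 0"
    by (rule conv_mol_tendsto[OF r(1) r1(1) r(3) l(1-3)])
  moreover have "ip (\<lambda>z. conv (mol (r n)) v z - v z) (\<lambda>z. conv (mol (r n)) v z - v z)
      = (LINT z|lborel. (conv (mol (r n)) v z - v z)\<^sup>2)" for n
  proof -
    have "conv (mol (r n)) v \<in> borel_measurable borel"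
      by (intro borel_measurable_continuous_onI test_fun_continuous t)
    moreover have "conv (mol (r n)) v z - v z = 0" if "norm z \<ge> 1" for z
      using l(2)[OF that] c1c_zero_outside(1)[OF c1c_test_fun[OF t] that] by simp
    ultimately show ?thesis
      unfolding ip_def power2_eq_square using l(1) by (intro LINT_disk_lborel) auto
  qed
  ultimately show "L2lim (\<lambda>n. conv (mol (r n)) v) v" using l(5) test_fun_L2[OF t] by (simp add: L2lim_def)
qed

lemma csob_sconv:
  assumes r: "\<And>n. 0 < r n" "\<And>n. 2 * r n < 1 - \<rho>" "r \<longlonglongrightarrow> 0" "0 \<le> \<rho>" "\<rho> < 1"
  shows "csob \<rho> k v \<Longrightarrow> sconv k (\<lambda>n. conv (mol (r n)) v) v"
proof (induction k arbitrary: v)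
  case (0 v)
  then show ?case using csob_mol_L2lim(2)[OF r 0] by simp
next
  case (Suc k v)
  note t = csob_mol_L2lim(1)[OF r Suc.prems]
  have "sconv k (\<lambda>n. wd b (conv (mol (r n)) v)) (wd b v)" if b: "b \<in> Basis" for b
  proof -
    obtain g where g: "weak_partial b v g" "csob \<rho> k g" using Suc.prems b by auto
    note lg = csob_lborel[OF g(2) r(5)]
    note w = wd_works[OF g(1) lg(5)]
    show ?thesis
    proof (rule sconv_cong[OF Suc.IH[OF g(2)]])
      show "AE z in lebesgue_on disk. g z = wd b v z" using w(3) by (rule eventually_mono) simp
      show "AE z in lebesgue_on disk. conv (mol (r n)) g z = wd b (conv (mol (r n)) v) z" for n
        using wd_test[OF t b, of n]
      proof (rule eventually_mono)
        fix z assume "wd b (conv (mol (r n)) v) z = pd b (conv (mol (r n)) v) z"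
        then show "conv (mol (r n)) g z = wd b (conv (mol (r n)) v) z"
          using pd_mol_conv[OF Suc.prems g(2,1) b r(5,1,2,4), of n z] by simp
      qed
      show "L2 (wd b (conv (mol (r n)) v))" for n by (rule sobolev_wd_L2[OF sobolev_test[OF t] b])
      show "L2 (wd b v)" by (rule w(1))
    qed
  qed
  then show ?case using csob_mol_L2lim(2)[OF r Suc.prems] by simp
qed

lemma test_fun_radius:
  assumes "test_fun \<zeta>"
  obtains \<rho> where "0 \<le> \<rho>" "\<rho> < 1" "\<And>z. norm z > \<rho> \<Longrightarrow> \<zeta> z = 0"
proof -
  obtain K where K: "compact K" "K \<subseteq> disk" "\<And>z. z \<notin> K \<Longrightarrow> \<zeta> z = 0"
    using test_fun_support[OF assms] by blast
  show ?thesis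
  proof (cases "K = {}")
    case True
    show ?thesis by (rule that[of 0]) (use K(3) True in auto)
  next
    case False
    have "continuous_on K norm" by (intro continuous_intros)
    from continuous_attains_sup[OF K(1) False this] obtain x where x: "x \<in> K" "\<And>y. y \<in> K \<Longrightarrow> norm y \<le> norm x"
      by blast
    have "norm x < 1" using x(1) K(2) by auto
    moreover have "\<zeta> z = 0" if "norm z > norm x" for z
    proof (rule K(3))
      show "z \<notin> K" using x(2)[of z] that by auto
    qed
    ultimately show ?thesis by (intro that[of "norm x"]) auto
  qed
qed

text \<open>A compactly supported Sobolev function is the limit of its mollifications.\<close>

lemma sobolev0_mult_test:
  assumes "sobolev k u" "test_fun \<zeta>" shows "sobolev0 k (\<lambda>z. \<zeta> z * u z)"
proof -
  obtain \<rho> where \<rho>: "0 \<le> \<rho>" "\<rho> < 1" "\<And>z. norm z > \<rho> \<Longrightarrow> \<zeta> z = 0"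
    using test_fun_radius[OF assms(2)] by blast
  obtain v where v: "csob \<rho> k v" "AE z in lebesgue_on disk. \<zeta> z * u z = v z"
    using csob_localize[OF assms \<rho>(3)] by blast
  define r where "r n = (1 - \<rho>) / 4 * (1 / real (Suc n))" for n
  have r: "0 < r n" "2 * r n < 1 - \<rho>" for n
  proof -
    show "0 < r n" using \<rho> by (simp add: r_def)
    have "r n \<le> (1 - \<rho>) / 4 * 1"
      unfolding r_def using \<rho> by (intro mult_left_mono) auto
    then show "2 * r n < 1 - \<rho>" using \<rho> by argo
  qed
  have r0: "r \<longlonglongrightarrow> 0"
    using tendsto_mult[OF tendsto_const LIMSEQ_Suc[OF lim_1_over_n], of "(1 - \<rho>) / 4"] by (simp add: r_def[abs_def])
  note t = csob_mol_L2lim(1)[OF r r0 \<rho>(1,2) v(1)]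
  have s: "sobolev k (\<lambda>z. \<zeta> z * u z)" by (intro sobolev_mult_smooth assms(1) test_fun_Ck assms(2))
  have "sconv k (\<lambda>n. conv (mol (r n)) v) (\<lambda>z. \<zeta> z * u z)"
  proof (rule sconv_cong[OF csob_sconv[OF r r0 \<rho>(1,2) v(1)]])
    show "AE z in lebesgue_on disk. v z = \<zeta> z * u z" using v(2) by (rule eventually_mono) simp
  qed (simp_all add: test_fun_L2[OF t] sobolev_L2[OF s])
  then show ?thesis unfolding sobolev0_iff using s t by (intro conjI exI[of _ "\<lambda>n. conv (mol (r n)) v"]) auto
qed

section \<open>Inequalities with weights singular at the boundary\<close>

text \<open>Equivalent to the distance to the boundary, but smooth and radial. Its powers are the weights with which functions that vanish
  on the boundary are controlled.\<close>

definition bd :: "plane \<Rightarrow> real" where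
  "bd z = 1 - (norm z)\<^sup>2"

lemma bd_pos: "norm z < 1 \<Longrightarrow> bd z > 0"
  by (simp add: bd_def norm_sq_less_1[symmetric])

lemma bd_le_1: "bd z \<le> 1"
  by (simp add: bd_def)

lemma bd_abs: "norm z < 1 \<Longrightarrow> \<bar>bd z\<bar> \<le> 1"
  using bd_pos[of z] bd_le_1[of z] by simp

lemma Ck_bd: "Ck k bd"
  unfolding bd_def[abs_def] by (intro Ck_diff Ck_const Ck_norm_sq)

lemma continuous_bd: "continuous_on A bd"
  unfolding bd_def[abs_def] by (intro continuous_intros)

lemma measurable_bd [measurable]: "bd \<in> borel_measurable (lebesgue_on disk)"
  by (intro measurable_disk_continuous continuous_bd)

lemma AE_bd: "AE z in lebesgue_on disk. bd z > 0"
  by (intro AE_diskI bd_pos)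

subsection \<open>Radial multipliers\<close>

text \<open>The divergence theorem for the vector field \<open>u\<^sup>2 m(|z|\<^sup>2) z\<close>.\<close>

lemma c1c_radial_field:
  assumes u: "c1c u G"
    and m: "\<And>t. t < 1 \<Longrightarrow> (m has_real_derivative m' t) (at t)" "continuous_on {..<1} m'"
  defines "W \<equiv> \<lambda>z. 2 * u z * (G z \<bullet> z) * m ((norm z)\<^sup>2) + (u z)\<^sup>2 * (2 * m ((norm z)\<^sup>2) + 2 * (norm z)\<^sup>2 * m' ((norm z)\<^sup>2))"
  shows "integrable (lebesgue_on disk) W" "(LINT z|lebesgue_on disk. W z) = 0"
proof -
  define f2 where "f2 z = u z * u z * m ((norm z)\<^sup>2)" for z
  define G2 where "G2 z = (u z * u z) *\<^sub>R ((2 * m' ((norm z)\<^sup>2)) *\<^sub>R z) + m ((norm z)\<^sup>2) *\<^sub>R (u z *\<^sub>R G z + u z *\<^sub>R G z)" for z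
  have c2: "c1c f2 G2" unfolding f2_def[abs_def] G2_def[abs_def] by (intro c1c_mult_radial[OF c1c_mult[OF u u] m])
  define G3 where "G3 b z = f2 z *\<^sub>R b + (z \<bullet> b) *\<^sub>R G2 z" for b z :: plane
  have c3: "c1c (\<lambda>z. f2 z * (z \<bullet> b)) (G3 b)" for b
    unfolding G3_def[abs_def]
    by (intro c1c_mult_disk[OF c2] continuous_on_const) (auto intro!: derivative_eq_intros)
  have W: "W z = G3 (1, 0) z \<bullet> (1, 0) + G3 (0, 1) z \<bullet> (0, 1)" for z
  proof -
    obtain x y where z: "z = (x, y)" by (cases z)
    have n: "(norm (x, y))\<^sup>2 = x\<^sup>2 + y\<^sup>2" by (simp add: norm_Pair)
    show ?thesis unfolding W_def G3_def G2_def f2_def z n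
      by (simp add: inner_prod_def power2_eq_square algebra_simps)
  qed
  have i: "integrable (lebesgue_on disk) (\<lambda>z. G3 b z \<bullet> b)" for b
    by (intro integrable_disk_continuous continuous_intros c1c_continuous(2)[OF c3])
  show "integrable (lebesgue_on disk) W" unfolding W[abs_def] by (intro Bochner_Integration.integrable_add i)
  show "(LINT z|lebesgue_on disk. W z) = 0"
    unfolding W using i c1c_integral_grad[OF c3] by simp
qed

definition gsq :: "(plane \<Rightarrow> plane) \<Rightarrow> real" where
  "gsq G = (LINT z|lebesgue_on disk. (norm (G z))\<^sup>2)"

lemma c1c_gsq_integrable: "c1c u G \<Longrightarrow> integrable (lebesgue_on disk) (\<lambda>z. (norm (G z))\<^sup>2)"
  by (intro integrable_disk_continuous continuous_intros c1c_continuous(2))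

text \<open>Completing the square in \<open>|\<nabla>u - u m z|\<^sup>2 \<ge> 0\<close>. If \<open>m z\<close> is the logarithmic gradient of a positive
  solution of \<open>-\<Delta>\<phi> = V\<phi>\<close>, the hypothesis on \<open>V\<close> holds with equality.\<close>

lemma c1c_barta:
  assumes u: "c1c u G"
    and m: "\<And>t. t < 1 \<Longrightarrow> (m has_real_derivative m' t) (at t)" "continuous_on {..<1} m'"
    and V: "continuous_on {..<1} V" "\<And>t. 0 \<le> t \<Longrightarrow> t < 1 \<Longrightarrow> V t \<le> - (2 * m t + 2 * t * m' t) - t * (m t)\<^sup>2"
  shows "integrable (lebesgue_on disk) (\<lambda>z. (u z)\<^sup>2 * V ((norm z)\<^sup>2))"
    "(LINT z|lebesgue_on disk. (u z)\<^sup>2 * V ((norm z)\<^sup>2)) \<le> gsq G"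
proof -
  obtain K where K: "compact K" "K \<subseteq> disk" "\<And>z. z \<notin> K \<Longrightarrow> u z = 0" "\<And>z. z \<notin> K \<Longrightarrow> G z = 0"
    using c1c_support[OF u] by blast
  have "continuous_on UNIV (\<lambda>z. (u z)\<^sup>2 * V ((norm z)\<^sup>2))"
  proof (rule continuous_on_UNIV_supported[OF _ K(1,2)])
    show "continuous_on disk (\<lambda>z. (u z)\<^sup>2 * V ((norm z)\<^sup>2))"
      by (intro continuous_intros continuous_on_compose2[OF V(1)] continuous_on_subset[OF c1c_continuous(1)[OF u]])
        (auto simp: norm_sq_less_1[symmetric])
  qed (simp add: K(3))
  then show iV: "integrable (lebesgue_on disk) (\<lambda>z. (u z)\<^sup>2 * V ((norm z)\<^sup>2))"
    by (rule integrable_disk_continuous)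
  define W where "W z = 2 * u z * (G z \<bullet> z) * m ((norm z)\<^sup>2) + (u z)\<^sup>2 * (2 * m ((norm z)\<^sup>2) + 2 * (norm z)\<^sup>2 * m' ((norm z)\<^sup>2))" for z
  have iW: "integrable (lebesgue_on disk) W" "(LINT z|lebesgue_on disk. W z) = 0"
    using c1c_radial_field[OF u m] by (simp_all add: W_def[abs_def])
  have "(LINT z|lebesgue_on disk. (u z)\<^sup>2 * V ((norm z)\<^sup>2)) = (LINT z|lebesgue_on disk. (u z)\<^sup>2 * V ((norm z)\<^sup>2) + W z)"
    using iV iW by simp
  also have "\<dots> \<le> gsq G"
    unfolding gsq_def
  proof (rule integral_mono_AE[OF Bochner_Integration.integrable_add[OF iV iW(1)] c1c_gsq_integrable[OF u]], rule AE_diskI)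
    fix z :: plane assume z: "norm z < 1"
    define t where "t = (norm z)\<^sup>2"
    have t: "0 \<le> t" "t < 1" using z by (auto simp: t_def norm_sq_less_1)
    have "0 \<le> (norm (G z - (u z * m t) *\<^sub>R z))\<^sup>2" by simp
    also have "\<dots> = (norm (G z))\<^sup>2 - 2 * u z * m t * (G z \<bullet> z) + (u z)\<^sup>2 * (m t)\<^sup>2 * t"
      unfolding t_def power2_norm_eq_inner
      by (simp add: inner_diff_left inner_diff_right inner_commute power2_eq_square algebra_simps)
    finally have 1: "2 * u z * m t * (G z \<bullet> z) - (u z)\<^sup>2 * (m t)\<^sup>2 * t \<le> (norm (G z))\<^sup>2" by simp
    have "(u z)\<^sup>2 * V t \<le> (u z)\<^sup>2 * (- (2 * m t + 2 * t * m' t) - t * (m t)\<^sup>2)"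
      using V(2)[OF t] by (intro mult_left_mono) auto
    then have "(u z)\<^sup>2 * V t + W z \<le> 2 * u z * m t * (G z \<bullet> z) - (u z)\<^sup>2 * (m t)\<^sup>2 * t"
      unfolding W_def t_def[symmetric] by (simp add: algebra_simps)
    with 1 show "(u z)\<^sup>2 * V ((norm z)\<^sup>2) + W z \<le> (norm (G z))\<^sup>2" by (simp add: t_def)
  qed
  finally show "(LINT z|lebesgue_on disk. (u z)\<^sup>2 * V ((norm z)\<^sup>2)) \<le> gsq G" .
qed

subsection \<open>Hardy's inequality and its consequences\<close>

text \<open>The choice \<open>m(t) = -1/(1 - t)\<close>, the logarithmic gradient of \<open>(1 - r\<^sup>2)\<^sup>1\<^sup>/\<^sup>2\<close>.\<close>

lemma c1c_hardy:
  assumes "c1c u G"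
  shows "integrable (lebesgue_on disk) (\<lambda>z. (u z / bd z)\<^sup>2)"
    "(LINT z|lebesgue_on disk. (u z / bd z)\<^sup>2) \<le> gsq G"
proof -
  have m: "((\<lambda>t. - 1 / (1 - t)) has_real_derivative - 1 / (1 - t)\<^sup>2) (at t)" if "t < 1" for t :: real
    using that by (auto intro!: derivative_eq_intros simp: power2_eq_square)
  have "1 / (1 - t)\<^sup>2 \<le> - (2 * (- 1 / (1 - t)) + 2 * t * (- 1 / (1 - t)\<^sup>2)) - t * (- 1 / (1 - t))\<^sup>2"
    if "0 \<le> t" "t < 1" for t :: real
  proof -
    have "- (2 * (- 1 / (1 - t)) + 2 * t * (- 1 / (1 - t)\<^sup>2)) - t * (- 1 / (1 - t))\<^sup>2 = (2 - t) / (1 - t)\<^sup>2"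
      using that by (simp add: power2_eq_square divide_simps)
    then show ?thesis using that by (simp add: divide_right_mono)
  qed
  note V = this
  have c1: "continuous_on {..<1} (\<lambda>t::real. - 1 / (1 - t)\<^sup>2)" and c2: "continuous_on {..<1} (\<lambda>t::real. 1 / (1 - t)\<^sup>2)"
    by (auto intro!: continuous_intros)
  have "integrable (lebesgue_on disk) (\<lambda>z. (u z)\<^sup>2 * (1 / (1 - (norm z)\<^sup>2)\<^sup>2))"
    "(LINT z|lebesgue_on disk. (u z)\<^sup>2 * (1 / (1 - (norm z)\<^sup>2)\<^sup>2)) \<le> gsq G"
    by (rule c1c_barta[OF assms m c1 c2 V], assumption+)+
  then show "integrable (lebesgue_on disk) (\<lambda>z. (u z / bd z)\<^sup>2)"
    "(LINT z|lebesgue_on disk. (u z / bd z)\<^sup>2) \<le> gsq G"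
    by (simp_all add: bd_def power_divide)
qed

lemma c1c_div_bd:
  assumes "c1c u G"
  shows "c1c (\<lambda>z. u z / bd z) (\<lambda>z. (2 * u z / (bd z)\<^sup>2) *\<^sub>R z + (1 / bd z) *\<^sub>R G z)"
proof -
  have m: "((\<lambda>t. 1 / (1 - t)) has_real_derivative 1 / (1 - t)\<^sup>2) (at t)" if "t < 1" for t :: real
    using that by (auto intro!: derivative_eq_intros simp: power2_eq_square)
  have "c1c (\<lambda>z. u z * (1 / (1 - (norm z)\<^sup>2)))
    (\<lambda>z. u z *\<^sub>R ((2 * (1 / (1 - (norm z)\<^sup>2)\<^sup>2)) *\<^sub>R z) + (1 / (1 - (norm z)\<^sup>2)) *\<^sub>R G z)"
    by (intro c1c_mult_radial[OF assms m]) (auto intro!: continuous_intros)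
  then show ?thesis by (simp add: bd_def mult.commute)
qed

text \<open>The inequality \<open>c1c_ladyzhenskaya\<close> applied to \<open>u\<^sup>2 / (1 - r\<^sup>2)\<close>, whose gradient is
  integrable by Hardy's inequality.\<close>

lemma c1c_L4:
  assumes u: "c1c u G"
  shows "ip (\<lambda>z. (u z)\<^sup>2 / bd z) (\<lambda>z. (u z)\<^sup>2 / bd z) \<le> 16 * (gsq G)\<^sup>2"
proof -
  define H where "H z = (2 * (u z * u z) / (bd z)\<^sup>2) *\<^sub>R z + (1 / bd z) *\<^sub>R (u z *\<^sub>R G z + u z *\<^sub>R G z)" for z
  have c: "c1c (\<lambda>z. (u z)\<^sup>2 / bd z) H"
    using c1c_div_bd[OF c1c_mult[OF u u]] by (simp add: H_def[abs_def] power2_eq_square)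
  have bound: "norm (H z) \<le> 3 * (u z / bd z)\<^sup>2 + (norm (G z))\<^sup>2" if z: "norm z < 1" for z
  proof -
    have b: "bd z > 0" using bd_pos[OF z] .
    have "norm (H z) \<le> \<bar>2 * (u z * u z) / (bd z)\<^sup>2\<bar> * norm z + \<bar>1 / bd z\<bar> * (\<bar>u z\<bar> * norm (G z) + \<bar>u z\<bar> * norm (G z))"
      unfolding H_def by (intro order.trans[OF norm_triangle_ineq] add_mono) (auto intro!: divide_right_mono order.trans[OF norm_triangle_ineq] simp: b)
    also have "\<dots> \<le> 2 * (u z / bd z)\<^sup>2 * 1 + 2 * (\<bar>u z / bd z\<bar> * norm (G z))"
    proof (rule add_mono)
      show "\<bar>2 * (u z * u z) / (bd z)\<^sup>2\<bar> * norm z \<le> 2 * (u z / bd z)\<^sup>2 * 1"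
        using b z by (intro mult_mono) (auto simp: power2_eq_square abs_mult)
      show "\<bar>1 / bd z\<bar> * (\<bar>u z\<bar> * norm (G z) + \<bar>u z\<bar> * norm (G z)) \<le> 2 * (\<bar>u z / bd z\<bar> * norm (G z))"
        using b by (simp add: abs_mult)
    qed
    also have "2 * (\<bar>u z / bd z\<bar> * norm (G z)) \<le> (u z / bd z)\<^sup>2 + (norm (G z))\<^sup>2"
      using sum_squares_bound[of "\<bar>u z / bd z\<bar>" "norm (G z)"] by (simp only: power2_abs mult.assoc)
    finally show ?thesis by simp
  qed
  note h = c1c_hardy[OF u]
  have ii: "integrable (lebesgue_on disk) (\<lambda>z. 3 * (u z / bd z)\<^sup>2 + (norm (G z))\<^sup>2)"
    using h(1) c1c_gsq_integrable[OF u] by simp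
  have le: "(LINT z|lebesgue_on disk. 3 * (u z / bd z)\<^sup>2 + (norm (G z))\<^sup>2) \<le> 4 * gsq G"
    using h c1c_gsq_integrable[OF u] by (simp add: gsq_def)
  note Hc = c1c_continuous(2)[OF c]
  have 1: "(LINT z|lebesgue_on disk. \<bar>fst (H z)\<bar>) \<le> 4 * gsq G"
  proof (rule order.trans[OF integral_mono_AE[OF _ ii] le])
    show "integrable (lebesgue_on disk) (\<lambda>z. \<bar>fst (H z)\<bar>)" by (intro integrable_disk_continuous continuous_intros Hc)
    show "AE z in lebesgue_on disk. \<bar>fst (H z)\<bar> \<le> 3 * (u z / bd z)\<^sup>2 + (norm (G z))\<^sup>2"
    proof (rule AE_diskI)
      fix z :: plane assume "norm z < 1"
      then show "\<bar>fst (H z)\<bar> \<le> 3 * (u z / bd z)\<^sup>2 + (norm (G z))\<^sup>2"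
        using bound[of z] norm_pair_ge(1)[of "fst (H z)" "snd (H z)"] by simp
    qed
  qed
  have 2: "(LINT z|lebesgue_on disk. \<bar>snd (H z)\<bar>) \<le> 4 * gsq G"
  proof (rule order.trans[OF integral_mono_AE[OF _ ii] le])
    show "integrable (lebesgue_on disk) (\<lambda>z. \<bar>snd (H z)\<bar>)" by (intro integrable_disk_continuous continuous_intros Hc)
    show "AE z in lebesgue_on disk. \<bar>snd (H z)\<bar> \<le> 3 * (u z / bd z)\<^sup>2 + (norm (G z))\<^sup>2"
    proof (rule AE_diskI)
      fix z :: plane assume "norm z < 1"
      then show "\<bar>snd (H z)\<bar> \<le> 3 * (u z / bd z)\<^sup>2 + (norm (G z))\<^sup>2"
        using bound[of z] norm_pair_ge(2)[of "snd (H z)" "fst (H z)"] by simp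
    qed
  qed
  have "ip (\<lambda>z. (u z)\<^sup>2 / bd z) (\<lambda>z. (u z)\<^sup>2 / bd z) \<le> (4 * gsq G) * (4 * gsq G)"
    by (rule order.trans[OF c1c_ladyzhenskaya[OF c] mult_mono[OF 1 2]])
      (auto simp: gsq_def intro!: Bochner_Integration.integral_nonneg)
  then show ?thesis by (simp add: power2_eq_square)
qed

text \<open>With \<open>v = u / (1 - r\<^sup>2)\<close>, expanding \<open>|\<nabla>u|\<^sup>2 / (1 - r\<^sup>2)\<^sup>2 = |\<nabla>v - 2 v z / (1 - r\<^sup>2)|\<^sup>2\<close> leaves, after an
  integration by parts of the cross term, \<open>|\<nabla>v|\<^sup>2\<close> plus a nonnegative multiple of \<open>v\<^sup>2\<close>.\<close>

lemma c1c_div_bd_gsq: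
  assumes u: "c1c u G"
  defines "H \<equiv> \<lambda>z. (2 * u z / (bd z)\<^sup>2) *\<^sub>R z + (1 / bd z) *\<^sub>R G z"
  shows "gsq H \<le> (LINT z|lebesgue_on disk. (norm (G z) / bd z)\<^sup>2)"
proof -
  define v where "v z = u z / bd z" for z
  have v: "c1c v H" using c1c_div_bd[OF u] by (simp add: v_def[abs_def] H_def)
  have m: "((\<lambda>t. 2 / (1 - t)) has_real_derivative 2 / (1 - t)\<^sup>2) (at t)" if "t < 1" for t :: real
    using that by (auto intro!: derivative_eq_intros simp: power2_eq_square)
  have c: "continuous_on {..<1} (\<lambda>t::real. 2 / (1 - t)\<^sup>2)" by (auto intro!: continuous_intros)
  define W where "W z = 2 * v z * (H z \<bullet> z) * (2 / (1 - (norm z)\<^sup>2)) + (v z)\<^sup>2 * (2 * (2 / (1 - (norm z)\<^sup>2)) + 2 * (norm z)\<^sup>2 * (2 / (1 - (norm z)\<^sup>2)\<^sup>2))" for z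
  have iW: "integrable (lebesgue_on disk) W" "(LINT z|lebesgue_on disk. W z) = 0"
    unfolding W_def[abs_def] by (rule c1c_radial_field[OF v m c], assumption)+
  obtain K where K: "compact K" "K \<subseteq> disk" "\<And>z. z \<notin> K \<Longrightarrow> u z = 0" "\<And>z. z \<notin> K \<Longrightarrow> G z = 0"
    using c1c_support[OF u] by blast
  have "continuous_on UNIV (\<lambda>z. (norm (G z) / bd z)\<^sup>2)"
  proof (rule continuous_on_UNIV_supported[OF _ K(1,2)])
    show "continuous_on disk (\<lambda>z. (norm (G z) / bd z)\<^sup>2)"
      by (intro continuous_intros continuous_bd continuous_on_subset[OF c1c_continuous(2)[OF u]]) (use bd_pos in force)+
  qed (simp add: K(4))
  then have i: "integrable (lebesgue_on disk) (\<lambda>z. (norm (G z) / bd z)\<^sup>2)" by (rule integrable_disk_continuous)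
  have "gsq H = (LINT z|lebesgue_on disk. (norm (H z))\<^sup>2 - W z)"
    using c1c_gsq_integrable[OF v] iW by (simp add: gsq_def)
  also have "\<dots> \<le> (LINT z|lebesgue_on disk. (norm (G z) / bd z)\<^sup>2)"
  proof (rule integral_mono_AE[OF Bochner_Integration.integrable_diff[OF c1c_gsq_integrable[OF v] iW(1)] i], rule AE_diskI)
    fix z :: plane assume z: "norm z < 1"
    have b: "bd z > 0" using bd_pos[OF z] .
    have "(1 / bd z) *\<^sub>R G z = H z - (2 * v z / bd z) *\<^sub>R z"
      using b by (simp add: H_def v_def power2_eq_square)
    then have "(norm (G z) / bd z)\<^sup>2 = (norm (H z - (2 * v z / bd z) *\<^sub>R z))\<^sup>2"
      using b by (metis abs_of_pos norm_scaleR divide_pos_pos zero_less_one mult_1 times_divide_eq_left)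
    also have "\<dots> = (norm (H z))\<^sup>2 - 2 * (2 * v z / bd z) * (H z \<bullet> z) + (2 * v z / bd z)\<^sup>2 * (norm z)\<^sup>2"
      unfolding power2_norm_eq_inner
      by (simp add: inner_diff_left inner_diff_right inner_commute power2_eq_square algebra_simps)
    also have "\<dots> = (norm (H z))\<^sup>2 - W z + (v z)\<^sup>2 * (4 / bd z + 8 * (norm z)\<^sup>2 / (bd z)\<^sup>2)"
      unfolding W_def bd_def[symmetric] by (simp add: power2_eq_square algebra_simps)
    finally show "(norm (H z))\<^sup>2 - W z \<le> (norm (G z) / bd z)\<^sup>2"
      using b by simp
  qed
  finally show ?thesis .
qed

subsection \<open>Sobolev functions vanishing on the boundary\<close>

text \<open>For an unbounded weight in \<open>h\<close>, convergence in \<open>L\<^sup>2\<close> does not carry over a weighted bound to the limit, but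
  Fatou's lemma does, along a subsequence that converges almost everywhere.\<close>

lemma L2_fatou:
  assumes lim: "L2lim f u" and h: "\<And>n. L2 (\<lambda>z. h z (f n z))" "\<And>n. ip (\<lambda>z. h z (f n z)) (\<lambda>z. h z (f n z)) \<le> c n"
    and c: "c \<longlonglongrightarrow> C" and cont: "\<And>z s. norm z < 1 \<Longrightarrow> isCont (h z) s"
    and meas: "(\<lambda>z. h z (u z)) \<in> borel_measurable (lebesgue_on disk)"
  shows "L2 (\<lambda>z. h z (u z))" "ip (\<lambda>z. h z (u z)) (\<lambda>z. h z (u z)) \<le> C"
proof -
  let ?M = "lebesgue_on disk"
  note l = L2lim_L2[OF lim]
  have "\<exists>r::nat\<Rightarrow>nat. strict_mono r \<and> (AE z in ?M. (\<lambda>n. (f (r n) z - u z) * (f (r n) z - u z)) \<longlonglongrightarrow> 0)"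
  proof (rule tendsto_L1_AE_subseq)
    show "integrable ?M (\<lambda>z. (f n z - u z) * (f n z - u z))" for n
      by (intro L2_integrable_mult L2_diff l)
    show "(\<lambda>n. LINT z|?M. norm ((f n z - u z) * (f n z - u z))) \<longlonglongrightarrow> 0"
      using lim by (simp add: L2lim_def ip_def)
  qed
  then obtain r :: "nat \<Rightarrow> nat" where r: "strict_mono r" "AE z in ?M. (\<lambda>n. (f (r n) z - u z) * (f (r n) z - u z)) \<longlonglongrightarrow> 0"
    by blast
  have dz: "AE z in ?M. norm z < 1" by (rule AE_diskI)
  have ae: "AE z in ?M. (\<lambda>n. (h z (f (r n) z))\<^sup>2) \<longlonglongrightarrow> (h z (u z))\<^sup>2"
    using r(2) dz
  proof eventually_elim
    case (elim z)
    have "(\<lambda>n. sqrt ((f (r n) z - u z) * (f (r n) z - u z))) \<longlonglongrightarrow> sqrt 0" using elim(1) by (rule tendsto_real_sqrt)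
    then have "(\<lambda>n. f (r n) z - u z) \<longlonglongrightarrow> 0" by (simp add: tendsto_rabs_zero_iff)
    then have "(\<lambda>n. f (r n) z) \<longlonglongrightarrow> u z" by (simp add: LIM_zero_iff)
    then show ?case using elim(2) by (intro tendsto_power isCont_tendsto_compose[OF cont])
  qed
  have int: "(\<integral>\<^sup>+z. ennreal ((h z (f n z))\<^sup>2) \<partial>?M) \<le> ennreal (c n)" for n
  proof -
    have "(\<integral>\<^sup>+z. ennreal ((h z (f n z))\<^sup>2) \<partial>?M) = ennreal (LINT z|?M. (h z (f n z))\<^sup>2)"
      using h(1)[of n] by (intro nn_integral_eq_integral) (auto simp: L2_def)
    then show ?thesis using h(2)[of n] by (simp add: ip_def power2_eq_square ennreal_leI)
  qed
  have "(\<integral>\<^sup>+z. ennreal ((h z (u z))\<^sup>2) \<partial>?M) = (\<integral>\<^sup>+z. liminf (\<lambda>n. ennreal ((h z (f (r n) z))\<^sup>2)) \<partial>?M)"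
  proof (rule nn_integral_cong_AE)
    show "AE z in ?M. ennreal ((h z (u z))\<^sup>2) = liminf (\<lambda>n. ennreal ((h z (f (r n) z))\<^sup>2))"
      using ae by (rule eventually_mono) (intro lim_imp_Liminf[symmetric] tendsto_ennrealI, auto)
  qed
  also have "\<dots> \<le> liminf (\<lambda>n. \<integral>\<^sup>+z. ennreal ((h z (f (r n) z))\<^sup>2) \<partial>?M)"
    using h(1) by (intro nn_integral_liminf) (auto simp: L2_def)
  also have "\<dots> \<le> liminf (\<lambda>n. ennreal (c (r n)))"
    by (intro Liminf_mono always_eventually allI int)
  also have "\<dots> = ennreal C"
    using LIMSEQ_subseq_LIMSEQ[OF c r(1)] by (intro lim_imp_Liminf tendsto_ennrealI) (auto simp: comp_def)
  finally have le: "(\<integral>\<^sup>+z. ennreal ((h z (u z))\<^sup>2) \<partial>?M) \<le> ennreal C" .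
  have i: "integrable ?M (\<lambda>z. (h z (u z))\<^sup>2)"
    using meas le by (intro integrableI_bounded) (auto intro: le_less_trans)
  then show "L2 (\<lambda>z. h z (u z))" using meas by (simp add: L2_def)
  have "0 \<le> c n" for n using h(2)[of n] ip_self_nonneg[of "\<lambda>z. h z (f n z)"] by linarith
  then have "0 \<le> C" using c by (intro tendsto_lowerbound[OF c]) auto
  then show "ip (\<lambda>z. h z (u z)) (\<lambda>z. h z (u z)) \<le> C"
    using le nn_integral_eq_integral[OF i] by (simp add: ip_def power2_eq_square)
qed

lemma sobolev0_add:
  assumes "sobolev0 k u" "sobolev0 k v" shows "sobolev0 k (\<lambda>z. u z + v z)"
proof -
  obtain \<phi> where \<phi>: "\<forall>n. test_fun (\<phi> n)" "(\<lambda>n::nat. sobolev_sq k (\<lambda>z. u z - \<phi> n z)) \<longlonglongrightarrow> 0"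
    using assms(1) unfolding sobolev0_def by (elim conjE exE)
  obtain \<eta> where \<eta>: "\<forall>n. test_fun (\<eta> n)" "(\<lambda>n::nat. sobolev_sq k (\<lambda>z. v z - \<eta> n z)) \<longlonglongrightarrow> 0"
    using assms(2) unfolding sobolev0_def by (elim conjE exE)
  have "(\<lambda>n. 2 * sobolev_sq k (\<lambda>z. u z - \<phi> n z) + 2 * sobolev_sq k (\<lambda>z. v z - \<eta> n z)) \<longlonglongrightarrow> 2 * 0 + 2 * 0"
    by (intro tendsto_add tendsto_mult tendsto_const \<phi> \<eta>)
  then have up: "(\<lambda>n. 2 * sobolev_sq k (\<lambda>z. u z - \<phi> n z) + 2 * sobolev_sq k (\<lambda>z. v z - \<eta> n z)) \<longlonglongrightarrow> 0"
    by (simp only: mult_zero_right add_0_left)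
  have le: "sobolev_sq k (\<lambda>z. (u z + v z) - (\<phi> n z + \<eta> n z)) \<le> 2 * sobolev_sq k (\<lambda>z. u z - \<phi> n z) + 2 * sobolev_sq k (\<lambda>z. v z - \<eta> n z)" for n
  proof -
    have "sobolev k (\<lambda>z. u z - \<phi> n z)" "sobolev k (\<lambda>z. v z - \<eta> n z)"
      by (intro sobolev_diff sobolev_test sobolev0_sobolev assms \<phi>(1)[rule_format] \<eta>(1)[rule_format])+
    from sobolev_sq_add_le[OF this] show ?thesis by (simp add: algebra_simps)
  qed
  have "(\<lambda>n. sobolev_sq k (\<lambda>z. (u z + v z) - (\<phi> n z + \<eta> n z))) \<longlonglongrightarrow> 0"
    by (rule tendsto_sandwich[OF always_eventually always_eventually tendsto_const up]) (intro allI sobolev_sq_nonneg le)+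
  then show ?thesis unfolding sobolev0_def
    using assms \<phi>(1) \<eta>(1) by (intro conjI sobolev_add sobolev0_sobolev exI[of _ "\<lambda>n z. \<phi> n z + \<eta> n z"]) (auto intro: test_fun_add)
qed

lemma sconv_test_pd:
  assumes "\<And>n. test_fun (\<phi> n)" "sconv (Suc k) \<phi> u" "sobolev (Suc k) u" "b \<in> Basis"
  shows "sconv k (\<lambda>n. pd b (\<phi> n)) (wd b u)"
proof (rule sconv_cong)
  show "sconv k (\<lambda>n. wd b (\<phi> n)) (wd b u)" using assms by simp
  show "AE z in lebesgue_on disk. wd b (\<phi> n) z = pd b (\<phi> n) z" for n by (rule wd_test[OF assms(1,4)])
  show "L2 (pd b (\<phi> n))" for n by (intro test_fun_L2 test_fun_pd assms)
  show "L2 (wd b u)" by (rule sobolev_wd_L2[OF assms(3,4)])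
qed simp

lemma sobolev0_wd:
  assumes "sobolev0 (Suc k) u" "b \<in> Basis" shows "sobolev0 k (wd b u)"
proof -
  obtain \<phi> where \<phi>: "\<forall>n. test_fun (\<phi> n)" "sconv (Suc k) \<phi> u"
    using assms(1) unfolding sobolev0_iff by (elim conjE exE)
  have "sconv k (\<lambda>n. pd b (\<phi> n)) (wd b u)"
    using \<phi> assms by (intro sconv_test_pd sobolev0_sobolev) auto
  then show ?thesis unfolding sobolev0_iff
    using \<phi>(1) assms by (intro conjI sobolev_wd sobolev0_sobolev exI[of _ "\<lambda>n. pd b (\<phi> n)"]) (auto intro: test_fun_pd)
qed

lemma sobolev0_cmult:
  assumes "sobolev0 k u" shows "sobolev0 k (\<lambda>z. c * u z)"
proof -
  have "sconv k (\<lambda>n z. c * f n z) (\<lambda>z. c * v z)" if "sconv k f v" "\<And>n. sobolev k (f n)" "sobolev k v" for f v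
    using that
  proof (induction k arbitrary: f v)
    case 0
    then show ?case by (simp add: L2lim_cmult)
  next
    case (Suc k)
    have "sconv k (\<lambda>n. wd b (\<lambda>z. c * f n z)) (wd b (\<lambda>z. c * v z))" if b: "b \<in> Basis" for b
    proof (rule sconv_cong)
      show "sconv k (\<lambda>n z. c * wd b (f n) z) (\<lambda>z. c * wd b v z)"
        using Suc.prems b by (intro Suc.IH sobolev_wd) auto
      show "AE z in lebesgue_on disk. c * wd b (f n) z = wd b (\<lambda>z. c * f n z) z" for n
        using wd_cmult[OF Suc.prems(2)[of n] b, of c] by (rule eventually_mono) simp
      show "AE z in lebesgue_on disk. c * wd b v z = wd b (\<lambda>z. c * v z) z"
        using wd_cmult[OF Suc.prems(3) b, of c] by (rule eventually_mono) simp
      show "L2 (wd b (\<lambda>z. c * f n z))" for n by (rule sobolev_wd_L2[OF sobolev_cmult[OF Suc.prems(2)] b])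
      show "L2 (wd b (\<lambda>z. c * v z))" by (rule sobolev_wd_L2[OF sobolev_cmult[OF Suc.prems(3)] b])
    qed
    then show ?case using Suc.prems(1) by (simp add: L2lim_cmult)
  qed
  note scm = this
  obtain \<phi> where \<phi>: "\<forall>n::nat. test_fun (\<phi> n)" "sconv k \<phi> u"
    using assms unfolding sobolev0_iff by (elim conjE exE)
  have "sconv k (\<lambda>n z. c * \<phi> n z) (\<lambda>z. c * u z)"
    by (rule scm[OF \<phi>(2) sobolev_test[OF \<phi>(1)[rule_format]] sobolev0_sobolev[OF assms]])
  then show ?thesis unfolding sobolev0_iff
    using \<phi>(1) assms by (intro conjI sobolev_cmult sobolev0_sobolev exI[of _ "\<lambda>n z. c * \<phi> n z"]) (simp_all add: test_fun_cmult)
qed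

lemma sobolev0_diff: "sobolev0 k u \<Longrightarrow> sobolev0 k v \<Longrightarrow> sobolev0 k (\<lambda>z. u z - v z)"
  using sobolev0_add[OF _ sobolev0_cmult[of k v "-1"], of u] by simp

lemma grad_ip_test:
  assumes "test_fun \<phi>"
  shows "grad_ip \<phi> \<phi> = gsq (grad \<phi>)"
proof -
  have "ip (wd b \<phi>) (wd b \<phi>) = ip (pd b \<phi>) (pd b \<phi>)" if "b \<in> Basis" for b
    using wd_test[OF assms that] sobolev_wd_L2[OF sobolev_test[OF assms] that] test_fun_L2[OF test_fun_pd[OF assms that]]
    by (intro ip_cong_AE) (auto intro: L2_measurable)
  moreover have "L2 (pd b \<phi>)" if "b \<in> Basis" for b by (intro test_fun_L2 test_fun_pd assms that)
  ultimately show ?thesis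
    unfolding grad_ip_def gsq_def sum_Basis_plane ip_def
    by (simp add: grad_def norm_Pair power2_eq_square L2_integrable_mult)
qed

lemma grad_ip_nonneg: "0 \<le> grad_ip u u"
  unfolding grad_ip_def by (intro sum_nonneg ip_self_nonneg)

lemma sconv_grad_ip:
  assumes "sconv (Suc k) f u" "sconv (Suc j) g v"
  shows "(\<lambda>n. grad_ip (f n) (g n)) \<longlonglongrightarrow> grad_ip u v"
  unfolding grad_ip_def using assms by (intro tendsto_sum L2lim_ip) (auto intro: sconv_L2lim)

lemma sobolev0_Suc_0E:
  assumes "sobolev0 (Suc 0) u"
  obtains \<phi> where "\<And>n::nat. test_fun (\<phi> n)" "sconv (Suc 0) \<phi> u" "L2lim \<phi> u" "(\<lambda>n. gsq (grad (\<phi> n))) \<longlonglongrightarrow> grad_ip u u"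
proof -
  obtain \<phi> where \<phi>: "\<forall>n. test_fun (\<phi> n)" "sconv (Suc 0) \<phi> u"
    using assms unfolding sobolev0_iff by (elim conjE exE)
  have "(\<lambda>n. grad_ip (\<phi> n) (\<phi> n)) \<longlonglongrightarrow> grad_ip u u" by (rule sconv_grad_ip[OF \<phi>(2) \<phi>(2)])
  then have "(\<lambda>n. gsq (grad (\<phi> n))) \<longlonglongrightarrow> grad_ip u u" using grad_ip_test \<phi>(1) by simp
  then show ?thesis using that \<phi> sconv_L2lim by blast
qed

lemma sobolev0_hardy:
  assumes "sobolev0 (Suc 0) u"
  shows "L2 (\<lambda>z. u z / bd z)" "ip (\<lambda>z. u z / bd z) (\<lambda>z. u z / bd z) \<le> grad_ip u u"
proof -
  obtain \<phi> where \<phi>: "\<And>n::nat. test_fun (\<phi> n)" "sconv (Suc 0) \<phi> u" "L2lim \<phi> u" "(\<lambda>n. gsq (grad (\<phi> n))) \<longlonglongrightarrow> grad_ip u u"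
    using sobolev0_Suc_0E[OF assms] by blast
  note h = c1c_hardy[OF c1c_test_fun[OF \<phi>(1)]]
  have "L2 (\<lambda>z. \<phi> n z / bd z)" for n
    using h(1) L2_measurable[OF test_fun_L2[OF \<phi>(1)]] by (auto simp: L2_def)
  moreover have "(\<lambda>z. u z / bd z) \<in> borel_measurable (lebesgue_on disk)"
    using L2_measurable[OF L2lim_L2(2)[OF \<phi>(3)]] by measurable
  moreover have "isCont (\<lambda>s. s / bd z) s" if "norm z < 1" for z s
    using bd_pos[OF that] by (intro continuous_intros) auto
  moreover have "ip (\<lambda>z. \<phi> n z / bd z) (\<lambda>z. \<phi> n z / bd z) \<le> gsq (grad (\<phi> n))" for n
    using h(2)[of n] by (simp add: ip_def power2_eq_square)
  ultimately show "L2 (\<lambda>z. u z / bd z)" "ip (\<lambda>z. u z / bd z) (\<lambda>z. u z / bd z) \<le> grad_ip u u"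
    using L2_fatou[OF \<phi>(3), of "\<lambda>z s. s / bd z", OF _ _ \<phi>(4)] by auto
qed

lemma sobolev0_L4:
  assumes "sobolev0 (Suc 0) u"
  shows "L2 (\<lambda>z. (u z)\<^sup>2 / bd z)" "ip (\<lambda>z. (u z)\<^sup>2 / bd z) (\<lambda>z. (u z)\<^sup>2 / bd z) \<le> 16 * (grad_ip u u)\<^sup>2"
proof -
  obtain \<phi> where \<phi>: "\<And>n::nat. test_fun (\<phi> n)" "sconv (Suc 0) \<phi> u" "L2lim \<phi> u" "(\<lambda>n. gsq (grad (\<phi> n))) \<longlonglongrightarrow> grad_ip u u"
    using sobolev0_Suc_0E[OF assms] by blast
  have A: "L2 (\<lambda>z. (\<phi> n z)\<^sup>2 / bd z)" for n
    using c1c_continuous(1)[OF c1c_div_bd[OF c1c_mult[OF c1c_test_fun[OF \<phi>(1)] c1c_test_fun[OF \<phi>(1)]]], of n n]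
    by (intro L2_continuous) (simp add: power2_eq_square)
  have B: "(\<lambda>z. (u z)\<^sup>2 / bd z) \<in> borel_measurable (lebesgue_on disk)"
    using L2_measurable[OF L2lim_L2(2)[OF \<phi>(3)]] by measurable
  have C: "isCont (\<lambda>s. s\<^sup>2 / bd z) s" if "norm z < 1" for z s
    using bd_pos[OF that] by (intro continuous_intros) auto
  have D: "(\<lambda>n. 16 * (gsq (grad (\<phi> n)))\<^sup>2) \<longlonglongrightarrow> 16 * (grad_ip u u)\<^sup>2"
    by (intro tendsto_intros \<phi>(4))
  show "L2 (\<lambda>z. (u z)\<^sup>2 / bd z)" "ip (\<lambda>z. (u z)\<^sup>2 / bd z) (\<lambda>z. (u z)\<^sup>2 / bd z) \<le> 16 * (grad_ip u u)\<^sup>2"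
    using L2_fatou[OF \<phi>(3), of "\<lambda>z s. s\<^sup>2 / bd z", OF A c1c_L4[OF c1c_test_fun[OF \<phi>(1)]] D C B] by auto
qed

text \<open>The square of the \<open>L\<^sup>2\<close> norm of the Hessian; for \<open>u\<close> in \<open>H\<^sub>0\<^sup>2\<close> it is that of the Laplacian (\<open>hsq_eq_lap\<close>).\<close>

definition hsq :: "(plane \<Rightarrow> real) \<Rightarrow> real" where
  "hsq u = (\<Sum>b\<in>Basis. grad_ip (wd b u) (wd b u))"

lemma test_div_bd_gsq:
  assumes "test_fun \<phi>"
  shows "gsq (\<lambda>z. (2 * \<phi> z / (bd z)\<^sup>2) *\<^sub>R z + (1 / bd z) *\<^sub>R grad \<phi> z) \<le> hsq \<phi>"
proof -
  have t: "test_fun (pd b \<phi>)" if "b \<in> Basis" for b by (rule test_fun_pd[OF assms that])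
  have h: "integrable (lebesgue_on disk) (\<lambda>z. (pd b \<phi> z / bd z)\<^sup>2)"
    "(LINT z|lebesgue_on disk. (pd b \<phi> z / bd z)\<^sup>2) \<le> grad_ip (wd b \<phi>) (wd b \<phi>)" if "b \<in> Basis" for b
  proof -
    show "integrable (lebesgue_on disk) (\<lambda>z. (pd b \<phi> z / bd z)\<^sup>2)" by (rule c1c_hardy(1)[OF c1c_test_fun[OF t[OF that]]])
    have "wd c (wd b \<phi>) = wd c (pd b \<phi>)" if "c \<in> Basis" for c
      using wd_test[OF assms \<open>b \<in> Basis\<close>] sobolev_wd_L2[OF sobolev_test[OF assms] \<open>b \<in> Basis\<close>] test_fun_L2[OF t[OF \<open>b \<in> Basis\<close>]] that
      by (intro wd_cong)
    then have "grad_ip (wd b \<phi>) (wd b \<phi>) = grad_ip (pd b \<phi>) (pd b \<phi>)" by (simp add: grad_ip_def)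
    then show "(LINT z|lebesgue_on disk. (pd b \<phi> z / bd z)\<^sup>2) \<le> grad_ip (wd b \<phi>) (wd b \<phi>)"
      using c1c_hardy(2)[OF c1c_test_fun[OF t[OF that]]] grad_ip_test[OF t[OF that]] by simp
  qed
  have "(norm (grad \<phi> z) / bd z)\<^sup>2 = (pd (1,0) \<phi> z / bd z)\<^sup>2 + (pd (0,1) \<phi> z / bd z)\<^sup>2" for z
    by (simp add: grad_def norm_Pair power_divide add_divide_distrib)
  then have "(LINT z|lebesgue_on disk. (norm (grad \<phi> z) / bd z)\<^sup>2) \<le> hsq \<phi>"
    using h[of "(1, 0)"] h[of "(0, 1)"] by (simp add: hsq_def sum_Basis_plane)
  with c1c_div_bd_gsq[OF c1c_test_fun[OF assms]] show ?thesis by linarith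
qed

text \<open>The weights are those of \<open>u / (1 - r\<^sup>2) \<in> H\<^sub>0\<^sup>1\<close>: by \<open>c1c_div_bd_gsq\<close> and Hardy's inequality for the
  derivatives of \<open>u\<close>, its gradient is bounded by the Hessian of \<open>u\<close>, and Hardy's inequality and \<open>c1c_L4\<close> apply once more.\<close>

lemma sobolev0_H2_weights:
  assumes "sobolev0 (Suc (Suc 0)) u"
  shows "L2 (\<lambda>z. u z / (bd z)\<^sup>2)" "ip (\<lambda>z. u z / (bd z)\<^sup>2) (\<lambda>z. u z / (bd z)\<^sup>2) \<le> hsq u"
    and "L2 (\<lambda>z. (u z)\<^sup>2 / (bd z) ^ 3)" "ip (\<lambda>z. (u z)\<^sup>2 / (bd z) ^ 3) (\<lambda>z. (u z)\<^sup>2 / (bd z) ^ 3) \<le> 16 * (hsq u)\<^sup>2"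
proof -
  obtain \<phi> where \<phi>: "\<forall>n::nat. test_fun (\<phi> n)" "sconv (Suc (Suc 0)) \<phi> u"
    using assms unfolding sobolev0_iff by (elim conjE exE)
  have lim: "L2lim \<phi> u" by (rule sconv_L2lim[OF \<phi>(2)])
  have "(\<lambda>n. hsq (\<phi> n)) \<longlonglongrightarrow> hsq u"
    unfolding hsq_def using \<phi>(2) by (intro tendsto_sum sconv_grad_ip[where k = 0 and j = 0]) auto
  note hl = this
  have t: "test_fun (\<phi> n)" for n using \<phi>(1) by simp
  define H where "H n z = (2 * \<phi> n z / (bd z)\<^sup>2) *\<^sub>R z + (1 / bd z) *\<^sub>R grad (\<phi> n) z" for n z
  have c: "c1c (\<lambda>z. \<phi> n z / bd z) (H n)" for n unfolding H_def[abs_def] by (rule c1c_div_bd[OF c1c_test_fun[OF t]])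
  have g: "gsq (H n) \<le> hsq (\<phi> n)" for n unfolding H_def[abs_def] by (rule test_div_bd_gsq[OF t])
  have g0: "0 \<le> gsq (H n)" for n unfolding gsq_def by simp
  have m: "u \<in> borel_measurable (lebesgue_on disk)" by (rule L2_measurable[OF L2lim_L2(2)[OF lim]])
  have e1: "\<phi> n z / bd z / bd z = \<phi> n z / (bd z)\<^sup>2" and e2: "(\<phi> n z / bd z)\<^sup>2 / bd z = (\<phi> n z)\<^sup>2 / (bd z) ^ 3" for n z
    by (simp_all add: power2_eq_square power3_eq_cube)
  have l1: "L2 (\<lambda>z. \<phi> n z / (bd z)\<^sup>2)" for n
    using L2_continuous[OF c1c_continuous(1)[OF c1c_div_bd[OF c]], of n] by (simp only: e1)
  have i1: "ip (\<lambda>z. \<phi> n z / (bd z)\<^sup>2) (\<lambda>z. \<phi> n z / (bd z)\<^sup>2) \<le> hsq (\<phi> n)" for n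
    using c1c_hardy(2)[OF c, of n] g[of n] unfolding e1 by (simp add: ip_def power2_eq_square)
  have l2: "L2 (\<lambda>z. (\<phi> n z)\<^sup>2 / (bd z) ^ 3)" for n
    using L2_continuous[OF c1c_continuous(1)[OF c1c_div_bd[OF c1c_mult[OF c c]]], of n n]
    unfolding power2_eq_square[symmetric] by (simp only: e2)
  have i2: "ip (\<lambda>z. (\<phi> n z)\<^sup>2 / (bd z) ^ 3) (\<lambda>z. (\<phi> n z)\<^sup>2 / (bd z) ^ 3) \<le> 16 * (hsq (\<phi> n))\<^sup>2" for n
  proof -
    have "(gsq (H n))\<^sup>2 \<le> (hsq (\<phi> n))\<^sup>2" using g g0 by (intro power_mono)
    then show ?thesis using c1c_L4[OF c, of n] unfolding e2 by linarith
  qed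
  have hl2: "(\<lambda>n. 16 * (hsq (\<phi> n))\<^sup>2) \<longlonglongrightarrow> 16 * (hsq u)\<^sup>2" by (intro tendsto_intros hl)
  have ic: "isCont (\<lambda>s. s / (bd z)\<^sup>2) s" "isCont (\<lambda>s. s\<^sup>2 / (bd z) ^ 3) s" if "norm z < 1" for z s
    using bd_pos[OF that] by (intro continuous_intros; simp)+
  have mm: "(\<lambda>z. u z / (bd z)\<^sup>2) \<in> borel_measurable (lebesgue_on disk)" "(\<lambda>z. (u z)\<^sup>2 / (bd z) ^ 3) \<in> borel_measurable (lebesgue_on disk)"
    using m by measurable
  show "L2 (\<lambda>z. u z / (bd z)\<^sup>2)" "ip (\<lambda>z. u z / (bd z)\<^sup>2) (\<lambda>z. u z / (bd z)\<^sup>2) \<le> hsq u"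
    using L2_fatou[OF lim, of "\<lambda>z s. s / (bd z)\<^sup>2", OF l1 i1 hl ic(1) mm(1)] by auto
  show "L2 (\<lambda>z. (u z)\<^sup>2 / (bd z) ^ 3)" "ip (\<lambda>z. (u z)\<^sup>2 / (bd z) ^ 3) (\<lambda>z. (u z)\<^sup>2 / (bd z) ^ 3) \<le> 16 * (hsq u)\<^sup>2"
    using L2_fatou[OF lim, of "\<lambda>z s. s\<^sup>2 / (bd z) ^ 3", OF l2 i2 hl2 ic(2) mm(2)] by auto
qed

section \<open>Cutting off near the boundary\<close>

abbreviation cutn :: "nat \<Rightarrow> plane \<Rightarrow> real" where
  "cutn n \<equiv> cut (1 / real (Suc n))"

lemma test_fun_cutn: "test_fun (cutn n)"
  by (intro test_fun_cut) simp

lemma power4_exp_le: "(1 + s) ^ 4 * exp (- s) \<le> (256::real)" if "s \<ge> 0"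
proof -
  have "1 + s \<le> 4 * exp (s / 4)" using exp_ge_add_one_self[of "s / 4"] that by argo
  then have "(1 + s) ^ 4 \<le> (4 * exp (s / 4)) ^ 4" using that by (intro power_mono) auto
  also have "\<dots> = 256 * exp s" by (simp add: power_mult_distrib exp_of_nat_mult[symmetric])
  finally have "(1 + s) ^ 4 * exp (- s) \<le> 256 * exp s * exp (- s)" by (intro mult_right_mono) auto
  then show ?thesis by (simp add: mult.assoc exp_minus_inverse)
qed

lemma poly_exp_le:
  assumes "s \<ge> 0" "p \<le> k * (1 + s) ^ 4" "k \<ge> 0" shows "p * exp (- s) \<le> k * (256::real)"
proof -
  have "p * exp (- s) \<le> k * ((1 + s) ^ 4 * exp (- s))"
    using mult_right_mono[OF assms(2), of "exp (- s)"] by (simp add: mult.assoc)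
  also have "\<dots> \<le> k * 256" using power4_exp_le[OF assms(1)] assms(3) by (intro mult_left_mono)
  finally show ?thesis .
qed

lemma pd_radial_mult_inner:
  assumes "(m has_real_derivative m') (at ((norm z)\<^sup>2))"
  shows "pd c (\<lambda>z. m ((norm z)\<^sup>2) * (z \<bullet> b)) z = m ((norm z)\<^sup>2) * (c \<bullet> b) + 2 * m' * (z \<bullet> c) * (z \<bullet> b)"
proof -
  have "((\<lambda>z. m ((norm z)\<^sup>2) * (z \<bullet> b)) has_derivative
      (\<lambda>h. m ((norm z)\<^sup>2) * (h \<bullet> b) + (h \<bullet> ((2 * m') *\<^sub>R z)) * (z \<bullet> b))) (at z)"
    by (intro has_derivative_mult has_derivative_radial assms) (auto intro!: derivative_eq_intros)
  from pd_unique[OF this] show ?thesis by (simp add: inner_commute)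
qed

lemma flat_affine_deriv:
  assumes "a > 0"
  shows "((\<lambda>t. flat p ((1 - a - t) / a) * k) has_real_derivative
    flat ([:0, 0, 1:] * (p - pderiv p)) ((1 - a - t) / a) * (- 1 / a) * k) (at t)"
  using assms by (auto intro!: derivative_eq_intros DERIV_chain2[OF flat_has_derivative])

lemma pd_cut:
  assumes "a > 0"
  shows "pd b (cut a) z = flat [:0, 0, 1:] ((1 - a - (norm z)\<^sup>2) / a) * (- 2 / a) * (z \<bullet> b)"
proof -
  have "[:0, 0, 1:] * (1 - pderiv 1) = ([:0, 0, 1:] :: real poly)" by simp
  with flat_affine_deriv[OF assms, of 1 1 "(norm z)\<^sup>2"]
  have "((\<lambda>z. flat 1 ((1 - a - (norm z)\<^sup>2) / a)) has_derivative
      (\<lambda>h. h \<bullet> ((2 * (flat [:0, 0, 1:] ((1 - a - (norm z)\<^sup>2) / a) * (- 1 / a))) *\<^sub>R z))) (at z)"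
    by (intro has_derivative_radial[where m = "\<lambda>t. flat 1 ((1 - a - t) / a)"]) simp
  from pd_unique[OF this] show ?thesis by (simp add: cut_def[abs_def] inner_commute)
qed

lemma pd_pd_cut:
  assumes "a > 0"
  shows "pd c (pd b (cut a)) z = flat [:0, 0, 1:] ((1 - a - (norm z)\<^sup>2) / a) * (- 2 / a) * (c \<bullet> b) +
    4 / a\<^sup>2 * flat [:0, 0, 0, -2, 1:] ((1 - a - (norm z)\<^sup>2) / a) * (z \<bullet> c) * (z \<bullet> b)"
proof -
  have q: "[:0, 0, 1:] * ([:0, 0, 1:] - pderiv [:0, 0, 1:]) = ([:0, 0, 0, -2, 1:] :: real poly)"
    by (simp add: pderiv_pCons)
  have eq: "pd b (cut a) = (\<lambda>z. flat [:0, 0, 1:] ((1 - a - (norm z)\<^sup>2) / a) * (- 2 / a) * (z \<bullet> b))"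
    using pd_cut[OF assms] by (rule ext)
  have "pd c (pd b (cut a)) z = flat [:0, 0, 1:] ((1 - a - (norm z)\<^sup>2) / a) * (- 2 / a) * (c \<bullet> b) +
    2 * (flat [:0, 0, 0, -2, 1:] ((1 - a - (norm z)\<^sup>2) / a) * (- 1 / a) * (- 2 / a)) * (z \<bullet> c) * (z \<bullet> b)"
    unfolding eq by (rule pd_radial_mult_inner[OF flat_affine_deriv[OF assms, of "[:0, 0, 1:]" "- 2 / a", unfolded q]])
  then show ?thesis by (simp add: power2_eq_square)
qed

text \<open>With \<open>s = a / (1 - r\<^sup>2 - a)\<close> every quantity below is a polynomial in \<open>s\<close> of degree at most 4 times
  \<open>exp (-s)\<close>, up to a power of \<open>a\<close>.\<close>

lemma cut_bounds_aux:
  assumes a: "0 < a" "a \<le> 1" and z: "norm z < 1"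
  defines "\<sigma> \<equiv> (1 - a - (norm z)\<^sup>2) / a"
  shows "\<bar>flat [:0, 0, 1:] \<sigma>\<bar> * (2 / a) * bd z \<le> 512"
    "\<bar>flat [:0, 0, 1:] \<sigma>\<bar> * (2 / a) * (bd z)\<^sup>2 \<le> 512 * a"
    "4 / a\<^sup>2 * \<bar>flat [:0, 0, 0, -2, 1:] \<sigma>\<bar> * (bd z)\<^sup>2 \<le> 2048"
    "4 / a\<^sup>2 * \<bar>flat [:0, 0, 0, -2, 1:] \<sigma>\<bar> * (bd z) ^ 3 \<le> 2048 * a"
proof -
  have "\<bar>flat [:0, 0, 1:] \<sigma>\<bar> * (2 / a) * bd z \<le> 512 \<and>
    \<bar>flat [:0, 0, 1:] \<sigma>\<bar> * (2 / a) * (bd z)\<^sup>2 \<le> 512 * a \<and>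
    4 / a\<^sup>2 * \<bar>flat [:0, 0, 0, -2, 1:] \<sigma>\<bar> * (bd z)\<^sup>2 \<le> 2048 \<and>
    4 / a\<^sup>2 * \<bar>flat [:0, 0, 0, -2, 1:] \<sigma>\<bar> * (bd z) ^ 3 \<le> 2048 * a"
  proof (cases "\<sigma> > 0")
    case False
    then show ?thesis using a by (simp add: flat_def)
  next
    case True
    define s where "s = 1 / \<sigma>"
    have s: "s > 0" using True by (simp add: s_def)
    have d: "bd z = a * (s + 1) / s"
    proof -
      have "bd z = a * \<sigma> + a" using a by (simp add: \<sigma>_def bd_def)
      also have "\<dots> = a * (s + 1) / s" using True by (simp add: s_def field_simps)
      finally show ?thesis .
    qed
    have f1: "\<bar>flat [:0, 0, 1:] \<sigma>\<bar> = s\<^sup>2 * exp (- s)"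
      using True by (simp add: flat_def s_def[symmetric] power2_eq_square)
    have f2: "\<bar>flat [:0, 0, 0, -2, 1:] \<sigma>\<bar> = s ^ 3 * \<bar>s - 2\<bar> * exp (- s)"
    proof -
      have "flat [:0, 0, 0, -2, 1:] \<sigma> = s ^ 3 * (s - 2) * exp (- s)"
        using True by (simp add: flat_def s_def[symmetric] power3_eq_cube algebra_simps)
      then show ?thesis using s by (simp add: abs_mult)
    qed
    have p: "(1 + s) ^ n \<le> (1 + s) ^ 4" if "n \<le> 4" for n using s that by (intro power_increasing) auto
    have b1: "s * (s + 1) * exp (- s) \<le> 1 * 256"
    proof (rule poly_exp_le)
      have "s * (s + 1) \<le> (1 + s) ^ 2" using s by (simp add: power2_eq_square algebra_simps)
      with p[of 2] show "s * (s + 1) \<le> 1 * (1 + s) ^ 4" by simp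
    qed (use s in auto)
    have b2: "(s + 1)\<^sup>2 * exp (- s) \<le> 1 * 256"
      by (rule poly_exp_le) (use s p[of 2] in \<open>auto simp: add.commute\<close>)
    have ab: "\<bar>s - 2\<bar> \<le> 2 * (1 + s)" using s by (simp add: abs_if)
    have b3: "s * \<bar>s - 2\<bar> * (s + 1)\<^sup>2 * exp (- s) \<le> 2 * 256"
    proof (rule poly_exp_le)
      have "s * \<bar>s - 2\<bar> * (s + 1)\<^sup>2 \<le> (1 + s) * (2 * (1 + s)) * (1 + s)\<^sup>2"
        using s ab by (intro mult_mono) (auto simp: add.commute)
      then show "s * \<bar>s - 2\<bar> * (s + 1)\<^sup>2 \<le> 2 * (1 + s) ^ 4" by (simp add: power2_eq_square power4_eq_xxxx mult_ac)
    qed (use s in auto)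
    have b4: "\<bar>s - 2\<bar> * (s + 1) ^ 3 * exp (- s) \<le> 2 * 256"
    proof (rule poly_exp_le)
      have "\<bar>s - 2\<bar> * (s + 1) ^ 3 \<le> (2 * (1 + s)) * (1 + s) ^ 3"
        using s ab by (intro mult_mono) (auto simp: add.commute)
      then show "\<bar>s - 2\<bar> * (s + 1) ^ 3 \<le> 2 * (1 + s) ^ 4" by (simp add: power3_eq_cube power4_eq_xxxx mult_ac)
    qed (use s in auto)
    have e1: "\<bar>flat [:0, 0, 1:] \<sigma>\<bar> * (2 / a) * bd z = 2 * (s * (s + 1) * exp (- s))"
      unfolding f1 d using s a by (simp add: power2_eq_square field_simps)
    have e2: "\<bar>flat [:0, 0, 1:] \<sigma>\<bar> * (2 / a) * (bd z)\<^sup>2 = 2 * a * ((s + 1)\<^sup>2 * exp (- s))"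
      unfolding f1 d using s a by (simp add: power2_eq_square field_simps)
    have e3: "4 / a\<^sup>2 * \<bar>flat [:0, 0, 0, -2, 1:] \<sigma>\<bar> * (bd z)\<^sup>2 = 4 * (s * \<bar>s - 2\<bar> * (s + 1)\<^sup>2 * exp (- s))"
      unfolding f2 d using s a by (simp add: power2_eq_square power3_eq_cube field_simps)
    have e4: "4 / a\<^sup>2 * \<bar>flat [:0, 0, 0, -2, 1:] \<sigma>\<bar> * (bd z) ^ 3 = 4 * a * (\<bar>s - 2\<bar> * (s + 1) ^ 3 * exp (- s))"
      unfolding f2 d using s a by (simp add: power2_eq_square power3_eq_cube field_simps)
    have "2 * a * ((s + 1)\<^sup>2 * exp (- s)) \<le> 2 * a * 256" using b2 a by (intro mult_left_mono) auto
    moreover have "4 * a * (\<bar>s - 2\<bar> * (s + 1) ^ 3 * exp (- s)) \<le> 4 * a * 512" using b4 a by (intro mult_left_mono) auto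
    ultimately show ?thesis unfolding e1 e2 e3 e4 using b1 b3 by (intro conjI) linarith+
  qed
  then show "\<bar>flat [:0, 0, 1:] \<sigma>\<bar> * (2 / a) * bd z \<le> 512"
    "\<bar>flat [:0, 0, 1:] \<sigma>\<bar> * (2 / a) * (bd z)\<^sup>2 \<le> 512 * a"
    "4 / a\<^sup>2 * \<bar>flat [:0, 0, 0, -2, 1:] \<sigma>\<bar> * (bd z)\<^sup>2 \<le> 2048"
    "4 / a\<^sup>2 * \<bar>flat [:0, 0, 0, -2, 1:] \<sigma>\<bar> * (bd z) ^ 3 \<le> 2048 * a" by auto
qed

lemma inner_Basis_le: "norm z < 1 \<Longrightarrow> b \<in> Basis \<Longrightarrow> \<bar>z \<bullet> b\<bar> \<le> (1::real)"
  using Basis_le_norm[of b z] by simp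

lemma Basis_inner_le: "b \<in> Basis \<Longrightarrow> c \<in> Basis \<Longrightarrow> \<bar>b \<bullet> c\<bar> \<le> (1::real)"
  by (simp add: inner_Basis)

text \<open>The first bound, uniform in \<open>a\<close>, provides a dominating function and the second, with one more power of the weight,
  the pointwise convergence to 0.\<close>

lemma pd_cut_bounds:
  assumes a: "0 < a" "a \<le> 1" and z: "norm z < 1" and b: "b \<in> Basis"
  shows "\<bar>pd b (cut a) z\<bar> * bd z \<le> 512" "\<bar>pd b (cut a) z\<bar> * (bd z)\<^sup>2 \<le> 512 * a"
proof -
  let ?F = "\<bar>flat [:0, 0, 1:] ((1 - a - (norm z)\<^sup>2) / a)\<bar> * (2 / a)"
  have "\<bar>pd b (cut a) z\<bar> = ?F * \<bar>z \<bullet> b\<bar>"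
    using a by (simp add: pd_cut[OF a(1)] abs_mult)
  also have "\<dots> \<le> ?F * 1" using inner_Basis_le[OF z b] a by (intro mult_left_mono) auto
  finally have le: "\<bar>pd b (cut a) z\<bar> \<le> ?F" by simp
  have "\<bar>pd b (cut a) z\<bar> * bd z \<le> ?F * bd z" "\<bar>pd b (cut a) z\<bar> * (bd z)\<^sup>2 \<le> ?F * (bd z)\<^sup>2"
    using le bd_pos[OF z] by (intro mult_right_mono; simp)+
  then show "\<bar>pd b (cut a) z\<bar> * bd z \<le> 512" "\<bar>pd b (cut a) z\<bar> * (bd z)\<^sup>2 \<le> 512 * a"
    using cut_bounds_aux(1,2)[OF a z] by linarith+
qed

lemma pd_pd_cut_bounds:
  assumes a: "0 < a" "a \<le> 1" and z: "norm z < 1" and b: "b \<in> Basis" "c \<in> Basis"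
  shows "\<bar>pd c (pd b (cut a)) z\<bar> * (bd z)\<^sup>2 \<le> 2560" "\<bar>pd c (pd b (cut a)) z\<bar> * (bd z) ^ 3 \<le> 2560 * a"
proof -
  let ?F = "\<bar>flat [:0, 0, 1:] ((1 - a - (norm z)\<^sup>2) / a)\<bar> * (2 / a)"
  let ?H = "4 / a\<^sup>2 * \<bar>flat [:0, 0, 0, -2, 1:] ((1 - a - (norm z)\<^sup>2) / a)\<bar>"
  note d = bd_pos[OF z] bd_le_1[of z]
  have 1: "?F * \<bar>c \<bullet> b\<bar> \<le> ?F * 1" using Basis_inner_le[OF b(2,1)] a by (intro mult_left_mono) auto
  have 2: "?H * (\<bar>z \<bullet> c\<bar> * \<bar>z \<bullet> b\<bar>) \<le> ?H * (1 * 1)"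
    using inner_Basis_le[OF z b(1)] inner_Basis_le[OF z b(2)] a by (intro mult_left_mono mult_mono) auto
  have "\<bar>pd c (pd b (cut a)) z\<bar> \<le> ?F * \<bar>c \<bullet> b\<bar> + ?H * (\<bar>z \<bullet> c\<bar> * \<bar>z \<bullet> b\<bar>)"
    unfolding pd_pd_cut[OF a(1)]
    by (rule order.trans[OF abs_triangle_ineq]) (use a in \<open>simp add: abs_mult mult.assoc\<close>)
  with 1 2 have le: "\<bar>pd c (pd b (cut a)) z\<bar> \<le> ?F + ?H" by simp
  have "\<bar>pd c (pd b (cut a)) z\<bar> * (bd z)\<^sup>2 \<le> (?F + ?H) * (bd z)\<^sup>2" using le by (intro mult_right_mono) auto
  moreover have "512 * a \<le> 512" using a by simp
  ultimately show "\<bar>pd c (pd b (cut a)) z\<bar> * (bd z)\<^sup>2 \<le> 2560"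
    using cut_bounds_aux(2,3)[OF a z] by (simp add: distrib_right)
  have "\<bar>pd c (pd b (cut a)) z\<bar> * (bd z) ^ 3 \<le> (?F + ?H) * (bd z) ^ 3" using le d by (intro mult_right_mono) auto
  also have "\<dots> = ?F * (bd z)\<^sup>2 * bd z + ?H * (bd z) ^ 3" by (simp add: distrib_right power2_eq_square power3_eq_cube)
  also have "?F * (bd z)\<^sup>2 * bd z \<le> 512 * a * 1"
    by (rule mult_mono[OF cut_bounds_aux(2)[OF a z] d(2)]) (use d a in auto)
  finally show "\<bar>pd c (pd b (cut a)) z\<bar> * (bd z) ^ 3 \<le> 2560 * a"
    using cut_bounds_aux(4)[OF a z] by linarith
qed

lemma L2lim_cut:
  assumes "L2 u" shows "L2lim (\<lambda>n z. cutn n z * u z) u"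
proof (rule L2lim_dominated[OF _ L2_measurable[OF assms] assms])
  show "(\<lambda>z. cutn n z * u z) \<in> borel_measurable (lebesgue_on disk)" for n
    by (intro borel_measurable_times L2_measurable assms test_fun_L2 test_fun_cutn)
  show "AE z in lebesgue_on disk. \<bar>cutn n z * u z\<bar> \<le> \<bar>u z\<bar>" for n
    using cut_bounds by (intro AE_I2) (auto simp: abs_mult intro!: mult_left_le_one_le)
  show "AE z in lebesgue_on disk. (\<lambda>n. cutn n z * u z) \<longlonglongrightarrow> u z"
  proof (rule AE_diskI)
    fix z :: plane assume "norm z < 1"
    from tendsto_mult[OF cut_tendsto_1[OF this] tendsto_const, of "u z"] show "(\<lambda>n. cutn n z * u z) \<longlonglongrightarrow> u z" by simp
  qed
qed

lemma tendsto_0_weighted: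
  fixes f :: "nat \<Rightarrow> real"
  assumes "\<And>n. \<bar>f n\<bar> * w \<le> C * (1 / real (Suc n))" "w > 0" shows "f \<longlonglongrightarrow> 0"
proof (rule Lim_null_comparison)
  show "\<forall>\<^sub>F n in sequentially. norm (f n) \<le> C / w * (1 / real (Suc n))"
  proof (intro always_eventually allI)
    fix n
    have "\<bar>f n\<bar> \<le> C * (1 / real (Suc n)) / w" using assms by (simp only: pos_le_divide_eq)
    then show "norm (f n) \<le> C / w * (1 / real (Suc n))" by (simp only: real_norm_def times_divide_eq_left)
  qed
  have "(\<lambda>n. C / w * (1 / real (Suc n))) \<longlonglongrightarrow> C / w * 0"
    by (intro tendsto_mult tendsto_const LIMSEQ_Suc[OF lim_1_over_n])
  then show "(\<lambda>n. C / w * (1 / real (Suc n))) \<longlonglongrightarrow> 0" by simp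
qed

lemma pd_cutn_tendsto_0: "norm z < 1 \<Longrightarrow> b \<in> Basis \<Longrightarrow> (\<lambda>n. pd b (cutn n) z) \<longlonglongrightarrow> 0"
  using pd_cut_bounds(2)[of "1 / real (Suc n)" z b for n] bd_pos[of z]
  by (intro tendsto_0_weighted[where w = "(bd z)\<^sup>2" and C = 512]) auto

lemma pd_pd_cutn_tendsto_0: "norm z < 1 \<Longrightarrow> b \<in> Basis \<Longrightarrow> c \<in> Basis \<Longrightarrow> (\<lambda>n. pd c (pd b (cutn n)) z) \<longlonglongrightarrow> 0"
  using pd_pd_cut_bounds(2)[of "1 / real (Suc n)" z b c for n] bd_pos[of z]
  by (intro tendsto_0_weighted[where w = "(bd z) ^ 3" and C = 2560]) auto

text \<open>A derivative of the cut-off costs one power of the weight.\<close>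

lemma L2lim_pd_cut:
  assumes u: "u \<in> borel_measurable (lebesgue_on disk)" "L2 (\<lambda>z. u z / bd z)" and b: "b \<in> Basis"
  shows "L2lim (\<lambda>n z. pd b (cutn n) z * u z) (\<lambda>z. 0)"
proof (rule L2lim_dominated[OF _ _ L2_cmult[OF u(2), of 512]])
  show "(\<lambda>z. pd b (cutn n) z * u z) \<in> borel_measurable (lebesgue_on disk)" for n
    by (intro borel_measurable_times u(1) L2_measurable test_fun_L2 test_fun_pd test_fun_cutn b)
  show "AE z in lebesgue_on disk. \<bar>pd b (cutn n) z * u z\<bar> \<le> \<bar>512 * (u z / bd z)\<bar>" for n
  proof (rule AE_diskI)
    fix z :: plane assume z: "norm z < 1"
    have "\<bar>pd b (cutn n) z\<bar> \<le> 512 / bd z"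
      using pd_cut_bounds(1)[OF _ _ z b, of "1 / real (Suc n)"] bd_pos[OF z] by (simp add: pos_le_divide_eq)
    then have "\<bar>pd b (cutn n) z\<bar> * \<bar>u z\<bar> \<le> 512 / bd z * \<bar>u z\<bar>" by (intro mult_right_mono) auto
    then show "\<bar>pd b (cutn n) z * u z\<bar> \<le> \<bar>512 * (u z / bd z)\<bar>" using bd_pos[OF z] by (simp add: abs_mult)
  qed
  show "AE z in lebesgue_on disk. (\<lambda>n. pd b (cutn n) z * u z) \<longlonglongrightarrow> 0"
    using b by (intro AE_diskI tendsto_mult_left_zero pd_cutn_tendsto_0)
qed simp

text \<open>Two derivatives of the cut-off cost two powers of the weight.\<close>

lemma L2lim_pd_pd_cut:
  assumes u: "u \<in> borel_measurable (lebesgue_on disk)" "L2 (\<lambda>z. u z / (bd z)\<^sup>2)" and b: "b \<in> Basis" "c \<in> Basis"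
  shows "L2lim (\<lambda>n z. pd c (pd b (cutn n)) z * u z) (\<lambda>z. 0)"
proof (rule L2lim_dominated[OF _ _ L2_cmult[OF u(2), of 2560]])
  show "(\<lambda>z. pd c (pd b (cutn n)) z * u z) \<in> borel_measurable (lebesgue_on disk)" for n
    by (intro borel_measurable_times u(1) L2_measurable test_fun_L2 test_fun_pd test_fun_cutn b)
  show "AE z in lebesgue_on disk. \<bar>pd c (pd b (cutn n)) z * u z\<bar> \<le> \<bar>2560 * (u z / (bd z)\<^sup>2)\<bar>" for n
  proof (rule AE_diskI)
    fix z :: plane assume z: "norm z < 1"
    have "\<bar>pd c (pd b (cutn n)) z\<bar> \<le> 2560 / (bd z)\<^sup>2"
      using pd_pd_cut_bounds(1)[OF _ _ z b, of "1 / real (Suc n)"] bd_pos[OF z] by (simp add: pos_le_divide_eq)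
    then have "\<bar>pd c (pd b (cutn n)) z\<bar> * \<bar>u z\<bar> \<le> 2560 / (bd z)\<^sup>2 * \<bar>u z\<bar>" by (intro mult_right_mono) auto
    then show "\<bar>pd c (pd b (cutn n)) z * u z\<bar> \<le> \<bar>2560 * (u z / (bd z)\<^sup>2)\<bar>" using bd_pos[OF z] by (simp add: abs_mult)
  qed
  show "AE z in lebesgue_on disk. (\<lambda>n. pd c (pd b (cutn n)) z * u z) \<longlonglongrightarrow> 0"
    using b by (intro AE_diskI tendsto_mult_left_zero pd_pd_cutn_tendsto_0)
qed simp

lemma sconv_Suc_I:
  assumes "L2lim f u" "\<And>b. b \<in> Basis \<Longrightarrow> sconv k (g b) (h b)"
    "\<And>b n. b \<in> Basis \<Longrightarrow> AE z in lebesgue_on disk. wd b (f n) z = g b n z"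
    "\<And>b. b \<in> Basis \<Longrightarrow> AE z in lebesgue_on disk. wd b u z = h b z"
    "\<And>n. sobolev (Suc k) (f n)" "sobolev (Suc k) u"
  shows "sconv (Suc k) f u"
proof -
  have "sconv k (\<lambda>n. wd b (f n)) (wd b u)" if b: "b \<in> Basis" for b
  proof (rule sconv_cong[OF assms(2)[OF b]])
    show "AE z in lebesgue_on disk. g b n z = wd b (f n) z" for n
      using assms(3)[OF b, of n] by (rule eventually_mono) simp
    show "AE z in lebesgue_on disk. h b z = wd b u z" using assms(4)[OF b] by (rule eventually_mono) simp
    show "L2 (wd b (f n))" for n by (rule sobolev_wd_L2[OF assms(5) b])
    show "L2 (wd b u)" by (rule sobolev_wd_L2[OF assms(6) b])
  qed
  then show ?thesis using assms(1) by simp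
qed

lemma sconv_add:
  assumes "sconv k f u" "sconv k g v" "\<And>n. sobolev k (f n)" "\<And>n. sobolev k (g n)" "sobolev k u" "sobolev k v"
  shows "sconv k (\<lambda>n z. f n z + g n z) (\<lambda>z. u z + v z)"
proof (subst sconv_iff)
  show "sobolev k (\<lambda>z. f n z + g n z)" for n by (intro sobolev_add assms)
  show "sobolev k (\<lambda>z. u z + v z)" by (intro sobolev_add assms)
  have l: "(\<lambda>n. sobolev_sq k (\<lambda>z. u z - f n z)) \<longlonglongrightarrow> 0" "(\<lambda>n. sobolev_sq k (\<lambda>z. v z - g n z)) \<longlonglongrightarrow> 0"
    using sconv_iff[of k f u] sconv_iff[of k g v] assms by auto
  have "(\<lambda>n. 2 * sobolev_sq k (\<lambda>z. u z - f n z) + 2 * sobolev_sq k (\<lambda>z. v z - g n z)) \<longlonglongrightarrow> 2 * 0 + 2 * 0"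
    by (intro tendsto_add tendsto_mult tendsto_const l)
  then have up: "(\<lambda>n. 2 * sobolev_sq k (\<lambda>z. u z - f n z) + 2 * sobolev_sq k (\<lambda>z. v z - g n z)) \<longlonglongrightarrow> 0"
    by (simp only: mult_zero_right add_0_left)
  have le: "sobolev_sq k (\<lambda>z. (u z + v z) - (f n z + g n z)) \<le> 2 * sobolev_sq k (\<lambda>z. u z - f n z) + 2 * sobolev_sq k (\<lambda>z. v z - g n z)" for n
    using sobolev_sq_add_le[OF sobolev_diff[OF assms(5,3)] sobolev_diff[OF assms(6,4)], of n n] by (simp add: algebra_simps)
  show "(\<lambda>n. sobolev_sq k (\<lambda>z. (u z + v z) - (f n z + g n z))) \<longlonglongrightarrow> 0"
    by (rule tendsto_sandwich[OF always_eventually always_eventually tendsto_const up]) (intro allI sobolev_sq_nonneg le)+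
qed

lemma sconv_cutn_1:
  assumes u: "sobolev (Suc 0) u" "L2 (\<lambda>z. u z / bd z)"
  shows "sconv (Suc 0) (\<lambda>n z. cutn n z * u z) u"
proof (rule sconv_Suc_I)
  note l = sobolev_L2[OF u(1)]
  show "L2lim (\<lambda>n z. cutn n z * u z) u" by (rule L2lim_cut[OF l])
  show "sobolev (Suc 0) (\<lambda>z. cutn n z * u z)" for n by (intro sobolev_mult_smooth u test_fun_Ck test_fun_cutn)
  fix b :: plane assume b: "b \<in> Basis"
  show "sconv 0 (\<lambda>n z. pd b (cutn n) z * u z + cutn n z * wd b u z) (\<lambda>z. 0 + wd b u z)"
    unfolding sconv.simps by (intro L2lim_add L2lim_pd_cut L2lim_cut sobolev_wd_L2[OF u(1) b] u(2) b L2_measurable l)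
  show "AE z in lebesgue_on disk. wd b (\<lambda>z. cutn n z * u z) z = pd b (cutn n) z * u z + cutn n z * wd b u z" for n
    by (rule wd_mult_smooth[OF u(1) b test_fun_Ck[OF test_fun_cutn]])
qed (use u in auto)

text \<open>Square integrability of \<open>u / (1 - r\<^sup>2)\<close> characterizes the vanishing of \<open>u\<close> on the boundary.\<close>

lemma sobolev0_if_hardy:
  assumes "sobolev (Suc 0) u" "L2 (\<lambda>z. u z / bd z)"
  shows "sobolev0 (Suc 0) u"
  by (rule sobolev0_closed[OF _ assms(1) sconv_cutn_1[OF assms]])
    (rule sobolev0_mult_test[OF assms(1) test_fun_cutn])

text \<open>In the second derivatives of \<open>\<chi>\<^sub>n u\<close> the terms \<open>\<partial>\<chi>\<^sub>n \<partial>u\<close> and \<open>\<partial>\<partial>\<chi>\<^sub>n u\<close> tend to 0, because \<open>\<partial>u / (1 - r\<^sup>2)\<close> and \<open>u / (1 - r\<^sup>2)\<^sup>2\<close>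
  are square integrable.\<close>

lemma sconv_cutn_2:
  assumes u: "sobolev0 (Suc (Suc 0)) u"
  shows "sconv (Suc (Suc 0)) (\<lambda>n z. cutn n z * u z) u"
proof (rule sconv_Suc_I)
  have s: "sobolev (Suc (Suc 0)) u" "sobolev (Suc 0) u" by (rule sobolev0_sobolev[OF u], rule sobolev0_sobolev[OF sobolev0_Suc_D[OF u]])
  note l = sobolev_L2[OF s(1)] and m = L2_measurable[OF sobolev_L2[OF s(1)]]
  show "L2lim (\<lambda>n z. cutn n z * u z) u" by (rule L2lim_cut[OF l])
  show "sobolev (Suc (Suc 0)) (\<lambda>z. cutn n z * u z)" for n by (intro sobolev_mult_smooth s test_fun_Ck test_fun_cutn)
  show "sobolev (Suc (Suc 0)) u" by (rule s)
  fix b :: plane assume b: "b \<in> Basis"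
  show "AE z in lebesgue_on disk. wd b (\<lambda>z. cutn n z * u z) z = pd b (cutn n) z * u z + cutn n z * wd b u z" for n
    by (rule wd_mult_smooth[OF s(1) b test_fun_Ck[OF test_fun_cutn]])
  show "AE z in lebesgue_on disk. wd b u z = 0 + wd b u z" by simp
  have t: "test_fun (pd b (cutn n))" for n by (intro test_fun_pd test_fun_cutn b)
  note ub = sobolev0_wd[OF u b] and hb = sobolev0_hardy(1)[OF sobolev0_wd[OF u]]
  have "sconv (Suc 0) (\<lambda>n z. pd b (cutn n) z * u z) (\<lambda>z. 0)"
  proof (rule sconv_Suc_I)
    show "L2lim (\<lambda>n z. pd b (cutn n) z * u z) (\<lambda>z. 0)"
      by (rule L2lim_pd_cut[OF m sobolev0_hardy(1)[OF sobolev0_Suc_D[OF u]] b])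
    show "sobolev (Suc 0) (\<lambda>z. pd b (cutn n) z * u z)" for n by (intro sobolev_mult_smooth s test_fun_Ck t)
    show "sobolev (Suc 0) (\<lambda>z. 0)" by (rule sobolev_zero)
    fix c :: plane assume c: "c \<in> Basis"
    show "AE z in lebesgue_on disk. wd c (\<lambda>z. pd b (cutn n) z * u z) z = pd c (pd b (cutn n)) z * u z + pd b (cutn n) z * wd c u z" for n
      by (rule wd_mult_smooth[OF s(2) c test_fun_Ck[OF t]])
    have "L2lim (\<lambda>n z. pd c (pd b (cutn n)) z * u z + pd b (cutn n) z * wd c u z) (\<lambda>z. 0 + 0)"
      by (intro L2lim_add L2lim_pd_cut L2lim_pd_pd_cut m sobolev0_H2_weights(1)[OF u] b c L2_measurable[OF sobolev_wd_L2[OF s(1) c]] hb[OF c])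
    then show "sconv 0 (\<lambda>n z. pd c (pd b (cutn n)) z * u z + pd b (cutn n) z * wd c u z) (\<lambda>z. 0)" by simp
    show "AE z in lebesgue_on disk. wd c (\<lambda>z. 0) z = 0"
      using wd_smooth[OF Ck_const c, of 0] by (rule eventually_mono) (simp add: frechet_derivative_const)
  qed
  moreover have "sconv (Suc 0) (\<lambda>n z. cutn n z * wd b u z) (wd b u)"
    by (rule sconv_cutn_1[OF sobolev0_sobolev[OF ub] hb[OF b]])
  ultimately show "sconv (Suc 0) (\<lambda>n z. pd b (cutn n) z * u z + cutn n z * wd b u z) (\<lambda>z. 0 + wd b u z)"
    by (rule sconv_add) (intro sobolev_mult_smooth s test_fun_Ck t test_fun_cutn sobolev_zero sobolev0_sobolev[OF ub])+
qed

subsection \<open>Functions without boundary condition\<close>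

lemma pd_bd: "pd b bd z = - 2 * (z \<bullet> b)"
proof -
  have "(bd has_derivative (\<lambda>h. 0 - h \<bullet> (2 *\<^sub>R z))) (at z)"
    unfolding bd_def[abs_def] by (intro has_derivative_diff has_derivative_const has_derivative_norm_sq)
  from pd_unique[OF this] show ?thesis by (simp add: inner_commute)
qed

lemma sobolev0_bd_mult:
  assumes v: "sobolev (Suc 0) v" shows "sobolev0 (Suc 0) (\<lambda>z. bd z * v z)"
proof (rule sobolev0_if_hardy)
  show "sobolev (Suc 0) (\<lambda>z. bd z * v z)" by (intro sobolev_mult_smooth v Ck_bd)
  show "L2 (\<lambda>z. bd z * v z / bd z)"
  proof (rule L2_cong_AE[OF _ sobolev_L2[OF v]])
    show "AE z in lebesgue_on disk. bd z * v z / bd z = v z" using AE_bd by eventually_elim simp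
    show "(\<lambda>z. bd z * v z / bd z) \<in> borel_measurable (lebesgue_on disk)"
      using L2_measurable[OF sobolev_L2[OF v]] by measurable
  qed
qed

lemma grad_ip_bd_mult_le:
  assumes v: "sobolev (Suc 0) v"
  shows "grad_ip (\<lambda>z. bd z * v z) (\<lambda>z. bd z * v z) \<le> 16 * sobolev_sq (Suc 0) v"
proof -
  have le: "ip (wd b (\<lambda>z. bd z * v z)) (wd b (\<lambda>z. bd z * v z)) \<le> 8 * ip v v + 2 * ip (wd b v) (wd b v)" if b: "b \<in> Basis" for b
  proof -
    note l = sobolev_L2[OF v] sobolev_wd_L2[OF v b]
    have c: "continuous_on UNIV (pd b bd)" by (rule Ck_continuous[OF Ck_all_pd[OF Ck_bd b]])
    have l1: "L2 (\<lambda>z. pd b bd z * v z)" and l2: "L2 (\<lambda>z. bd z * wd b v z)"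
      by (intro L2_mult_continuous l c continuous_bd)+
    have "ip (wd b (\<lambda>z. bd z * v z)) (wd b (\<lambda>z. bd z * v z)) =
        ip (\<lambda>z. pd b bd z * v z + bd z * wd b v z) (\<lambda>z. pd b bd z * v z + bd z * wd b v z)"
      using wd_mult_smooth[OF v b Ck_bd] sobolev_wd_L2[OF sobolev_mult_smooth[OF v Ck_bd] b] L2_add[OF l1 l2]
      by (intro ip_cong_AE) (auto intro: L2_measurable)
    also have "\<dots> \<le> 2 * ip (\<lambda>z. pd b bd z * v z) (\<lambda>z. pd b bd z * v z) + 2 * ip (\<lambda>z. bd z * wd b v z) (\<lambda>z. bd z * wd b v z)"
      by (rule ip_add_le[OF l1 l2])
    also have "ip (\<lambda>z. pd b bd z * v z) (\<lambda>z. pd b bd z * v z) \<le> ip (\<lambda>z. 2 * v z) (\<lambda>z. 2 * v z)"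
    proof (intro ip_mono l1 L2_cmult l AE_diskI)
      fix z :: plane assume "norm z < 1"
      from inner_Basis_le[OF this b] show "\<bar>pd b bd z * v z\<bar> \<le> \<bar>2 * v z\<bar>"
        unfolding pd_bd abs_mult by (intro mult_right_mono) auto
    qed
    also have "ip (\<lambda>z. bd z * wd b v z) (\<lambda>z. bd z * wd b v z) \<le> ip (wd b v) (wd b v)"
    proof (intro ip_mono l2 l AE_diskI)
      fix z :: plane assume "norm z < 1"
      from bd_abs[OF this] show "\<bar>bd z * wd b v z\<bar> \<le> \<bar>wd b v z\<bar>"
        unfolding abs_mult by (intro mult_left_le_one_le) auto
    qed
    finally show ?thesis by (simp add: ip_cmult_left ip_cmult_right)
  qed
  show ?thesis
    unfolding grad_ip_def sobolev_sq.simps sum_Basis_plane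
    using le[of "(1, 0)"] le[of "(0, 1)"] ip_self_nonneg[of "wd (1, 0) v"] ip_self_nonneg[of "wd (0, 1) v"] by simp
qed

text \<open>For functions in \<open>H\<^sup>1\<close> that need not vanish on the boundary an inequality for \<open>u\<^sup>2 / (1 - r\<^sup>2)\<close> is not to be
  expected. Applied to \<open>(1 - r\<^sup>2) v\<close>, which does vanish, that inequality bounds \<open>(1 - r\<^sup>2) v\<^sup>2\<close>, with
  the weight inverse to the one of \<open>sobolev0_L4\<close>.\<close>

lemma sobolev_interior_L4:
  assumes v: "sobolev (Suc 0) v"
  shows "L2 (\<lambda>z. bd z * (v z)\<^sup>2)" "ip (\<lambda>z. bd z * (v z)\<^sup>2) (\<lambda>z. bd z * (v z)\<^sup>2) \<le> 16 * (16 * sobolev_sq (Suc 0) v)\<^sup>2"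
proof -
  let ?u = "\<lambda>z. bd z * v z"
  note L4 = sobolev0_L4[OF sobolev0_bd_mult[OF v]]
  have m: "(\<lambda>z. bd z * (v z)\<^sup>2) \<in> borel_measurable (lebesgue_on disk)"
    using L2_measurable[OF sobolev_L2[OF v]] by measurable
  have ae: "AE z in lebesgue_on disk. bd z * (v z)\<^sup>2 = (?u z)\<^sup>2 / bd z"
    using AE_bd by eventually_elim (simp add: power2_eq_square)
  show l: "L2 (\<lambda>z. bd z * (v z)\<^sup>2)" by (rule L2_cong_AE[OF ae L4(1) m])
  have "ip (\<lambda>z. bd z * (v z)\<^sup>2) (\<lambda>z. bd z * (v z)\<^sup>2) = ip (\<lambda>z. (?u z)\<^sup>2 / bd z) (\<lambda>z. (?u z)\<^sup>2 / bd z)"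
    by (intro ip_cong_AE ae L2_measurable l L4(1))
  also have "\<dots> \<le> 16 * (grad_ip ?u ?u)\<^sup>2" by (rule L4(2))
  also have "\<dots> \<le> 16 * (16 * sobolev_sq (Suc 0) v)\<^sup>2"
    using grad_ip_bd_mult_le[OF v] grad_ip_nonneg by (intro mult_left_mono power_mono) auto
  finally show "ip (\<lambda>z. bd z * (v z)\<^sup>2) (\<lambda>z. bd z * (v z)\<^sup>2) \<le> 16 * (16 * sobolev_sq (Suc 0) v)\<^sup>2" .
qed

section \<open>The first Dirichlet eigenvalue\<close>

subsection \<open>The Bessel function \<open>J\<^sub>0\<close>\<close>

text \<open>\<open>bess s = J\<^sub>0(\<surd>s)\<close>, so that \<open>bess (\<eta> r\<^sup>2)\<close> is a radial solution of \<open>-\<Delta>u = \<eta>u\<close>.\<close>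

definition bc :: "nat \<Rightarrow> real" where "bc n = (- 1 / 4) ^ n / (fact n)\<^sup>2"

definition pser :: "(nat \<Rightarrow> real) \<Rightarrow> real \<Rightarrow> real" where "pser c x = (\<Sum>n. c n * x ^ n)"

abbreviation bess :: "real \<Rightarrow> real" where "bess \<equiv> pser bc"
abbreviation bess' :: "real \<Rightarrow> real" where "bess' \<equiv> pser (diffs bc)"
abbreviation bess'' :: "real \<Rightarrow> real" where "bess'' \<equiv> pser (diffs (diffs bc))"

definition entire :: "(nat \<Rightarrow> real) \<Rightarrow> bool" where "entire c \<longleftrightarrow> (\<forall>x. summable (\<lambda>n. c n * x ^ n))"

lemma entire_diffs: "entire c \<Longrightarrow> entire (diffs c)"
  unfolding entire_def using termdiff_converges_all[of c] by blast

lemma pser_deriv: "entire c \<Longrightarrow> (pser c has_real_derivative pser (diffs c) x) (at x)"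
  unfolding entire_def pser_def[abs_def] by (intro termdiffs_strong_converges_everywhere) auto

lemma pser_continuous: "entire c \<Longrightarrow> continuous_on A (pser c)"
  by (meson DERIV_continuous continuous_at_imp_continuous_on pser_deriv)

lemma Ck_pser:
  assumes "entire c" "\<And>k. Ck k \<sigma>" shows "Ck k (\<lambda>z. pser c (\<sigma> z))"
proof (rule Ck_comp_family[of "pser ` Collect entire", OF _ assms(2)])
  fix f assume "f \<in> pser ` Collect entire"
  then obtain d where d: "f = pser d" "entire d" by (elim imageE) simp
  show "\<exists>f'\<in>pser ` Collect entire. \<forall>t. (f has_real_derivative f' t) (at t)"
    using pser_deriv[OF d(2)] entire_diffs[OF d(2)] unfolding d(1)
    by (intro bexI[of _ "pser (diffs d)"]) auto
qed (use assms(1) in auto)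

lemma entire_bc: "entire bc"
  unfolding entire_def
proof
  fix x :: real
  show "summable (\<lambda>n. bc n * x ^ n)"
  proof (rule summable_comparison_test'[OF summable_exp[of "\<bar>x\<bar>"]])
    fix n :: nat
    have "\<bar>bc n\<bar> = (1 / 4) ^ n / (fact n * fact n)"
      by (simp add: bc_def power_abs power2_eq_square)
    also have "\<dots> \<le> 1 / fact n"
    proof -
      have "(1 / 4 :: real) ^ n \<le> 1" by (intro power_le_one) auto
      moreover have "fact n \<le> (fact n * fact n :: real)" by simp
      ultimately show ?thesis by (intro frac_le) auto
    qed
    finally have "\<bar>bc n\<bar> * \<bar>x\<bar> ^ n \<le> 1 / fact n * \<bar>x\<bar> ^ n" by (intro mult_right_mono) auto
    then show "norm (bc n * x ^ n) \<le> inverse (fact n) * \<bar>x\<bar> ^ n"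
      by (simp add: abs_mult power_abs inverse_eq_divide)
  qed
qed

lemmas bess_deriv = pser_deriv[OF entire_bc]
lemmas bess'_deriv = pser_deriv[OF entire_diffs[OF entire_bc]]

text \<open>Both sides are the derivative of \<open>s bess' s = \<Sum> n c\<^sub>n s\<^sup>n\<close>, by the recursion
  \<open>(n + 1)\<^sup>2 c\<^sub>n\<^sub>+\<^sub>1 = - c\<^sub>n / 4\<close>.\<close>

lemma bess_ode: "bess' s + s * bess'' s = - bess s / 4"
proof -
  define d where "d n = real n * bc n" for n
  have sum1: "summable (\<lambda>n. diffs bc n * x ^ n)" for x
    using entire_diffs[OF entire_bc] by (simp add: entire_def)
  have Suc: "d (Suc n) * x ^ Suc n = x * (diffs bc n * x ^ n)" for n x
    by (simp add: d_def diffs_def)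
  have sd: "summable (\<lambda>n. d n * x ^ n)" for x
  proof -
    have "summable (\<lambda>n. d (Suc n) * x ^ Suc n)" unfolding Suc by (intro summable_mult sum1)
    then show ?thesis using summable_Suc_iff[of "\<lambda>n. d n * x ^ n"] by simp
  qed
  have e: "pser d x = x * bess' x" for x
  proof -
    have "pser d x = (\<Sum>n. d (Suc n) * x ^ Suc n) + d 0 * x ^ 0"
      unfolding pser_def using suminf_split_head[OF sd[of x]] by simp
    then show ?thesis unfolding Suc pser_def by (simp add: suminf_mult[OF sum1] d_def)
  qed
  have "entire d" using sd by (simp add: entire_def)
  from pser_deriv[OF this, of s] have "((\<lambda>x. x * bess' x) has_real_derivative pser (diffs d) s) (at s)"
    unfolding e[abs_def, symmetric] by simp
  moreover have "((\<lambda>x. x * bess' x) has_real_derivative bess' s + s * bess'' s) (at s)"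
    by (auto intro!: derivative_eq_intros bess'_deriv)
  ultimately have "bess' s + s * bess'' s = pser (diffs d) s" using DERIV_unique by blast
  also have "diffs d = (\<lambda>n. - 1 / 4 * bc n)"
    by (auto simp: fun_eq_iff diffs_def d_def bc_def power2_eq_square field_simps simp del: of_nat_Suc)
  also have "pser (\<lambda>n. - 1 / 4 * bc n) s = - bess s / 4"
    unfolding pser_def mult.assoc using entire_bc by (subst suminf_mult) (auto simp: entire_def)
  finally show ?thesis .
qed

subsection \<open>Its first zero\<close>

text \<open>The partial sum of degree 5, in the variable \<open>s / 4\<close>.\<close>

definition bpoly :: "real \<Rightarrow> real" where
  "bpoly x = 1 - x + x\<^sup>2 / 4 - x ^ 3 / 36 + x ^ 4 / 576 - x ^ 5 / 14400"

lemma bess_approx: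
  assumes "0 \<le> s" "s \<le> 8"
  shows "\<bar>bess s - bpoly (s / 4)\<bar> \<le> (s / 4) ^ 6 / 259200"
proof -
  have sm: "summable (\<lambda>n. bc n * s ^ n)" using entire_bc by (simp add: entire_def)
  have abs: "\<bar>bc n * s ^ n\<bar> = (s / 4) ^ n / (fact n)\<^sup>2" for n
    using assms by (simp add: bc_def abs_mult power_abs power_divide)
  have t: "\<bar>bc (n + 6) * s ^ (n + 6)\<bar> \<le> (s / 4) ^ 6 / 518400 * (1 / 2) ^ n" for n
  proof (induction n)
    case 0
    have "(fact 6 :: real)\<^sup>2 = 518400" by (simp add: fact_numeral)
    then show ?case using abs[of 6] by simp
  next
    case (Suc n)
    have "(s / 4) ^ (Suc n + 6) / (fact (Suc n + 6))\<^sup>2 = (s / 4) ^ (n + 6) / (fact (n + 6))\<^sup>2 * ((s / 4) / (real (n + 7))\<^sup>2)"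
    proof -
      have s1: "Suc n + 6 = Suc (n + 6)" by simp
      have "fact (Suc n + 6) = real (Suc (n + 6)) * (fact (n + 6) :: real)" by (simp only: s1 fact_Suc)
      moreover have "Suc (n + 6) = n + 7" by simp
      moreover have "(s / 4) ^ (Suc n + 6) = (s / 4) * (s / 4) ^ (n + 6)" by (simp only: s1 power_Suc)
      ultimately show ?thesis by (simp only: power_mult_distrib times_divide_times_eq mult.commute)
    qed
    also have "\<dots> \<le> (s / 4) ^ (n + 6) / (fact (n + 6))\<^sup>2 * (1 / 2)"
    proof (rule mult_left_mono)
      have "7\<^sup>2 \<le> (real (n + 7))\<^sup>2" by (intro power_mono) auto
      then have "(s / 4) / (real (n + 7))\<^sup>2 \<le> 2 / 7\<^sup>2" using assms by (intro frac_le) auto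
      also have "2 / 7\<^sup>2 \<le> (1 / 2 :: real)" by simp
      finally show "(s / 4) / (real (n + 7))\<^sup>2 \<le> 1 / 2" .
    qed (use assms in auto)
    also have "\<dots> \<le> ((s / 4) ^ 6 / 518400 * (1 / 2) ^ n) * (1 / 2)"
      using Suc abs[of "n + 6"] by (intro mult_right_mono) auto
    finally show ?case using abs[of "Suc n + 6"] by simp
  qed
  have gs: "summable (\<lambda>n. (s / 4) ^ 6 / 518400 * (1 / 2 :: real) ^ n)" by (intro summable_mult summable_geometric) simp
  have sa: "summable (\<lambda>n. \<bar>bc (n + 6) * s ^ (n + 6)\<bar>)"
    by (rule summable_comparison_test'[OF gs, of 0]) (use t in auto)
  have "bess s = (\<Sum>n. bc (n + 6) * s ^ (n + 6)) + (\<Sum>n<6. bc n * s ^ n)"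
    unfolding pser_def by (rule suminf_split_initial_segment[OF sm])
  also have "(\<Sum>n<6. bc n * s ^ n) = bpoly (s / 4)"
    by (simp add: bpoly_def bc_def lessThan_Suc numeral_eq_Suc fact_numeral power_divide)
  finally have "\<bar>bess s - bpoly (s / 4)\<bar> = \<bar>\<Sum>n. bc (n + 6) * s ^ (n + 6)\<bar>" by simp
  also have "\<dots> \<le> (\<Sum>n. \<bar>bc (n + 6) * s ^ (n + 6)\<bar>)" by (rule summable_rabs[OF sa])
  also have "\<dots> \<le> (\<Sum>n. (s / 4) ^ 6 / 518400 * (1 / 2) ^ n)" by (rule suminf_le[OF t sa gs])
  also have "\<dots> = (s / 4) ^ 6 / 518400 * 2"
    by (subst suminf_mult) (auto intro: summable_geometric simp: suminf_geometric)
  finally show ?thesis by simp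
qed

text \<open>The lower bound \<open>Q\<close> that the remainder estimate gives is decreasing, so it suffices to evaluate it at the right end.\<close>

lemma bess_pos:
  assumes "0 \<le> s" "s \<le> (231/40)" shows "bess s > 0"
proof -
  define Q where "Q x = bpoly x - x ^ 6 / 259200" for x
  define Q' where "Q' x = - 1 + x / 2 - x\<^sup>2 / 12 + x ^ 3 / 144 - x ^ 4 / 2880 - x ^ 5 / 43200" for x :: real
  have d: "(Q has_real_derivative Q' x) (at x)" for x
    unfolding Q_def[abs_def] bpoly_def Q'_def by (auto intro!: derivative_eq_intros simp: field_simps)
  have neg: "Q' x \<le> 0" if "0 \<le> x" "x \<le> (231/160)" for x
  proof -
    have "x ^ 3 \<le> (231/160) ^ 3" using that by (intro power_mono) auto
    then have "x ^ 3 / 144 \<le> 3 / 100" by (simp add: power3_eq_cube)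
    moreover have "0 \<le> x\<^sup>2" "0 \<le> x ^ 4" "0 \<le> x ^ 5" using that by auto
    ultimately show ?thesis using that unfolding Q'_def by linarith
  qed
  have "Q (231/160) \<le> Q (s / 4)"
    using assms by (intro DERIV_nonpos_imp_nonincreasing[of "s / 4" "231/160" Q]) (use d neg in \<open>auto intro!: exI\<close>)
  moreover have "Q (231/160) > 0" unfolding Q_def bpoly_def by (simp add: power2_eq_square power3_eq_cube power4_eq_xxxx eval_nat_numeral)
  ultimately have "bpoly (s / 4) - (s / 4) ^ 6 / 259200 > 0" by (simp add: Q_def)
  then show ?thesis using bess_approx[of s] assms by linarith
qed

lemma bess_neg: "bess (1157/200) < 0"
proof -
  have e: "1157 / 200 / 4 = (1157 / 800 :: real)" by simp
  have "bpoly (1157/800) + (1157/800) ^ 6 / 259200 < 0"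
    unfolding bpoly_def by (simp add: power2_eq_square power3_eq_cube power4_eq_xxxx eval_nat_numeral)
  moreover have "\<bar>bess (1157 / 200) - bpoly (1157 / 800)\<bar> \<le> (1157 / 800) ^ 6 / 259200"
    using bess_approx[of "1157 / 200"] unfolding e by linarith
  ultimately show ?thesis by linarith
qed

lemma bess_first_zero:
  obtains \<eta> where "(231/40) < \<eta>" "\<eta> < (1157/200)" "bess \<eta> = 0" "\<And>s. 0 \<le> s \<Longrightarrow> s < \<eta> \<Longrightarrow> bess s > 0"
proof -
  note cont = pser_continuous[OF entire_bc]
  define Z where "Z = {s \<in> {(231/40)..(1157/200)}. bess s = 0}"
  have "closed Z" unfolding Z_def by (rule continuous_closed_preimage_constant[OF cont closed_atLeastAtMost])
  moreover have "bounded Z"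
    by (rule bounded_subset[OF bounded_closed_interval[of "231/40" "1157/200"]]) (auto simp: Z_def)
  ultimately have "compact Z" by (simp add: compact_eq_bounded_closed)
  moreover have "Z \<noteq> {}"
    using IVT2'[OF _ _ _ cont, of "1157/200" 0 "231/40"] bess_pos[of "231/40"] bess_neg by (auto simp: Z_def)
  ultimately obtain \<eta> where \<eta>: "\<eta> \<in> Z" "\<And>s. s \<in> Z \<Longrightarrow> \<eta> \<le> s"
    using compact_attains_inf[of Z] by blast
  have pos: "bess s > 0" if "0 \<le> s" "s < \<eta>" for s
  proof (rule ccontr)
    assume "\<not> bess s > 0"
    then have n: "bess s \<le> 0" by simp
    have "s > (231/40)" using bess_pos[of s] that n by force
    then obtain t where "(231/40) \<le> t" "t \<le> s" "bess t = 0"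
      using IVT2'[OF n _ _ cont, of "231/40"] bess_pos[of "231/40"] by auto
    then have "t \<in> Z" using that \<eta>(1) by (auto simp: Z_def)
    then show False using \<eta>(2)[of t] \<open>t \<le> s\<close> that by simp
  qed
  have z0: "bess \<eta> = 0" using \<eta>(1) by (simp add: Z_def)
  have "\<eta> \<noteq> (231/40)"
  proof
    assume e: "\<eta> = (231/40)"
    show False using bess_pos[of \<eta>] z0 unfolding e by simp
  qed
  moreover have "\<eta> \<noteq> (1157/200)"
  proof
    assume e: "\<eta> = (1157/200)"
    show False using bess_neg z0 unfolding e by simp
  qed
  ultimately show ?thesis using \<eta>(1) pos by (intro that[of \<eta>]) (auto simp: Z_def)
qed

subsection \<open>Poincare's inequality with the optimal constant\<close>

text \<open>By \<open>c1c_barta\<close> for \<open>m z\<close> the logarithmic gradient of \<open>bess (\<eta> r\<^sup>2)\<close>, which has no zero in the open disk when \<open>\<eta>\<close> is at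
  most the first zero of \<open>bess\<close>.\<close>

lemma c1c_poincare:
  assumes u: "c1c u G" and \<eta>: "\<eta> > 0" "\<And>s. 0 \<le> s \<Longrightarrow> s < \<eta> \<Longrightarrow> bess s > 0"
  shows "\<eta> * ip u u \<le> gsq G"
proof -
  \<comment> \<open>for negative arguments the series has positive terms\<close>
  have pos: "bess (\<eta> * t) > 0" if "t < 1" for t
  proof (cases "t \<ge> 0")
    case True
    then show ?thesis using \<eta> that by (intro \<eta>(2)) auto
  next
    case False
    have nn: "bc n * (\<eta> * t) ^ n \<ge> 0" for n
    proof -
      have "((- 1 / 4) * (\<eta> * t)) ^ n = (- 1 / 4) ^ n * (\<eta> * t) ^ n" by (rule power_mult_distrib)
      then have "bc n * (\<eta> * t) ^ n = ((- 1 / 4) * (\<eta> * t)) ^ n / (fact n)\<^sup>2"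
        by (simp only: bc_def) (rule times_divide_eq_left)
      moreover have "(- 1 / 4) * (\<eta> * t) \<ge> 0" using False \<eta>(1) by (simp add: mult_nonneg_nonpos)
      ultimately show ?thesis by (simp only: zero_le_divide_iff zero_le_power zero_le_power2) simp
    qed
    have "(\<Sum>n<1. bc n * (\<eta> * t) ^ n) \<le> bess (\<eta> * t)"
      unfolding pser_def using entire_bc nn by (intro sum_le_suminf) (auto simp: entire_def)
    then show ?thesis by (simp add: bc_def)
  qed
  define m where "m t = 2 * \<eta> * bess' (\<eta> * t) / bess (\<eta> * t)" for t
  define m' where "m' t = (2 * \<eta>\<^sup>2 * bess'' (\<eta> * t) * bess (\<eta> * t) - 2 * \<eta>\<^sup>2 * (bess' (\<eta> * t))\<^sup>2) / (bess (\<eta> * t))\<^sup>2" for t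
  have d: "(m has_real_derivative m' t) (at t)" if "t < 1" for t
  proof -
    have d1: "((\<lambda>t. bess (\<eta> * t)) has_real_derivative bess' (\<eta> * t) * \<eta>) (at t)"
      by (rule DERIV_chain2[OF bess_deriv]) (auto intro!: derivative_eq_intros)
    have d2: "((\<lambda>t. bess' (\<eta> * t)) has_real_derivative bess'' (\<eta> * t) * \<eta>) (at t)"
      by (rule DERIV_chain2[OF bess'_deriv]) (auto intro!: derivative_eq_intros)
    have "bess (\<eta> * t) \<noteq> 0" using pos[OF that] by simp
    from DERIV_divide[OF DERIV_cmult[OF d2, of "2 * \<eta>"] d1 this] show ?thesis
      unfolding m_def[abs_def] m'_def by (simp add: power2_eq_square mult_ac)
  qed
  have cont: "continuous_on A (\<lambda>t. pser c (\<eta> * t))" if "entire c" for A c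
    by (intro continuous_on_compose2[OF pser_continuous[OF that, of UNIV]] continuous_intros) auto
  have c': "continuous_on {..<1} m'"
    unfolding m'_def[abs_def]
    by (intro continuous_intros cont entire_diffs entire_bc) (use pos in force)
  have V: "\<eta> \<le> - (2 * m t + 2 * t * m' t) - t * (m t)\<^sup>2" if "0 \<le> t" "t < 1" for t
  proof -
    let ?g = "bess (\<eta> * t)" and ?g1 = "bess' (\<eta> * t)" and ?g2 = "bess'' (\<eta> * t)"
    have g: "?g \<noteq> 0" using pos[OF that(2)] by simp
    have "- (2 * m t + 2 * t * m' t) - t * (m t)\<^sup>2 = - 4 * \<eta> * (?g1 + \<eta> * t * ?g2) / ?g"
      unfolding m_def m'_def using g by (simp add: power2_eq_square field_simps)
    also have "\<dots> = \<eta>" unfolding bess_ode using g by simp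
    finally show ?thesis by simp
  qed
  have "(LINT z|lebesgue_on disk. (u z)\<^sup>2 * \<eta>) \<le> gsq G"
    by (rule c1c_barta(2)[OF u d c' continuous_on_const V])
  then show ?thesis by (simp add: ip_def power2_eq_square mult.commute)
qed

lemma sobolev0_poincare:
  assumes u: "sobolev0 (Suc 0) u" and \<eta>: "\<eta> > 0" "\<And>s. 0 \<le> s \<Longrightarrow> s < \<eta> \<Longrightarrow> bess s > 0"
  shows "\<eta> * ip u u \<le> grad_ip u u"
proof -
  obtain \<phi> where \<phi>: "\<And>n::nat. test_fun (\<phi> n)" "sconv (Suc 0) \<phi> u" "L2lim \<phi> u" "(\<lambda>n. gsq (grad (\<phi> n))) \<longlonglongrightarrow> grad_ip u u"
    using sobolev0_Suc_0E[OF u] by blast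
  have "(\<lambda>n. \<eta> * ip (\<phi> n) (\<phi> n)) \<longlonglongrightarrow> \<eta> * ip u u"
    by (intro tendsto_mult tendsto_const L2lim_ip \<phi>)
  then show ?thesis
    by (rule LIMSEQ_le[OF _ \<phi>(4)]) (use c1c_poincare[OF c1c_test_fun[OF \<phi>(1)] \<eta>] in auto)
qed

subsection \<open>The eigenfunction\<close>

lemma grad_ip_test_right:
  assumes "sobolev (Suc 0) u" "test_fun \<phi>"
  shows "grad_ip u \<phi> = (\<Sum>b\<in>Basis. ip (wd b u) (pd b \<phi>))"
  unfolding grad_ip_def
proof (rule sum.cong)
  fix b :: plane assume b: "b \<in> Basis"
  show "ip (wd b u) (wd b \<phi>) = ip (wd b u) (pd b \<phi>)"
    using wd_test[OF assms(2) b] sobolev_wd_L2[OF assms(1) b] sobolev_wd_L2[OF sobolev_test[OF assms(2)] b] test_fun_L2[OF test_fun_pd[OF assms(2) b]]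
    by (intro ip_cong_AE) (auto intro: L2_measurable)
qed simp

text \<open>\<open>bess (\<eta> r\<^sup>2)\<close> is smooth on the plane and satisfies \<open>-\<Delta>u = \<eta>u\<close>. It vanishes on the circle to first order, so
  \<open>sobolev0_if_hardy\<close> shows that it lies in \<open>H\<^sub>0\<^sup>1\<close>.\<close>

lemma bess_eigenfunction:
  assumes \<eta>: "\<eta> > 0" "bess \<eta> = 0" "\<And>s. 0 \<le> s \<Longrightarrow> s < \<eta> \<Longrightarrow> bess s > 0"
  shows "dirichlet_eigenvalue \<eta>"
proof -
  define u where "u z = bess (\<eta> * (norm z)\<^sup>2)" for z :: plane
  have C: "Ck k u" for k
    unfolding u_def[abs_def] by (intro Ck_pser entire_bc Ck_cmult Ck_norm_sq)
  have s: "sobolev (Suc 0) u" by (rule sobolev_smooth[OF C])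
  obtain B where B: "B > 0" "\<And>x. x \<in> {0..\<eta>} \<Longrightarrow> \<bar>bess' x\<bar> \<le> B"
  proof -
    have "compact (bess' ` {0..\<eta>})" by (intro compact_continuous_image pser_continuous entire_diffs entire_bc) simp
    then obtain B where "B > 0" "\<forall>y\<in>bess' ` {0..\<eta>}. norm y \<le> B" using compact_imp_bounded bounded_pos by metis
    then show ?thesis by (intro that[of B]) auto
  qed
  have bound: "\<bar>u z / bd z\<bar> \<le> B * \<eta>" if z: "norm z < 1" for z
  proof -
    define t where "t = (norm z)\<^sup>2"
    have t: "0 \<le> t" "t < 1" using z by (auto simp: t_def norm_sq_less_1)
    have lt: "\<eta> * t < \<eta>" using t \<eta>(1) by simp
    obtain \<xi> where \<xi>: "\<eta> * t < \<xi>" "\<xi> < \<eta>" "bess \<eta> - bess (\<eta> * t) = (\<eta> - \<eta> * t) * bess' \<xi>"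
      using MVT2[OF lt, of bess bess'] bess_deriv by blast
    have "0 \<le> \<eta> * t" using t \<eta>(1) by simp
    then have "\<bar>bess' \<xi>\<bar> \<le> B" using \<xi> by (intro B) auto
    moreover have "u z = - (\<eta> * bd z * bess' \<xi>)" using \<xi>(3) \<eta>(2) by (simp add: u_def bd_def t_def[symmetric] algebra_simps)
    ultimately show ?thesis using bd_pos[OF z] \<eta>(1) by (simp add: abs_mult mult.commute)
  qed
  have L: "L2 (\<lambda>z. u z / bd z)"
  proof (rule L2_bounded_measurable[OF _ bound])
    show "(\<lambda>z. u z / bd z) \<in> borel_measurable (lebesgue_on disk)"
      using L2_measurable[OF sobolev_L2[OF s]] by measurable
  qed
  have "sobolev0 1 u" using sobolev0_if_hardy[OF s L] by simp
  moreover have "\<not> (AE z in lebesgue_on disk. u z = 0)"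
  proof
    assume ae: "AE z in lebesgue_on disk. u z = 0"
    have "u z > 0" if "norm z < 1" for z
      unfolding u_def using that \<eta>(1) by (intro \<eta>(3)) (auto simp: norm_sq_less_1)
    then have pos: "AE z in lebesgue_on disk. u z > 0" by (rule AE_diskI)
    have "AE z in lebesgue_on disk. False" using ae pos by eventually_elim simp
    then obtain N where N: "{z \<in> space (lebesgue_on disk). \<not> False} \<subseteq> N" "emeasure (lebesgue_on disk) N = 0" "N \<in> sets (lebesgue_on disk)"
      by (rule AE_E)
    have "emeasure (lebesgue_on disk) (space (lebesgue_on disk)) \<le> emeasure (lebesgue_on disk) N"
      using N by (intro emeasure_mono) auto
    then have "emeasure (lebesgue_on disk) (space (lebesgue_on disk)) = 0" using N(2) by simp
    then have "emeasure lebesgue disk = 0" by (simp add: emeasure_restrict_space space_restrict_space)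
    moreover have "emeasure lborel (ball (0::plane) 1) > 0"
      using content_ball_pos[of 1 "0::plane"] by (simp add: measure_def enn2real_positive_iff)
    ultimately show False by simp
  qed
  moreover have "grad_ip u \<phi> = \<eta> * ip u \<phi>" if \<phi>: "test_fun \<phi>" for \<phi>
  proof -
    define m where "m t = 2 * \<eta> * bess' (\<eta> * t)" for t
    define m' where "m' t = 2 * \<eta>\<^sup>2 * bess'' (\<eta> * t)" for t
    have dm: "(m has_real_derivative m' t) (at t)" for t
    proof -
      have "((\<lambda>t. bess' (\<eta> * t)) has_real_derivative bess'' (\<eta> * t) * \<eta>) (at t)"
        by (rule DERIV_chain2[OF bess'_deriv]) (auto intro!: derivative_eq_intros)
      then show ?thesis unfolding m_def[abs_def] m'_def by (auto intro!: derivative_eq_intros simp: power2_eq_square)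
    qed
    have p1: "pd b u = (\<lambda>z. m ((norm z)\<^sup>2) * (z \<bullet> b))" for b
    proof
      fix z :: plane
      have "((\<lambda>t. bess (\<eta> * t)) has_real_derivative bess' (\<eta> * (norm z)\<^sup>2) * \<eta>) (at ((norm z)\<^sup>2))"
        by (rule DERIV_chain2[OF bess_deriv]) (auto intro!: derivative_eq_intros)
      from pd_unique[OF has_derivative_radial[OF this]] show "pd b u z = m ((norm z)\<^sup>2) * (z \<bullet> b)"
        by (simp add: u_def[abs_def] m_def inner_commute mult_ac)
    qed
    have p2: "pd b (pd b u) z = m ((norm z)\<^sup>2) * (b \<bullet> b) + 2 * m' ((norm z)\<^sup>2) * (z \<bullet> b) * (z \<bullet> b)" for b z
      unfolding p1 by (rule pd_radial_mult_inner[OF dm])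
    have lap: "pd (1,0) (pd (1,0) u) z + pd (0,1) (pd (0,1) u) z = - \<eta> * u z" for z
    proof -
      obtain x y where z: "z = (x, y)" by (cases z)
      define t where "t = (norm z)\<^sup>2"
      have t: "t = x\<^sup>2 + y\<^sup>2" by (simp add: t_def z norm_Pair)
      have "pd (1,0) (pd (1,0) u) z + pd (0,1) (pd (0,1) u) z = 2 * m t + 2 * t * m' t"
        unfolding p2 t_def[symmetric] unfolding t by (simp add: z inner_prod_def power2_eq_square algebra_simps)
      also have "\<dots> = 4 * \<eta> * (bess' (\<eta> * t) + (\<eta> * t) * bess'' (\<eta> * t))"
        by (simp add: m_def m'_def power2_eq_square algebra_simps)
      also have "\<dots> = - \<eta> * u z" unfolding bess_ode by (simp add: u_def t_def)
      finally show ?thesis .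
    qed
    have Cb: "Ck k (pd b u)" if "b \<in> Basis" for b k by (rule Ck_all_pd[OF C that])
    have L2b: "L2 (pd b (pd b u))" if "b \<in> Basis" for b
      by (intro L2_continuous Ck_continuous[OF Ck_all_pd[OF Cb[OF that] that]])
    have step: "ip (wd b u) (pd b \<phi>) = - ip (pd b (pd b u)) \<phi>" if b: "b \<in> Basis" for b
    proof -
      have "ip (wd b u) (pd b \<phi>) = ip (pd b u) (pd b \<phi>)"
        using wd_smooth[OF C b] sobolev_wd_L2[OF s b] L2_continuous[OF Ck_continuous[OF Cb[OF b]]] test_fun_L2[OF test_fun_pd[OF \<phi> b]]
        by (intro ip_cong_AE_left)
      also have "\<dots> = - ip (pd b (pd b u)) \<phi>" using test_fun_by_parts[OF \<phi> Cb[OF b] b] by simp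
      finally show ?thesis .
    qed
    have "grad_ip u \<phi> = - (ip (pd (1,0) (pd (1,0) u)) \<phi> + ip (pd (0,1) (pd (0,1) u)) \<phi>)"
      unfolding grad_ip_test_right[OF s \<phi>] sum_Basis_plane by (simp add: step)
    also have "\<dots> = - ip (\<lambda>z. pd (1,0) (pd (1,0) u) z + pd (0,1) (pd (0,1) u) z) \<phi>"
      by (simp add: ip_add_left L2b test_fun_L2[OF \<phi>])
    also have "\<dots> = \<eta> * ip u \<phi>" unfolding lap ip_cmult_left by simp
    finally show ?thesis .
  qed
  ultimately show ?thesis unfolding dirichlet_eigenvalue_def by (intro exI[of _ u]) blast
qed

text \<open>Poincare's inequality with the constant \<open>\<eta>\<close>, applied to an eigenfunction.\<close>

lemma dirichlet_eigenvalue_ge: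
  assumes "dirichlet_eigenvalue \<mu>" and \<eta>: "\<eta> > 0" "\<And>s. 0 \<le> s \<Longrightarrow> s < \<eta> \<Longrightarrow> bess s > 0"
  shows "\<eta> \<le> \<mu>"
proof -
  obtain u where u: "sobolev0 1 u" "\<not> (AE z in lebesgue_on disk. u z = 0)"
    "\<And>\<phi>. test_fun \<phi> \<Longrightarrow> grad_ip u \<phi> = \<mu> * ip u \<phi>"
    using assms(1) unfolding dirichlet_eigenvalue_def by blast
  have u0: "sobolev0 (Suc 0) u" using u(1) by simp
  obtain \<phi> where \<phi>: "\<And>n::nat. test_fun (\<phi> n)" "sconv (Suc 0) \<phi> u" "L2lim \<phi> u" "(\<lambda>n. gsq (grad (\<phi> n))) \<longlonglongrightarrow> grad_ip u u"
    using sobolev0_Suc_0E[OF u0] by blast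
  have L: "L2 u" by (rule L2lim_L2(2)[OF \<phi>(3)])
  have "sconv (Suc 0) (\<lambda>n. u) u"
    using sobolev_wd_L2[OF sobolev0_sobolev[OF u0]] by (auto intro: L2lim_const L)
  from sconv_grad_ip[OF this \<phi>(2)] have "(\<lambda>n. \<mu> * ip u (\<phi> n)) \<longlonglongrightarrow> grad_ip u u" by (simp add: u(3) \<phi>(1))
  moreover have "(\<lambda>n. \<mu> * ip u (\<phi> n)) \<longlonglongrightarrow> \<mu> * ip u u"
    by (intro tendsto_mult tendsto_const L2lim_ip L2lim_const L \<phi>)
  ultimately have "grad_ip u u = \<mu> * ip u u" using LIMSEQ_unique by blast
  then have "\<eta> * ip u u \<le> \<mu> * ip u u" using sobolev0_poincare[OF u0 \<eta>] by simp
  moreover have "ip u u > 0" using ip_self_nonneg[of u] ip_self_eq_0_iff[OF L] u(2) by (simp add: order.strict_iff_order)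
  ultimately show ?thesis by simp
qed

text \<open>Numerically \<open>231/40 = 5.775\<close> and \<open>1157/200 = 5.785\<close>. The first zero of \<open>bess\<close> is an eigenvalue and, by Poincare's
  inequality, a lower bound of all eigenvalues, so the least one exists and the constant in Poincare's inequality is \<open>eta1\<close>.\<close>

lemma eta1_facts:
  shows "(231/40) < eta1" "eta1 < (1157/200)" "sobolev0 (Suc 0) u \<Longrightarrow> eta1 * ip u u \<le> grad_ip u u"
proof -
  obtain \<eta> where \<eta>: "(231/40) < \<eta>" "\<eta> < (1157/200)" "bess \<eta> = 0" "\<And>s. 0 \<le> s \<Longrightarrow> s < \<eta> \<Longrightarrow> bess s > 0"
    using bess_first_zero by blast
  have pos: "\<eta> > 0" using \<eta>(1) by simp
  have "eta1 = \<eta>"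
    unfolding eta1_def
  proof (rule Least_equality)
    show "dirichlet_eigenvalue \<eta>" by (rule bess_eigenfunction[OF pos \<eta>(3)]) (rule \<eta>(4))
    show "\<eta> \<le> \<mu>" if "dirichlet_eigenvalue \<mu>" for \<mu> by (rule dirichlet_eigenvalue_ge[OF that pos]) (rule \<eta>(4))
  qed
  then show "(231/40) < eta1" "eta1 < (1157/200)" "sobolev0 (Suc 0) u \<Longrightarrow> eta1 * ip u u \<le> grad_ip u u"
    using \<eta>(1,2) sobolev0_poincare[OF _ pos \<eta>(4)] by auto
qed

section \<open>The nonlinear terms\<close>

abbreviation ex :: plane where "ex \<equiv> (1, 0)"
abbreviation ey :: plane where "ey \<equiv> (0, 1)"

lemma ip_cong_AE_right:
  assumes "AE z in lebesgue_on disk. u z = v z" "L2 u" "L2 v" "L2 w"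
  shows "ip w u = ip w v"
  using assms by (intro ip_cong_AE) (auto intro!: L2_measurable)

subsection \<open>Products\<close>

lemma L2_if_sq_eq_mult:
  assumes m: "m \<in> borel_measurable (lebesgue_on disk)" and p: "L2 p" "L2 q"
    and eq: "AE z in lebesgue_on disk. (m z)\<^sup>2 = p z * q z"
  shows "L2 m" "ip m m \<le> sqrt (ip p p) * sqrt (ip q q)"
proof -
  have "integrable (lebesgue_on disk) (\<lambda>z. (m z)\<^sup>2) \<longleftrightarrow> integrable (lebesgue_on disk) (\<lambda>z. p z * q z)"
    using m L2_measurable[OF p(1)] L2_measurable[OF p(2)] by (intro integrable_cong_AE eq) auto
  then show "L2 m" using L2_integrable_mult[OF p] m by (simp add: L2_def)
  have "ip m m = (LINT z|lebesgue_on disk. p z * q z)"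
    unfolding ip_def power2_eq_square[symmetric]
    using m L2_measurable[OF p(1)] L2_measurable[OF p(2)] by (intro integral_cong_AE eq) auto
  then have "ip m m = ip p q" by (simp add: ip_def)
  then show "ip m m \<le> sqrt (ip p p) * sqrt (ip q q)" using ip_cauchy_schwarz[OF p] by simp
qed

text \<open>The weights that Hardy's inequality provides for \<open>a\<close>, \<open>a'\<close> in \<open>H\<^sub>0\<^sup>1\<close>, \<open>b\<close> in \<open>H\<^sup>1\<close>, \<open>c\<close> in \<open>H\<^sub>0\<^sup>2\<close>.\<close>

lemma L2_mult_weighted:
  assumes a: "sobolev0 (Suc 0) a" "sobolev0 (Suc 0) a'" and b: "sobolev (Suc 0) b" and c: "sobolev0 (Suc (Suc 0)) c"
  shows "L2 (\<lambda>z. a z * a' z / bd z)" "L2 (\<lambda>z. c z * b z / bd z)" "L2 (\<lambda>z. c z * a z / (bd z)\<^sup>2)"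
proof -
  note m = L2_measurable[OF sobolev_L2[OF sobolev0_sobolev[OF a(1)]]] L2_measurable[OF sobolev_L2[OF sobolev0_sobolev[OF a(2)]]]
    L2_measurable[OF sobolev_L2[OF b]] L2_measurable[OF sobolev_L2[OF sobolev0_sobolev[OF c]]]
  note A = sobolev0_L4(1)[OF a(1)] and A' = sobolev0_L4(1)[OF a(2)] and B = sobolev_interior_L4(1)[OF b]
    and C = sobolev0_H2_weights(3)[OF c]
  have "(\<lambda>z. a z * a' z / bd z) \<in> borel_measurable (lebesgue_on disk)" using m by measurable
  then show "L2 (\<lambda>z. a z * a' z / bd z)"
    by (rule L2_if_sq_eq_mult(1)[OF _ A A']) (simp add: power_divide power_mult_distrib power2_eq_square)
  have "(\<lambda>z. c z * b z / bd z) \<in> borel_measurable (lebesgue_on disk)" using m by measurable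
  moreover have "AE z in lebesgue_on disk. (c z * b z / bd z)\<^sup>2 = (c z)\<^sup>2 / (bd z) ^ 3 * (bd z * (b z)\<^sup>2)"
    using AE_bd by eventually_elim (simp add: power2_eq_square power3_eq_cube field_simps)
  ultimately show "L2 (\<lambda>z. c z * b z / bd z)" by (rule L2_if_sq_eq_mult(1)[OF _ C B])
  have "(\<lambda>z. c z * a z / (bd z)\<^sup>2) \<in> borel_measurable (lebesgue_on disk)" using m by measurable
  moreover have "AE z in lebesgue_on disk. (c z * a z / (bd z)\<^sup>2)\<^sup>2 = (c z)\<^sup>2 / (bd z) ^ 3 * ((a z)\<^sup>2 / bd z)"
    using AE_bd by eventually_elim (simp add: power2_eq_square power3_eq_cube field_simps)
  ultimately show "L2 (\<lambda>z. c z * a z / (bd z)\<^sup>2)" by (rule L2_if_sq_eq_mult(1)[OF _ C A])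
qed

text \<open>In two dimensions both factors would be in \<open>L\<^sup>4\<close>. Here the boundary weights of the two \<open>L\<^sup>4\<close> bounds cancel in
  \<open>(a b)\<^sup>2 = a\<^sup>2 / (1 - r\<^sup>2) \<cdot> (1 - r\<^sup>2) b\<^sup>2\<close>, and no extension of \<open>b\<close> across the boundary is needed.\<close>

lemma L2_mult_H01_H1:
  assumes a: "sobolev0 (Suc 0) a" and b: "sobolev (Suc 0) b"
  shows "L2 (\<lambda>z. a z * b z)" "ip (\<lambda>z. a z * b z) (\<lambda>z. a z * b z) \<le> 256 * grad_ip a a * sobolev_sq (Suc 0) b"
proof -
  note m = L2_measurable[OF sobolev_L2[OF sobolev0_sobolev[OF a]]] L2_measurable[OF sobolev_L2[OF b]]
  note A = sobolev0_L4[OF a] and B = sobolev_interior_L4[OF b]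
  have ab: "(\<lambda>z. a z * b z) \<in> borel_measurable (lebesgue_on disk)" using m by measurable
  have eq: "AE z in lebesgue_on disk. (a z * b z)\<^sup>2 = (a z)\<^sup>2 / bd z * (bd z * (b z)\<^sup>2)"
    using AE_bd by eventually_elim (simp add: power2_eq_square field_simps)
  note L = L2_if_sq_eq_mult[OF ab A(1) B(1) eq]
  show "L2 (\<lambda>z. a z * b z)" by (rule L(1))
  have "sqrt (ip (\<lambda>z. (a z)\<^sup>2 / bd z) (\<lambda>z. (a z)\<^sup>2 / bd z)) \<le> sqrt (16 * (grad_ip a a)\<^sup>2)"
    by (rule real_sqrt_le_mono[OF A(2)])
  also have "\<dots> = 4 * grad_ip a a" using grad_ip_nonneg[of a] by (simp add: real_sqrt_mult)
  finally have 1: "sqrt (ip (\<lambda>z. (a z)\<^sup>2 / bd z) (\<lambda>z. (a z)\<^sup>2 / bd z)) \<le> 4 * grad_ip a a" .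
  have "sqrt (ip (\<lambda>z. bd z * (b z)\<^sup>2) (\<lambda>z. bd z * (b z)\<^sup>2)) \<le> sqrt (16 * (16 * sobolev_sq (Suc 0) b)\<^sup>2)"
    by (rule real_sqrt_le_mono[OF B(2)])
  also have "\<dots> = 64 * sobolev_sq (Suc 0) b"
    using sobolev_sq_nonneg[of "Suc 0" b] by (simp add: real_sqrt_mult del: sobolev_sq.simps)
  finally have 2: "sqrt (ip (\<lambda>z. bd z * (b z)\<^sup>2) (\<lambda>z. bd z * (b z)\<^sup>2)) \<le> 64 * sobolev_sq (Suc 0) b" .
  have "sqrt (ip (\<lambda>z. (a z)\<^sup>2 / bd z) (\<lambda>z. (a z)\<^sup>2 / bd z)) * sqrt (ip (\<lambda>z. bd z * (b z)\<^sup>2) (\<lambda>z. bd z * (b z)\<^sup>2))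
      \<le> (4 * grad_ip a a) * (64 * sobolev_sq (Suc 0) b)"
    using grad_ip_nonneg[of a] ip_self_nonneg by (intro mult_mono 1 2) auto
  with L(2) show "ip (\<lambda>z. a z * b z) (\<lambda>z. a z * b z) \<le> 256 * grad_ip a a * sobolev_sq (Suc 0) b"
    by (simp del: sobolev_sq.simps)
qed

lemma L2lim_mult_right:
  assumes a: "sobolev0 (Suc 0) a" and b: "\<And>n. sobolev (Suc 0) (f n)" "sobolev (Suc 0) b" "sconv (Suc 0) f b"
  shows "L2lim (\<lambda>n z. a z * f n z) (\<lambda>z. a z * b z)"
proof (rule L2limI_bound)
  show "L2 (\<lambda>z. a z * f n z)" "L2 (\<lambda>z. a z * b z)" for n by (intro L2_mult_H01_H1(1) a b)+
  have "(\<lambda>n. sobolev_sq (Suc 0) (\<lambda>z. b z - f n z)) \<longlonglongrightarrow> 0" using sconv_iff[of "Suc 0" f b] b by blast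
  from tendsto_mult[OF tendsto_const this, of "256 * grad_ip a a"]
  show "(\<lambda>n. 256 * grad_ip a a * sobolev_sq (Suc 0) (\<lambda>z. b z - f n z)) \<longlonglongrightarrow> 0" by (simp del: sobolev_sq.simps)
  fix n
  have "ip (\<lambda>z. a z * f n z - a z * b z) (\<lambda>z. a z * f n z - a z * b z) = ip (\<lambda>z. a z * (b z - f n z)) (\<lambda>z. a z * (b z - f n z))"
    by (rule ip_cong) (simp add: algebra_simps)
  also have "\<dots> \<le> 256 * grad_ip a a * sobolev_sq (Suc 0) (\<lambda>z. b z - f n z)"
    by (intro L2_mult_H01_H1 a sobolev_diff b)
  finally show "ip (\<lambda>z. a z * f n z - a z * b z) (\<lambda>z. a z * f n z - a z * b z) \<le> 256 * grad_ip a a * sobolev_sq (Suc 0) (\<lambda>z. b z - f n z)" .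
qed

lemma L2lim_mult_left:
  assumes a: "\<And>n. sobolev0 (Suc 0) (f n)" "sobolev0 (Suc 0) a" "sconv (Suc 0) f a" and b: "sobolev (Suc 0) b"
  shows "L2lim (\<lambda>n z. f n z * b z) (\<lambda>z. a z * b z)"
proof (rule L2limI_bound)
  show "L2 (\<lambda>z. f n z * b z)" "L2 (\<lambda>z. a z * b z)" for n by (intro L2_mult_H01_H1(1) a b)+
  have "(\<lambda>n. sobolev_sq (Suc 0) (\<lambda>z. a z - f n z)) \<longlonglongrightarrow> 0"
    using sconv_iff[of "Suc 0" f a] sobolev0_sobolev[OF a(1)] sobolev0_sobolev[OF a(2)] a(3) by blast
  from tendsto_mult[OF tendsto_const this, of "256 * sobolev_sq (Suc 0) b"]
  show "(\<lambda>n. 256 * sobolev_sq (Suc 0) b * sobolev_sq (Suc 0) (\<lambda>z. a z - f n z)) \<longlonglongrightarrow> 0" by (simp del: sobolev_sq.simps)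
  fix n
  have g: "grad_ip (\<lambda>z. a z - f n z) (\<lambda>z. a z - f n z) \<le> sobolev_sq (Suc 0) (\<lambda>z. a z - f n z)"
    using ip_self_nonneg[of "\<lambda>z. a z - f n z"] by (simp add: grad_ip_def)
  have "ip (\<lambda>z. f n z * b z - a z * b z) (\<lambda>z. f n z * b z - a z * b z) = ip (\<lambda>z. (a z - f n z) * b z) (\<lambda>z. (a z - f n z) * b z)"
    by (rule ip_cong) (simp add: algebra_simps)
  also have "\<dots> \<le> 256 * grad_ip (\<lambda>z. a z - f n z) (\<lambda>z. a z - f n z) * sobolev_sq (Suc 0) b"
    by (intro L2_mult_H01_H1 a sobolev0_diff b)
  also have "\<dots> \<le> 256 * sobolev_sq (Suc 0) (\<lambda>z. a z - f n z) * sobolev_sq (Suc 0) b"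
    by (intro mult_right_mono mult_left_mono g sobolev_sq_nonneg) simp
  finally show "ip (\<lambda>z. f n z * b z - a z * b z) (\<lambda>z. f n z * b z - a z * b z) \<le> 256 * sobolev_sq (Suc 0) b * sobolev_sq (Suc 0) (\<lambda>z. a z - f n z)"
    by (simp only: mult_ac)
qed

subsection \<open>The advection operator\<close>

text \<open>Equal to the advection operator except at the centre of the disk, where polar coordinates are singular.\<close>

definition Jc :: "(plane \<Rightarrow> real) \<Rightarrow> (plane \<Rightarrow> real) \<Rightarrow> plane \<Rightarrow> real" where
  "Jc u v z = wd ex u z * wd ey v z - wd ey u z * wd ex v z"

lemma AE_nonzero: "AE z in lebesgue_on disk. z \<noteq> 0"
proof -
  have "AE z :: plane in lborel. z \<noteq> 0" by (rule AE_lborel_singleton)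
  then have "AE z :: plane in lebesgue. z \<noteq> 0" by (rule AE_completion)
  then have "AE z :: plane in lebesgue. z \<in> disk \<longrightarrow> z \<noteq> 0" by (rule eventually_mono) simp
  then show ?thesis by (simp add: AE_restrict_space_iff)
qed

lemma J_AE: "AE z in lebesgue_on disk. J f g z = Jc f g z"
  using AE_nonzero by eventually_elim (simp add: J_cartesian Jc_def)

lemma J_measurable:
  assumes "sobolev (Suc 0) f" "sobolev (Suc 0) g"
  shows "J f g \<in> borel_measurable (lebesgue_on disk)" "Jc f g \<in> borel_measurable (lebesgue_on disk)"
proof -
  have [measurable]: "wd ex f \<in> borel_measurable (lebesgue_on disk)" "wd ey f \<in> borel_measurable (lebesgue_on disk)"
    "wd ex g \<in> borel_measurable (lebesgue_on disk)" "wd ey g \<in> borel_measurable (lebesgue_on disk)"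
    by (intro L2_measurable sobolev_wd_L2[OF assms(1)] sobolev_wd_L2[OF assms(2)]; simp)+
  have [measurable]: "fst \<in> borel_measurable (lebesgue_on disk)" "snd \<in> borel_measurable (lebesgue_on disk)"
    "(norm :: plane \<Rightarrow> real) \<in> borel_measurable (lebesgue_on disk)"
    by (intro measurable_disk_continuous continuous_intros)+
  show "Jc f g \<in> borel_measurable (lebesgue_on disk)" unfolding Jc_def[abs_def] by measurable
  show "J f g \<in> borel_measurable (lebesgue_on disk)"
    unfolding J_def[abs_def] d_r_def d_theta_def by measurable
qed

lemma ip_J:
  assumes "sobolev (Suc 0) f" "sobolev (Suc 0) g" "L2 h"
  shows "ip h (J f g) = ip h (Jc f g)"
  using J_measurable[OF assms(1,2)] L2_measurable[OF assms(3)] by (intro ip_cong_AE J_AE) auto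

lemma Jc_L2:
  assumes "sobolev0 (Suc (Suc 0)) \<psi>" "sobolev (Suc (Suc 0)) v" shows "L2 (Jc \<psi> v)"
  unfolding Jc_def[abs_def]
  by (intro L2_diff L2_mult_H01_H1 sobolev0_wd[OF assms(1)] sobolev_wd[OF assms(2)]) auto

lemma Jc_L2':
  assumes "sobolev (Suc (Suc 0)) w" "sobolev0 (Suc (Suc 0)) v" shows "L2 (Jc w v)"
proof -
  have "L2 (\<lambda>z. wd ey v z * wd ex w z - wd ex v z * wd ey w z)"
    by (intro L2_diff L2_mult_H01_H1 sobolev0_wd[OF assms(2)] sobolev_wd[OF assms(1)]) auto
  then show ?thesis unfolding Jc_def[abs_def] by (simp add: mult.commute)
qed

lemma sconv_wd: "sconv (Suc k) f u \<Longrightarrow> b \<in> Basis \<Longrightarrow> sconv k (\<lambda>n. wd b (f n)) (wd b u)"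
  by simp

lemma Jc_lim:
  assumes "sobolev0 (Suc (Suc 0)) \<psi>" "\<And>n. sobolev (Suc (Suc 0)) (f n)" "sobolev (Suc (Suc 0)) v" "sconv (Suc (Suc 0)) f v"
  shows "L2lim (\<lambda>n. Jc \<psi> (f n)) (Jc \<psi> v)"
  unfolding Jc_def[abs_def]
  by (intro L2lim_diff L2lim_mult_right sobolev0_wd[OF assms(1)] sobolev_wd[OF assms(2)] sobolev_wd[OF assms(3)] sconv_wd[OF assms(4)]) auto

lemma Jc_lim':
  assumes "sobolev (Suc (Suc 0)) w" "\<And>n. sobolev0 (Suc (Suc 0)) (f n)" "sobolev0 (Suc (Suc 0)) v" "sconv (Suc (Suc 0)) f v"
  shows "L2lim (\<lambda>n. Jc w (f n)) (Jc w v)"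
proof -
  have "L2lim (\<lambda>n z. wd ey (f n) z * wd ex w z - wd ex (f n) z * wd ey w z) (\<lambda>z. wd ey v z * wd ex w z - wd ex v z * wd ey w z)"
    by (intro L2lim_diff L2lim_mult_left sobolev0_wd[OF assms(2)] sobolev0_wd[OF assms(3)] sobolev_wd[OF assms(1)] sconv_wd[OF assms(4)]) auto
  then show ?thesis unfolding Jc_def[abs_def] by (simp add: mult.commute)
qed

text \<open>The right side of the product rule for \<open>\<partial>\<^sub>b J(u, v)\<close>. It makes sense for \<open>v\<close> in \<open>H\<^sub>0\<^sup>3\<close> and is continuous there (\<open>DJ_lim\<close>),
  so that the product rule itself is needed for test functions \<open>v\<close> alone.\<close>

definition DJ :: "plane \<Rightarrow> (plane \<Rightarrow> real) \<Rightarrow> (plane \<Rightarrow> real) \<Rightarrow> plane \<Rightarrow> real" where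
  "DJ b u v z = (wd ey v z * wd b (wd ex u) z + wd ex u z * wd b (wd ey v) z)
    - (wd ex v z * wd b (wd ey u) z + wd ey u z * wd b (wd ex v) z)"

lemma wd_J_test:
  assumes \<psi>: "sobolev (Suc (Suc 0)) \<psi>" and \<phi>: "test_fun \<phi>" and b: "b \<in> Basis"
  shows "L2 (wd b (J \<psi> \<phi>))" "AE z in lebesgue_on disk. wd b (J \<psi> \<phi>) z = DJ b \<psi> \<phi> z"
proof -
  let ?p = "\<lambda>z. pd ey \<phi> z * wd ex \<psi> z" and ?q = "\<lambda>z. pd ex \<phi> z * wd ey \<psi> z"
  have t: "test_fun (pd ex \<phi>)" "test_fun (pd ey \<phi>)" by (intro test_fun_pd \<phi>; simp)+
  have s: "sobolev (Suc 0) (wd ex \<psi>)" "sobolev (Suc 0) (wd ey \<psi>)" by (intro sobolev_wd[OF \<psi>]; simp)+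
  have s1: "sobolev (Suc 0) \<psi>" by (rule sobolev_Suc_D[OF \<psi>])
  have sp: "sobolev (Suc 0) ?p" "sobolev (Suc 0) ?q" by (intro sobolev_mult_smooth s test_fun_Ck t)+
  have sJ: "sobolev (Suc 0) (\<lambda>z. ?p z - ?q z)" by (intro sobolev_diff sp)
  have wx: "AE z in lebesgue_on disk. wd ex \<phi> z = pd ex \<phi> z" and wy: "AE z in lebesgue_on disk. wd ey \<phi> z = pd ey \<phi> z"
    by (intro wd_test \<phi>; simp)+
  have ae: "AE z in lebesgue_on disk. J \<psi> \<phi> z = ?p z - ?q z"
    using J_AE[of \<psi> \<phi>] wx wy by eventually_elim (simp add: Jc_def)
  have "L2 (J \<psi> \<phi>)" by (rule L2_cong_AE[OF ae sobolev_L2[OF sJ] J_measurable(1)[OF s1 sobolev_test[OF \<phi>]]])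
  then have e: "wd b (J \<psi> \<phi>) = wd b (\<lambda>z. ?p z - ?q z)" by (intro wd_cong ae sobolev_L2[OF sJ] b)
  show "L2 (wd b (J \<psi> \<phi>))" unfolding e by (rule sobolev_wd_L2[OF sJ b])
  have wwx: "AE z in lebesgue_on disk. wd b (wd ex \<phi>) z = pd b (pd ex \<phi>) z"
    and wwy: "AE z in lebesgue_on disk. wd b (wd ey \<phi>) z = pd b (pd ey \<phi>) z"
  proof -
    have "wd b (wd ex \<phi>) = wd b (pd ex \<phi>)" "wd b (wd ey \<phi>) = wd b (pd ey \<phi>)"
      by (intro wd_cong wx wy sobolev_wd_L2[OF sobolev_test[OF \<phi>, of "Suc 0"]] test_fun_L2 t b; simp)+
    then show "AE z in lebesgue_on disk. wd b (wd ex \<phi>) z = pd b (pd ex \<phi>) z"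
      "AE z in lebesgue_on disk. wd b (wd ey \<phi>) z = pd b (pd ey \<phi>) z"
      using wd_test[OF t(1) b] wd_test[OF t(2) b] by auto
  qed
  show "AE z in lebesgue_on disk. wd b (J \<psi> \<phi>) z = DJ b \<psi> \<phi> z"
    unfolding e
    using wd_diff[OF sp b] wd_mult_smooth[OF s(1) b test_fun_Ck[OF t(2)]] wd_mult_smooth[OF s(2) b test_fun_Ck[OF t(1)]] wx wy wwx wwy
    by eventually_elim (simp add: DJ_def mult.commute)
qed

lemma DJ_lim:
  assumes \<psi>: "sobolev0 (Suc (Suc 0)) \<psi>" "sobolev (Suc (Suc (Suc 0))) \<psi>"
    and f: "\<And>n. sobolev0 (Suc (Suc (Suc 0))) (f n)" "sobolev0 (Suc (Suc (Suc 0))) v" "sconv (Suc (Suc (Suc 0))) f v" and b: "b \<in> Basis"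
  shows "L2lim (\<lambda>n. DJ b \<psi> (f n)) (DJ b \<psi> v)"
proof -
  note f0 = sobolev0_Suc_D[OF f(1)] sobolev0_Suc_D[OF f(2)] sconv_Suc_D[OF f(3)]
  note s = sobolev0_sobolev[OF f(1)] sobolev0_sobolev[OF f(2)]
  show ?thesis
    unfolding DJ_def[abs_def]
    by (intro L2lim_diff L2lim_add L2lim_mult_left L2lim_mult_right sobolev0_wd[OF f0(1)] sobolev0_wd[OF f0(2)]
        sobolev_wd[OF sobolev_wd[OF \<psi>(2)]] sobolev0_wd[OF \<psi>(1)] sobolev_wd[OF sobolev_wd[OF s(1)]] sobolev_wd[OF sobolev_wd[OF s(2)]]
        sconv_wd[OF f0(3)] sconv_wd[OF sconv_wd[OF f(3)]] b) auto
qed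

subsection \<open>Antisymmetry\<close>

lemma Jc_antisym_test:
  assumes \<psi>: "sobolev (Suc 0) \<psi>" and \<phi>: "test_fun \<phi>"
  shows "ip (wd ex \<psi>) (\<lambda>z. \<phi> z * pd ey \<phi> z) = ip (wd ey \<psi>) (\<lambda>z. \<phi> z * pd ex \<phi> z)"
proof -
  let ?z = "\<lambda>z. \<phi> z * \<phi> z"
  have t: "test_fun ?z" by (rule test_fun_mult[OF \<phi> \<phi>])
  have p: "pd b ?z = (\<lambda>z. 2 * (\<phi> z * pd b \<phi> z))" for b
  proof
    fix z show "pd b ?z z = 2 * (\<phi> z * pd b \<phi> z)"
      by (subst pd_mult) (auto intro: test_fun_differentiable \<phi>)
  qed
  have w: "ip (wd c \<psi>) (pd b ?z) = - ip \<psi> (pd c (pd b ?z))" if "b \<in> Basis" "c \<in> Basis" for b c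
    using weak_partialD[OF sobolev_weak[OF \<psi> that(2)] test_fun_pd[OF t that(1)]] by simp
  have "ip (wd ex \<psi>) (pd ey ?z) = ip (wd ey \<psi>) (pd ex ?z)"
    using w[of ey ex] w[of ex ey] pd_commute[OF t, of ex ey] by simp
  then show ?thesis unfolding p ip_cmult_right by simp
qed

text \<open>\<open>2 w J(\<psi>, w) = J(\<psi>, w\<^sup>2)\<close> is a divergence.\<close>

lemma Jc_antisym:
  assumes w: "sobolev0 (Suc 0) w" "sobolev (Suc (Suc 0)) w" and \<psi>: "sobolev0 (Suc (Suc 0)) \<psi>"
  shows "ip w (Jc \<psi> w) = 0"
proof -
  obtain \<phi> where \<phi>: "\<And>n::nat. test_fun (\<phi> n)" "sconv (Suc 0) \<phi> w" "L2lim \<phi> w" "(\<lambda>n. gsq (grad (\<phi> n))) \<longlonglongrightarrow> grad_ip w w"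
    using sobolev0_Suc_0E[OF w(1)] by blast
  note sw = sobolev0_sobolev[OF w(1)] and Lw = sobolev_L2[OF w(2)]
  have pl: "L2lim (\<lambda>n. pd b (\<phi> n)) (wd b w)" if "b \<in> Basis" for b
    using sconv_test_pd[OF \<phi>(1,2) sw that] by simp
  have ml: "L2lim (\<lambda>n z. wd c \<psi> z * \<phi> n z) (\<lambda>z. wd c \<psi> z * w z)" if "c \<in> Basis" for c
    by (rule L2lim_mult_right[OF sobolev0_wd[OF \<psi> that] sobolev_test[OF \<phi>(1)] sw \<phi>(2)])
  have "(\<lambda>n. ip (\<lambda>z. wd ex \<psi> z * \<phi> n z) (pd ey (\<phi> n)) - ip (\<lambda>z. wd ey \<psi> z * \<phi> n z) (pd ex (\<phi> n)))
    \<longlonglongrightarrow> ip (\<lambda>z. wd ex \<psi> z * w z) (wd ey w) - ip (\<lambda>z. wd ey \<psi> z * w z) (wd ex w)"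
    by (intro tendsto_diff L2lim_ip ml pl) auto
  moreover have "ip (\<lambda>z. wd ex \<psi> z * \<phi> n z) (pd ey (\<phi> n)) - ip (\<lambda>z. wd ey \<psi> z * \<phi> n z) (pd ex (\<phi> n)) = 0" for n
  proof -
    have "ip (\<lambda>z. wd c \<psi> z * \<phi> n z) (pd b (\<phi> n)) = ip (wd c \<psi>) (\<lambda>z. \<phi> n z * pd b (\<phi> n) z)" for b c
      by (rule ip_cong) simp
    then show ?thesis
      using Jc_antisym_test[OF sobolev0_sobolev[OF sobolev0_Suc_D[OF \<psi>]] \<phi>(1)[of n]] by simp
  qed
  ultimately have "ip (\<lambda>z. wd ex \<psi> z * w z) (wd ey w) - ip (\<lambda>z. wd ey \<psi> z * w z) (wd ex w) = 0"
    by (simp add: LIMSEQ_const_iff)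
  moreover have "ip (\<lambda>z. wd c \<psi> z * w z) (wd b w) = ip w (\<lambda>z. wd c \<psi> z * wd b w z)" for b c
    by (rule ip_cong) simp
  moreover have "L2 (\<lambda>z. wd c \<psi> z * wd b w z)" if "b \<in> Basis" "c \<in> Basis" for b c
    by (intro L2_mult_H01_H1 sobolev0_wd[OF \<psi>] sobolev_wd[OF w(2)] that)
  ultimately show ?thesis unfolding Jc_def[abs_def] by (simp add: ip_diff_right Lw)
qed

subsection \<open>The nonlinear terms tested with the solution\<close>

text \<open>The pairings of the nonlinear terms of the axial and the stream equation with a function \<open>v\<close> that need not be smooth.\<close>

definition NL1 :: "real \<Rightarrow> (plane \<Rightarrow> real) \<Rightarrow> (plane \<Rightarrow> real) \<Rightarrow> (plane \<Rightarrow> real) \<Rightarrow> real" where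
  "NL1 \<epsilon> w \<psi> v = ip (\<lambda>z. w z - \<epsilon> * lap w z) (Jc \<psi> v)"

definition NL2 :: "real \<Rightarrow> (plane \<Rightarrow> real) \<Rightarrow> (plane \<Rightarrow> real) \<Rightarrow> (plane \<Rightarrow> real) \<Rightarrow> real" where
  "NL2 \<epsilon> w \<psi> v = ip (lap \<psi>) (Jc \<psi> v) + \<epsilon> * (\<Sum>b\<in>Basis. ip (wd b (lap \<psi>)) (DJ b \<psi> v)) + \<epsilon> * ip (lap w) (Jc w v)"

lemma ip_expand:
  assumes "L2 u" "L2 l" "L2 a" "L2 b"
  shows "ip (\<lambda>z. u z - e * l z) (\<lambda>z. a z + b z) = ip u a + ip u b - e * (ip l a + ip l b)"
  using assms by (simp add: ip_add_right ip_diff_left ip_cmult_left L2_diff L2_cmult L2_add algebra_simps)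

lemma lap_sobolev: "sobolev (Suc (Suc k)) u \<Longrightarrow> sobolev k (lap u)"
  unfolding lap_def[abs_def] by (intro sobolev_sum sobolev_wd)

lemma lap_L2: "sobolev (Suc (Suc k)) u \<Longrightarrow> L2 (lap u)"
  using lap_sobolev sobolev_L2 by blast

lemma NL1_lim:
  assumes w: "sobolev (Suc (Suc 0)) w" and \<psi>: "sobolev0 (Suc (Suc 0)) \<psi>"
    and f: "\<And>n. sobolev (Suc (Suc 0)) (f n)" "sobolev (Suc (Suc 0)) v" "sconv (Suc (Suc 0)) f v"
  shows "(\<lambda>n. NL1 \<epsilon> w \<psi> (f n)) \<longlonglongrightarrow> NL1 \<epsilon> w \<psi> v"
  unfolding NL1_def
  by (intro L2lim_ip L2lim_const Jc_lim \<psi> f L2_diff L2_cmult lap_L2[OF w] sobolev_L2[OF w])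

lemma NL2_lim:
  assumes w: "sobolev (Suc (Suc 0)) w" and \<psi>: "sobolev0 (Suc (Suc 0)) \<psi>" "sobolev (Suc (Suc (Suc 0))) \<psi>"
    and f: "\<And>n. sobolev0 (Suc (Suc (Suc 0))) (f n)" "sobolev0 (Suc (Suc (Suc 0))) v" "sconv (Suc (Suc (Suc 0))) f v"
  shows "(\<lambda>n. NL2 \<epsilon> w \<psi> (f n)) \<longlonglongrightarrow> NL2 \<epsilon> w \<psi> v"
proof -
  note f0 = sobolev0_Suc_D[OF f(1)] sobolev0_Suc_D[OF f(2)] sconv_Suc_D[OF f(3)]
  show ?thesis
    unfolding NL2_def
    by (intro tendsto_add tendsto_mult tendsto_const tendsto_sum L2lim_ip L2lim_const Jc_lim Jc_lim' DJ_lim \<psi> w f f0 lap_L2[OF w]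
        lap_L2[OF \<psi>(2)] sobolev_wd_L2[OF lap_sobolev[OF \<psi>(2)]] sobolev0_sobolev[OF f0(1)] sobolev0_sobolev[OF f0(2)])
qed

text \<open>Cutting off the solution itself, all terms in which no derivative falls on the cut-off cancel except
  \<open>-\<langle>w, J(\<psi>, w)\<rangle>\<close>; in the others the derivatives of the cut-off are compensated by the boundary weights.\<close>

lemma nonlinear_cancellation:
  assumes w: "sobolev0 (Suc 0) w" "sobolev (Suc (Suc 0)) w"
    and \<psi>: "sobolev0 (Suc (Suc 0)) \<psi>" "sobolev (Suc (Suc (Suc 0))) \<psi>"
  shows "(\<lambda>n. NL2 \<epsilon> w \<psi> (\<lambda>z. cutn n z * \<psi> z) - NL1 \<epsilon> w \<psi> (\<lambda>z. cutn n z * w z)) \<longlonglongrightarrow> 0"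
proof -
  note s1 = sobolev0_sobolev[OF \<psi>(1)] sobolev0_Suc_D[OF \<psi>(1)] sobolev0_sobolev[OF w(1)]
  have \<psi>b: "sobolev0 (Suc 0) (wd b \<psi>)" if "b \<in> Basis" for b by (rule sobolev0_wd[OF \<psi>(1) that])
  have \<psi>bc: "sobolev (Suc 0) (wd c (wd b \<psi>))" if "b \<in> Basis" "c \<in> Basis" for b c
    by (intro sobolev_wd[OF sobolev_wd[OF \<psi>(2)]] that)
  have wb: "sobolev (Suc 0) (wd b w)" if "b \<in> Basis" for b by (rule sobolev_wd[OF w(2) that])
  note t = test_fun_cutn
  have tb: "test_fun (pd b (cutn n))" if "b \<in> Basis" for b n by (intro test_fun_pd t that)
  have [simp]: "ex \<in> Basis" "ey \<in> Basis" by simp_all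
  have Lw: "L2 w" and Llw: "L2 (lap w)" and Ll\<psi>: "L2 (lap \<psi>)" and Lbl: "\<And>b. b \<in> Basis \<Longrightarrow> L2 (wd b (lap \<psi>))"
    using sobolev_L2[OF w(2)] lap_L2[OF w(2)] lap_L2[OF \<psi>(2)] sobolev_wd_L2[OF lap_sobolev[OF \<psi>(2)]] by auto
  define q where "q n z = pd ey (cutn n) z * wd ex \<psi> z - pd ex (cutn n) z * wd ey \<psi> z" for n z
  define qw where "qw n z = pd ey (cutn n) z * wd ex w z - pd ex (cutn n) z * wd ey w z" for n z
  define R where "R b n z = (pd ey (cutn n) z * (\<psi> z * wd b (wd ex \<psi>) z) - pd ex (cutn n) z * (\<psi> z * wd b (wd ey \<psi>) z))
    + (pd b (pd ey (cutn n)) z * (\<psi> z * wd ex \<psi> z) - pd b (pd ex (cutn n)) z * (\<psi> z * wd ey \<psi> z))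
    + (pd ey (cutn n) z * (wd b \<psi> z * wd ex \<psi> z) - pd ex (cutn n) z * (wd b \<psi> z * wd ey \<psi> z))" for b n z
  \<comment> \<open>the terms in which a derivative falls on the cut-off tend to 0\<close>
  have m: "a \<in> borel_measurable (lebesgue_on disk)" if "sobolev (Suc 0) a" for a by (rule L2_measurable[OF sobolev_L2[OF that]])
  have mm: "(\<lambda>z. a z * c z) \<in> borel_measurable (lebesgue_on disk)" if "sobolev (Suc 0) a" "sobolev (Suc 0) c" for a c
    using m[OF that(1)] m[OF that(2)] by measurable
  have lim1: "L2lim (\<lambda>n z. pd b (cutn n) z * (a z * c z)) (\<lambda>z. 0)" if "sobolev0 (Suc 0) a" "sobolev0 (Suc 0) c" "b \<in> Basis" for a b c
    using that by (intro L2lim_pd_cut mm L2_mult_weighted(1)[OF _ _ wb[of ex] \<psi>(1)] sobolev0_sobolev) auto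
  have lim2: "L2lim (\<lambda>n z. pd b (cutn n) z * (\<psi> z * c z)) (\<lambda>z. 0)" if "sobolev (Suc 0) c" "b \<in> Basis" for b c
    using that by (intro L2lim_pd_cut mm L2_mult_weighted(2)[OF w(1) w(1) _ \<psi>(1)] sobolev0_sobolev[OF s1(2)]) auto
  have lim3: "L2lim (\<lambda>n z. pd d (pd b (cutn n)) z * (\<psi> z * c z)) (\<lambda>z. 0)" if "sobolev0 (Suc 0) c" "b \<in> Basis" "d \<in> Basis" for b c d
    using that by (intro L2lim_pd_pd_cut mm L2_mult_weighted(3)[OF _ w(1) wb[of ex] \<psi>(1)] sobolev0_sobolev[OF s1(2)] sobolev0_sobolev) auto
  have Lq: "L2lim (\<lambda>n z. pd ey (cutn n) z * (w z * wd ex \<psi> z) - pd ex (cutn n) z * (w z * wd ey \<psi> z)) (\<lambda>z. 0 - 0)"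
    by (intro L2lim_diff lim1 w \<psi>b) auto
  then have Lwq: "L2lim (\<lambda>n z. w z * q n z) (\<lambda>z. 0)" by (simp add: q_def algebra_simps)
  have "L2lim (\<lambda>n z. pd ey (cutn n) z * (\<psi> z * wd ex \<psi> z) - pd ex (cutn n) z * (\<psi> z * wd ey \<psi> z)) (\<lambda>z. 0 - 0)"
    by (intro L2lim_diff lim1 s1 \<psi>b) auto
  then have L\<psi>q: "L2lim (\<lambda>n z. \<psi> z * q n z) (\<lambda>z. 0)" by (simp add: q_def algebra_simps)
  have "L2lim (\<lambda>n z. pd ey (cutn n) z * (\<psi> z * wd ex w z) - pd ex (cutn n) z * (\<psi> z * wd ey w z)) (\<lambda>z. 0 - 0)"
    by (intro L2lim_diff lim2 wb) auto
  then have L\<psi>qw: "L2lim (\<lambda>n z. \<psi> z * qw n z) (\<lambda>z. 0)" by (simp add: qw_def algebra_simps)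
  have LR: "L2lim (R b) (\<lambda>z. 0)" if b: "b \<in> Basis" for b
  proof -
    have "L2lim (\<lambda>n z. R b n z) (\<lambda>z. (0 - 0) + (0 - 0) + (0 - 0))"
      unfolding R_def by (intro L2lim_add L2lim_diff lim1 lim2 lim3 \<psi>b \<psi>bc b) auto
    then show ?thesis by simp
  qed
  have LJ: "L2 (Jc \<psi> w)" by (rule Jc_L2[OF \<psi>(1) w(2)])
  have LcJ: "L2lim (\<lambda>n z. cutn n z * Jc \<psi> w z) (Jc \<psi> w)" by (rule L2lim_cut[OF LJ])
  \<comment> \<open>the cut-off functions inserted: \<open>J(\<psi>, \<chi>\<^sub>n \<psi>) = \<psi> J(\<psi>, \<chi>\<^sub>n)\<close>, because \<open>J(\<psi>, \<psi>) = 0\<close>\<close>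
  have wdw: "AE z in lebesgue_on disk. wd b (\<lambda>z. cutn n z * w z) z = pd b (cutn n) z * w z + cutn n z * wd b w z" if "b \<in> Basis" for b n
    by (rule wd_mult_smooth[OF s1(3) that test_fun_Ck[OF t]])
  have wd\<psi>: "AE z in lebesgue_on disk. wd b (\<lambda>z. cutn n z * \<psi> z) z = pd b (cutn n) z * \<psi> z + cutn n z * wd b \<psi> z" if "b \<in> Basis" for b n
    by (rule wd_mult_smooth[OF s1(1) that test_fun_Ck[OF t]])
  have sc\<psi>: "sobolev0 (Suc (Suc (Suc 0))) (\<lambda>z. cutn n z * \<psi> z)" and scw: "sobolev0 (Suc (Suc 0)) (\<lambda>z. cutn n z * w z)" for n
    by (intro sobolev0_mult_test \<psi> w t)+
  have J1: "AE z in lebesgue_on disk. Jc \<psi> (\<lambda>z. cutn n z * w z) z = cutn n z * Jc \<psi> w z + w z * q n z" for n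
    using wdw[of ex n] wdw[of ey n] by (auto simp: Jc_def q_def algebra_simps elim!: eventually_elim2)
  have J2: "AE z in lebesgue_on disk. Jc \<psi> (\<lambda>z. cutn n z * \<psi> z) z = \<psi> z * q n z" for n
    using wd\<psi>[of ex n] wd\<psi>[of ey n] by (auto simp: Jc_def q_def algebra_simps elim!: eventually_elim2)
  have J3: "AE z in lebesgue_on disk. Jc w (\<lambda>z. cutn n z * \<psi> z) z = \<psi> z * qw n z - cutn n z * Jc \<psi> w z" for n
    using wd\<psi>[of ex n] wd\<psi>[of ey n] by (auto simp: Jc_def qw_def algebra_simps elim!: eventually_elim2)
  have wdd: "AE z in lebesgue_on disk. wd b (wd c (\<lambda>z. cutn n z * \<psi> z)) z
      = pd b (pd c (cutn n)) z * \<psi> z + pd c (cutn n) z * wd b \<psi> z + pd b (cutn n) z * wd c \<psi> z + cutn n z * wd b (wd c \<psi>) z"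
    if bc: "b \<in> Basis" "c \<in> Basis" for b c n
  proof -
    have sa: "sobolev (Suc 0) (\<lambda>z. pd c (cutn n) z * \<psi> z)" "sobolev (Suc 0) (\<lambda>z. cutn n z * wd c \<psi> z)"
      by (intro sobolev_mult_smooth sobolev0_sobolev[OF s1(2)] sobolev0_sobolev[OF \<psi>b] bc test_fun_Ck t tb)+
    have e: "wd b (wd c (\<lambda>z. cutn n z * \<psi> z)) = wd b (\<lambda>z. pd c (cutn n) z * \<psi> z + cutn n z * wd c \<psi> z)"
      by (intro wd_cong wd\<psi> bc sobolev_L2[OF sobolev_add[OF sa]] sobolev_wd_L2[OF sobolev0_sobolev[OF sc\<psi>] bc(2)])
    show ?thesis unfolding e
      using wd_add[OF sa bc(1)] wd_mult_smooth[OF sobolev0_sobolev[OF s1(2)] bc(1) test_fun_Ck[OF tb[OF bc(2)]], of n]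
        wd_mult_smooth[OF sobolev0_sobolev[OF \<psi>b[OF bc(2)]] bc(1) test_fun_Ck[OF t], of n]
      by eventually_elim simp
  qed
  have J4: "AE z in lebesgue_on disk. DJ b \<psi> (\<lambda>z. cutn n z * \<psi> z) z = R b n z" if b: "b \<in> Basis" for b n
    using wd\<psi>[of ex n, simplified] wd\<psi>[of ey n, simplified] wdd[OF b, of ex n, simplified] wdd[OF b, of ey n, simplified]
    by eventually_elim (simp add: DJ_def R_def algebra_simps)
  have sws: "sobolev (Suc (Suc 0)) (\<lambda>z. cutn n z * w z)" "sobolev (Suc (Suc 0)) (\<lambda>z. cutn n z * \<psi> z)" for n
    using sobolev0_sobolev[OF scw[of n]] sobolev0_sobolev[OF sobolev0_Suc_D[OF sc\<psi>[of n]]] by auto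
  have L1: "L2 (Jc \<psi> (\<lambda>z. cutn n z * w z))" and L2': "L2 (Jc \<psi> (\<lambda>z. cutn n z * \<psi> z))" for n
    by (intro Jc_L2 \<psi> sws)+
  have L3: "L2 (Jc w (\<lambda>z. cutn n z * \<psi> z))" for n
    by (intro Jc_L2' w sobolev0_Suc_D[OF sc\<psi>])
  have L4: "L2 (DJ b \<psi> (\<lambda>z. cutn n z * \<psi> z))" if b: "b \<in> Basis" for b n
    by (rule L2_cong_AE[OF J4[OF b] L2lim_L2(1)[OF LR[OF b]]])
      (use b sobolev_wd_L2[OF sws(2)] sobolev_wd_L2[OF sobolev_wd[OF sws(2)]] sobolev_wd_L2[OF s1(1)] sobolev_wd_L2[OF sobolev_wd[OF s1(1)]]
        in \<open>unfold DJ_def[abs_def], intro borel_measurable_diff borel_measurable_add borel_measurable_times L2_measurable, auto\<close>)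
  note l = L2lim_L2(1)[OF LcJ] L2lim_L2(1)[OF Lwq] L2lim_L2(1)[OF L\<psi>q] L2lim_L2(1)[OF L\<psi>qw] L2lim_L2(1)[OF LR]
  have N1: "NL1 \<epsilon> w \<psi> (\<lambda>z. cutn n z * w z) = ip w (\<lambda>z. cutn n z * Jc \<psi> w z) + ip w (\<lambda>z. w z * q n z)
      - \<epsilon> * (ip (lap w) (\<lambda>z. cutn n z * Jc \<psi> w z) + ip (lap w) (\<lambda>z. w z * q n z))" for n
  proof -
    have "NL1 \<epsilon> w \<psi> (\<lambda>z. cutn n z * w z) = ip (\<lambda>z. w z - \<epsilon> * lap w z) (\<lambda>z. cutn n z * Jc \<psi> w z + w z * q n z)"
      unfolding NL1_def by (intro ip_cong_AE_right J1 L1 L2_add L2_diff L2_cmult l Lw Llw)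
    also have "\<dots> = ip w (\<lambda>z. cutn n z * Jc \<psi> w z) + ip w (\<lambda>z. w z * q n z)
      - \<epsilon> * (ip (lap w) (\<lambda>z. cutn n z * Jc \<psi> w z) + ip (lap w) (\<lambda>z. w z * q n z))"
      by (rule ip_expand[OF Lw Llw l(1,2)])
    finally show ?thesis .
  qed
  have N2: "NL2 \<epsilon> w \<psi> (\<lambda>z. cutn n z * \<psi> z) = ip (lap \<psi>) (\<lambda>z. \<psi> z * q n z) + \<epsilon> * (\<Sum>b\<in>Basis. ip (wd b (lap \<psi>)) (R b n))
      + \<epsilon> * (ip (lap w) (\<lambda>z. \<psi> z * qw n z) - ip (lap w) (\<lambda>z. cutn n z * Jc \<psi> w z))" for n
  proof -
    have "ip (lap \<psi>) (Jc \<psi> (\<lambda>z. cutn n z * \<psi> z)) = ip (lap \<psi>) (\<lambda>z. \<psi> z * q n z)"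
      by (intro ip_cong_AE_right J2 L2' l Ll\<psi>)
    moreover have "ip (wd b (lap \<psi>)) (DJ b \<psi> (\<lambda>z. cutn n z * \<psi> z)) = ip (wd b (lap \<psi>)) (R b n)" if "b \<in> Basis" for b
      using that by (intro ip_cong_AE_right J4 L4 l Lbl)
    moreover have "ip (lap w) (Jc w (\<lambda>z. cutn n z * \<psi> z)) = ip (lap w) (\<lambda>z. \<psi> z * qw n z - cutn n z * Jc \<psi> w z)"
      by (intro ip_cong_AE_right J3 L3 L2_diff l Llw)
    moreover have "\<dots> = ip (lap w) (\<lambda>z. \<psi> z * qw n z) - ip (lap w) (\<lambda>z. cutn n z * Jc \<psi> w z)"
      by (rule ip_diff_right[OF l(4,1) Llw])
    ultimately show ?thesis unfolding NL2_def by (simp only: cong: sum.cong)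
  qed
  have diff: "NL2 \<epsilon> w \<psi> (\<lambda>z. cutn n z * \<psi> z) - NL1 \<epsilon> w \<psi> (\<lambda>z. cutn n z * w z) =
      ip (lap \<psi>) (\<lambda>z. \<psi> z * q n z) + \<epsilon> * (\<Sum>b\<in>Basis. ip (wd b (lap \<psi>)) (R b n)) + \<epsilon> * ip (lap w) (\<lambda>z. \<psi> z * qw n z)
      - ip w (\<lambda>z. cutn n z * Jc \<psi> w z) - ip w (\<lambda>z. w z * q n z) + \<epsilon> * ip (lap w) (\<lambda>z. w z * q n z)" for n
    unfolding N1 N2 by (simp add: algebra_simps)
  have "(\<lambda>n. ip (lap \<psi>) (\<lambda>z. \<psi> z * q n z) + \<epsilon> * (\<Sum>b\<in>Basis. ip (wd b (lap \<psi>)) (R b n)) + \<epsilon> * ip (lap w) (\<lambda>z. \<psi> z * qw n z)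
      - ip w (\<lambda>z. cutn n z * Jc \<psi> w z) - ip w (\<lambda>z. w z * q n z) + \<epsilon> * ip (lap w) (\<lambda>z. w z * q n z))
    \<longlonglongrightarrow> ip (lap \<psi>) (\<lambda>z. 0) + \<epsilon> * (\<Sum>b\<in>Basis. ip (wd b (lap \<psi>)) (\<lambda>z. 0)) + \<epsilon> * ip (lap w) (\<lambda>z. 0)
      - ip w (Jc \<psi> w) - ip w (\<lambda>z. 0) + \<epsilon> * ip (lap w) (\<lambda>z. 0)"
    by (intro tendsto_add tendsto_diff tendsto_mult tendsto_const tendsto_sum L2lim_ip L2lim_const L\<psi>q LR L\<psi>qw LcJ Lwq Lw Llw Ll\<psi> Lbl)
  then show ?thesis unfolding diff using Jc_antisym[OF w \<psi>(1)] by simp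
qed

section \<open>The linear terms\<close>

lemma sconv_const: "sobolev k u \<Longrightarrow> sconv k (\<lambda>n. u) u"
  by (induction k arbitrary: u) (auto intro: L2lim_const sobolev_wd sobolev_L2 simp del: sobolev.simps(2))

lemma grad_ip_commute: "grad_ip u v = grad_ip v u"
  by (simp add: grad_ip_def ip_commute)

lemma sobolev0_E:
  assumes "sobolev0 k u"
  obtains \<phi> where "\<And>n::nat. test_fun (\<phi> n)" "sconv k \<phi> u"
  using assms unfolding sobolev0_iff by (elim conjE exE) (rule that, auto)

lemma L2lim_lap: "sconv (Suc (Suc k)) f u \<Longrightarrow> L2lim (\<lambda>n. lap (f n)) (lap u)"
  unfolding lap_def[abs_def] by (intro L2lim_sum sconv_L2lim[of k]) simp

lemma L2lim_d_theta:
  assumes "sconv (Suc k) f u" shows "L2lim (\<lambda>n. d_theta (f n)) (d_theta u)"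
proof -
  have "L2lim (\<lambda>n. wd b (f n)) (wd b u)" if "b \<in> Basis" for b
    by (rule sconv_L2lim[OF sconv_wd[OF assms that]])
  then show ?thesis unfolding d_theta_def[abs_def]
    by (intro L2lim_diff L2lim_mult_continuous continuous_intros) auto
qed

lemma sobolev0_mult_smooth:
  assumes "sobolev0 (Suc 0) u" "\<And>k. Ck k f" shows "sobolev0 (Suc 0) (\<lambda>z. f z * u z)"
proof (rule sobolev0_if_hardy)
  show "sobolev (Suc 0) (\<lambda>z. f z * u z)" by (intro sobolev_mult_smooth sobolev0_sobolev assms)
  show "L2 (\<lambda>z. f z * u z / bd z)"
    using L2_mult_continuous[OF sobolev0_hardy(1)[OF assms(1)] Ck_continuous[OF assms(2)]] by simp
qed

lemma sobolev0_d_theta: "sobolev0 (Suc (Suc 0)) \<psi> \<Longrightarrow> sobolev0 (Suc 0) (d_theta \<psi>)"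
  unfolding d_theta_def[abs_def] by (intro sobolev0_diff sobolev0_mult_smooth sobolev0_wd Ck_fst Ck_snd) auto

text \<open>Only \<open>a\<close> has to vanish on the boundary. This identifies the term \<open>\<epsilon>R \<langle>\<Delta>w, \<psi>\<^sub>\<theta>\<rangle>\<close> of the stream equation with the
  gradient term of \<open>I2\<close>.\<close>

lemma grad_ip_by_parts:
  assumes a: "sobolev0 (Suc 0) a" and w: "sobolev (Suc (Suc 0)) w"
  shows "grad_ip a w = - ip (lap w) a"
proof -
  obtain \<phi> where \<phi>: "\<And>n::nat. test_fun (\<phi> n)" "sconv (Suc 0) \<phi> a" using sobolev0_E[OF a] by blast
  note sw = sobolev_Suc_D[OF w]
  have "grad_ip w (\<phi> n) = - ip (lap w) (\<phi> n)" for n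
  proof -
    have "ip (wd b w) (pd b (\<phi> n)) = - ip (wd b (wd b w)) (\<phi> n)" if "b \<in> Basis" for b
      by (rule weak_partialD[OF sobolev_weak[OF sobolev_wd[OF w that] that] \<phi>(1)])
    moreover have "ip (lap w) (\<phi> n) = (\<Sum>b\<in>Basis. ip (wd b (wd b w)) (\<phi> n))"
      unfolding lap_def[abs_def] by (intro ip_sum_left sobolev_wd_L2[OF sobolev_wd[OF w]] test_fun_L2 \<phi>)
    ultimately show ?thesis unfolding grad_ip_test_right[OF sw \<phi>(1)] by (simp add: sum_negf)
  qed
  moreover have "(\<lambda>n. grad_ip w (\<phi> n)) \<longlonglongrightarrow> grad_ip w a" by (rule sconv_grad_ip[OF sconv_const[OF sw] \<phi>(2)])
  moreover have "(\<lambda>n. - ip (lap w) (\<phi> n)) \<longlonglongrightarrow> - ip (lap w) a"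
    by (intro tendsto_minus L2lim_ip L2lim_const lap_L2[OF w] sconv_L2lim[OF \<phi>(2)])
  ultimately show ?thesis using LIMSEQ_unique by (simp add: grad_ip_commute)
qed

subsection \<open>Norm estimates\<close>

text \<open>For test functions, two integrations by parts give \<open>\<parallel>\<partial>\<^sub>c\<partial>\<^sub>b\<phi>\<parallel>\<^sup>2 = \<langle>\<partial>\<^sub>b\<partial>\<^sub>b\<phi>, \<partial>\<^sub>c\<partial>\<^sub>c\<phi>\<rangle>\<close>.\<close>

lemma hsq_eq_lap:
  assumes \<psi>: "sobolev0 (Suc (Suc 0)) \<psi>" shows "hsq \<psi> = ip (lap \<psi>) (lap \<psi>)"
proof -
  obtain \<phi> where \<phi>: "\<And>n::nat. test_fun (\<phi> n)" "sconv (Suc (Suc 0)) \<phi> \<psi>" using sobolev0_E[OF \<psi>] by blast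
  note s = sobolev0_sobolev[OF \<psi>]
  have lim: "L2lim (\<lambda>n. pd c (pd b (\<phi> n))) (wd c (wd b \<psi>))" if "b \<in> Basis" "c \<in> Basis" for b c
    using sconv_test_pd[OF _ sconv_test_pd[OF \<phi> s that(1)] sobolev_wd[OF s that(1)] that(2)] test_fun_pd[OF \<phi>(1) that(1)] by simp
  have eq: "ip (wd c (wd b \<psi>)) (wd c (wd b \<psi>)) = ip (wd b (wd b \<psi>)) (wd c (wd c \<psi>))" if bc: "b \<in> Basis" "c \<in> Basis" for b c
  proof -
    have "ip (pd c (pd b (\<phi> n))) (pd c (pd b (\<phi> n))) = ip (pd b (pd b (\<phi> n))) (pd c (pd c (\<phi> n)))" for n
    proof -
      note t = \<phi>(1)[of n]
      have tb: "test_fun (pd b (\<phi> n))" and tc: "test_fun (pd c (\<phi> n))" by (intro test_fun_pd t bc)+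
      have tcb: "test_fun (pd c (pd b (\<phi> n)))" and tcc: "test_fun (pd c (pd c (\<phi> n)))" by (intro test_fun_pd tb tc bc)+
      have "ip (pd c (pd b (\<phi> n))) (pd c (pd b (\<phi> n))) = - ip (pd b (\<phi> n)) (pd c (pd c (pd b (\<phi> n))))"
        by (rule test_fun_by_parts[OF tcb test_fun_Ck[OF tb] bc(2)])
      also have "pd c (pd c (pd b (\<phi> n))) = pd b (pd c (pd c (\<phi> n)))"
        using pd_commute[OF t bc(2,1)] pd_commute[OF tc bc(2,1)] by simp
      also have "- ip (pd b (\<phi> n)) (pd b (pd c (pd c (\<phi> n)))) = ip (pd b (pd b (\<phi> n))) (pd c (pd c (\<phi> n)))"
        using test_fun_by_parts[OF tcc test_fun_Ck[OF tb] bc(1)] by simp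
      finally show ?thesis .
    qed
    then show ?thesis
      using LIMSEQ_unique[OF L2lim_ip[OF lim[OF bc] lim[OF bc]]] L2lim_ip[OF lim[OF bc(1,1)] lim[OF bc(2,2)]] by simp
  qed
  have L: "L2 (wd b (wd b \<psi>))" if "b \<in> Basis" for b by (rule sobolev_wd_L2[OF sobolev_wd[OF s that] that])
  have "ip (lap \<psi>) (lap \<psi>) = (\<Sum>b\<in>Basis. ip (wd b (wd b \<psi>)) (lap \<psi>))"
    using lap_L2[OF s] unfolding lap_def[abs_def] by (intro ip_sum_left L)
  also have "\<dots> = (\<Sum>b\<in>Basis. \<Sum>c\<in>Basis. ip (wd b (wd b \<psi>)) (wd c (wd c \<psi>)))"
  proof (rule sum.cong[OF refl])
    fix b :: plane assume b: "b \<in> Basis"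
    have "ip (lap \<psi>) (wd b (wd b \<psi>)) = (\<Sum>c\<in>Basis. ip (wd c (wd c \<psi>)) (wd b (wd b \<psi>)))"
      unfolding lap_def[abs_def] by (intro ip_sum_left L b)
    then show "ip (wd b (wd b \<psi>)) (lap \<psi>) = (\<Sum>c\<in>Basis. ip (wd b (wd b \<psi>)) (wd c (wd c \<psi>)))"
      by (simp add: ip_commute)
  qed
  also have "\<dots> = hsq \<psi>" unfolding hsq_def grad_ip_def by (intro sum.cong refl) (simp add: eq)
  finally show ?thesis by simp
qed

lemma eta1_pos: "eta1 > 0" and eta1_ge_1: "eta1 \<ge> 1"
  using eta1_facts(1) by auto

text \<open>Poincare's inequality for the partial derivatives of \<open>\<psi>\<close>, which vanish on the boundary.\<close>

lemma poincare_H2: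
  assumes "sobolev0 (Suc (Suc 0)) \<psi>" shows "eta1 * grad_ip \<psi> \<psi> \<le> ip (lap \<psi>) (lap \<psi>)"
  unfolding hsq_eq_lap[OF assms, symmetric] hsq_def grad_ip_def[of \<psi>] sum_distrib_left
  by (intro sum_mono eta1_facts(3) sobolev0_wd assms)

lemma le_if_eta1_mult_le: "eta1 * a \<le> b \<Longrightarrow> 0 \<le> a \<Longrightarrow> a \<le> b"
  using mult_right_mono[OF eta1_ge_1, of a] by simp

lemma sobolev0_ip_le: "sobolev0 (Suc 0) u \<Longrightarrow> ip u u \<le> grad_ip u u"
  by (rule le_if_eta1_mult_le[OF eta1_facts(3) ip_self_nonneg])

lemma sobolev0_grad_ip_le: "sobolev0 (Suc (Suc 0)) u \<Longrightarrow> grad_ip u u \<le> ip (lap u) (lap u)"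
  by (rule le_if_eta1_mult_le[OF poincare_H2 grad_ip_nonneg])

lemma ip_diff_le:
  assumes "L2 u" "L2 v"
  shows "ip (\<lambda>z. u z - v z) (\<lambda>z. u z - v z) \<le> 2 * ip u u + 2 * ip v v"
  using ip_add_le[OF assms(1) L2_cmult[OF assms(2), of "-1"]] by (simp add: ip_uminus_left ip_uminus_right)

lemma ip_mult_le:
  assumes "L2 u" "continuous_on UNIV f" "\<And>z. norm z < 1 \<Longrightarrow> \<bar>f z\<bar> \<le> 1"
  shows "ip (\<lambda>z. f z * u z) (\<lambda>z. f z * u z) \<le> ip u u"
  using assms by (intro ip_mono L2_mult_continuous AE_diskI) (auto simp: abs_mult intro: mult_left_le_one_le)

lemma ip_wd_mult_le:
  assumes u: "sobolev (Suc 0) u" and f: "\<And>k. Ck k f" "\<And>z. norm z < 1 \<Longrightarrow> \<bar>f z\<bar> \<le> 1"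
    "\<And>z. norm z < 1 \<Longrightarrow> \<bar>pd b f z\<bar> \<le> 1" and b: "b \<in> Basis"
  shows "ip (wd b (\<lambda>z. f z * u z)) (wd b (\<lambda>z. f z * u z)) \<le> 2 * ip u u + 2 * ip (wd b u) (wd b u)"
proof -
  note L = sobolev_L2[OF u] sobolev_wd_L2[OF u b]
  note c = Ck_continuous[OF f(1)] Ck_continuous[OF Ck_all_pd[OF f(1) b]]
  have L': "L2 (\<lambda>z. pd b f z * u z)" "L2 (\<lambda>z. f z * wd b u z)" by (intro L2_mult_continuous L c)+
  have "ip (wd b (\<lambda>z. f z * u z)) (wd b (\<lambda>z. f z * u z))
      = ip (\<lambda>z. pd b f z * u z + f z * wd b u z) (\<lambda>z. pd b f z * u z + f z * wd b u z)"
    using wd_mult_smooth[OF u b f(1)] sobolev_wd_L2[OF sobolev_mult_smooth[OF u f(1)] b] L2_add[OF L']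
    by (intro ip_cong_AE L2_measurable) auto
  also have "\<dots> \<le> 2 * ip (\<lambda>z. pd b f z * u z) (\<lambda>z. pd b f z * u z) + 2 * ip (\<lambda>z. f z * wd b u z) (\<lambda>z. f z * wd b u z)"
    by (rule ip_add_le[OF L'])
  also have "\<dots> \<le> 2 * ip u u + 2 * ip (wd b u) (wd b u)"
    by (intro add_mono mult_left_mono ip_mult_le L c f) auto
  finally show ?thesis .
qed

lemma d_theta_bounds:
  assumes \<psi>: "sobolev0 (Suc (Suc 0)) \<psi>"
  shows "ip (d_theta \<psi>) (d_theta \<psi>) \<le> 2 * ip (lap \<psi>) (lap \<psi>)"
    "grad_ip (d_theta \<psi>) (d_theta \<psi>) \<le> 12 * ip (lap \<psi>) (lap \<psi>)"
proof -
  let ?p = "wd ey \<psi>" and ?q = "wd ex \<psi>"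
  have p: "sobolev (Suc 0) ?p" and q: "sobolev (Suc 0) ?q" by (intro sobolev_wd[OF sobolev0_sobolev[OF \<psi>]]; simp)+
  note L = sobolev_L2[OF p] sobolev_L2[OF q]
  have fs: "\<bar>fst z\<bar> \<le> 1" "\<bar>snd z\<bar> \<le> 1" if "norm z < 1" for z :: plane
    using that norm_fst_le[of "fst z" "snd z"] norm_snd_le[of "snd z" "fst z"] by auto
  have pdf: "pd b fst z = fst b" "pd b snd z = snd b" for b z :: plane
    by (auto intro!: pd_unique has_derivative_fst has_derivative_snd)
  have bs: "\<bar>fst b\<bar> \<le> 1" "\<bar>snd b\<bar> \<le> 1" if "b \<in> Basis" for b :: plane using that by (auto simp: Basis_plane)
  have e: "d_theta \<psi> = (\<lambda>z. fst z * ?p z - snd z * ?q z)" by (simp add: d_theta_def[abs_def])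
  have sp: "sobolev (Suc 0) (\<lambda>z. fst z * ?p z)" "sobolev (Suc 0) (\<lambda>z. snd z * ?q z)"
    by (intro sobolev_mult_smooth p q Ck_fst Ck_snd)+
  have "ip (d_theta \<psi>) (d_theta \<psi>) \<le> 2 * ip (\<lambda>z. fst z * ?p z) (\<lambda>z. fst z * ?p z) + 2 * ip (\<lambda>z. snd z * ?q z) (\<lambda>z. snd z * ?q z)"
    unfolding e by (intro ip_diff_le sobolev_L2[OF sp(1)] sobolev_L2[OF sp(2)])
  also have "\<dots> \<le> 2 * ip ?p ?p + 2 * ip ?q ?q"
    by (intro add_mono mult_left_mono ip_mult_le L fs continuous_intros) auto
  also have "\<dots> = 2 * grad_ip \<psi> \<psi>" by (simp add: grad_ip_def sum_Basis_plane)
  finally show "ip (d_theta \<psi>) (d_theta \<psi>) \<le> 2 * ip (lap \<psi>) (lap \<psi>)" using sobolev0_grad_ip_le[OF \<psi>] by simp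
  have "ip (wd b (d_theta \<psi>)) (wd b (d_theta \<psi>)) \<le> 4 * ip ?p ?p + 4 * ip (wd b ?p) (wd b ?p) + (4 * ip ?q ?q + 4 * ip (wd b ?q) (wd b ?q))"
    if b: "b \<in> Basis" for b
  proof -
    note L1 = sobolev_wd_L2[OF sp(1) b] sobolev_wd_L2[OF sp(2) b]
    have "ip (wd b (d_theta \<psi>)) (wd b (d_theta \<psi>)) = ip (\<lambda>z. wd b (\<lambda>z. fst z * ?p z) z - wd b (\<lambda>z. snd z * ?q z) z) (\<lambda>z. wd b (\<lambda>z. fst z * ?p z) z - wd b (\<lambda>z. snd z * ?q z) z)"
      unfolding e using wd_diff[OF sp b] sobolev_wd_L2[OF sobolev_diff[OF sp] b] L2_diff[OF L1]
      by (intro ip_cong_AE L2_measurable) auto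
    also have "\<dots> \<le> 2 * ip (wd b (\<lambda>z. fst z * ?p z)) (wd b (\<lambda>z. fst z * ?p z)) + 2 * ip (wd b (\<lambda>z. snd z * ?q z)) (wd b (\<lambda>z. snd z * ?q z))"
      by (rule ip_diff_le[OF L1])
    also have "\<dots> \<le> 2 * (2 * ip ?p ?p + 2 * ip (wd b ?p) (wd b ?p)) + 2 * (2 * ip ?q ?q + 2 * ip (wd b ?q) (wd b ?q))"
      by (intro add_mono mult_left_mono ip_wd_mult_le p q b Ck_fst Ck_snd fs) (auto simp: pdf bs b)
    finally show ?thesis by simp
  qed
  then have "grad_ip (d_theta \<psi>) (d_theta \<psi>) \<le> (\<Sum>b\<in>Basis. 4 * ip ?p ?p + 4 * ip (wd b ?p) (wd b ?p) + (4 * ip ?q ?q + 4 * ip (wd b ?q) (wd b ?q)))"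
    unfolding grad_ip_def by (intro sum_mono)
  also have "\<dots> = 8 * grad_ip \<psi> \<psi> + 4 * hsq \<psi>" by (simp add: grad_ip_def hsq_def sum_Basis_plane)
  finally show "grad_ip (d_theta \<psi>) (d_theta \<psi>) \<le> 12 * ip (lap \<psi>) (lap \<psi>)"
    using sobolev0_grad_ip_le[OF \<psi>] hsq_eq_lap[OF \<psi>] by simp
qed

lemma I1_nonneg: "0 \<le> I1 w \<psi>"
  unfolding I1_def by (intro add_nonneg_nonneg grad_ip_nonneg ip_self_nonneg)

text \<open>The supremum that defines \<open>critical_ratio\<close> bounds the ratios only because they are bounded above. The rotation field has
  bounded coefficients, so \<open>\<psi>\<^sub>\<theta>\<close> is controlled in \<open>H\<^sup>1\<close> by \<open>\<Delta>\<psi>\<close>.\<close>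

lemma I2_le:
  assumes w: "sobolev0 (Suc 0) w" and \<psi>: "sobolev0 (Suc (Suc 0)) \<psi>" and \<epsilon>: "\<epsilon> \<ge> 0"
  shows "I2 \<epsilon> w \<psi> \<le> (1 + 6 * \<epsilon>) * I1 w \<psi>"
proof -
  note sw = sobolev0_sobolev[OF w] and st = sobolev0_sobolev[OF sobolev0_d_theta[OF \<psi>]]
  let ?L = "ip (lap \<psi>) (lap \<psi>)"
  have 1: "2 * ip (d_theta \<psi>) w \<le> ip (d_theta \<psi>) (d_theta \<psi>) + ip w w"
    using ip_young[OF sobolev_L2[OF st] sobolev_L2[OF sw], of 1] by simp
  have "2 * ip (wd b (d_theta \<psi>)) (wd b w) \<le> ip (wd b (d_theta \<psi>)) (wd b (d_theta \<psi>)) + ip (wd b w) (wd b w)" if "b \<in> Basis" for b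
    using ip_young[OF sobolev_wd_L2[OF st that] sobolev_wd_L2[OF sw that], of 1] by simp
  then have "2 * grad_ip (d_theta \<psi>) w \<le> grad_ip (d_theta \<psi>) (d_theta \<psi>) + grad_ip w w"
    unfolding grad_ip_def sum_distrib_left sum.distrib[symmetric] by (intro sum_mono)
  then have "2 * grad_ip (d_theta \<psi>) w \<le> 12 * (grad_ip w w + ?L)"
    using d_theta_bounds(2)[OF \<psi>] grad_ip_nonneg[of w] by simp
  then have "\<epsilon> * grad_ip (d_theta \<psi>) w \<le> \<epsilon> * (6 * I1 w \<psi>)" using \<epsilon> by (intro mult_left_mono) (auto simp: I1_def)
  moreover have "ip (d_theta \<psi>) w \<le> I1 w \<psi>"
    using 1 d_theta_bounds(1)[OF \<psi>] sobolev0_ip_le[OF w] grad_ip_nonneg[of w] by (simp add: I1_def)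
  ultimately show ?thesis by (simp add: I2_def algebra_simps)
qed

lemma wd_AE_zero:
  assumes "L2 u" "AE z in lebesgue_on disk. u z = 0" "b \<in> Basis"
  shows "AE z in lebesgue_on disk. wd b u z = 0"
proof -
  have "wd b u = wd b (\<lambda>z. 0)" by (intro wd_cong assms L2_zero)
  then show ?thesis using wd_smooth[of "\<lambda>z. 0" b] assms(3) by (simp add: Ck_const)
qed

lemma grad_ip_AE_zero:
  assumes "sobolev (Suc 0) u" "AE z in lebesgue_on disk. u z = 0"
  shows "grad_ip u u = 0"
  unfolding grad_ip_def
  using ip_self_eq_0_iff[OF sobolev_wd_L2[OF assms(1)]] wd_AE_zero[OF sobolev_L2[OF assms(1)] assms(2)] by simp

lemma I1_pos_iff:
  assumes w: "sobolev0 (Suc 0) w" and \<psi>: "sobolev0 (Suc (Suc 0)) \<psi>"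
  shows "I1 w \<psi> > 0 \<longleftrightarrow> (w, \<psi>) \<in> X1_nonzero"
proof -
  note sw = sobolev0_sobolev[OF w] and s\<psi> = sobolev0_sobolev[OF \<psi>] and \<psi>1 = sobolev0_Suc_D[OF \<psi>]
  have "I1 w \<psi> = 0 \<longleftrightarrow> (AE z in lebesgue_on disk. w z = 0 \<and> \<psi> z = 0)"
  proof
    assume "I1 w \<psi> = 0"
    then have "grad_ip w w = 0" "ip (lap \<psi>) (lap \<psi>) = 0"
      using grad_ip_nonneg[of w] ip_self_nonneg[of "lap \<psi>"] by (auto simp: I1_def)
    then have "ip w w = 0" "ip \<psi> \<psi> = 0"
      using sobolev0_ip_le[OF w] sobolev0_ip_le[OF \<psi>1] sobolev0_grad_ip_le[OF \<psi>] ip_self_nonneg[of w] ip_self_nonneg[of \<psi>] by auto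
    then show "AE z in lebesgue_on disk. w z = 0 \<and> \<psi> z = 0"
      using ip_self_eq_0_iff[OF sobolev_L2[OF sw]] ip_self_eq_0_iff[OF sobolev_L2[OF s\<psi>]] by simp
  next
    assume "AE z in lebesgue_on disk. w z = 0 \<and> \<psi> z = 0"
    then have 0: "AE z in lebesgue_on disk. w z = 0" "AE z in lebesgue_on disk. \<psi> z = 0" by auto
    have "hsq \<psi> = 0"
      unfolding hsq_def using grad_ip_AE_zero[OF sobolev_wd[OF s\<psi>] wd_AE_zero[OF sobolev_L2[OF s\<psi>] 0(2)]] by simp
    then show "I1 w \<psi> = 0" using grad_ip_AE_zero[OF sw 0(1)] hsq_eq_lap[OF \<psi>] by (simp add: I1_def)
  qed
  then show ?thesis using I1_nonneg[of w \<psi>] w \<psi>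
    by (auto simp: X1_nonzero_def numeral_2_eq_2 simp del: sobolev.simps)
qed

lemma I2_le_critical:
  assumes w: "sobolev0 (Suc 0) w" and \<psi>: "sobolev0 (Suc (Suc 0)) \<psi>" and \<epsilon>: "\<epsilon> \<ge> 0"
  shows "I2 \<epsilon> w \<psi> \<le> critical_ratio \<epsilon> * I1 w \<psi>"
proof (cases "(w, \<psi>) \<in> X1_nonzero")
  case True
  have pos: "I1 w \<psi> > 0" using I1_pos_iff[OF w \<psi>] True by simp
  have "bdd_above ((\<lambda>(w, \<psi>). I2 \<epsilon> w \<psi> / I1 w \<psi>) ` X1_nonzero)"
  proof (rule bdd_aboveI2)
    fix p assume p: "p \<in> X1_nonzero"
    obtain u v where uv: "p = (u, v)" by (rule prod.exhaust)
    have s: "sobolev0 (Suc 0) u" "sobolev0 (Suc (Suc 0)) v" using p by (auto simp: uv X1_nonzero_def numeral_2_eq_2)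
    have "I1 u v > 0" using I1_pos_iff[OF s] p uv by simp
    then show "(case p of (w, \<psi>) \<Rightarrow> I2 \<epsilon> w \<psi> / I1 w \<psi>) \<le> 1 + 6 * \<epsilon>"
      using I2_le[OF s \<epsilon>] by (simp add: uv divide_le_eq)
  qed
  from cSUP_upper[OF True this] have "I2 \<epsilon> w \<psi> / I1 w \<psi> \<le> critical_ratio \<epsilon>" by (simp add: critical_ratio_def)
  then show ?thesis using pos by (simp add: divide_le_eq)
next
  case False
  then have "I1 w \<psi> = 0" using I1_pos_iff[OF w \<psi>] I1_nonneg[of w \<psi>] by simp
  then show ?thesis using I2_le[OF w \<psi> \<epsilon>] by simp
qed

lemma energy_le_I1:
  assumes w: "sobolev0 (Suc 0) w" and \<psi>: "sobolev0 (Suc (Suc 0)) \<psi>" and \<epsilon>: "\<epsilon> \<ge> 0"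
  shows "eta1 / (1 + \<epsilon> * eta1) * energy \<epsilon> w \<psi> \<le> I1 w \<psi>"
proof -
  have "eta1 * energy \<epsilon> w \<psi> \<le> (1 + \<epsilon> * eta1) * I1 w \<psi>"
    using eta1_facts(3)[OF w] poincare_H2[OF \<psi>] by (simp add: energy_def I1_def algebra_simps)
  moreover have "1 + \<epsilon> * eta1 > 0" using \<epsilon> eta1_pos by (simp add: add_pos_nonneg)
  ultimately show ?thesis by (simp add: divide_le_eq mult.commute)
qed

section \<open>The energy identity\<close>

text \<open>Both sides are continuous in \<open>v\<close> with respect to the norm of \<open>H\<^sup>2\<close>, and test functions are dense in \<open>H\<^sub>0\<^sup>2\<close>. The
  left side is even continuous in \<open>H\<^sup>1\<close>, which is used in the limit \<open>\<chi>\<^sub>n w \<rightarrow> w\<close>.\<close>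

lemma axial_equation_extended:
  assumes eq: "axial_equation \<epsilon> R w' w \<psi>" and w': "sobolev (Suc 0) w'"
    and w: "sobolev (Suc (Suc 0)) w" and \<psi>: "sobolev0 (Suc (Suc 0)) \<psi>" and v: "sobolev0 (Suc (Suc 0)) v"
  shows "ip w' v + \<epsilon> * grad_ip w' v + (1 / R) * grad_ip w v - R * ip (d_theta \<psi>) v = - NL1 \<epsilon> w \<psi> v"
proof -
  obtain \<phi> where \<phi>: "\<And>n::nat. test_fun (\<phi> n)" "sconv (Suc (Suc 0)) \<phi> v" using sobolev0_E[OF v] by blast
  note s1 = sconv_Suc_D[OF \<phi>(2)] and w1 = sobolev_Suc_D[OF w] and \<psi>1 = sobolev_Suc_D[OF sobolev0_sobolev[OF \<psi>]]
  have "ip w' (\<phi> n) + \<epsilon> * grad_ip w' (\<phi> n) + (1 / R) * grad_ip w (\<phi> n) - R * ip (d_theta \<psi>) (\<phi> n) = - NL1 \<epsilon> w \<psi> (\<phi> n)" for n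
  proof -
    have "ip (\<lambda>z. w z - \<epsilon> * lap w z) (J \<psi> (\<phi> n)) = NL1 \<epsilon> w \<psi> (\<phi> n)"
      unfolding NL1_def by (intro ip_J \<psi>1 sobolev_test \<phi> L2_diff L2_cmult sobolev_L2[OF w] lap_L2[OF w])
    then show ?thesis using eq \<phi>(1)[of n] unfolding axial_equation_def by simp
  qed
  moreover have "(\<lambda>n. ip w' (\<phi> n) + \<epsilon> * grad_ip w' (\<phi> n) + (1 / R) * grad_ip w (\<phi> n) - R * ip (d_theta \<psi>) (\<phi> n))
    \<longlonglongrightarrow> ip w' v + \<epsilon> * grad_ip w' v + (1 / R) * grad_ip w v - R * ip (d_theta \<psi>) v"
    by (intro tendsto_add tendsto_diff tendsto_mult tendsto_const L2lim_ip L2lim_const sconv_grad_ip[OF sconv_const[OF w'] s1]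
        sconv_grad_ip[OF sconv_const[OF w1] s1] sobolev_L2[OF w'] sconv_L2lim[OF s1] sobolev_L2[OF sobolev0_sobolev[OF sobolev0_d_theta[OF \<psi>]]])
  moreover have "(\<lambda>n. - NL1 \<epsilon> w \<psi> (\<phi> n)) \<longlonglongrightarrow> - NL1 \<epsilon> w \<psi> v"
    by (intro tendsto_minus NL1_lim w \<psi> sobolev_test \<phi> sobolev0_sobolev v)
  ultimately show ?thesis using LIMSEQ_unique by simp
qed

lemma stream_equation_extended:
  assumes eq: "stream_equation \<epsilon> R \<psi>' w \<psi>" and \<psi>': "sobolev (Suc (Suc 0)) \<psi>'"
    and w: "sobolev (Suc (Suc 0)) w" and \<psi>: "sobolev0 (Suc (Suc 0)) \<psi>" "sobolev (Suc (Suc (Suc 0))) \<psi>"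
    and v: "sobolev0 (Suc (Suc (Suc 0))) v"
  shows "grad_ip \<psi>' v + \<epsilon> * ip (lap \<psi>') (lap v) + (1 / R) * ip (lap \<psi>) (lap v) + \<epsilon> * R * ip (lap w) (d_theta v) = NL2 \<epsilon> w \<psi> v"
proof -
  obtain \<phi> where \<phi>: "\<And>n::nat. test_fun (\<phi> n)" "sconv (Suc (Suc (Suc 0))) \<phi> v" using sobolev0_E[OF v] by blast
  note s2 = sconv_Suc_D[OF \<phi>(2)] and w1 = sobolev_Suc_D[OF w] and \<psi>2 = sobolev0_sobolev[OF \<psi>(1)]
  note s1 = sconv_Suc_D[OF s2] and \<psi>1 = sobolev_Suc_D[OF \<psi>2]
  have "grad_ip \<psi>' (\<phi> n) + \<epsilon> * ip (lap \<psi>') (lap (\<phi> n)) + (1 / R) * ip (lap \<psi>) (lap (\<phi> n)) + \<epsilon> * R * ip (lap w) (d_theta (\<phi> n)) = NL2 \<epsilon> w \<psi> (\<phi> n)" for n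
  proof -
    note t = \<phi>(1)[of n]
    have D: "L2 (DJ b \<psi> (\<phi> n))" if "b \<in> Basis" for b
      by (rule L2lim_L2(2)[OF DJ_lim[OF \<psi> sobolev0_test[OF t] sobolev0_test[OF t] sconv_const[OF sobolev_test[OF t]] that]])
    have "ip (wd b (lap \<psi>)) (wd b (J \<psi> (\<phi> n))) = ip (wd b (lap \<psi>)) (DJ b \<psi> (\<phi> n))" if b: "b \<in> Basis" for b
      by (intro ip_cong_AE_right wd_J_test[OF \<psi>2 t b] D b sobolev_wd_L2[OF lap_sobolev[OF \<psi>(2)]])
    then have "grad_ip (lap \<psi>) (J \<psi> (\<phi> n)) = (\<Sum>b\<in>Basis. ip (wd b (lap \<psi>)) (DJ b \<psi> (\<phi> n)))"
      unfolding grad_ip_def by (intro sum.cong refl)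
    moreover have "ip (lap \<psi>) (J \<psi> (\<phi> n)) = ip (lap \<psi>) (Jc \<psi> (\<phi> n))"
      by (intro ip_J \<psi>1 sobolev_test t lap_L2[OF \<psi>(2)])
    moreover have "ip (lap w) (J w (\<phi> n)) = ip (lap w) (Jc w (\<phi> n))"
      by (intro ip_J w1 sobolev_test t lap_L2[OF w])
    ultimately show ?thesis using eq t unfolding stream_equation_def NL2_def by simp
  qed
  moreover have "(\<lambda>n. grad_ip \<psi>' (\<phi> n) + \<epsilon> * ip (lap \<psi>') (lap (\<phi> n)) + (1 / R) * ip (lap \<psi>) (lap (\<phi> n)) + \<epsilon> * R * ip (lap w) (d_theta (\<phi> n)))
    \<longlonglongrightarrow> grad_ip \<psi>' v + \<epsilon> * ip (lap \<psi>') (lap v) + (1 / R) * ip (lap \<psi>) (lap v) + \<epsilon> * R * ip (lap w) (d_theta v)"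
    by (intro tendsto_add tendsto_mult tendsto_const L2lim_ip L2lim_const sconv_grad_ip[OF sconv_const[OF \<psi>'] s1]
        L2lim_lap[OF s2] L2lim_d_theta[OF s1] lap_L2[OF w] lap_L2[OF \<psi>'] lap_L2[OF \<psi>2])
  moreover have "(\<lambda>n. NL2 \<epsilon> w \<psi> (\<phi> n)) \<longlonglongrightarrow> NL2 \<epsilon> w \<psi> v"
    by (intro NL2_lim w \<psi> sobolev0_test \<phi> v)
  ultimately show ?thesis using LIMSEQ_unique by simp
qed

text \<open>The functions \<open>w\<close> and \<open>\<psi>\<close> need not be admissible arguments of the extended equations, but \<open>\<chi>\<^sub>n w\<close> and \<open>\<chi>\<^sub>n \<psi>\<close> are. In the limit
  the linear terms converge by continuity and the nonlinear ones cancel.\<close>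

lemma energy_identity:
  assumes a: "axial_equation \<epsilon> R w' w \<psi>" and s: "stream_equation \<epsilon> R \<psi>' w \<psi>"
    and w': "sobolev (Suc 0) w'" and \<psi>': "sobolev (Suc (Suc 0)) \<psi>'"
    and w: "sobolev0 (Suc 0) w" "sobolev (Suc (Suc 0)) w"
    and \<psi>: "sobolev0 (Suc (Suc 0)) \<psi>" "sobolev (Suc (Suc (Suc 0))) \<psi>"
  shows "ip w' w + \<epsilon> * grad_ip w' w + grad_ip \<psi>' \<psi> + \<epsilon> * ip (lap \<psi>') (lap \<psi>) = - (1 / R) * I1 w \<psi> + R * I2 \<epsilon> w \<psi>"
proof -
  let ?w = "\<lambda>n z. cutn n z * w z" and ?p = "\<lambda>n z. cutn n z * \<psi> z"
  let ?A = "\<lambda>v. ip w' v + \<epsilon> * grad_ip w' v + (1 / R) * grad_ip w v - R * ip (d_theta \<psi>) v"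
  let ?B = "\<lambda>v. grad_ip \<psi>' v + \<epsilon> * ip (lap \<psi>') (lap v) + (1 / R) * ip (lap \<psi>) (lap v) + \<epsilon> * R * ip (lap w) (d_theta v)"
  note sw = sobolev0_sobolev[OF w(1)] and \<psi>2 = sobolev0_sobolev[OF \<psi>(1)]
  note c1 = sconv_cutn_1[OF sw sobolev0_hardy(1)[OF w(1)]] and c2 = sconv_cutn_2[OF \<psi>(1)]
  have "?B (?p n) + ?A (?w n) = NL2 \<epsilon> w \<psi> (?p n) - NL1 \<epsilon> w \<psi> (?w n)" for n
    using axial_equation_extended[OF a w' w(2) \<psi>(1) sobolev0_mult_test[OF w(2) test_fun_cutn], of n]
      stream_equation_extended[OF s \<psi>' w(2) \<psi> sobolev0_mult_test[OF \<psi>(2) test_fun_cutn], of n] by linarith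
  then have "(\<lambda>n. ?B (?p n) + ?A (?w n)) \<longlonglongrightarrow> 0" using nonlinear_cancellation[OF w \<psi>, of \<epsilon>] by (simp only:)
  moreover have "(\<lambda>n. ?B (?p n) + ?A (?w n)) \<longlonglongrightarrow> ?B \<psi> + ?A w"
    by (intro tendsto_add tendsto_diff tendsto_mult tendsto_const L2lim_ip L2lim_const sconv_grad_ip[OF sconv_const[OF \<psi>'] c2]
        sconv_grad_ip[OF sconv_const[OF w'] c1] sconv_grad_ip[OF sconv_const[OF sw] c1]
        L2lim_lap[OF c2] L2lim_d_theta[OF c2] sconv_L2lim[OF c1] lap_L2[OF w(2)] lap_L2[OF \<psi>'] lap_L2[OF \<psi>2]
        sobolev_L2[OF w'] sobolev_L2[OF sobolev0_sobolev[OF sobolev0_d_theta[OF \<psi>(1)]]])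
  ultimately have "?B \<psi> + ?A w = 0" by (rule LIMSEQ_unique[symmetric])
  moreover have "grad_ip (d_theta \<psi>) w = - ip (lap w) (d_theta \<psi>)" by (rule grad_ip_by_parts[OF sobolev0_d_theta[OF \<psi>(1)] w(2)])
  ultimately show ?thesis by (simp add: I1_def I2_def algebra_simps)
qed

section \<open>Differentiation of the energy\<close>

text \<open>The energy is a sum of quadratic forms that are continuous in \<open>H\<^sup>1\<close> or \<open>H\<^sup>2\<close>; differentiation and continuity at time 0 are
  proved once for all of them.\<close>

definition cont_form :: "nat \<Rightarrow> ((plane \<Rightarrow> real) \<Rightarrow> (plane \<Rightarrow> real) \<Rightarrow> real) \<Rightarrow> bool" where
  "cont_form k B \<longleftrightarrow> (\<forall>u v. B u v = B v u) \<and>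
    (\<forall>u v w c. sobolev k u \<longrightarrow> sobolev k v \<longrightarrow> sobolev k w \<longrightarrow> B (\<lambda>z. u z + c * v z) w = B u w + c * B v w) \<and>
    (\<forall>f u g v. sconv k f u \<longrightarrow> sconv k g v \<longrightarrow> (\<lambda>n. B (f n) (g n)) \<longlonglongrightarrow> B u v)"

lemma cont_formD:
  assumes "cont_form k B"
  shows "B u v = B v u"
    "sobolev k u \<Longrightarrow> sobolev k v \<Longrightarrow> sobolev k w \<Longrightarrow> B (\<lambda>z. u z + c * v z) w = B u w + c * B v w"
    "sconv k f u \<Longrightarrow> sconv k g v \<Longrightarrow> (\<lambda>n. B (f n) (g n)) \<longlonglongrightarrow> B u v"
  using assms unfolding cont_form_def by blast+

lemma cont_form_ip: "cont_form k ip"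
  unfolding cont_form_def
proof (intro conjI allI impI)
  show "ip u v = ip v u" for u v by (rule ip_commute)
qed (auto simp: ip_add_left ip_cmult_left L2_cmult sobolev_L2 intro: L2lim_ip sconv_L2lim)

lemma wd_add_cmult:
  assumes "sobolev (Suc k) u" "sobolev (Suc k) v" "b \<in> Basis"
  shows "AE z in lebesgue_on disk. wd b (\<lambda>z. u z + c * v z) z = wd b u z + c * wd b v z"
  using wd_add[OF assms(1) sobolev_cmult[OF assms(2), of c] assms(3)] wd_cmult[OF assms(2,3), of c] by eventually_elim simp

lemma lap_add_cmult:
  assumes "sobolev (Suc (Suc k)) u" "sobolev (Suc (Suc k)) v"
  shows "AE z in lebesgue_on disk. lap (\<lambda>z. u z + c * v z) z = lap u z + c * lap v z"
proof -
  have *: "AE z in lebesgue_on disk. wd b (wd b (\<lambda>z. u z + c * v z)) z = wd b (wd b u) z + c * wd b (wd b v) z" if b: "b \<in> Basis" for b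
  proof -
    have s: "sobolev (Suc k) (wd b u)" "sobolev (Suc k) (wd b v)" by (intro sobolev_wd assms b)+
    have "wd b (wd b (\<lambda>z. u z + c * v z)) = wd b (\<lambda>z. wd b u z + c * wd b v z)"
      by (intro wd_cong wd_add_cmult[OF assms b] sobolev_wd_L2[OF sobolev_add[OF assms(1) sobolev_cmult[OF assms(2)]]]
          sobolev_L2[OF sobolev_add[OF s(1) sobolev_cmult[OF s(2)]]] b)
    then show ?thesis using wd_add_cmult[OF s b, of c] by simp
  qed
  have "AE z in lebesgue_on disk. \<forall>b\<in>Basis. wd b (wd b (\<lambda>z. u z + c * v z)) z = wd b (wd b u) z + c * wd b (wd b v) z"
    using * by (intro AE_finite_allI) auto
  then show ?thesis
    by eventually_elim (simp add: lap_def sum.distrib sum_distrib_left)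
qed

lemma cont_form_grad_ip: "cont_form (Suc k) grad_ip"
  unfolding cont_form_def
proof (intro conjI allI impI)
  fix u v w c assume s: "sobolev (Suc k) u" "sobolev (Suc k) v" "sobolev (Suc k) w"
  have "ip (wd b (\<lambda>z. u z + c * v z)) (wd b w) = ip (wd b u) (wd b w) + c * ip (wd b v) (wd b w)" if b: "b \<in> Basis" for b
  proof -
    note L = sobolev_wd_L2[OF s(1) b] sobolev_wd_L2[OF s(2) b] sobolev_wd_L2[OF s(3) b]
    have "ip (wd b (\<lambda>z. u z + c * v z)) (wd b w) = ip (\<lambda>z. wd b u z + c * wd b v z) (wd b w)"
      by (intro ip_cong_AE_left wd_add_cmult[OF s(1,2) b] sobolev_wd_L2[OF sobolev_add[OF s(1) sobolev_cmult[OF s(2)]] b] L2_add L2_cmult L)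
    then show ?thesis by (simp add: ip_add_left ip_cmult_left L2_cmult L)
  qed
  then show "grad_ip (\<lambda>z. u z + c * v z) w = grad_ip u w + c * grad_ip v w"
    by (simp add: grad_ip_def sum.distrib sum_distrib_left)
qed (auto simp: grad_ip_commute intro: sconv_grad_ip)

lemma cont_form_lap: "cont_form (Suc (Suc k)) (\<lambda>u v. ip (lap u) (lap v))"
  unfolding cont_form_def
proof (intro conjI allI impI)
  fix u v w c assume s: "sobolev (Suc (Suc k)) u" "sobolev (Suc (Suc k)) v" "sobolev (Suc (Suc k)) w"
  note L = lap_L2[OF s(1)] lap_L2[OF s(2)] lap_L2[OF s(3)]
  have "ip (lap (\<lambda>z. u z + c * v z)) (lap w) = ip (\<lambda>z. lap u z + c * lap v z) (lap w)"
    by (intro ip_cong_AE_left lap_add_cmult[OF s(1,2)] lap_L2[OF sobolev_add[OF s(1) sobolev_cmult[OF s(2)]]] L2_add L2_cmult L)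
  then show "ip (lap (\<lambda>z. u z + c * v z)) (lap w) = ip (lap u) (lap w) + c * ip (lap v) (lap w)"
    by (simp add: ip_add_left ip_cmult_left L2_cmult L)
qed (auto simp: ip_commute intro: L2lim_ip L2lim_lap simp del: sconv.simps)

lemma cont_form_add_cmult:
  assumes "cont_form k B" "cont_form k C" shows "cont_form k (\<lambda>u v. B u v + \<epsilon> * C u v)"
  unfolding cont_form_def
proof (intro conjI allI impI)
  show "B u v + \<epsilon> * C u v = B v u + \<epsilon> * C v u" for u v
    using cont_formD(1)[OF assms(1)] cont_formD(1)[OF assms(2)] by simp
  show "B (\<lambda>z. u z + c * v z) w + \<epsilon> * C (\<lambda>z. u z + c * v z) w = B u w + \<epsilon> * C u w + c * (B v w + \<epsilon> * C v w)"
    if "sobolev k u" "sobolev k v" "sobolev k w" for u v w c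
    using cont_formD(2)[OF assms(1) that] cont_formD(2)[OF assms(2) that] by (simp add: algebra_simps)
  show "(\<lambda>n. B (f n) (g n) + \<epsilon> * C (f n) (g n)) \<longlonglongrightarrow> B u v + \<epsilon> * C u v"
    if "sconv k f u" "sconv k g v" for f u g v
    by (intro tendsto_add tendsto_mult tendsto_const cont_formD(3)[OF assms(1) that] cont_formD(3)[OF assms(2) that])
qed

lemma sobolev_sq_minus: "sobolev k u \<Longrightarrow> sobolev_sq k (\<lambda>z. - u z) = sobolev_sq k u"
proof (induction k arbitrary: u)
  case 0
  then show ?case by (simp add: ip_uminus_left ip_uminus_right)
next
  case (Suc k)
  have "sobolev_sq k (wd b (\<lambda>z. - u z)) = sobolev_sq k (wd b u)" if b: "b \<in> Basis" for b
  proof -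
    note sb = sobolev_wd[OF Suc.prems b]
    have "AE z in lebesgue_on disk. wd b (\<lambda>z. - u z) z = - wd b u z" using wd_cmult[OF Suc.prems b, of "-1"] by simp
    moreover have "L2 (wd b (\<lambda>z. - u z))" using sobolev_wd_L2[OF sobolev_cmult[OF Suc.prems, of "-1"] b] by simp
    moreover have "L2 (\<lambda>z. - wd b u z)" using sobolev_L2[OF sobolev_cmult[OF sb, of "-1"]] by simp
    ultimately have "sobolev_sq k (wd b (\<lambda>z. - u z)) = sobolev_sq k (\<lambda>z. - wd b u z)" by (rule sobolev_sq_cong)
    also have "\<dots> = sobolev_sq k (wd b u)" by (rule Suc.IH[OF sb])
    finally show ?thesis .
  qed
  then show ?case by (simp add: ip_uminus_left ip_uminus_right)
qed

lemma sconv_iff':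
  assumes "\<And>n. sobolev k (f n)" "sobolev k u"
  shows "sconv k f u \<longleftrightarrow> (\<lambda>n. sobolev_sq k (\<lambda>z. f n z - u z)) \<longlonglongrightarrow> 0"
proof -
  have "sobolev_sq k (\<lambda>z. f n z - u z) = sobolev_sq k (\<lambda>z. u z - f n z)" for n
    using sobolev_sq_minus[OF sobolev_diff[OF assms(2) assms(1)[of n]]] by simp
  then show ?thesis using sconv_iff[of k f u] assms by simp
qed

text \<open>With the difference quotient \<open>D\<close>, \<open>B(u + hD, u + hD) - B(u, u) = 2h B(D, u) + h\<^sup>2 B(D, D)\<close>. Sequences \<open>h\<^sub>n \<rightarrow> 0\<close> suffice, and
  they can be kept above \<open>-t\<close>, where \<open>u\<close> is known to be in \<open>H\<^sup>k\<close>.\<close>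

lemma cont_form_deriv:
  assumes B: "cont_form k B" and t: "t > 0" and u: "\<And>s. s > 0 \<Longrightarrow> sobolev k (u s)" and u': "sobolev k u'"
    and d: "sobolev_deriv k u u' t"
  shows "((\<lambda>s. B (u s) (u s)) has_real_derivative 2 * B u' (u t)) (at t)"
proof -
  have at: "at 0 within {-t<..} = (at 0 :: real filter)" using t by (intro at_within_open) auto
  have "((\<lambda>h. (B (u (t + h)) (u (t + h)) - B (u t) (u t)) / h) \<longlongrightarrow> 2 * B u' (u t)) (at 0 within {-t<..})"
    unfolding tendsto_at_iff_sequentially
  proof (intro allI impI)
    fix X :: "nat \<Rightarrow> real" assume X: "\<forall>i. X i \<in> {-t<..} - {0}" "X \<longlonglongrightarrow> 0"
    define D where "D n z = (u (t + X n) z - u t z) / X n" for n z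
    have st: "sobolev k (u t)" by (rule u[OF t])
    have sX: "sobolev k (u (t + X n))" for n using X(1)[rule_format, of n] by (intro u) auto
    have sD: "sobolev k (D n)" for n
      using sobolev_cmult[OF sobolev_diff[OF sX st], of "1 / X n" n] by (simp add: D_def[abs_def])
    have X0: "X n \<noteq> 0" for n using X(1)[rule_format, of n] by simp
    have "((\<lambda>h. sobolev_sq k (\<lambda>z. (u (t + h) z - u t z) / h - u' z)) \<longlongrightarrow> 0) (at 0 within {-t<..})"
      using d unfolding at sobolev_deriv_def .
    from this[unfolded tendsto_at_iff_sequentially, THEN spec, THEN mp, THEN mp, OF X]
    have "(\<lambda>n. sobolev_sq k (\<lambda>z. D n z - u' z)) \<longlonglongrightarrow> 0" by (simp only: D_def comp_def)
    then have c: "sconv k D u'" using sconv_iff'[of k D u', OF sD u'] by simp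
    have e: "(B (u (t + X n)) (u (t + X n)) - B (u t) (u t)) / X n = 2 * B (D n) (u t) + X n * B (D n) (D n)" for n
    proof -
      have eq: "u (t + X n) = (\<lambda>z. u t z + X n * D n z)" using X0[of n] by (simp add: D_def)
      have "B (\<lambda>z. u t z + X n * D n z) (\<lambda>z. u t z + X n * D n z)
        = B (u t) (\<lambda>z. u t z + X n * D n z) + X n * B (D n) (\<lambda>z. u t z + X n * D n z)"
        using sX[of n] unfolding eq by (intro cont_formD(2)[OF B] st sD)
      also have "B (u t) (\<lambda>z. u t z + X n * D n z) = B (u t) (u t) + X n * B (D n) (u t)"
        using cont_formD(2)[OF B st sD st, of "X n" n] cont_formD(1)[OF B, of "u t" "\<lambda>z. u t z + X n * D n z"] by simp
      also have "B (D n) (\<lambda>z. u t z + X n * D n z) = B (D n) (u t) + X n * B (D n) (D n)"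
        using cont_formD(2)[OF B st sD sD, of "X n" n n] cont_formD(1)[OF B, of "D n" "\<lambda>z. u t z + X n * D n z"]
          cont_formD(1)[OF B, of "D n" "u t"] by simp
      finally show ?thesis unfolding eq using X0[of n] by (simp add: field_simps)
    qed
    have "(\<lambda>n. 2 * B (D n) (u t) + X n * B (D n) (D n)) \<longlonglongrightarrow> 2 * B u' (u t) + 0 * B u' u'"
      by (intro tendsto_add tendsto_mult tendsto_const X cont_formD(3)[OF B] c sconv_const st)
    then show "((\<lambda>h. (B (u (t + h)) (u (t + h)) - B (u t) (u t)) / h) \<circ> X) \<longlonglongrightarrow> 2 * B u' (u t)"
      by (simp add: comp_def e)
  qed
  then show ?thesis unfolding at DERIV_def .
qed

lemma cont_form_tendsto:
  assumes B: "cont_form k B" and u: "\<And>s. s \<ge> 0 \<Longrightarrow> sobolev k (u s)"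
    and l: "((\<lambda>t. sobolev_sq k (\<lambda>z. u t z - u 0 z)) \<longlongrightarrow> 0) (at_right 0)"
  shows "((\<lambda>s. B (u s) (u s)) \<longlongrightarrow> B (u 0) (u 0)) (at_right (0::real))"
  unfolding tendsto_at_iff_sequentially
proof (intro allI impI)
  fix X :: "nat \<Rightarrow> real" assume X: "\<forall>i. X i \<in> {0<..} - {0}" "X \<longlonglongrightarrow> 0"
  have s: "sobolev k (u (X n))" for n using X(1)[rule_format, of n] by (intro u) auto
  have "(\<lambda>n. sobolev_sq k (\<lambda>z. u (X n) z - u 0 z)) \<longlonglongrightarrow> 0"
    using l X unfolding tendsto_at_iff_sequentially comp_def by blast
  then have "sconv k (\<lambda>n. u (X n)) (u 0)" using sconv_iff'[of k "\<lambda>n. u (X n)" "u 0"] s u[of 0] by simp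
  from cont_formD(3)[OF B this this] show "((\<lambda>s. B (u s) (u s)) \<circ> X) \<longlonglongrightarrow> B (u 0) (u 0)" by (simp add: comp_def)
qed

lemma energy_forms:
  "energy \<epsilon> w \<psi> = (ip w w + \<epsilon> * grad_ip w w) + (grad_ip \<psi> \<psi> + \<epsilon> * ip (lap \<psi>) (lap \<psi>))"
  by (simp add: energy_def)

lemma cont_form_axial: "cont_form (Suc 0) (\<lambda>u v. ip u v + \<epsilon> * grad_ip u v)"
  and cont_form_stream: "cont_form (Suc (Suc 0)) (\<lambda>u v. grad_ip u v + \<epsilon> * ip (lap u) (lap v))"
  by (intro cont_form_add_cmult cont_form_ip cont_form_grad_ip cont_form_lap)+

section \<open>Decay of the energy\<close>

lemma is_solutionD:
  assumes "is_solution \<epsilon> R w \<psi>"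
  shows "t \<ge> 0 \<Longrightarrow> sobolev0 (Suc 0) (w t)" "t \<ge> 0 \<Longrightarrow> sobolev0 (Suc (Suc 0)) (\<psi> t)"
    "((\<lambda>t. sobolev_sq (Suc 0) (\<lambda>z. w t z - w 0 z)) \<longlongrightarrow> 0) (at_right 0)"
    "((\<lambda>t. sobolev_sq (Suc (Suc 0)) (\<lambda>z. \<psi> t z - \<psi> 0 z)) \<longlongrightarrow> 0) (at_right 0)"
  using assms unfolding is_solution_def One_nat_def numeral_2_eq_2 by blast+

lemma energy_deriv:
  assumes sol: "is_solution \<epsilon> R w \<psi>" and t: "t > 0"
  shows "((\<lambda>s. energy \<epsilon> (w s) (\<psi> s)) has_real_derivative 2 * (- (1 / R) * I1 (w t) (\<psi> t) + R * I2 \<epsilon> (w t) (\<psi> t))) (at t)"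
proof -
  obtain w' \<psi>' where p: "sobolev0 (Suc 0) w'" "sobolev0 (Suc (Suc 0)) \<psi>'" "sobolev_deriv (Suc 0) w w' t" "sobolev_deriv (Suc (Suc 0)) \<psi> \<psi>' t"
    and eqs: "axial_equation \<epsilon> R w' (w t) (\<psi> t)" "stream_equation \<epsilon> R \<psi>' (w t) (\<psi> t)"
    and reg: "sobolev (Suc (Suc 0)) (w t)" "sobolev (Suc (Suc (Suc 0))) (\<psi> t)"
    using sol t unfolding is_solution_def One_nat_def numeral_2_eq_2 numeral_3_eq_3 by blast
  note sol0 = is_solutionD(1,2)[OF sol]
  note s' = sobolev0_sobolev[OF p(1)] sobolev0_sobolev[OF p(2)]
  have "((\<lambda>s. energy \<epsilon> (w s) (\<psi> s)) has_real_derivative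
    2 * (ip w' (w t) + \<epsilon> * grad_ip w' (w t)) + 2 * (grad_ip \<psi>' (\<psi> t) + \<epsilon> * ip (lap \<psi>') (lap (\<psi> t)))) (at t)"
    unfolding energy_forms
    by (intro DERIV_add cont_form_deriv[OF cont_form_axial t _ s'(1) p(3)] cont_form_deriv[OF cont_form_stream t _ s'(2) p(4)]
        sobolev0_sobolev sol0) auto
  also have "2 * (ip w' (w t) + \<epsilon> * grad_ip w' (w t)) + 2 * (grad_ip \<psi>' (\<psi> t) + \<epsilon> * ip (lap \<psi>') (lap (\<psi> t)))
    = 2 * (- (1 / R) * I1 (w t) (\<psi> t) + R * I2 \<epsilon> (w t) (\<psi> t))"
    using energy_identity[OF eqs s' sol0(1)[of t] reg(1) sol0(2)[of t] reg(2)] t by simp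
  finally show ?thesis .
qed

lemma energy_tendsto_initial:
  assumes "is_solution \<epsilon> R w \<psi>"
  shows "((\<lambda>s. energy \<epsilon> (w s) (\<psi> s)) \<longlongrightarrow> energy \<epsilon> (w 0) (\<psi> 0)) (at_right 0)"
  unfolding energy_forms using is_solutionD[OF assms]
  by (intro tendsto_add cont_form_tendsto[OF cont_form_axial] cont_form_tendsto[OF cont_form_stream] sobolev0_sobolev) auto

lemma gronwall_decay:
  fixes E :: "real \<Rightarrow> real"
  assumes d: "\<And>s. s > 0 \<Longrightarrow> (E has_real_derivative E' s) (at s)" "\<And>s. s > 0 \<Longrightarrow> E' s \<le> - c * E s"
    and l: "(E \<longlongrightarrow> E 0) (at_right 0)" and t: "t \<ge> 0"
  shows "E t \<le> exp (- c * t) * E 0"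
proof (cases "t = 0")
  case False
  have mono: "exp (c * t) * E t \<le> exp (c * s) * E s" if "0 < s" "s \<le> t" for s
  proof (rule DERIV_nonpos_imp_nonincreasing[OF that(2)])
    fix x assume x: "s \<le> x" "x \<le> t"
    have "((\<lambda>x. exp (c * x) * E x) has_real_derivative exp (c * x) * (c * E x + E' x)) (at x)"
      using that x by (auto intro!: derivative_eq_intros d simp: algebra_simps)
    moreover have "exp (c * x) * (c * E x + E' x) \<le> 0"
      using d(2)[of x] that x by (intro mult_nonneg_nonpos) auto
    ultimately show "\<exists>y. ((\<lambda>x. exp (c * x) * E x) has_real_derivative y) (at x) \<and> y \<le> 0" by blast
  qed
  have "((\<lambda>s. exp (c * s) * E s) \<longlongrightarrow> exp (c * 0) * E 0) (at_right 0)" by (intro tendsto_intros l)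
  moreover have "\<forall>\<^sub>F s in at_right 0. exp (c * t) * E t \<le> exp (c * s) * E s"
    using mono t False by (intro eventually_at_rightI[of 0 t]) auto
  ultimately have "exp (c * t) * E t \<le> exp (c * 0) * E 0"
    by (intro tendsto_lowerbound) auto
  then show ?thesis by (simp add: exp_minus field_simps)
qed simp

text \<open>The coefficient of \<open>I1\<close> in \<open>E' \<le> 2R (critical_ratio - 1/R\<^sup>2) I1\<close> is negative, so the lower bound of \<open>I1\<close> by the energy
  may be inserted.\<close>

lemma energy_decay:
  assumes \<epsilon>: "\<epsilon> \<ge> 0" and R: "R > 0" "critical_ratio \<epsilon> < 1 / R\<^sup>2" and sol: "is_solution \<epsilon> R w \<psi>" and t: "t \<ge> 0"
  shows "energy \<epsilon> (w t) (\<psi> t) \<le> exp (- (2 * R * eta1 / (1 + \<epsilon> * eta1) * (1 / R\<^sup>2 - critical_ratio \<epsilon>)) * t) * energy \<epsilon> (w 0) (\<psi> 0)"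
proof (rule gronwall_decay[OF energy_deriv[OF sol] _ energy_tendsto_initial[OF sol] t])
  fix s :: real assume s: "s > 0"
  let ?I = "I1 (w s) (\<psi> s)" and ?E = "energy \<epsilon> (w s) (\<psi> s)" and ?d = "1 / R\<^sup>2 - critical_ratio \<epsilon>"
  have S: "sobolev0 (Suc 0) (w s)" "sobolev0 (Suc (Suc 0)) (\<psi> s)" using is_solutionD(1,2)[OF sol] s by auto
  have "R * I2 \<epsilon> (w s) (\<psi> s) \<le> R * (critical_ratio \<epsilon> * ?I)" using R by (intro mult_left_mono I2_le_critical S \<epsilon>) auto
  then have "2 * (- (1 / R) * ?I + R * I2 \<epsilon> (w s) (\<psi> s)) \<le> - (2 * R * ?d * ?I)"
    using R(1) by (simp add: field_simps power2_eq_square)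
  also have "\<dots> \<le> - (2 * R * ?d * (eta1 / (1 + \<epsilon> * eta1) * ?E))"
    using mult_left_mono[OF energy_le_I1[OF S \<epsilon>], of "2 * R * ?d"] R by simp
  also have "\<dots> = - (2 * R * eta1 / (1 + \<epsilon> * eta1) * ?d) * ?E" by (simp add: mult_ac)
  finally show "2 * (- (1 / R) * ?I + R * I2 \<epsilon> (w s) (\<psi> s)) \<le> - (2 * R * eta1 / (1 + \<epsilon> * eta1) * ?d) * ?E" .
qed

lemma energy_nonneg: "\<epsilon> \<ge> 0 \<Longrightarrow> 0 \<le> energy \<epsilon> w \<psi>"
  unfolding energy_def by (intro add_nonneg_nonneg mult_nonneg_nonneg grad_ip_nonneg ip_self_nonneg)

theorem mainTheorem3:
  fixes \<epsilon> R R\<^sub>E c\<^sub>R :: real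
  assumes "\<epsilon> \<ge> 0"
    and "R > 0"
    and "R\<^sub>E > 0"
    and "1 / R\<^sub>E\<^sup>2 = critical_ratio \<epsilon>"
    and "R < R\<^sub>E"
    and "c\<^sub>R = 2 * R * eta1 / (1 + \<epsilon> * eta1) * (1 / R\<^sup>2 - 1 / R\<^sub>E\<^sup>2)"
  shows "\<bar>eta1 - 5.78\<bar> < 0.005
    \<and> c\<^sub>R > 0
    \<and> (\<forall>w \<psi>. is_solution \<epsilon> R w \<psi> \<longrightarrow>
         (\<forall>t\<ge>0. energy \<epsilon> (w t) (\<psi> t) \<le> exp (- c\<^sub>R * t) * energy \<epsilon> (w 0) (\<psi> 0)))
    \<and> unconditionally_stable \<epsilon> R"
proof -
  have gap: "critical_ratio \<epsilon> < 1 / R\<^sup>2"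
    unfolding assms(4)[symmetric] using assms by (intro divide_strict_left_mono power_strict_mono mult_pos_pos) auto
  have "1 + \<epsilon> * eta1 > 0" using assms(1) eta1_pos by (simp add: add_pos_nonneg)
  then have c: "c\<^sub>R > 0" unfolding assms(4,6) using assms(2) eta1_pos gap by simp
  have dec: "energy \<epsilon> (w t) (\<psi> t) \<le> exp (- c\<^sub>R * t) * energy \<epsilon> (w 0) (\<psi> 0)" if "is_solution \<epsilon> R w \<psi>" "t \<ge> 0" for w \<psi> t
    using energy_decay[OF assms(1,2) gap that] unfolding assms(4,6) .
  have "unconditionally_stable \<epsilon> R"
    unfolding unconditionally_stable_def
  proof (intro conjI allI impI)
    fix e :: real assume e: "e > 0"
    have "energy \<epsilon> (w t) (\<psi> t) < e" if "is_solution \<epsilon> R w \<psi>" "energy \<epsilon> (w 0) (\<psi> 0) < e" "t \<ge> 0" for w \<psi> t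
    proof -
      have "exp (- c\<^sub>R * t) * energy \<epsilon> (w 0) (\<psi> 0) \<le> 1 * energy \<epsilon> (w 0) (\<psi> 0)"
        using c that(3) by (intro mult_right_mono energy_nonneg assms) auto
      then show ?thesis using dec[OF that(1,3)] that(2) by simp
    qed
    then show "\<exists>d>0. \<forall>w \<psi>. is_solution \<epsilon> R w \<psi> \<and> energy \<epsilon> (w 0) (\<psi> 0) < d \<longrightarrow> (\<forall>t\<ge>0. energy \<epsilon> (w t) (\<psi> t) < e)"
      using e by blast
  next
    fix w \<psi> assume sol: "is_solution \<epsilon> R w \<psi>"
    have "((\<lambda>t. exp (- c\<^sub>R * t)) \<longlongrightarrow> 0) at_top"
      using c by (intro filterlim_compose[OF exp_at_bot] filterlim_tendsto_neg_mult_at_bot[OF tendsto_const] filterlim_ident) auto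
    from tendsto_mult[OF this tendsto_const, of "energy \<epsilon> (w 0) (\<psi> 0)"]
    have lim: "((\<lambda>t. exp (- c\<^sub>R * t) * energy \<epsilon> (w 0) (\<psi> 0)) \<longlongrightarrow> 0) at_top" by simp
    show "((\<lambda>t. energy \<epsilon> (w t) (\<psi> t)) \<longlongrightarrow> 0) at_top"
      by (rule tendsto_sandwich[OF _ _ tendsto_const lim])
        (intro always_eventually allI energy_nonneg assms(1), rule eventually_at_top_linorderI[of 0], rule dec[OF sol])
  qed
  moreover have "\<bar>eta1 - 5.78\<bar> < 0.005" unfolding abs_less_iff using eta1_facts(1,2) by (simp add: field_simps)
  ultimately show ?thesis using c dec by simp
qed

end
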